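(* Let $G$ be a planar trivalent graph, $E$ the set of edges of $G$, and $\Gamma$ a plane graph of $G$. Define the $2$-factor polynomial of $G$ to be $\langle G\rangle_2:=\langle\Gamma^\flat{:}E\rangle_2$ and the cohomology of $G$ to be $H^{*,*}(G):=H^{*,*}(\Gamma^\flat,E)$. Then the polynomial and the cohomology (up to isomorphism of bigraded $\mathbb{Z}_2$-vector spaces) are invariants of the graph $G$, i.e. they do not depend on the choice of plane graph $\Gamma$. Furthermore, the $2$-factor polynomial of $G$ is the graded Euler characteristic of its cohomology: $\langle G\rangle_2(q)=\sum_i(-1)^i\,q\!\dim H^{i,*}(G)$.
   Context: Graphs are finite multigraphs; loops, multiple edges, vertexless "circle" edges (edges with no endpoints) and the empty graph are allowed. A graph is trivalent if every vertex has degree $3$ (loops counted twice), and planar if it embeds in $S^2$. A plane graph of $G$ is (the image $\Gamma\subset S^2$ of) an embedding $G\to S^2$. A perfect matching graph is a trivalent plane graph together with a perfect matching (a set of non-loop edges such that each vertex is an endpoint of exactly one of them). Blow-up. The blow-up $\Gamma^\flat$ of a trivalent plane graph $\Gamma$ is the trivalent plane graph obtained by replacing every vertex of $\Gamma$ by a small circle: the circle around a vertex meets the three half-edges at it in three new vertices, and the interior of the circle is emptied, leaving three arcs as new edges. The original edges $E$ of $\Gamma$ (shortened) form a perfect matching of $\Gamma^\flat$. (Vertexless circle components of $\Gamma$, if any, are left unchanged and are not counted in the matching.) States. Let $(\Gamma',M)$ be a perfect matching graph with $M=\{e_1,\dots,e_n\}$. Let $e\in M$ have end vertices $u,v$. Going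 counterclockwise around $u$ starting from $e$, let $x_1,x_2$ be the other two half-edges; going counterclockwise around $v$ starting from $e$, let $y_1,y_2$ be the other two half-edges. The $0$-smoothing of $e$ replaces a small neighborhood of $e$ by two disjoint arcs parallel to $e$ joining $x_1$ to $y_2$ and $x_2$ to $y_1$; the $1$-smoothing replaces it by two arcs crossing once transversely, joining $x_1$ to $y_1$ and $x_2$ to $y_2$. For $\alpha\in\{0,1\}^n$ the state $\Gamma'_\alpha$ is the collection of (possibly immersed) circles obtained by performing the $\alpha_i$-smoothing at $e_i$ for every $i$; $k_\alpha$ is the number of circles and $|\alpha|=\sum\alpha_i$. $2$-factor polynomial: $\langle\Gamma'{:}M\rangle_2(q)=\sum_{\alpha}(-q)^{|\alpha|}(q^{-1}+q)^{k_\alpha}$. Cohomology $H^{*,*}(\Gamma',M)$. Let $V=\mathbb{Z}_2[x]/(x^2)$, graded by $\deg 1=1$, $\deg x=-1$; $(W\{\ell\})^m=W^{m-\ell}$ and $q\!\dim W=\sum_m q^m\dim W^m$. Put $V_\alpha=V^{\otimes k_\alpha}\{|\alpha|\}$, with one tensor factor for each circle of $\Gamma'_\alpha$, and $C^{i,*}=\bigoplus_{|\alpha|=i}V_\alpha$, where the second grading is the grading of $V_\alpha$. If $\alpha'$ is obtained from $\alpha$ by changing a single $\alpha_k$ from $0$ to $1$, define $\partial_{\alpha\alpha'}:V_\alpha\to V_{\alpha'}$ as the tensor product of the identity on factors of circles not passing through the smoothing of $e_k$ with: multiplication $m$ ($1\otimes1\mapsto1$, $1\otimes x,\ x\otimes1\mapsto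 x$, $x\otimes x\mapsto0$) if two circles fuse into one; $\Delta$ ($1\mapsto 1\otimes x+x\otimes1$, $x\mapsto x\otimes x$) if one circle splits into two; the zero map if one circle becomes one circle. The differential $\partial:C^{i,*}\to C^{i+1,*}$ is the sum of all $\partial_{\alpha\alpha'}$ with $|\alpha|=i$, and $H^{i,j}$ is the cohomology of $(C^{*,j},\partial)$ in degree $i$. *)

theory Defs
  imports
    "HOL-Analysis.Analysis"
    "HOL-Library.Z2"
    "HOL-Computational_Algebra.Formal_Laurent_Series"
    "Jordan_Normal_Form.VS_Connect"
begin

section \<open>Multigraphs and their plane graphs\<close>

text \<open>
  An edge \<open>e\<close> has the two half-edges \<open>(e, False)\<close> and \<open>(e, True)\<close>; \<open>endpoint\<close> sends a half-edge to
  the vertex it is attached to, so that \<open>e\<close> is a loop iff both its half-edges have the same endpoint.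
  The edges without endpoints are kept apart in \<open>circles\<close>. Which half-edge of \<open>e\<close> is called
  \<open>(e, False)\<close> is a reference choice without geometric meaning.
\<close>

type_synonym 'e half_edge = "'e \<times> bool"

record ('v, 'e) multigraph =
  verts :: "'v set"
  edges :: "'e set"
  circles :: "'e set"
  endpoint :: "'e half_edge \<Rightarrow> 'v"

definition half_edges :: "('v, 'e, 'z) multigraph_scheme \<Rightarrow> 'e half_edge set" where
  "half_edges G = edges G \<times> UNIV"

definition half_edges_at :: "('v, 'e, 'z) multigraph_scheme \<Rightarrow> 'v \<Rightarrow> 'e half_edge set" where
  "half_edges_at G v = {h \<in> half_edges G. endpoint G h = v}"

definition finite_multigraph :: "('v, 'e, 'z) multigraph_scheme \<Rightarrow> bool" where
  "finite_multigraph G \<longleftrightarrow>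
     finite (verts G) \<and> finite (edges G) \<and> finite (circles G) \<and>
     edges G \<inter> circles G = {} \<and> endpoint G ` half_edges G \<subseteq> verts G"

definition trivalent :: "('v, 'e, 'z) multigraph_scheme \<Rightarrow> bool" where
  "trivalent G \<longleftrightarrow> finite_multigraph G \<and> (\<forall>v\<in>verts G. card (half_edges_at G v) = 3)"

text \<open>
  A map of (the topological realization of) \<open>G\<close> to \<open>\<real>\<^sup>3\<close>, given by the images of the vertices and a
  parametrization over \<open>[0,1]\<close> of the image of each edge and each vertexless circle.
\<close>

record ('v, 'e) drawing =
  place :: "'v \<Rightarrow> real ^ 3"
  curve :: "'e \<Rightarrow> real \<Rightarrow> real ^ 3"

definition open_curve :: "('v, 'e, 'z) multigraph_scheme \<Rightarrow> ('v, 'e) drawing \<Rightarrow> 'e \<Rightarrow> (real ^ 3) set" where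
  "open_curve G \<Gamma> e = (if e \<in> circles G then path_image (curve \<Gamma> e) else curve \<Gamma> e ` {0<..<1})"

text \<open>
  \<open>\<Gamma>\<close> is a topological embedding of \<open>G\<close> into \<open>S\<^sup>2\<close>. Since the realization of a finite graph is compact,
  this means continuous and injective.
\<close>

definition plane_graph :: "('v, 'e, 'z) multigraph_scheme \<Rightarrow> ('v, 'e) drawing \<Rightarrow> bool" where
  "plane_graph G \<Gamma> \<longleftrightarrow>
     inj_on (place \<Gamma>) (verts G) \<and>
     place \<Gamma> ` verts G \<subseteq> sphere 0 1 \<and>
     (\<forall>e \<in> edges G \<union> circles G. simple_path (curve \<Gamma> e) \<and> path_image (curve \<Gamma> e) \<subseteq> sphere 0 1) \<and>
     (\<forall>e \<in> edges G.
        pathstart (curve \<Gamma> e) = place \<Gamma> (endpoint G (e, False)) \<and>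
        pathfinish (curve \<Gamma> e) = place \<Gamma> (endpoint G (e, True))) \<and>
     (\<forall>e \<in> circles G. pathfinish (curve \<Gamma> e) = pathstart (curve \<Gamma> e)) \<and>
     (\<forall>e \<in> edges G \<union> circles G. open_curve G \<Gamma> e \<inter> place \<Gamma> ` verts G = {}) \<and>
     disjoint_family_on (open_curve G \<Gamma>) (edges G \<union> circles G)"

definition planar :: "('v, 'e) multigraph \<Rightarrow> bool" where
  "planar G \<longleftrightarrow> (\<exists>\<Gamma>. plane_graph G \<Gamma>)"


section \<open>The counterclockwise order at a vertex\<close>

definition half_curve :: "('v, 'e) drawing \<Rightarrow> 'e half_edge \<Rightarrow> real \<Rightarrow> real ^ 3" where
  "half_curve \<Gamma> h = (if snd h then reversepath (curve \<Gamma> (fst h)) else curve \<Gamma> (fst h))"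

text \<open>The point at which a path first meets the sphere of radius \<open>r\<close> around its starting point.\<close>

definition first_exit :: "(real \<Rightarrow> 'a::metric_space) \<Rightarrow> real \<Rightarrow> 'a" where
  "first_exit g r = g (Inf {t \<in> {0..1}. dist (pathstart g) (g t) = r})"

text \<open>
  Let three half-edges start at the point \<open>p\<close> of \<open>S\<^sup>2\<close>. For small \<open>r\<close> they leave the disc
  \<open>{z \<in> S\<^sup>2. dist p z \<le> r}\<close> for the first time at three distinct points \<open>a, b, c\<close> of its boundary circle.
  That circle lies in a plane orthogonal to \<open>p\<close>, so \<open>a, b, c\<close> follow each other counterclockwise,
  seen from outside \<open>S\<^sup>2\<close>, iff the triple product of \<open>b - a\<close>, \<open>c - a\<close> and \<open>p\<close> is positive.
\<close>

definition ccw_triple :: "('v, 'e) drawing \<Rightarrow> 'e half_edge \<Rightarrow> 'e half_edge \<Rightarrow> 'e half_edge \<Rightarrow> bool" where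
  "ccw_triple \<Gamma> h1 h2 h3 \<longleftrightarrow>
     (\<forall>\<^sub>F r in at_right 0.
        let a = first_exit (half_curve \<Gamma> h1) r;
            b = first_exit (half_curve \<Gamma> h2) r;
            c = first_exit (half_curve \<Gamma> h3) r
        in cross3 (b - a) (c - a) \<bullet> pathstart (half_curve \<Gamma> h1) > 0)"

text \<open>
  A trivalent graph together with, for each half-edge \<open>h\<close>, the half-edge \<open>ccw h\<close> that follows \<open>h\<close> in
  counterclockwise direction around their common vertex. Blow-ups and states of a plane graph
  depend on the plane graph only through these data.
\<close>

record ('v, 'e) rot_graph = "('v, 'e) multigraph" +
  ccw :: "'e half_edge \<Rightarrow> 'e half_edge"

definition rotation :: "('v, 'e) multigraph \<Rightarrow> ('v, 'e) drawing \<Rightarrow> 'e half_edge \<Rightarrow> 'e half_edge" where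
  "rotation G \<Gamma> h =
     (THE h'. \<exists>h''. half_edges_at G (endpoint G h) = {h, h', h''} \<and> ccw_triple \<Gamma> h h' h'')"

definition rot_graph_of :: "('v, 'e) multigraph \<Rightarrow> ('v, 'e) drawing \<Rightarrow> ('v, 'e) rot_graph" where
  "rot_graph_of G \<Gamma> =
     \<lparr>verts = verts G, edges = edges G, circles = circles G, endpoint = endpoint G,
      ccw = rotation G \<Gamma>\<rparr>"


section \<open>Blow-up\<close>

text \<open>
  The circle around a vertex meets each half-edge \<open>h\<close> at it in a new vertex, again called \<open>h\<close>. The
  original edge \<open>e\<close> becomes \<open>Inl e\<close>; \<open>Inr h\<close> is the arc of the circle that runs counterclockwise from
  \<open>h\<close> to the next new vertex \<open>ccw P h\<close>. Around the new vertex \<open>h\<close> one meets, counterclockwise from the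
  half-edge of the original edge (which points out of the circle): the beginning of the arc \<open>Inr h\<close>,
  then the end of the arc that arrives at \<open>h\<close>. The latter is \<open>Inr (ccw P (ccw P h))\<close>, as \<open>ccw P\<close>
  has order three on the half-edges.
\<close>

fun blowup_endpoint :: "('v, 'e) rot_graph \<Rightarrow> ('e + 'e half_edge) half_edge \<Rightarrow> 'e half_edge" where
  "blowup_endpoint P (Inl e, b) = (e, b)"
| "blowup_endpoint P (Inr h, False) = h"
| "blowup_endpoint P (Inr h, True) = ccw P h"

fun blowup_ccw ::
  "('v, 'e) rot_graph \<Rightarrow> ('e + 'e half_edge) half_edge \<Rightarrow> ('e + 'e half_edge) half_edge" where
  "blowup_ccw P (Inl e, b) = (Inr (e, b), False)"
| "blowup_ccw P (Inr h, False) = (Inr (ccw P (ccw P h)), True)"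
| "blowup_ccw P (Inr h, True) = (Inl (fst (ccw P h)), snd (ccw P h))"

definition blowup :: "('v, 'e) rot_graph \<Rightarrow> ('e half_edge, 'e + 'e half_edge) rot_graph" where
  "blowup P =
     \<lparr>verts = half_edges P,
      edges = Inl ` edges P \<union> Inr ` half_edges P,
      circles = Inl ` circles P,
      endpoint = blowup_endpoint P,
      ccw = blowup_ccw P\<rparr>"


section \<open>States and the 2-factor polynomial\<close>

text \<open>
  In the following \<open>M\<close> is a perfect matching of \<open>P\<close>, and a vector \<open>\<alpha> \<in> {0,1}\<^sup>n\<close> is represented by the
  set \<open>A \<subseteq> M\<close> of those matching edges whose entry is \<open>1\<close>. For \<open>m \<in> M\<close> with half-edges \<open>(m, False)\<close>
  at \<open>u\<close> and \<open>(m, True)\<close> at \<open>v\<close>, the other half-edges at \<open>u\<close> and \<open>v\<close> are \<open>x\<^sub>1, x\<^sub>2\<close> and \<open>y\<^sub>1, y\<^sub>2\<close>.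
\<close>

definition end_x1 :: "('v, 'e) rot_graph \<Rightarrow> 'e \<Rightarrow> 'e half_edge" where
  "end_x1 P m = ccw P (m, False)"

definition end_x2 :: "('v, 'e) rot_graph \<Rightarrow> 'e \<Rightarrow> 'e half_edge" where
  "end_x2 P m = ccw P (ccw P (m, False))"

definition end_y1 :: "('v, 'e) rot_graph \<Rightarrow> 'e \<Rightarrow> 'e half_edge" where
  "end_y1 P m = ccw P (m, True)"

definition end_y2 :: "('v, 'e) rot_graph \<Rightarrow> 'e \<Rightarrow> 'e half_edge" where
  "end_y2 P m = ccw P (ccw P (m, True))"

definition smoothing :: "('v, 'e) rot_graph \<Rightarrow> 'e set \<Rightarrow> 'e \<Rightarrow> 'e half_edge rel" where
  "smoothing P A m =
     (if m \<in> A then {(end_x1 P m, end_y1 P m), (end_x2 P m, end_y2 P m)}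
      else {(end_x1 P m, end_y2 P m), (end_x2 P m, end_y1 P m)})"

definition state_edges :: "('v, 'e) rot_graph \<Rightarrow> 'e set \<Rightarrow> 'e set" where
  "state_edges P M = (edges P - M) \<union> circles P"

definition state_joins :: "('v, 'e) rot_graph \<Rightarrow> 'e set \<Rightarrow> 'e set \<Rightarrow> 'e half_edge rel" where
  "state_joins P M A =
     {((e, False), (e, True)) | e. e \<in> state_edges P M} \<union> (\<Union>m\<in>M. smoothing P A m)"

text \<open>
  A circle of the state is represented by the set of half-edges it runs through; a vertexless circle
  \<open>e\<close> of \<open>P\<close> gives \<open>{(e, False), (e, True)}\<close>. Thereby a circle that does not pass through the
  smoothing of \<open>m\<close> is the same element in the states \<open>A\<close> and \<open>insert m A\<close>.
\<close>

definition state_circles :: "('v, 'e) rot_graph \<Rightarrow> 'e set \<Rightarrow> 'e set \<Rightarrow> 'e half_edge set set" where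
  "state_circles P M A =
     (state_edges P M \<times> UNIV) // (state_joins P M A \<union> (state_joins P M A)\<inverse>)\<^sup>*"

definition two_factor_poly :: "('v, 'e) rot_graph \<Rightarrow> 'e set \<Rightarrow> int fls" where
  "two_factor_poly P M =
     (\<Sum>A\<in>Pow M. (- fls_X) ^ card A * (fls_X_inv + fls_X) ^ card (state_circles P M A))"


section \<open>The cochain complex\<close>

text \<open>
  \<open>Lab1\<close> and \<open>LabX\<close> are the basis vectors \<open>1\<close> and \<open>x\<close> of \<open>V\<close>; \<open>V\<^bsup>\<otimes>k\<^esup>\<close> has the labelings of the \<open>k\<close> circles
  by \<open>Lab1\<close> and \<open>LabX\<close> as a basis. A cochain is given by its coordinates with respect to the
  basis of all labeled states \<open>(A, s)\<close>.
\<close>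

datatype label = Lab1 | LabX

fun label_degree :: "label \<Rightarrow> int" where
  "label_degree Lab1 = 1"
| "label_degree LabX = -1"

text \<open>\<open>mult_coeff a b c\<close> is the coefficient of \<open>c\<close> in \<open>m (a \<otimes> b)\<close>, and \<open>comult_coeff a b c\<close> is the
  coefficient of \<open>b \<otimes> c\<close> in \<open>\<Delta> a\<close>.\<close>

fun mult_coeff :: "label \<Rightarrow> label \<Rightarrow> label \<Rightarrow> bit" where
  "mult_coeff Lab1 b c = of_bool (c = b)"
| "mult_coeff LabX Lab1 c = of_bool (c = LabX)"
| "mult_coeff LabX LabX c = 0"

fun comult_coeff :: "label \<Rightarrow> label \<Rightarrow> label \<Rightarrow> bit" where
  "comult_coeff Lab1 b c = of_bool ((b = Lab1 \<and> c = LabX) \<or> (b = LabX \<and> c = Lab1))"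
| "comult_coeff LabX b c = of_bool (b = LabX \<and> c = LabX)"

definition labelings ::
  "('v, 'e) rot_graph \<Rightarrow> 'e set \<Rightarrow> 'e set \<Rightarrow> ('e half_edge set \<Rightarrow> label) set" where
  "labelings P M A = (state_circles P M A \<rightarrow>\<^sub>E UNIV)"

definition circles_at ::
  "('v, 'e) rot_graph \<Rightarrow> 'e set \<Rightarrow> 'e set \<Rightarrow> 'e \<Rightarrow> 'e half_edge set set" where
  "circles_at P M A m =
     {c \<in> state_circles P M A. c \<inter> {end_x1 P m, end_x2 P m, end_y1 P m, end_y2 P m} \<noteq> {}}"

text \<open>
  The coefficient of the labeled state \<open>(insert m A, t)\<close> in the image of \<open>(A, s)\<close> under
  the map from \<open>V\<^bsub>A\<^esub>\<close> to \<open>V\<^bsub>insert m A\<^esub>\<close>. The choice of the names \<open>a\<close>, \<open>b\<close> (resp. \<open>c\<close>, \<open>d\<close>) for two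
  circles is immaterial because \<open>m\<close> is commutative and \<open>\<Delta>\<close> is cocommutative.
\<close>

definition edge_map_coeff ::
  "('v, 'e) rot_graph \<Rightarrow> 'e set \<Rightarrow> 'e set \<Rightarrow> 'e \<Rightarrow>
   ('e half_edge set \<Rightarrow> label) \<Rightarrow> ('e half_edge set \<Rightarrow> label) \<Rightarrow> bit" where
  "edge_map_coeff P M A m s t = of_bool
     ((\<forall>c \<in> state_circles P M A - circles_at P M A m. t c = s c) \<and>
      ((\<exists>a b c. circles_at P M A m = {a, b} \<and> a \<noteq> b \<and> circles_at P M (insert m A) m = {c} \<and>
                mult_coeff (s a) (s b) (t c) = 1) \<or>
       (\<exists>a c d. circles_at P M A m = {a} \<and> circles_at P M (insert m A) m = {c, d} \<and> c \<noteq> d \<and>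
                comult_coeff (s a) (t c) (t d) = 1)))"

type_synonym 'e cochain = "'e set \<times> ('e half_edge set \<Rightarrow> label) \<Rightarrow> bit"

text \<open>The summand \<open>card A\<close> in the second degree is the shift \<open>{|\<alpha>|}\<close>.\<close>

definition labeled_states ::
  "('v, 'e) rot_graph \<Rightarrow> 'e set \<Rightarrow> int \<Rightarrow> int \<Rightarrow> ('e set \<times> ('e half_edge set \<Rightarrow> label)) set" where
  "labeled_states P M i j =
     {(A, s). A \<subseteq> M \<and> s \<in> labelings P M A \<and> int (card A) = i \<and>
              (\<Sum>c\<in>state_circles P M A. label_degree (s c)) + int (card A) = j}"

definition cochains :: "('v, 'e) rot_graph \<Rightarrow> 'e set \<Rightarrow> int \<Rightarrow> int \<Rightarrow> 'e cochain set" where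
  "cochains P M i j = {f. \<forall>g. g \<notin> labeled_states P M i j \<longrightarrow> f g = 0}"

definition differential :: "('v, 'e) rot_graph \<Rightarrow> 'e set \<Rightarrow> 'e cochain \<Rightarrow> 'e cochain" where
  "differential P M f = (\<lambda>(B, t).
     if B \<subseteq> M \<and> t \<in> labelings P M B
     then \<Sum>m\<in>B. \<Sum>s\<in>labelings P M (B - {m}).
            edge_map_coeff P M (B - {m}) m s t * f (B - {m}, s)
     else 0)"

definition cocycles :: "('v, 'e) rot_graph \<Rightarrow> 'e set \<Rightarrow> int \<Rightarrow> int \<Rightarrow> 'e cochain set" where
  "cocycles P M i j = {f \<in> cochains P M i j. differential P M f = (\<lambda>_. 0)}"

definition coboundaries :: "('v, 'e) rot_graph \<Rightarrow> 'e set \<Rightarrow> int \<Rightarrow> int \<Rightarrow> 'e cochain set" where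
  "coboundaries P M i j = differential P M ` cochains P M (i - 1) j"


section \<open>Cohomology\<close>

text \<open>
  The quotient of a space \<open>Z\<close> of functions by a subspace \<open>B\<close>, with the cosets of \<open>B\<close> as elements.
  The fields \<open>mult\<close> and \<open>one\<close> exist only because \<open>module\<close> extends \<open>ring\<close>; they play no role.
\<close>

definition quotient_space ::
  "('a \<Rightarrow> 'k::field) set \<Rightarrow> ('a \<Rightarrow> 'k) set \<Rightarrow> ('k, ('a \<Rightarrow> 'k) set) module" where
  "quotient_space Z B =
     \<lparr>carrier = (\<lambda>f. {(\<lambda>x. f x + b x) | b. b \<in> B}) ` Z,
      mult = (\<lambda>_ _. B),
      one = B,
      zero = B,
      add = (\<lambda>S T. {(\<lambda>x. f x + g x) | f g. f \<in> S \<and> g \<in> T}),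
      smult = (\<lambda>k S. {(\<lambda>x. k * f x + b x) | f b. f \<in> S \<and> b \<in> B})\<rparr>"

definition cohomology ::
  "('v, 'e) rot_graph \<Rightarrow> 'e set \<Rightarrow> int \<Rightarrow> int \<Rightarrow> (bit, 'e cochain set) module" where
  "cohomology P M i j = quotient_space (cocycles P M i j) (coboundaries P M i j)"

definition bigraded_isomorphic ::
  "(int \<Rightarrow> int \<Rightarrow> ('k::field, 'a) module) \<Rightarrow> (int \<Rightarrow> int \<Rightarrow> ('k, 'b) module) \<Rightarrow> bool" where
  "bigraded_isomorphic H H' \<longleftrightarrow>
     (\<forall>i j. \<exists>\<phi> \<in> module_hom class_ring (H i j) (H' i j).
        bij_betw \<phi> (carrier (H i j)) (carrier (H' i j)))"

definition qdim :: "(int \<Rightarrow> ('k::field, 'a) module) \<Rightarrow> int fls" where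
  "qdim W =
     (\<Sum>m | vectorspace.dim class_ring (W m) \<noteq> 0.
        of_nat (vectorspace.dim class_ring (W m)) * fls_X_intpow m)"


section \<open>The polynomial and the cohomology obtained from a plane graph\<close>

definition plane_graph_poly :: "('v, 'e) multigraph \<Rightarrow> ('v, 'e) drawing \<Rightarrow> int fls" where
  "plane_graph_poly G \<Gamma> = two_factor_poly (blowup (rot_graph_of G \<Gamma>)) (Inl ` edges G)"

definition plane_graph_cohomology ::
  "('v, 'e) multigraph \<Rightarrow> ('v, 'e) drawing \<Rightarrow> int \<Rightarrow> int \<Rightarrow>
   (bit, ('e + 'e half_edge) cochain set) module" where
  "plane_graph_cohomology G \<Gamma> = cohomology (blowup (rot_graph_of G \<Gamma>)) (Inl ` edges G)"

end

theory Submission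
  imports Defs "HOL-Complex_Analysis.Complex_Analysis"
begin

text \<open>
  The state of the blow-up for the all-zero vector consists of the boundary circles of the faces of
  \<open>\<Gamma>\<close>, so in general the states depend on \<open>\<Gamma>\<close>. What does not depend on it is the space
  \<open>W\<^sub>A\<close> of unions of circles of the state \<open>A\<close>, for all \<open>A\<close> at the same time. A union of circles is a
  \<open>\<int>\<^sub>2\<close>-valued function on the corners of \<open>\<Gamma>\<close>. Its jumps across the edges form an even set \<open>z\<close> of
  edges of \<open>G\<close>. By the Jordan curve theorem every even \<open>z\<close> is the boundary of a set of faces, and this
  set can be chosen to depend linearly on \<open>z\<close>. The difference to the chosen set is constant around
  every vertex, that is, a set \<open>t\<close> of vertices, and the union is compatible with the smoothings of \<open>A\<close>
  iff the coboundary of \<open>t\<close> is \<open>z \<inter> A\<close>. This condition on \<open>(z, t)\<close> involves only \<open>G\<close>.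

  The chain group at \<open>A\<close> is the exterior algebra of \<open>W\<^sub>A\<close>: a labeled state corresponds to the
  product of its circles labeled \<open>1\<close>. A split at \<open>m\<close> is then an inclusion \<open>W\<^sub>A \<subseteq> W\<^bsub>A\<union>{m}\<^esub>\<close>, and a
  merge is the contraction with the coordinate \<open>m\<close> of \<open>z\<close>. Hence the whole complex is determined by
  the spaces \<open>W\<^sub>A\<close>, and the Euler characteristic is computed by counting dimensions.
\<close>

section \<open>An exterior algebra over the field with two elements\<close>

text \<open>A tensor power of V refers to individual circles, an exterior algebra only to the space
  that they span. Reading the label 1 as a factor and x as its absence turns both structure maps
  into operations natural in that space. Which of merge, split and zero map occurs at m is visible
  in the spaces too, from where the coordinate m vanishes. So equal spaces give isomorphic complexes
  although the circles of two plane graphs need not correspond to each other.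

  Planarity enters only through the fact that even edge sets are boundaries. An even set is a sum of
  simple cycles, so it is enough that one cycle bounds. The obstacle is that edges are merely
  continuous: they may spiral into a vertex, and the counterclockwise order is defined by first
  exits from small discs. This order has to be shown independent of the disc and consistent with the
  sides of a cycle; both are expressed by winding numbers after a stereographic projection from a
  point off the edges.

  All spaces are finite over the field with two elements, so dimensions are found as exponents of
  cardinalities.\<close>

declare add_bit_eq_xor [simp del] mult_bit_eq_and [simp del]

lemma bit_add_self [simp]: "(b :: bit) + b = 0"
  by (cases b) auto

text \<open>
  An element is given by its coefficients at the square-free monomials, which are the finite sets of
  generators. The support itself need not be finite. As the characteristic is two, the algebra is
  commutative and every generator has square zero.
\<close>

typedef 'a ext = "{f :: 'a set \<Rightarrow> bit. \<forall>K. infinite K \<longrightarrow> f K = 0}"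
  morphisms ext_coeff Abs_ext
  by (rule exI[of _ "\<lambda>_. 0"]) simp

setup_lifting type_definition_ext

lemma ext_eqI: "(\<And>K. finite K \<Longrightarrow> ext_coeff f K = ext_coeff g K) \<Longrightarrow> f = g"
  by transfer (metis ext)

instantiation ext :: (type) comm_ring_1
begin

lift_definition zero_ext :: "'a ext" is "\<lambda>_. 0" by simp

lift_definition one_ext :: "'a ext" is "\<lambda>K. of_bool (K = {})" by auto

lift_definition plus_ext :: "'a ext \<Rightarrow> 'a ext \<Rightarrow> 'a ext" is "\<lambda>f g K. f K + g K" by simp

lift_definition minus_ext :: "'a ext \<Rightarrow> 'a ext \<Rightarrow> 'a ext" is "\<lambda>f g K. f K - g K" by simp

lift_definition uminus_ext :: "'a ext \<Rightarrow> 'a ext" is "\<lambda>f K. - f K" by simp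

text \<open>For infinite \<open>K\<close> the index set is infinite and the sum is 0 by convention,
  so the product vanishes there as the type demands.\<close>

lift_definition times_ext :: "'a ext \<Rightarrow> 'a ext \<Rightarrow> 'a ext"
  is "\<lambda>f g K. \<Sum>L\<in>Pow K. f L * g (K - L)"
  by (simp add: finite_Pow_iff)

instance
proof
  fix a b c :: "'a ext"
  show "a + b + c = a + (b + c)" by transfer (simp add: add.assoc)
  show "a + b = b + a" by transfer (simp add: add.commute)
  show "0 + a = a" by transfer simp
  show "- a + a = 0" by transfer simp
  show "a - b = a + - b" by transfer simp
  show "(a + b) * c = a * c + b * c" by transfer (simp add: distrib_right sum.distrib)
  show "(0::'a ext) \<noteq> 1" by transfer (auto simp: fun_eq_iff)
  show "a * b = b * a"
  proof (transfer, rule ext)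
    fix f g :: "'a set \<Rightarrow> bit" and K
    show "(\<Sum>L\<in>Pow K. f L * g (K - L)) = (\<Sum>L\<in>Pow K. g L * f (K - L))"
      by (rule sum.reindex_bij_witness[of _ "\<lambda>L. K - L" "\<lambda>L. K - L"])
        (auto simp: double_diff mult.commute)
  qed
  show "1 * a = a"
  proof (rule ext_eqI)
    fix K :: "'a set" assume "finite K"
    then show "ext_coeff (1 * a) K = ext_coeff a K"
    proof transfer
      fix K :: "'a set" and f :: "'a set \<Rightarrow> bit" assume "finite K"
      have "(\<Sum>L\<in>Pow K. of_bool (L = {}) * f (K - L)) = (\<Sum>L\<in>{{}}. of_bool (L = {}) * f (K - L))"
        by (rule sum.mono_neutral_right) (use \<open>finite K\<close> in auto)
      then show "(\<Sum>L\<in>Pow K. of_bool (L = {}) * f (K - L)) = f K" by simp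
    qed
  qed
  show "a * b * c = a * (b * c)"
  proof (rule ext_eqI)
    fix K :: "'a set" assume "finite K"
    then show "ext_coeff (a * b * c) K = ext_coeff (a * (b * c)) K"
    proof transfer
      fix K :: "'a set" and f g h :: "'a set \<Rightarrow> bit" assume K: "finite K"
      have "(\<Sum>L\<in>Pow K. (\<Sum>N\<in>Pow L. f N * g (L - N)) * h (K - L)) =
            (\<Sum>(L, N)\<in>(SIGMA L:Pow K. Pow L). f N * g (L - N) * h (K - L))"
        using K by (subst sum.Sigma[symmetric]) (auto intro: finite_subset simp: sum_distrib_right)
      also have "\<dots> = (\<Sum>(N, Q)\<in>(SIGMA N:Pow K. Pow (K - N)). f N * (g Q * h (K - N - Q)))"
        by (rule sum.reindex_bij_witness[of _ "\<lambda>(N, Q). (N \<union> Q, N)" "\<lambda>(L, N). (N, L - N)"])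
          (auto simp: mult.assoc Diff_Diff_Int intro!: arg_cong[of _ _ h] arg_cong[of _ _ g])
      also have "\<dots> = (\<Sum>N\<in>Pow K. f N * (\<Sum>Q\<in>Pow (K - N). g Q * h (K - N - Q)))"
        using K by (subst sum.Sigma[symmetric]) (auto simp: sum_distrib_left)
      finally show "(\<Sum>L\<in>Pow K. (\<Sum>N\<in>Pow L. f N * g (L - N)) * h (K - L)) =
        (\<Sum>N\<in>Pow K. f N * (\<Sum>Q\<in>Pow (K - N). g Q * h (K - N - Q)))" .
    qed
  qed
qed

end

lemma ext_add_self [simp]: "(x :: 'a ext) + x = 0"
  by transfer (simp add: fun_eq_iff)

lemma ext_two_eq_0 [simp]: "(2 :: 'a ext) = 0"
  by (metis one_add_one ext_add_self)

lemma ext_minus_eq [simp]: "- (x :: 'a ext) = x"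
  using ext_add_self[of x] by (simp add: eq_neg_iff_add_eq_0)

lemma ext_add_left_self [simp]: "(x :: 'a ext) + (x + y) = y"
  by (simp flip: add.assoc)

lift_definition gen :: "'a \<Rightarrow> 'a ext" is "\<lambda>a K. of_bool (K = {a})" by auto

lemma ext_coeff_add [simp]: "ext_coeff (f + g) K = ext_coeff f K + ext_coeff g K"
  by transfer simp

lemma ext_coeff_0 [simp]: "ext_coeff 0 K = 0"
  by transfer simp

text \<open>
  Contraction with the coordinate \<open>a\<close>; it is a derivation because there are no signs modulo two.
\<close>

lift_definition pderiv_at :: "'a \<Rightarrow> 'a ext \<Rightarrow> 'a ext"
  is "\<lambda>a f K. if a \<in> K then 0 else f (insert a K)" by simp

lemma pderiv_at_add: "pderiv_at a (f + g) = pderiv_at a f + pderiv_at a g"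
  by transfer auto

lemma pderiv_at_0 [simp]: "pderiv_at a 0 = 0"
  by transfer auto

lemma pderiv_at_1 [simp]: "pderiv_at a 1 = 0"
  by transfer auto

lemma pderiv_at_gen: "pderiv_at a (gen b) = of_bool (a = b)"
proof (cases "a = b")
  case True
  then show ?thesis by (simp, transfer) (auto simp: fun_eq_iff)
next
  case False
  then show ?thesis by (simp, transfer) (auto simp: fun_eq_iff)
qed

lemma pderiv_at_mult: "pderiv_at a (f * g) = pderiv_at a f * g + f * pderiv_at a g"
proof (rule ext_eqI)
  fix K :: "'a set" assume "finite K"
  then show "ext_coeff (pderiv_at a (f * g)) K = ext_coeff (pderiv_at a f * g + f * pderiv_at a g) K"
  proof transfer
    fix K :: "'a set" and a f and g :: "'a set \<Rightarrow> bit" assume K: "finite K"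
    show "(if a \<in> K then 0 else \<Sum>L\<in>Pow (insert a K). f L * g (insert a K - L)) =
      (\<Sum>L\<in>Pow K. (if a \<in> L then 0 else f (insert a L)) * g (K - L)) +
      (\<Sum>L\<in>Pow K. f L * (if a \<in> K - L then 0 else g (insert a (K - L))))"
      (is "?l = ?r1 + ?r2")
    proof (cases "a \<in> K")
      case False
      have "?l = (\<Sum>L\<in>insert a ` Pow K. f L * g (insert a K - L)) +
                 (\<Sum>L\<in>Pow K. f L * g (insert a K - L))"
        using False K by (simp add: Pow_insert, subst sum.union_disjoint[symmetric])
          (auto simp: Un_commute)
      also have "(\<Sum>L\<in>insert a ` Pow K. f L * g (insert a K - L)) =
                 (\<Sum>L\<in>Pow K. f (insert a L) * g (insert a K - insert a L))"
        by (subst sum.reindex) (use False in \<open>auto simp: inj_on_def\<close>)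
      also have "\<dots> = ?r1"
        by (rule sum.cong) (use False in \<open>auto simp: insert_Diff_if intro!: arg_cong[of _ _ g]\<close>)
      also have "(\<Sum>L\<in>Pow K. f L * g (insert a K - L)) = ?r2"
        by (rule sum.cong) (use False in \<open>auto simp: insert_Diff_if\<close>)
      finally show ?thesis .
    next
      case True
      \<comment> \<open>The left side is 0. The two sums on the right correspond term by term under
        inserting \<open>a\<close> into \<open>L\<close>, hence they cancel modulo two.\<close>
      have "?r1 = (\<Sum>L\<in>Pow (K - {a}). f (insert a L) * g (K - L))"
        by (rule sum.mono_neutral_cong_right) (use K in auto)
      also have "\<dots> = (\<Sum>L\<in>{L \<in> Pow K. a \<in> L}. f L * g (insert a (K - L)))"
        by (rule sum.reindex_bij_witness[of _ "\<lambda>L. L - {a}" "insert a"])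
          (use True in \<open>auto simp: insert_absorb intro!: arg_cong[of _ _ g]\<close>)
      also have "\<dots> = ?r2"
        by (rule sum.mono_neutral_cong_left) (use K True in auto)
      finally show ?thesis using True by simp
    qed
  qed
qed

lemma gen_sq [simp]: "gen a * gen a = 0"
proof (rule ext_eqI)
  fix K :: "'a set" assume "finite K"
  then show "ext_coeff (gen a * gen a) K = ext_coeff 0 K"
  proof transfer
    fix K :: "'a set" and a assume "finite K"
    have "of_bool (L = {a}) * of_bool (K - L = {a}) = (0::bit)" for L
      by (cases "L = {a}") auto
    then show "(\<Sum>L\<in>Pow K. of_bool (L = {a}) * of_bool (K - L = {a})) = (0::bit)"
      by (simp del: of_bool_conj)
  qed
qed

lemma pderiv_at_commute: "pderiv_at a (pderiv_at b f) = pderiv_at b (pderiv_at a f)"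
  by transfer (auto simp: fun_eq_iff insert_commute)

text \<open>For finite \<open>J\<close>, contraction with the functional that is 1 exactly on the
  coordinates in \<open>J\<close>. It is again a derivation; such operators serve as functionals
  dual to the circles of a state.\<close>

definition set_deriv :: "'a set \<Rightarrow> 'a ext \<Rightarrow> 'a ext" where
  "set_deriv J f = (\<Sum>a\<in>J. pderiv_at a f)"

lemma set_deriv_add: "set_deriv J (f + g) = set_deriv J f + set_deriv J g"
  by (simp add: set_deriv_def pderiv_at_add sum.distrib)

lemma set_deriv_0 [simp]: "set_deriv J 0 = 0"
  by (simp add: set_deriv_def)

lemma set_deriv_1 [simp]: "set_deriv J 1 = 0"
  by (simp add: set_deriv_def)

lemma set_deriv_mult: "set_deriv J (f * g) = set_deriv J f * g + f * set_deriv J g"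
  by (simp add: set_deriv_def pderiv_at_mult sum.distrib sum_distrib_left sum_distrib_right)

lemma set_deriv_sum: "set_deriv J (sum f A) = (\<Sum>a\<in>A. set_deriv J (f a))"
  by (induction A rule: infinite_finite_induct) (simp_all add: set_deriv_add)

definition vec_of :: "'a set \<Rightarrow> 'a ext" where
  "vec_of K = (\<Sum>a\<in>K. gen a)"

lemma vec_of_empty [simp]: "vec_of {} = 0"
  by (simp add: vec_of_def)

lemma vec_of_insert: "finite K \<Longrightarrow> a \<notin> K \<Longrightarrow> vec_of (insert a K) = gen a + vec_of K"
  by (simp add: vec_of_def)

text \<open>Mixed products occur twice and cancel, and generators have square zero.\<close>

lemma vec_of_sq [simp]: "vec_of K * vec_of K = 0"
proof (induction K rule: infinite_finite_induct)
  case (insert a K)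
  have "vec_of (insert a K) * vec_of (insert a K) =
    gen a * gen a + (gen a * vec_of K + gen a * vec_of K) + vec_of K * vec_of K"
    using insert by (simp add: vec_of_insert algebra_simps)
  then show ?case using insert by simp
qed (simp_all add: vec_of_def)

lemma vec_of_symdiff:
  assumes "finite K" "finite L"
  shows "vec_of (sym_diff K L) = vec_of K + vec_of L"
proof -
  have "vec_of K = vec_of (K - L) + vec_of (K \<inter> L)" "vec_of L = vec_of (L - K) + vec_of (K \<inter> L)"
    unfolding vec_of_def using assms
    by (subst sum.union_disjoint[symmetric]; auto intro!: sum.cong)+
  moreover have "vec_of (sym_diff K L) = vec_of (K - L) + vec_of (L - K)"
    unfolding vec_of_def using assms by (subst sum.union_disjoint[symmetric]) auto
  ultimately show ?thesis
    by (simp add: algebra_simps)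
qed

lemma of_bool_ext_add: "of_bool p + of_bool q = (of_bool (p \<noteq> q) :: 'a ext)"
  by auto

lemma set_deriv_gen: "finite J \<Longrightarrow> set_deriv J (gen b) = of_bool (b \<in> J)"
  by (simp add: set_deriv_def pderiv_at_gen of_bool_def)

lemma sum_of_bool_ext: "finite A \<Longrightarrow> (\<Sum>a\<in>A. of_bool (p a)) = (of_bool (odd (card {a\<in>A. p a})) :: 'a ext)"
proof (induction A rule: finite_induct)
  case (insert a A)
  have "{x \<in> insert a A. p x} = (if p a then insert a {x\<in>A. p x} else {x\<in>A. p x})" by auto
  then have "card {x \<in> insert a A. p x} = of_bool (p a) + card {x\<in>A. p x}"
    using insert by simp
  then show ?case using insert by (simp add: of_bool_ext_add del: sum_of_bool_eq)
qed simp

lemma set_deriv_vec_of: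
  assumes "finite J" "finite K"
  shows "set_deriv J (vec_of K) = of_bool (odd (card (J \<inter> K)))"
proof -
  have "{a\<in>K. a \<in> J} = J \<inter> K" by auto
  then show ?thesis
    using assms by (simp add: vec_of_def set_deriv_sum set_deriv_gen sum_of_bool_ext del: sum_of_bool_eq)
qed

definition emb :: "bit \<Rightarrow> 'a ext" where
  "emb b = (if b = 0 then 0 else 1)"

lemma emb_0 [simp]: "emb 0 = 0" and emb_1 [simp]: "emb 1 = 1"
  by (simp_all add: emb_def)

lemma emb_add: "emb (a + b) = emb a + emb b"
  by (cases a; cases b) simp_all

lemma emb_mult: "emb (a * b) = emb a * emb b"
  by (cases a; cases b) simp_all

lemma emb_of_bool [simp]: "emb (of_bool p) = of_bool p"
  by simp

lemma emb_sum: "emb (sum f A) = (\<Sum>a\<in>A. emb (f a))"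
  by (induction A rule: infinite_finite_induct) (simp_all add: emb_add)

lemma pderiv_at_sum: "pderiv_at a (sum f A) = (\<Sum>x\<in>A. pderiv_at a (f x))"
  by (induction A rule: infinite_finite_induct) (simp_all add: pderiv_at_add)

lemma UNIV_label: "(UNIV :: label set) = {Lab1, LabX}"
  by (auto intro: label.exhaust)

instance label :: finite
  by standard (simp add: UNIV_label)

text \<open>The \<open>p\<close>-th exterior power of the span of \<open>W\<close>; over two
  elements, sums of products suffice. It is built from \<open>W\<close> without a basis, which lets
  two different systems of circles share it.\<close>

inductive_set ext_power :: "'a ext set \<Rightarrow> nat \<Rightarrow> 'a ext set" for W :: "'a ext set" and p :: nat where
  zero: "0 \<in> ext_power W p"
| add: "length ws = p \<Longrightarrow> set ws \<subseteq> W \<Longrightarrow> y \<in> ext_power W p \<Longrightarrow> prod_list ws + y \<in> ext_power W p"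

lemma ext_power_prod: "length ws = p \<Longrightarrow> set ws \<subseteq> W \<Longrightarrow> prod_list ws \<in> ext_power W p"
  using ext_power.add[OF _ _ ext_power.zero, of ws p W] by simp

lemma ext_power_add: "x \<in> ext_power W p \<Longrightarrow> y \<in> ext_power W p \<Longrightarrow> x + y \<in> ext_power W p"
  by (induction rule: ext_power.induct) (simp_all add: add.assoc ext_power.add)

lemma ext_power_sum: "(\<And>a. a \<in> A \<Longrightarrow> f a \<in> ext_power W p) \<Longrightarrow> sum f A \<in> ext_power W p"
  by (induction A rule: infinite_finite_induct) (simp_all add: ext_power.zero ext_power_add)

lemma ext_power_emb: "x \<in> ext_power W p \<Longrightarrow> emb b * x \<in> ext_power W p"
  by (cases b) (simp_all add: ext_power.zero)

text \<open>By the Leibniz rule a derivation is determined on products by its values on the factors.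
  This serves coordinates that agree on \<open>W\<close> but not on the whole algebra.\<close>

lemma pderiv_at_ext_power_cong:
  assumes "x \<in> ext_power W p" and "\<And>w. w \<in> W \<Longrightarrow> pderiv_at a w = pderiv_at b w"
  shows "pderiv_at a x = pderiv_at b x"
  using assms(1)
proof (induction rule: ext_power.induct)
  case (add ws y)
  have "pderiv_at a (prod_list ws) = pderiv_at b (prod_list ws)"
    using add(2) by (induction ws) (simp_all add: pderiv_at_mult assms(2))
  then show ?case using add by (simp add: pderiv_at_add)
qed simp

lemma pderiv_at_ext_power_eq_0:
  assumes "x \<in> ext_power W p" and "\<And>w. w \<in> W \<Longrightarrow> pderiv_at a w = 0"
  shows "pderiv_at a x = 0"
  using assms(1)
proof (induction rule: ext_power.induct)
  case (add ws y)
  have "pderiv_at a (prod_list ws) = 0"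
    using add(2) by (induction ws) (simp_all add: pderiv_at_mult assms(2))
  then show ?case using add by (simp add: pderiv_at_add)
qed simp

datatype transition = Merge | Split | Single

section \<open>Complexes modelled in the exterior algebra\<close>

text \<open>
  The circles of each state \<open>A\<close> are realized as a basis of \<open>W A\<close>; \<open>ix m\<close> is the coordinate with
  respect to which a merge at \<open>m\<close> is a contraction.
\<close>

locale circle_model =
  fixes P :: "('v, 'e) rot_graph" and M :: "'e set"
    and vec :: "'e half_edge set \<Rightarrow> 'i ext"
    and W :: "'e set \<Rightarrow> 'i ext set" and ix :: "'e \<Rightarrow> 'i"
  assumes finite_M: "finite M"
    and finite_circles: "A \<subseteq> M \<Longrightarrow> finite (state_circles P M A)"
    and W_eq: "A \<subseteq> M \<Longrightarrow> W A = sum vec ` Pow (state_circles P M A)"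
    and vec_sq: "A \<subseteq> M \<Longrightarrow> c \<in> state_circles P M A \<Longrightarrow> vec c * vec c = 0"
    and dual: "A \<subseteq> M \<Longrightarrow> c \<in> state_circles P M A \<Longrightarrow>
      \<exists>J. \<forall>c'\<in>state_circles P M A. set_deriv J (vec c') = of_bool (c' = c)"
    and W_Int: "A \<subseteq> M \<Longrightarrow> m \<in> M - A \<Longrightarrow>
      {w \<in> W (insert m A). pderiv_at (ix m) w = 0} = {w \<in> W A. pderiv_at (ix m) w = 0}"
    and pderiv_W: "A \<subseteq> M \<Longrightarrow> m \<in> M \<Longrightarrow> w \<in> W A \<Longrightarrow> pderiv_at (ix m) w \<in> {0, 1}"
    and away: "A \<subseteq> M \<Longrightarrow> m \<in> M - A \<Longrightarrow>
      state_circles P M (insert m A) - circles_at P M (insert m A) m =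
      state_circles P M A - circles_at P M A m"
    and pderiv_away: "A \<subseteq> M \<Longrightarrow> m \<in> M - A \<Longrightarrow>
      c \<in> state_circles P M A - circles_at P M A m \<Longrightarrow> pderiv_at (ix m) (vec c) = 0"
    and transition_cases: "A \<subseteq> M \<Longrightarrow> m \<in> M - A \<Longrightarrow>
      (\<exists>a b c. circles_at P M A m = {a, b} \<and> a \<noteq> b \<and> circles_at P M (insert m A) m = {c} \<and>
         vec c = vec a + vec b \<and> pderiv_at (ix m) (vec a) = 1 \<and> pderiv_at (ix m) (vec b) = 1) \<or>
      (\<exists>a c d. circles_at P M A m = {a} \<and> circles_at P M (insert m A) m = {c, d} \<and> c \<noteq> d \<and>
         vec a = vec c + vec d \<and> pderiv_at (ix m) (vec c) = 1 \<and> pderiv_at (ix m) (vec d) = 1) \<or>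
      (\<exists>a c. circles_at P M A m = {a} \<and> circles_at P M (insert m A) m = {c} \<and>
         pderiv_at (ix m) (vec a) = 0 \<and> pderiv_at (ix m) (vec c) = 0)"

text \<open>The type is read off from the spaces alone: a coordinate that is nonzero somewhere
  before the change is lost by merging, one that is nonzero only afterwards is gained by
  splitting.\<close>

definition transition_type :: "('e set \<Rightarrow> 'i ext set) \<Rightarrow> ('e \<Rightarrow> 'i) \<Rightarrow> 'e set \<Rightarrow> 'e \<Rightarrow> transition" where
  "transition_type W ix A m =
     (if \<exists>w\<in>W A. pderiv_at (ix m) w \<noteq> 0 then Merge
      else if \<exists>w\<in>W (insert m A). pderiv_at (ix m) w \<noteq> 0 then Split else Single)"

text \<open>If \<open>vec c = vec a + vec b\<close> and both summands have coordinate 1, contraction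
  maps \<open>vec a * vec b\<close> to \<open>vec c\<close>, each of \<open>vec a\<close> and
  \<open>vec b\<close> to 1, and 1 to 0; this is the table of the multiplication. For a split,
  \<open>vec a = vec c + vec d\<close> is itself the value of the comultiplication at the label
  1.\<close>

definition edge_op :: "('e set \<Rightarrow> 'i ext set) \<Rightarrow> ('e \<Rightarrow> 'i) \<Rightarrow> 'e set \<Rightarrow> 'e \<Rightarrow> 'i ext \<Rightarrow> 'i ext" where
  "edge_op W ix A m x =
     (case transition_type W ix A m of Merge \<Rightarrow> pderiv_at (ix m) x | Split \<Rightarrow> x | Single \<Rightarrow> 0)"

definition model_diff ::
  "'e set \<Rightarrow> ('e set \<Rightarrow> 'i ext set) \<Rightarrow> ('e \<Rightarrow> 'i) \<Rightarrow> ('e set \<Rightarrow> 'i ext) \<Rightarrow> 'e set \<Rightarrow> 'i ext" where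
  "model_diff M W ix g B = (if B \<subseteq> M then \<Sum>m\<in>B. edge_op W ix (B - {m}) m (g (B - {m})) else 0)"

text \<open>
  A labeling with \<open>p\<close> labels \<open>1\<close> on \<open>k\<close> circles has degree \<open>p - (k - p)\<close> before the shift.
\<close>

definition model_cochains ::
  "'e set \<Rightarrow> ('e set \<Rightarrow> 'i ext set) \<Rightarrow> ('e set \<Rightarrow> nat) \<Rightarrow> int \<Rightarrow> int \<Rightarrow> ('e set \<Rightarrow> 'i ext) set" where
  "model_cochains M W k i j =
     {g. \<forall>A. g A = 0 \<or>
           A \<subseteq> M \<and> int (card A) = i \<and> (\<exists>p. g A \<in> ext_power (W A) p \<and> 2 * int p - int (k A) + i = j)}"

lemma edge_op_add: "edge_op W ix A m (x + y) = edge_op W ix A m x + edge_op W ix A m y"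
  by (simp add: edge_op_def pderiv_at_add split: transition.split)

lemma edge_op_0 [simp]: "edge_op W ix A m 0 = 0"
  by (simp add: edge_op_def split: transition.split)

lemma edge_op_emb: "edge_op W ix A m (emb b * x) = emb b * edge_op W ix A m x"
  by (cases b) simp_all

lemma edge_op_sum: "edge_op W ix A m (sum f S) = (\<Sum>x\<in>S. edge_op W ix A m (f x))"
  by (induction S rule: infinite_finite_induct) (simp_all add: edge_op_add)

section \<open>Words of labeled states as a basis of the exterior algebra\<close>

context circle_model
begin

abbreviation "circs A \<equiv> state_circles P M A"
abbreviation "labs A \<equiv> labelings P M A"

definition ones :: "'e set \<Rightarrow> ('e half_edge set \<Rightarrow> label) \<Rightarrow> 'e half_edge set set" where
  "ones A s = {c \<in> circs A. s c = Lab1}"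

definition word :: "'e set \<Rightarrow> ('e half_edge set \<Rightarrow> label) \<Rightarrow> 'i ext" where
  "word A s = prod vec (ones A s)"

definition realize :: "'e cochain \<Rightarrow> 'e set \<Rightarrow> 'i ext" where
  "realize f A = (\<Sum>s\<in>labs A. emb (f (A, s)) * word A s)"

lemma finite_ones: "A \<subseteq> M \<Longrightarrow> finite (ones A s)"
  using finite_circles by (simp add: ones_def)

lemma finite_labs: "A \<subseteq> M \<Longrightarrow> finite (labs A)"
  using finite_circles by (simp add: labelings_def finite_PiE)

lemma labs_eqI:
  assumes "s \<in> labs A" "t \<in> labs A" "ones A s = ones A t"
  shows "s = t"
proof (rule PiE_ext[of s "circs A" "\<lambda>_. UNIV"])
  show "s \<in> circs A \<rightarrow>\<^sub>E UNIV" "t \<in> circs A \<rightarrow>\<^sub>E UNIV"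
    using assms by (simp_all add: labelings_def)
  show "s c = t c" if "c \<in> circs A" for c
  proof -
    have "c \<in> ones A s \<longleftrightarrow> c \<in> ones A t" using assms(3) by simp
    then show ?thesis using that by (cases "s c"; cases "t c") (simp_all add: ones_def)
  qed
qed

lemma vec_in_W: "A \<subseteq> M \<Longrightarrow> c \<in> circs A \<Longrightarrow> vec c \<in> W A"
  using W_eq[of A] by (auto intro!: image_eqI[of _ _ "{c}"])

definition dual_set :: "'e set \<Rightarrow> 'e half_edge set \<Rightarrow> 'i set" where
  "dual_set A c = (SOME J. \<forall>c'\<in>circs A. set_deriv J (vec c') = of_bool (c' = c))"

lemma dual_set:
  assumes "A \<subseteq> M" "c \<in> circs A" "c' \<in> circs A"
  shows "set_deriv (dual_set A c) (vec c') = of_bool (c' = c)"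
  unfolding dual_set_def using someI_ex[OF dual[OF assms(1,2)]] assms(3) by blast

text \<open>The functional dual to \<open>c\<close> extends to a derivation that kills every other
  factor, so it strikes \<open>c\<close> out of a product of distinct circles.\<close>

lemma dual_prod:
  assumes A: "A \<subseteq> M" and c: "c \<in> circs A" and L: "L \<subseteq> circs A"
  shows "set_deriv (dual_set A c) (prod vec L) = (if c \<in> L then prod vec (L - {c}) else 0)"
proof -
  have "finite L" using L finite_circles[OF A] by (rule finite_subset)
  then show ?thesis using L
  proof (induction L rule: finite_induct)
    case (insert d L)
    have "insert d L - {c} = insert d (L - {c})" if "d \<noteq> c" using that by auto
    then show ?case
      using insert dual_set[OF A c, of d] by (auto simp: set_deriv_mult)
  qed simp
qed

fun dual_list :: "'e set \<Rightarrow> 'e half_edge set list \<Rightarrow> 'i ext \<Rightarrow> 'i ext" where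
  "dual_list A [] x = x"
| "dual_list A (c # cs) x = dual_list A cs (set_deriv (dual_set A c) x)"

lemma dual_list_0 [simp]: "dual_list A cs 0 = 0"
  by (induction cs) simp_all

lemma dual_list_add: "dual_list A cs (x + y) = dual_list A cs x + dual_list A cs y"
  by (induction cs arbitrary: x y) (simp_all add: set_deriv_add)

lemma dual_list_emb: "dual_list A cs (emb b * x) = emb b * dual_list A cs x"
  by (cases b) simp_all

lemma dual_list_sum: "dual_list A cs (sum f S) = (\<Sum>x\<in>S. dual_list A cs (f x))"
  by (induction S rule: infinite_finite_induct) (simp_all add: dual_list_add)

lemma dual_list_prod:
  assumes A: "A \<subseteq> M" and "set cs \<subseteq> circs A" "distinct cs" "L \<subseteq> circs A"
  shows "dual_list A cs (prod vec L) = (if set cs \<subseteq> L then prod vec (L - set cs) else 0)"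
  using assms(2-)
proof (induction cs arbitrary: L)
  case (Cons c cs)
  have 1: "set_deriv (dual_set A c) (prod vec L) = (if c \<in> L then prod vec (L - {c}) else 0)"
    using dual_prod[OF A] Cons.prems by simp
  have 2: "dual_list A cs (prod vec (L - {c})) =
      (if set cs \<subseteq> L - {c} then prod vec (L - {c} - set cs) else 0)"
    using Cons.prems by (intro Cons.IH) auto
  have 3: "L - {c} - set cs = L - insert c (set cs)" by auto
  show ?case
    using Cons.prems(2) by (auto simp: 1 2 3)
qed simp

text \<open>Among the labelings with nonzero coefficient take one with the most labels
  \<open>Lab1\<close> and strike out all its circles. Its word becomes 1; the other words vanish,
  because by maximality their sets of circles do not contain that one.\<close>

lemma word_independent:
  assumes A: "A \<subseteq> M" and "(\<Sum>s\<in>labs A. emb (g s) * word A s) = 0" and "s \<in> labs A"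
  shows "g s = 0"
proof (rule ccontr)
  assume "g s \<noteq> 0"
  define S where "S = {s \<in> labs A. g s \<noteq> 0}"
  have S: "finite S" "S \<noteq> {}"
    using finite_labs[OF A] \<open>g s \<noteq> 0\<close> assms(3) by (auto simp: S_def)
  obtain s0 where s0: "s0 \<in> S" and max: "\<And>s. s \<in> S \<Longrightarrow> card (ones A s) \<le> card (ones A s0)"
    using finite_has_maximal[of "(\<lambda>s. card (ones A s)) ` S"] S
    by (smt (verit, best) finite_imageI image_iff image_is_empty linorder_linear)
  obtain cs where cs: "set cs = ones A s0" "distinct cs"
    using finite_distinct_list finite_ones[OF A] by metis
  have cs_sub: "set cs \<subseteq> circs A" by (auto simp: cs ones_def)
  have *: "emb (g s) * dual_list A cs (word A s) = (if s = s0 then 1 else 0)" if "s \<in> labs A" for s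
  proof (cases "s \<in> S")
    case True
    have eq: "dual_list A cs (word A s) = (if ones A s0 \<subseteq> ones A s then prod vec (ones A s - ones A s0) else 0)"
      unfolding word_def cs(1)[symmetric] by (rule dual_list_prod[OF A cs_sub cs(2)]) (auto simp: ones_def)
    have "s = s0" if "ones A s0 \<subseteq> ones A s"
      using card_subset_eq[OF finite_ones[OF A] that] max[OF True]
        card_mono[OF finite_ones[OF A] that] labs_eqI[of s A s0] \<open>s \<in> labs A\<close> s0 by (auto simp: S_def)
    then show ?thesis using True s0 eq by (auto simp: S_def emb_def)
  next
    case False
    then show ?thesis using that s0 by (auto simp: S_def)
  qed
  have "0 = (\<Sum>s\<in>labs A. emb (g s) * dual_list A cs (word A s))"
    using arg_cong[OF assms(2), of "dual_list A cs"] by (simp add: dual_list_sum dual_list_emb)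
  also have "\<dots> = (\<Sum>s\<in>labs A. if s = s0 then 1 else 0)"
    by (rule sum.cong) (use * in auto)
  also have "\<dots> = 1"
    using finite_labs[OF A] s0 by (simp add: S_def)
  finally show False by simp
qed

text \<open>The dual functionals recover a set of circles from the sum of its vectors. Hence the
  space determines the number of circles, which both the polynomial and the second grading
  use.\<close>

lemma card_W:
  assumes A: "A \<subseteq> M"
  shows "card (W A) = 2 ^ card (circs A)"
proof -
  have "inj_on (sum vec) (Pow (circs A))"
  proof (rule inj_onI)
    fix S T assume ST: "S \<in> Pow (circs A)" "T \<in> Pow (circs A)" "sum vec S = sum vec T"
    have *: "set_deriv (dual_set A c) (sum vec S) = of_bool (c \<in> S)"
      if "c \<in> circs A" "S \<subseteq> circs A" for c S
    proof -
      have "finite S" using that finite_circles[OF A] finite_subset by auto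
      have "set_deriv (dual_set A c) (sum vec S) = (\<Sum>c'\<in>S. if c' = c then 1 else 0)"
        unfolding set_deriv_sum using that dual_set[OF A that(1)] by (intro sum.cong) auto
      also have "\<dots> = of_bool (c \<in> S)" using \<open>finite S\<close> by simp
      finally show ?thesis .
    qed
    have "(c \<in> S) = (c \<in> T)" if "c \<in> circs A" for c
      using *[OF that, of S] *[OF that, of T] ST
      by (cases "c \<in> S"; cases "c \<in> T") auto
    then show "S = T" using ST by blast
  qed
  then show ?thesis
    using finite_circles[OF A] by (simp add: W_eq[OF A] card_image card_Pow)
qed

end

context circle_model
begin

definition word_span :: "'e set \<Rightarrow> nat \<Rightarrow> 'i ext set" where
  "word_span A p =
     {\<Sum>s\<in>labs A. emb (g s) * word A s | g. \<forall>s. card (ones A s) \<noteq> p \<longrightarrow> g s = 0}"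

lemma word_span_0: "0 \<in> word_span A p"
  unfolding word_span_def by (rule CollectI, rule exI[of _ "\<lambda>_. 0"]) simp

lemma word_span_add:
  assumes "x \<in> word_span A p" "y \<in> word_span A p"
  shows "x + y \<in> word_span A p"
proof -
  obtain g h where "x = (\<Sum>s\<in>labs A. emb (g s) * word A s)" "\<forall>s. card (ones A s) \<noteq> p \<longrightarrow> g s = 0"
    "y = (\<Sum>s\<in>labs A. emb (h s) * word A s)" "\<forall>s. card (ones A s) \<noteq> p \<longrightarrow> h s = 0"
    using assms by (auto simp: word_span_def)
  then show ?thesis
    unfolding word_span_def
    by (intro CollectI exI[of _ "\<lambda>s. g s + h s"]) (simp add: emb_add distrib_right sum.distrib)
qed

lemma word_span_sum: "(\<And>a. a \<in> S \<Longrightarrow> f a \<in> word_span A p) \<Longrightarrow> sum f S \<in> word_span A p"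
  by (induction S rule: infinite_finite_induct) (simp_all add: word_span_0 word_span_add)

lemma word_in_span:
  assumes "A \<subseteq> M" "s \<in> labs A"
  shows "word A s \<in> word_span A (card (ones A s))"
proof -
  have "(\<Sum>t\<in>labs A. emb (of_bool (t = s)) * word A t) = (\<Sum>t\<in>labs A. if t = s then word A t else 0)"
    by (rule sum.cong) auto
  also have "\<dots> = word A s"
    using assms finite_labs by simp
  finally show ?thesis
    unfolding word_span_def by (intro CollectI exI[of _ "\<lambda>t. of_bool (t = s)"]) auto
qed

text \<open>If \<open>c\<close> is already labeled \<open>Lab1\<close> in a word, the square of its
  vector kills the product; otherwise the product is the word with \<open>c\<close>
  relabeled.\<close>

lemma vec_mult_word_span:
  assumes A: "A \<subseteq> M" and c: "c \<in> circs A" and x: "x \<in> word_span A p"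
  shows "vec c * x \<in> word_span A (Suc p)"
proof -
  obtain g where g: "x = (\<Sum>s\<in>labs A. emb (g s) * word A s)" "\<forall>s. card (ones A s) \<noteq> p \<longrightarrow> g s = 0"
    using x by (auto simp: word_span_def)
  have "vec c * (emb (g s) * word A s) \<in> word_span A (Suc p)" if s: "s \<in> labs A" for s
  proof (cases "g s = 0 \<or> s c = Lab1")
    case True
    have "vec c * word A s = 0" if "s c = Lab1"
    proof -
      have "word A s = vec c * prod vec (ones A s - {c})"
        unfolding word_def using that c finite_ones[OF A] by (intro prod.remove) (auto simp: ones_def)
      then show ?thesis using vec_sq[OF A c] by (simp flip: mult.assoc)
    qed
    then have "vec c * (emb (g s) * word A s) = 0"
      using True by (auto simp: mult.left_commute[of "vec c"])
    then show ?thesis by (simp add: word_span_0)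
  next
    case False
    then have sc: "s c = LabX" and gs: "g s = 1" by (cases "s c"; cases "g s"; simp)+
    have p: "card (ones A s) = p" using g(2) gs by fastforce
    let ?t = "s(c := Lab1)"
    have ones: "ones A ?t = insert c (ones A s)" "c \<notin> ones A s"
      using c sc by (auto simp: ones_def)
    have t: "?t \<in> labs A" using s c by (auto simp: labelings_def PiE_def extensional_def)
    have "word A ?t = vec c * word A s"
      unfolding word_def ones(1) using finite_ones[OF A] ones(2) by simp
    moreover have "card (ones A ?t) = Suc p"
      using ones finite_ones[OF A, of s] p by simp
    ultimately show ?thesis
      using word_in_span[OF A t] gs by simp
  qed
  then show ?thesis
    unfolding g(1) sum_distrib_left by (intro word_span_sum) auto
qed

lemma one_in_word_span:
  assumes A: "A \<subseteq> M"
  shows "1 \<in> word_span A 0"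
proof -
  let ?s = "\<lambda>c\<in>circs A. LabX"
  have "?s \<in> labs A" "ones A ?s = {}"
    by (auto simp: labelings_def ones_def)
  then show ?thesis
    using word_in_span[OF A, of ?s] by (simp add: word_def)
qed

text \<open>One inclusion expands each factor into circles and multiplies out, the other lists the
  circles labeled \<open>Lab1\<close>. This connects labeled states with the description that is
  free of circles.\<close>

lemma ext_power_eq_word_span:
  assumes A: "A \<subseteq> M"
  shows "ext_power (W A) p = word_span A p"
proof (intro equalityI subsetI)
  fix x assume "x \<in> ext_power (W A) p"
  then show "x \<in> word_span A p"
  proof (induction rule: ext_power.induct)
    case (add ws y)
    have "prod_list ws \<in> word_span A (length ws)"
      using add(2)
    proof (induction ws)
      case (Cons w ws)
      obtain S where S: "S \<subseteq> circs A" "w = sum vec S"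
        using Cons.prems W_eq[OF A] by auto
      have "(\<Sum>c\<in>S. vec c * prod_list ws) \<in> word_span A (Suc (length ws))"
        using S Cons by (intro word_span_sum vec_mult_word_span[OF A]) auto
      then show ?case using S by (simp add: sum_distrib_right)
    qed (simp add: one_in_word_span[OF A])
    then show ?case using add by (simp add: word_span_add)
  qed (rule word_span_0)
next
  fix x assume "x \<in> word_span A p"
  then obtain g where g: "x = (\<Sum>s\<in>labs A. emb (g s) * word A s)" "\<forall>s. card (ones A s) \<noteq> p \<longrightarrow> g s = 0"
    by (auto simp: word_span_def)
  have "emb (g s) * word A s \<in> ext_power (W A) p" for s
  proof (cases "card (ones A s) = p")
    case True
    obtain cs where cs: "set cs = ones A s" "distinct cs"
      using finite_distinct_list finite_ones[OF A] by metis
    have "word A s = prod_list (map vec cs)"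
      unfolding word_def cs(1)[symmetric] by (rule prod.distinct_set_conv_list[OF cs(2)])
    moreover have "length cs = p" using cs True distinct_card by fastforce
    moreover have "set (map vec cs) \<subseteq> W A" using cs vec_in_W[OF A] by (auto simp: ones_def)
    ultimately have "word A s \<in> ext_power (W A) p"
      using ext_power_prod[of "map vec cs" p "W A"] by simp
    then show ?thesis by (rule ext_power_emb)
  next
    case False
    then show ?thesis using g(2) by (simp add: ext_power.zero)
  qed
  then show "x \<in> ext_power (W A) p"
    unfolding g(1) by (intro ext_power_sum)
qed

lemma sum_label_degree:
  assumes A: "A \<subseteq> M"
  shows "(\<Sum>c\<in>circs A. label_degree (s c)) = 2 * int (card (ones A s)) - int (card (circs A))"
proof -
  have "label_degree (s c) = 2 * of_bool (c \<in> ones A s) - 1" if "c \<in> circs A" for c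
    using that by (cases "s c") (simp_all add: ones_def)
  then have "(\<Sum>c\<in>circs A. label_degree (s c)) = (\<Sum>c\<in>circs A. 2 * of_bool (c \<in> ones A s) - 1)"
    by (intro sum.cong) auto
  also have "\<dots> = 2 * int (card (circs A \<inter> ones A s)) - int (card (circs A))"
    using finite_circles[OF A] by (simp add: sum_subtractf flip: sum_distrib_left)
  also have "circs A \<inter> ones A s = ones A s" by (auto simp: ones_def)
  finally show ?thesis .
qed

lemma labeled_states_iff:
  "(A, s) \<in> labeled_states P M i j \<longleftrightarrow>
     A \<subseteq> M \<and> s \<in> labs A \<and> int (card A) = i \<and> 2 * int (card (ones A s)) - int (card (circs A)) + i = j"
  using sum_label_degree by (auto simp: labeled_states_def)

lemma realize_eq_0: "(\<And>s. s \<in> labs A \<Longrightarrow> f (A, s) = 0) \<Longrightarrow> realize f A = 0"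
  by (simp add: realize_def)

lemma realize_add: "realize (\<lambda>x. f x + g x) A = realize f A + realize g A"
  by (simp add: realize_def emb_add distrib_right sum.distrib)

lemma realize_in_model:
  assumes f: "f \<in> cochains P M i j"
  shows "realize f \<in> model_cochains M W (\<lambda>A. card (circs A)) i j"
  unfolding model_cochains_def
proof (rule CollectI, rule allI, rule disj_imp[THEN iffD2], rule impI)
  fix A assume "realize f A \<noteq> 0"
  then obtain s where s: "s \<in> labs A" "f (A, s) \<noteq> 0"
    using realize_eq_0 by blast
  have "(A, s) \<in> labeled_states P M i j"
    using f s(2) unfolding cochains_def by blast
  then have *: "A \<subseteq> M" "int (card A) = i"
    "2 * int (card (ones A s)) - int (card (circs A)) + i = j"
    unfolding labeled_states_iff by auto
  have "f (A, t) = 0" if "t \<in> labs A" "card (ones A t) \<noteq> card (ones A s)" for t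
    using f labeled_states_iff[of A t] that * by (auto simp: cochains_def)
  \<comment> \<open>Size of \<open>A\<close> and second degree together fix the number of labels
    \<open>Lab1\<close>, so only words with that number contribute.\<close>
  then have eq: "realize f A = (\<Sum>t\<in>labs A. emb (if card (ones A t) = card (ones A s) then f (A, t) else 0) * word A t)"
    unfolding realize_def by (intro sum.cong) auto
  have "realize f A \<in> word_span A (card (ones A s))"
    unfolding word_span_def eq
    by (intro CollectI exI[of _ "\<lambda>t. if card (ones A t) = card (ones A s) then f (A, t) else 0"]) simp
  then show "A \<subseteq> M \<and> int (card A) = i \<and>
      (\<exists>p. realize f A \<in> ext_power (W A) p \<and> 2 * int p - int (card (circs A)) + i = j)"
    using * ext_power_eq_word_span by blast
qed

lemma cochains_eqI:
  assumes f: "f \<in> cochains P M i j" and g: "g \<in> cochains P M i' j'"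
    and eq: "\<And>A. A \<subseteq> M \<Longrightarrow> realize f A = realize g A"
  shows "f = g"
proof (rule ext, clarify)
  fix A s
  have "f (A, s) = 0 \<and> g (A, s) = 0" if "\<not> (A \<subseteq> M \<and> s \<in> labs A)"
  proof -
    have "(A, s) \<notin> labeled_states P M i j" "(A, s) \<notin> labeled_states P M i' j'"
      using that by (auto simp: labeled_states_iff)
    then show ?thesis using f g by (auto simp: cochains_def)
  qed
  moreover have "f (A, s) = g (A, s)" if "A \<subseteq> M" "s \<in> labs A"
  proof -
    have "(\<Sum>s\<in>labs A. emb (f (A, s) + g (A, s)) * word A s) = realize f A + realize g A"
      by (simp add: realize_def emb_add distrib_right sum.distrib)
    then have "(\<Sum>s\<in>labs A. emb (f (A, s) + g (A, s)) * word A s) = 0"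
      by (simp add: eq[OF that(1)])
    then have "f (A, s) + g (A, s) = 0"
      using word_independent[OF that(1) _ that(2), of "\<lambda>s. f (A, s) + g (A, s)"] by blast
    then show ?thesis by (cases "f (A, s)"; cases "g (A, s)") auto
  qed
  ultimately show "f (A, s) = g (A, s)" by metis
qed

lemma realize_inj: "inj_on realize (cochains P M i j)"
  by (rule inj_onI) (metis cochains_eqI)

lemma realize_surj:
  assumes g: "g \<in> model_cochains M W (\<lambda>A. card (circs A)) i j"
  shows "\<exists>f\<in>cochains P M i j. realize f = g"
proof -
  have "\<exists>h. (\<forall>s. (A, s) \<notin> labeled_states P M i j \<longrightarrow> h s = 0) \<and>
      (\<Sum>s\<in>labs A. emb (h s) * word A s) = g A" for A
  proof (cases "g A = 0")
    case True
    then show ?thesis by (intro exI[of _ "\<lambda>_. 0"]) simp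
  next
    case False
    then obtain p where A: "A \<subseteq> M" "int (card A) = i" and p: "g A \<in> word_span A p"
      "2 * int p - int (card (circs A)) + i = j"
      using g ext_power_eq_word_span[of A] by (fastforce simp: model_cochains_def)
    obtain h where h: "g A = (\<Sum>s\<in>labs A. emb (h s) * word A s)" "\<forall>s. card (ones A s) \<noteq> p \<longrightarrow> h s = 0"
      using p(1) by (auto simp: word_span_def)
    have "(\<Sum>s\<in>labs A. emb (if s \<in> labs A then h s else 0) * word A s) = g A"
      unfolding h(1) by (rule sum.cong) auto
    moreover have "\<forall>s. (A, s) \<notin> labeled_states P M i j \<longrightarrow> (if s \<in> labs A then h s else 0) = 0"
      using A p(2) h(2) by (auto simp: labeled_states_iff)
    ultimately show ?thesis by (intro exI[of _ "\<lambda>s. if s \<in> labs A then h s else 0"]) simp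
  qed
  then obtain h where h: "\<And>A s. (A, s) \<notin> labeled_states P M i j \<Longrightarrow> h A s = 0"
    "\<And>A. (\<Sum>s\<in>labs A. emb (h A s) * word A s) = g A"
    by metis
  show ?thesis
  proof (rule bexI[of _ "\<lambda>(A, s). h A s"])
    show "realize (\<lambda>(A, s). h A s) = g" by (simp add: fun_eq_iff realize_def h(2))
    show "(\<lambda>(A, s). h A s) \<in> cochains P M i j" using h(1) by (auto simp: cochains_def)
  qed
qed

lemma realize_bij:
  "bij_betw realize (cochains P M i j) (model_cochains M W (\<lambda>A. card (circs A)) i j)"
  unfolding bij_betw_def using realize_inj realize_in_model realize_surj by fast

end

section \<open>The structure maps in the exterior algebra\<close>

context circle_model
begin

text \<open>The type defined from the spaces agrees with the geometric one. In the split case the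
  circle at \<open>m\<close> before the change has coordinate \<open>1 + 1 = 0\<close>, so the test
  for a merge fails.\<close>

lemma transition_typeE:
  assumes A: "A \<subseteq> M" and m: "m \<in> M - A"
  obtains
    (merge) a b c where "transition_type W ix A m = Merge"
      "circles_at P M A m = {a, b}" "a \<noteq> b" "circles_at P M (insert m A) m = {c}"
      "vec c = vec a + vec b" "pderiv_at (ix m) (vec a) = 1" "pderiv_at (ix m) (vec b) = 1"
  | (split) a c d where "transition_type W ix A m = Split"
      "circles_at P M A m = {a}" "circles_at P M (insert m A) m = {c, d}" "c \<noteq> d"
      "vec a = vec c + vec d" "pderiv_at (ix m) (vec c) = 1" "pderiv_at (ix m) (vec d) = 1"
  | (single) a c where "transition_type W ix A m = Single"
      "circles_at P M A m = {a}" "circles_at P M (insert m A) m = {c}"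
proof -
  have A': "insert m A \<subseteq> M" using A m by auto
  have sub: "circles_at P M B m \<subseteq> circs B" for B by (auto simp: circles_at_def)
  have W0: "\<forall>w\<in>W B. pderiv_at (ix m) w = 0" if "B \<subseteq> M" "\<forall>c\<in>circs B. pderiv_at (ix m) (vec c) = 0" for B
    using that by (auto simp: W_eq pderiv_at_sum subset_iff intro!: sum.neutral)
  from transition_cases[OF A m] show ?thesis
  proof (elim disjE exE conjE)
    fix a b c
    assume *: "circles_at P M A m = {a, b}" "a \<noteq> b" "circles_at P M (insert m A) m = {c}"
      "vec c = vec a + vec b" "pderiv_at (ix m) (vec a) = 1" "pderiv_at (ix m) (vec b) = 1"
    have "vec a \<in> W A" using *(1) sub[of A] by (intro vec_in_W[OF A]) auto
    then have "\<exists>w\<in>W A. pderiv_at (ix m) w \<noteq> 0"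
      using *(5) by (intro bexI[of _ "vec a"]) simp_all
    then have "transition_type W ix A m = Merge"
      by (simp add: transition_type_def)
    then show ?thesis using * by (rule merge)
  next
    fix a c d
    assume *: "circles_at P M A m = {a}" "circles_at P M (insert m A) m = {c, d}" "c \<noteq> d"
      "vec a = vec c + vec d" "pderiv_at (ix m) (vec c) = 1" "pderiv_at (ix m) (vec d) = 1"
    have "vec c \<in> W (insert m A)" using *(2) sub[of "insert m A"] by (intro vec_in_W[OF A']) auto
    then have "\<exists>w\<in>W (insert m A). pderiv_at (ix m) w \<noteq> 0"
      using *(5) by (intro bexI[of _ "vec c"]) simp_all
    moreover have "\<forall>w\<in>W A. pderiv_at (ix m) w = 0"
    proof (rule W0[OF A], rule ballI)
      fix e assume "e \<in> circs A"
      then show "pderiv_at (ix m) (vec e) = 0"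
        using pderiv_away[OF A m, of e] * by (cases "e = a") (auto simp: pderiv_at_add)
    qed
    ultimately have "transition_type W ix A m = Split"
      by (simp add: transition_type_def)
    then show ?thesis using * by (rule split)
  next
    fix a c
    assume *: "circles_at P M A m = {a}" "circles_at P M (insert m A) m = {c}"
      "pderiv_at (ix m) (vec a) = 0" "pderiv_at (ix m) (vec c) = 0"
    have "\<forall>w\<in>W A. pderiv_at (ix m) w = 0"
      using pderiv_away[OF A m] * by (intro W0[OF A]) auto
    moreover have "\<forall>w\<in>W (insert m A). pderiv_at (ix m) w = 0"
      using pderiv_away[OF A m] away[OF A m] * by (intro W0[OF A']) auto
    ultimately have "transition_type W ix A m = Single"
      by (auto simp: transition_type_def)
    then show ?thesis using * by (intro single)
  qed
qed

abbreviation away_circs :: "'e set \<Rightarrow> 'e \<Rightarrow> 'e half_edge set set" where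
  "away_circs A m \<equiv> circs A - circles_at P M A m"

lemma circs_insert:
  assumes "A \<subseteq> M" "m \<in> M - A"
  shows "circs (insert m A) = away_circs A m \<union> circles_at P M (insert m A) m"
    and "away_circs A m \<inter> circles_at P M (insert m A) m = {}"
proof -
  have "circles_at P M (insert m A) m \<subseteq> circs (insert m A)" by (auto simp: circles_at_def)
  then show "circs (insert m A) = away_circs A m \<union> circles_at P M (insert m A) m"
    and "away_circs A m \<inter> circles_at P M (insert m A) m = {}"
    using away[OF assms] by blast+
qed

lemma prod_ones:
  assumes A: "A \<subseteq> M" and "circs A = R \<union> S" "R \<inter> S = {}"
  shows "word A s = prod vec {c \<in> R. s c = Lab1} * (\<Prod>c\<in>S. if s c = Lab1 then vec c else 1)"
proof -
  have fin: "finite R" "finite S" using finite_circles[OF A] assms(2) by auto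
  have "ones A s = {c \<in> R. s c = Lab1} \<union> {c \<in> S. s c = Lab1}" using assms(2) by (auto simp: ones_def)
  then have "word A s = prod vec {c \<in> R. s c = Lab1} * prod vec {c \<in> S. s c = Lab1}"
    unfolding word_def using assms(3) fin by (simp add: prod.union_disjoint disjoint_iff)
  also have "prod vec {c \<in> S. s c = Lab1} = (\<Prod>c\<in>S. if s c = Lab1 then vec c else 1)"
    using fin by (simp add: prod.inter_filter)
  finally show ?thesis .
qed

text \<open>The circles away from \<open>m\<close> form a common factor of coordinate 0, so
  contraction passes through it. What remains is to compare the tables of multiplication and
  comultiplication for the one or two circles at \<open>m\<close>.\<close>

lemma edge_map_word:
  assumes A: "A \<subseteq> M" and m: "m \<in> M - A" and s: "s \<in> labs A"
  shows "(\<Sum>t\<in>labs (insert m A). emb (edge_map_coeff P M A m s t) * word (insert m A) t) =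
         edge_op W ix A m (word A s)"
proof -
  let ?A' = "insert m A"
  have A': "?A' \<subseteq> M" using A m by auto
  define R where "R = away_circs A m"
  define \<rho> where "\<rho> = prod vec {c \<in> R. s c = Lab1}"
  have CA: "circs A = R \<union> circles_at P M A m" "R \<inter> circles_at P M A m = {}"
    by (auto simp: R_def circles_at_def)
  have CA': "circs ?A' = R \<union> circles_at P M ?A' m" "R \<inter> circles_at P M ?A' m = {}"
    using circs_insert[OF A m] by (auto simp: R_def)
  have finR: "finite R" using CA(1) finite_circles[OF A] by auto
  have d\<rho>: "pderiv_at (ix m) \<rho> = 0"
  proof -
    have "pderiv_at (ix m) (prod vec S) = 0" if "finite S" "S \<subseteq> R" for S
      using that pderiv_away[OF A m] by (induction S) (auto simp: pderiv_at_mult R_def)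
    then show ?thesis using finR by (simp add: \<rho>_def)
  qed
  have word_A': "word ?A' t = \<rho> * (\<Prod>c\<in>circles_at P M ?A' m. if t c = Lab1 then vec c else 1)"
    if "\<forall>c\<in>R. t c = s c" for t
  proof -
    have "{c \<in> R. t c = Lab1} = {c \<in> R. s c = Lab1}" using that by auto
    then show ?thesis using prod_ones[OF A' CA', of t] by (simp add: \<rho>_def)
  qed
  have word_A: "word A s = \<rho> * (\<Prod>c\<in>circles_at P M A m. if s c = Lab1 then vec c else 1)"
    using prod_ones[OF A CA, of s] by (simp add: \<rho>_def)
  have coeff0: "edge_map_coeff P M A m s t = 0" if "\<not> (\<forall>c\<in>R. t c = s c)" for t
    using that by (auto simp: edge_map_coeff_def R_def)
  show ?thesis
  proof (rule transition_typeE[OF A m])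
    fix a b c
    assume ty: "transition_type W ix A m = Merge"
      and a: "circles_at P M A m = {a, b}" "a \<noteq> b" and c: "circles_at P M ?A' m = {c}"
      and v: "vec c = vec a + vec b" "pderiv_at (ix m) (vec a) = 1" "pderiv_at (ix m) (vec b) = 1"
    \<comment> \<open>\<open>T l\<close> keeps the labels away from \<open>m\<close> and puts
      \<open>l\<close> on the new circle; no other labeling has a nonzero coefficient.\<close>
    define T where "T l = (restrict s R)(c := l)" for l
    have cR: "c \<notin> R" using CA'(2) c by auto
    have T: "T l \<in> labs ?A'" "\<forall>x\<in>R. T l x = s x" "T l c = l" for l
      using CA'(1) c cR by (auto simp: T_def labelings_def PiE_def extensional_def)
    have range: "t \<in> range T" if "t \<in> labs ?A'" "\<forall>x\<in>R. t x = s x" for t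
    proof -
      have "t = T (t c)"
        using that CA'(1) c by (auto simp: T_def labelings_def PiE_def extensional_def fun_eq_iff)
      then show ?thesis by blast
    qed
    have word_T: "word ?A' (T l) = \<rho> * (if l = Lab1 then vec c else 1)" for l
      unfolding word_A'[OF T(2)] c by (simp add: T(3))
    have inj: "inj T" by (metis T(3) injI)
    have comm: "mult_coeff p q l = mult_coeff q p l" for p q l
      by (cases p; cases q) auto
    have coeff: "edge_map_coeff P M A m s (T l) = mult_coeff (s a) (s b) l" for l
    proof -
      have "(\<exists>a' b' c'. circles_at P M A m = {a', b'} \<and> a' \<noteq> b' \<and> circles_at P M ?A' m = {c'} \<and>
              mult_coeff (s a') (s b') (T l c') = 1) \<longleftrightarrow> mult_coeff (s a) (s b) l = 1" (is "?L \<longleftrightarrow> ?R")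
      proof
        show "?L \<Longrightarrow> ?R" using a(1) c T(3) comm by (metis doubleton_eq_iff singleton_inject)
        show "?R \<Longrightarrow> ?L" using a c T(3) by metis
      qed
      moreover have "\<not> (\<exists>a' c' d'. circles_at P M A m = {a'} \<and> circles_at P M ?A' m = {c', d'} \<and>
              c' \<noteq> d' \<and> comult_coeff (s a') (T l c') (T l d') = 1)"
        using a by (metis doubleton_eq_iff insert_absorb2)
      ultimately have "edge_map_coeff P M A m s (T l) = of_bool (mult_coeff (s a) (s b) l = 1)"
        unfolding edge_map_coeff_def using T(2)[of l] by (simp add: R_def)
      then show ?thesis by (cases "mult_coeff (s a) (s b) l") simp_all
    qed
    have "(\<Sum>t\<in>labs ?A'. emb (edge_map_coeff P M A m s t) * word ?A' t) =
          (\<Sum>t\<in>range T. emb (edge_map_coeff P M A m s t) * word ?A' t)"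
    proof (intro sum.mono_neutral_right ballI)
      fix t assume "t \<in> labs ?A' - range T"
      then have "\<not> (\<forall>x\<in>R. t x = s x)" using range by blast
      then have "edge_map_coeff P M A m s t = 0" by (rule coeff0)
      then show "emb (edge_map_coeff P M A m s t) * word ?A' t = 0" by simp
    qed (use finite_labs[OF A'] T(1) in auto)
    also have "\<dots> = (\<Sum>l\<in>UNIV. emb (mult_coeff (s a) (s b) l) * (\<rho> * (if l = Lab1 then vec c else 1)))"
      using inj by (simp add: sum.reindex coeff word_T)
    also have "\<dots> = pderiv_at (ix m) (word A s)"
      unfolding UNIV_label word_A a(1) using a(2) v d\<rho>
      by (cases "s a"; cases "s b") (simp_all add: pderiv_at_mult algebra_simps)
    finally show ?thesis by (simp add: edge_op_def ty)
  next
    fix a c d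
    assume ty: "transition_type W ix A m = Split"
      and a: "circles_at P M A m = {a}" and c: "circles_at P M ?A' m = {c, d}" "c \<noteq> d"
      and v: "vec a = vec c + vec d"
    define T where "T l = (restrict s R)(c := fst l, d := snd l)" for l :: "label \<times> label"
    have cR: "c \<notin> R" "d \<notin> R" using CA'(2) c by auto
    have T: "T l \<in> labs ?A'" "\<forall>x\<in>R. T l x = s x" "T l c = fst l" "T l d = snd l" for l
      using CA'(1) c cR by (auto simp: T_def labelings_def PiE_def extensional_def)
    have range: "t \<in> range T" if "t \<in> labs ?A'" "\<forall>x\<in>R. t x = s x" for t
    proof -
      have "t = T (t c, t d)"
        using that CA'(1) c by (auto simp: T_def labelings_def PiE_def extensional_def fun_eq_iff)
      then show ?thesis by blast
    qed
    have word_T: "word ?A' (T l) =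
        \<rho> * ((if fst l = Lab1 then vec c else 1) * (if snd l = Lab1 then vec d else 1))" for l
      unfolding word_A'[OF T(2)] c(1) using c(2) by (simp add: T(3,4))
    have inj: "inj T" by (metis T(3,4) injI prod.expand)
    have comm: "comult_coeff p q l = comult_coeff p l q" for p q l
      by (cases p) auto
    have coeff: "edge_map_coeff P M A m s (T l) = comult_coeff (s a) (fst l) (snd l)" for l
    proof -
      have "(\<exists>a' c' d'. circles_at P M A m = {a'} \<and> circles_at P M ?A' m = {c', d'} \<and> c' \<noteq> d' \<and>
              comult_coeff (s a') (T l c') (T l d') = 1) \<longleftrightarrow>
            comult_coeff (s a) (fst l) (snd l) = 1" (is "?L \<longleftrightarrow> ?R")
      proof
        show "?L \<Longrightarrow> ?R" using a c(1) T(3,4) comm by (metis doubleton_eq_iff singleton_inject)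
        show "?R \<Longrightarrow> ?L" using a c T(3,4) by metis
      qed
      moreover have "\<not> (\<exists>a' b' c'. circles_at P M A m = {a', b'} \<and> a' \<noteq> b' \<and>
              circles_at P M ?A' m = {c'} \<and> mult_coeff (s a') (s b') (T l c') = 1)"
        using a by (metis doubleton_eq_iff insert_absorb2)
      ultimately have "edge_map_coeff P M A m s (T l) = of_bool (comult_coeff (s a) (fst l) (snd l) = 1)"
        unfolding edge_map_coeff_def using T(2)[of l] by (simp add: R_def)
      then show ?thesis by (cases "comult_coeff (s a) (fst l) (snd l)") simp_all
    qed
    have "(\<Sum>t\<in>labs ?A'. emb (edge_map_coeff P M A m s t) * word ?A' t) =
          (\<Sum>t\<in>range T. emb (edge_map_coeff P M A m s t) * word ?A' t)"
    proof (intro sum.mono_neutral_right ballI)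
      fix t assume "t \<in> labs ?A' - range T"
      then have "\<not> (\<forall>x\<in>R. t x = s x)" using range by blast
      then have "edge_map_coeff P M A m s t = 0" by (rule coeff0)
      then show "emb (edge_map_coeff P M A m s t) * word ?A' t = 0" by simp
    qed (use finite_labs[OF A'] T(1) in auto)
    also have "\<dots> = (\<Sum>l\<in>UNIV. emb (comult_coeff (s a) (fst l) (snd l)) *
          (\<rho> * ((if fst l = Lab1 then vec c else 1) * (if snd l = Lab1 then vec d else 1))))"
      using inj by (simp add: sum.reindex coeff word_T)
    also have "\<dots> = word A s"
      unfolding UNIV_Times_UNIV[symmetric] sum.cartesian_product' UNIV_label word_A a(1) using c(2) v
      by (cases "s a") (simp_all add: algebra_simps)
    finally show ?thesis by (simp add: edge_op_def ty)
  next
    fix a c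
    assume ty: "transition_type W ix A m = Single"
      and a: "circles_at P M A m = {a}" and c: "circles_at P M ?A' m = {c}"
    have "edge_map_coeff P M A m s t = 0" for t
      using a c by (auto simp: edge_map_coeff_def doubleton_eq_iff)
    then show ?thesis by (simp add: edge_op_def ty)
  qed
qed

lemma realize_differential:
  "realize (differential P M f) B = model_diff M W ix (realize f) B"
proof (cases "B \<subseteq> M")
  case B: True
  have "realize (differential P M f) B =
      (\<Sum>t\<in>labs B. \<Sum>m\<in>B. \<Sum>s\<in>labs (B - {m}).
         emb (f (B - {m}, s)) * (emb (edge_map_coeff P M (B - {m}) m s t) * word B t))"
    unfolding realize_def differential_def using B
    by (intro sum.cong refl) (simp add: emb_sum emb_mult sum_distrib_left sum_distrib_right ac_simps)
  also have "\<dots> = (\<Sum>m\<in>B. \<Sum>s\<in>labs (B - {m}). emb (f (B - {m}, s)) *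
         (\<Sum>t\<in>labs B. emb (edge_map_coeff P M (B - {m}) m s t) * word B t))"
  proof (subst sum.swap, rule sum.cong[OF refl])
    fix m assume "m \<in> B"
    show "(\<Sum>t\<in>labs B. \<Sum>s\<in>labs (B - {m}).
         emb (f (B - {m}, s)) * (emb (edge_map_coeff P M (B - {m}) m s t) * word B t)) =
       (\<Sum>s\<in>labs (B - {m}). emb (f (B - {m}, s)) *
         (\<Sum>t\<in>labs B. emb (edge_map_coeff P M (B - {m}) m s t) * word B t))"
      unfolding sum_distrib_left by (rule sum.swap)
  qed
  also have "\<dots> = (\<Sum>m\<in>B. \<Sum>s\<in>labs (B - {m}). emb (f (B - {m}, s)) *
         edge_op W ix (B - {m}) m (word (B - {m}) s))"
  proof (intro sum.cong refl)
    fix m s assume "m \<in> B" "s \<in> labs (B - {m})"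
    moreover have "B - {m} \<subseteq> M" "m \<in> M" using \<open>m \<in> B\<close> B by auto
    ultimately show "emb (f (B - {m}, s)) *
         (\<Sum>t\<in>labs B. emb (edge_map_coeff P M (B - {m}) m s t) * word B t) =
       emb (f (B - {m}, s)) * edge_op W ix (B - {m}) m (word (B - {m}) s)"
      using edge_map_word[of "B - {m}" m s] insert_Diff[OF \<open>m \<in> B\<close>] by auto
  qed
  also have "\<dots> = model_diff M W ix (realize f) B"
    using B by (simp add: model_diff_def realize_def edge_op_sum edge_op_emb)
  finally show ?thesis .
next
  case False
  then show ?thesis by (simp add: realize_def differential_def model_diff_def)
qed

text \<open>Multiplication and comultiplication both lower the degree by one. The shift by the size
  of the state compensates this, so the differential preserves the second grading.\<close>

lemma edge_map_degree:
  assumes A: "A \<subseteq> M" and m: "m \<in> M - A" and nz: "edge_map_coeff P M A m s t \<noteq> 0"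
  shows "(\<Sum>c\<in>circs (insert m A). label_degree (t c)) = (\<Sum>c\<in>circs A. label_degree (s c)) - 1"
proof -
  let ?A' = "insert m A" and ?R = "away_circs A m"
  have A': "?A' \<subseteq> M" using A m by auto
  have C: "circs A = ?R \<union> circles_at P M A m" by (auto simp: circles_at_def)
  have fin: "finite ?R" "finite (circles_at P M A m)" "finite (circles_at P M ?A' m)"
    using finite_circles[OF A] finite_circles[OF A'] by (auto simp: circles_at_def)
  have R: "\<forall>c\<in>?R. t c = s c" using nz by (auto simp: edge_map_coeff_def)
  have 1: "(\<Sum>c\<in>circs A. label_degree (s c)) =
      (\<Sum>c\<in>?R. label_degree (s c)) + (\<Sum>c\<in>circles_at P M A m. label_degree (s c))"
    by (subst C, rule sum.union_disjoint) (use fin in auto)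
  have 2: "(\<Sum>c\<in>circs ?A'. label_degree (t c)) =
      (\<Sum>c\<in>?R. label_degree (s c)) + (\<Sum>c\<in>circles_at P M ?A' m. label_degree (t c))"
    unfolding circs_insert(1)[OF A m] using fin circs_insert(2)[OF A m] R
    by (subst sum.union_disjoint) auto
  have M: "label_degree c = label_degree a + label_degree b - 1" if "mult_coeff a b c = 1" for a b c
    using that by (cases a; cases b; cases c) auto
  have S: "label_degree b + label_degree c = label_degree a - 1" if "comult_coeff a b c = 1" for a b c
    using that by (cases a; cases b; cases c) auto
  have "(\<Sum>c\<in>circles_at P M ?A' m. label_degree (t c)) =
      (\<Sum>c\<in>circles_at P M A m. label_degree (s c)) - 1"
  proof -
    from nz have "(\<exists>a b c. circles_at P M A m = {a, b} \<and> a \<noteq> b \<and> circles_at P M ?A' m = {c} \<and>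
                mult_coeff (s a) (s b) (t c) = 1) \<or>
       (\<exists>a c d. circles_at P M A m = {a} \<and> circles_at P M ?A' m = {c, d} \<and> c \<noteq> d \<and>
                comult_coeff (s a) (t c) (t d) = 1)"
      unfolding edge_map_coeff_def of_bool_eq_0_iff by blast
    then show ?thesis
    proof (elim disjE exE conjE)
      fix a b c assume "circles_at P M A m = {a, b}" "a \<noteq> b" "circles_at P M ?A' m = {c}"
        "mult_coeff (s a) (s b) (t c) = 1"
      then show ?thesis using M[of "s a" "s b" "t c"] by simp
    next
      fix a c d assume "circles_at P M A m = {a}" "circles_at P M ?A' m = {c, d}" "c \<noteq> d"
        "comult_coeff (s a) (t c) (t d) = 1"
      then show ?thesis using S[of "s a" "t c" "t d"] by simp
    qed
  qed
  then show ?thesis using 1 2 by simp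
qed

lemma differential_cochains:
  assumes f: "f \<in> cochains P M i j"
  shows "differential P M f \<in> cochains P M (i + 1) j"
proof -
  have *: "(B, t) \<in> labeled_states P M (i + 1) j" if nz: "differential P M f (B, t) \<noteq> 0" for B t
  proof -
    have B: "B \<subseteq> M" "t \<in> labs B" using nz by (auto simp: differential_def split: if_splits)
    have "\<exists>m\<in>B. \<exists>s\<in>labs (B - {m}). edge_map_coeff P M (B - {m}) m s t * f (B - {m}, s) \<noteq> 0"
    proof (rule ccontr)
      assume "\<not> ?thesis"
      then have "(\<Sum>m\<in>B. \<Sum>s\<in>labs (B - {m}). edge_map_coeff P M (B - {m}) m s t * f (B - {m}, s)) = 0"
        by (intro sum.neutral ballI) simp
      then show False using nz B by (simp add: differential_def)
    qed
    then obtain m s where m: "m \<in> B" "s \<in> labs (B - {m})"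
      and ef: "edge_map_coeff P M (B - {m}) m s t * f (B - {m}, s) \<noteq> 0"
      by blast
    have e: "edge_map_coeff P M (B - {m}) m s t \<noteq> 0" by (rule contrapos_nn[OF ef]) simp
    have fs: "f (B - {m}, s) \<noteq> 0" by (rule contrapos_nn[OF ef]) simp
    have "(B - {m}, s) \<in> labeled_states P M i j"
      using f fs unfolding cochains_def by blast
    moreover have "int (card B) = int (card (B - {m})) + 1"
      using card.remove[OF finite_subset[OF B(1) finite_M] m(1)] by simp
    moreover have "(\<Sum>c\<in>circs B. label_degree (t c)) = (\<Sum>c\<in>circs (B - {m}). label_degree (s c)) - 1"
      using edge_map_degree[of "B - {m}" m s t] B m(1) e insert_Diff[OF m(1)] by auto
    ultimately show ?thesis
      unfolding labeled_states_def using B by simp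
  qed
  show ?thesis unfolding cochains_def
  proof (intro CollectI allI impI)
    fix g assume "g \<notin> labeled_states P M (i + 1) j"
    then show "differential P M f g = 0"
      using *[of "fst g" "snd g"] unfolding prod.collapse by blast
  qed
qed

end

section \<open>The differential squares to zero\<close>

lemma sum_symmetric_pairs:
  fixes F :: "'a \<Rightarrow> 'a \<Rightarrow> 'i ext"
  assumes "finite B" and "\<And>m m'. m \<in> B \<Longrightarrow> m' \<in> B \<Longrightarrow> m \<noteq> m' \<Longrightarrow> F m m' = F m' m"
  shows "(\<Sum>m\<in>B. \<Sum>m'\<in>B - {m}. F m m') = 0"
  using assms
proof (induction B rule: finite_induct)
  case (insert b B)
  have "(\<Sum>m'\<in>insert b B - {m}. F m m') = F m b + (\<Sum>m'\<in>B - {m}. F m m')" if "m \<in> B" for m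
  proof -
    have "insert b B - {m} = insert b (B - {m})" using that insert by auto
    then show ?thesis using insert by simp
  qed
  then have "(\<Sum>m\<in>B. \<Sum>m'\<in>insert b B - {m}. F m m') =
      (\<Sum>m\<in>B. F m b) + (\<Sum>m\<in>B. \<Sum>m'\<in>B - {m}. F m m')"
    by (simp add: sum.distrib)
  also have "(\<Sum>m\<in>B. \<Sum>m'\<in>B - {m}. F m m') = 0"
    using insert by simp
  also have "(\<Sum>m\<in>B. F m b) = (\<Sum>m\<in>B. F b m)"
    using insert by (intro sum.cong) auto
  \<comment> \<open>The two sums that involve \<open>b\<close> are equal and cancel: each unordered
    pair is counted twice.\<close>
  finally show ?case using insert by simp
qed simp

context circle_model
begin

text \<open>After a merge the new circle has coordinate \<open>1 + 1\<close> and the circles away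
  from \<open>m\<close> have coordinate 0, so the kernel condition in \<open>W_Int\<close> is
  automatic for \<open>insert m A\<close>.\<close>

lemma transition_Merge:
  assumes A: "A \<subseteq> M" and m: "m \<in> M - A" and ty: "transition_type W ix A m = Merge"
  shows "W (insert m A) = {w \<in> W A. pderiv_at (ix m) w = 0}"
proof (rule transition_typeE[OF A m])
  fix a b c
  assume *: "circles_at P M A m = {a, b}" "circles_at P M (insert m A) m = {c}"
      "vec c = vec a + vec b" "pderiv_at (ix m) (vec a) = 1" "pderiv_at (ix m) (vec b) = 1"
  have "pderiv_at (ix m) (vec e) = 0" if "e \<in> circs (insert m A)" for e
    using that circs_insert(1)[OF A m] pderiv_away[OF A m, of e] * by (auto simp: pderiv_at_add)
  moreover have "insert m A \<subseteq> M" using A m by auto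
  ultimately have "\<forall>w\<in>W (insert m A). pderiv_at (ix m) w = 0"
    by (auto simp: W_eq pderiv_at_sum subset_iff intro!: sum.neutral)
  then show ?thesis using W_Int[OF A m] by blast
qed (use ty in simp_all)

lemma transition_Split:
  assumes A: "A \<subseteq> M" and m: "m \<in> M - A" and ty: "transition_type W ix A m = Split"
  shows "W A = {w \<in> W (insert m A). pderiv_at (ix m) w = 0}"
proof -
  have "\<forall>w\<in>W A. pderiv_at (ix m) w = 0"
    using ty by (auto simp: transition_type_def split: if_splits)
  then show ?thesis using W_Int[OF A m] by blast
qed

lemma transition_Single:
  assumes A: "A \<subseteq> M" and m: "m \<in> M - A" and ty: "transition_type W ix A m = Single"
  shows "W (insert m A) = W A"
proof -
  have "\<forall>w\<in>W A. pderiv_at (ix m) w = 0" "\<forall>w\<in>W (insert m A). pderiv_at (ix m) w = 0"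
    using ty by (auto simp: transition_type_def split: if_splits)
  then show ?thesis using W_Int[OF A m] by blast
qed

lemma transition_card:
  assumes A: "A \<subseteq> M" and m: "m \<in> M - A"
  shows "int (card (circs (insert m A))) = int (card (circs A)) +
    (case transition_type W ix A m of Merge \<Rightarrow> -1 | Split \<Rightarrow> 1 | Single \<Rightarrow> 0)"
proof -
  have A': "insert m A \<subseteq> M" using A m by auto
  have C: "circs A = away_circs A m \<union> circles_at P M A m" by (auto simp: circles_at_def)
  have fin: "finite (away_circs A m)" "finite (circles_at P M A m)" "finite (circles_at P M (insert m A) m)"
    using finite_circles[OF A] finite_circles[OF A'] by (auto simp: circles_at_def)
  have 1: "card (circs A) = card (away_circs A m) + card (circles_at P M A m)"
    by (subst C, rule card_Un_disjoint) (use fin in auto)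
  have 2: "card (circs (insert m A)) = card (away_circs A m) + card (circles_at P M (insert m A) m)"
    unfolding circs_insert(1)[OF A m] using fin(1,3) circs_insert(2)[OF A m] by (rule card_Un_disjoint)
  show ?thesis
    by (rule transition_typeE[OF A m]) (simp_all add: 1 2)
qed

text \<open>Comparing the numbers of circles leaves few combinations of types along the two ways.
  Equal pairs of types mostly agree because contractions commute; otherwise some coordinate vanishes
  on \<open>W A\<close>, or one of the facts K3 to K5 is needed.\<close>

lemma edge_op_commute:
  assumes A: "A \<subseteq> M" and m: "m \<in> M - A" and m': "m' \<in> M - A" and ne: "m \<noteq> m'"
    and x: "x \<in> ext_power (W A) p"
  shows "edge_op W ix (insert m A) m' (edge_op W ix A m x) =
         edge_op W ix (insert m' A) m (edge_op W ix A m' x)"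
proof -
  let ?A1 = "insert m A" and ?A2 = "insert m' A" and ?A3 = "insert m' (insert m A)"
  have A1: "?A1 \<subseteq> M" "m' \<in> M - ?A1" and A2: "?A2 \<subseteq> M" "m \<in> M - ?A2" and A3: "insert m ?A2 = ?A3"
    using assms by auto
  define t01 where "t01 = transition_type W ix A m"
  define t13 where "t13 = transition_type W ix ?A1 m'"
  define t02 where "t02 = transition_type W ix A m'"
  define t23 where "t23 = transition_type W ix ?A2 m"
  note t_defs = t01_def t13_def t02_def t23_def
  have cards: "(case t01 of Merge \<Rightarrow> -1 | Split \<Rightarrow> 1 | Single \<Rightarrow> 0) +
      (case t13 of Merge \<Rightarrow> -1 | Split \<Rightarrow> 1 | Single \<Rightarrow> 0) =
      (case t02 of Merge \<Rightarrow> -1 | Split \<Rightarrow> 1 | Single \<Rightarrow> 0) +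
      (case t23 of Merge \<Rightarrow> -1 | Split \<Rightarrow> 1 | Single \<Rightarrow> (0::int))"
    using transition_card[OF A m] transition_card[OF A1] transition_card[OF A m'] transition_card[OF A2]
    unfolding A3 t_defs by linarith
  have K1: "pderiv_at (ix m) x = 0" if "t01 \<noteq> Merge"
    using that by (intro pderiv_at_ext_power_eq_0[OF x]) (auto simp: t_defs transition_type_def split: if_splits)
  have K2: "pderiv_at (ix m') x = 0" if "t02 \<noteq> Merge"
    using that by (intro pderiv_at_ext_power_eq_0[OF x]) (auto simp: t_defs transition_type_def split: if_splits)
  \<comment> \<open>Both ways merge and then split. The kernel of one coordinate on
    \<open>W A\<close> is the space after the first merge, on which the other coordinate vanishes
    too. So the kernels agree, and as all values are 0 or 1 the coordinates agree on
    \<open>W A\<close>.\<close>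
  have K3: "pderiv_at (ix m) x = pderiv_at (ix m') x"
    if t: "t01 = Merge" "t13 = Split" "t02 = Merge" "t23 = Split"
  proof (rule pderiv_at_ext_power_cong[OF x])
    fix w assume w: "w \<in> W A"
    have W1: "W ?A1 = {w \<in> W A. pderiv_at (ix m) w = 0}" "W ?A1 = {w \<in> W ?A3. pderiv_at (ix m') w = 0}"
      using transition_Merge[OF A m] transition_Split[OF A1] t by (auto simp: t_defs)
    have W2: "W ?A2 = {w \<in> W A. pderiv_at (ix m') w = 0}" "W ?A2 = {w \<in> W ?A3. pderiv_at (ix m) w = 0}"
      using transition_Merge[OF A m'] transition_Split[OF A2] t A3 by (auto simp: t_defs)
    have "pderiv_at (ix m) w = 0 \<longleftrightarrow> pderiv_at (ix m') w = 0"
      using W1 W2 w by blast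
    moreover have "pderiv_at (ix m) w \<in> {0, 1}" "pderiv_at (ix m') w \<in> {0, 1}"
      using pderiv_W[OF A] m m' w by auto
    ultimately show "pderiv_at (ix m) w = pderiv_at (ix m') w" by auto
  qed
  \<comment> \<open>A single transition leaves the space unchanged, so it cannot turn a merge at the
    other edge into a single transition.\<close>
  have K4: False if t: "t01 = Merge" "t02 = Single" "t23 = Single"
  proof -
    have "W ?A2 = W A" using transition_Single[OF A m'] t by (simp add: t_defs)
    moreover have "\<forall>w\<in>W ?A2. pderiv_at (ix m) w = 0"
      using t by (auto simp: t_defs transition_type_def split: if_splits)
    ultimately show False using t(1) by (auto simp: t_defs transition_type_def split: if_splits)
  qed
  have K5: False if t: "t02 = Merge" "t01 = Single" "t13 = Single"
  proof -
    have "W ?A1 = W A" using transition_Single[OF A m] t by (simp add: t_defs)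
    moreover have "\<forall>w\<in>W ?A1. pderiv_at (ix m') w = 0"
      using t by (auto simp: t_defs transition_type_def split: if_splits)
    ultimately show False using t(1) by (auto simp: t_defs transition_type_def split: if_splits)
  qed
  have "(case t13 of Merge \<Rightarrow> pderiv_at (ix m') | Split \<Rightarrow> id | Single \<Rightarrow> (\<lambda>_. 0))
          ((case t01 of Merge \<Rightarrow> pderiv_at (ix m) | Split \<Rightarrow> id | Single \<Rightarrow> (\<lambda>_. 0)) x) =
        (case t23 of Merge \<Rightarrow> pderiv_at (ix m) | Split \<Rightarrow> id | Single \<Rightarrow> (\<lambda>_. 0))
          ((case t02 of Merge \<Rightarrow> pderiv_at (ix m') | Split \<Rightarrow> id | Single \<Rightarrow> (\<lambda>_. 0)) x)"
    using cards K1 K2 K3 K4 K5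
    by (cases t01; cases t02; cases t13; cases t23) (simp_all add: pderiv_at_commute)
  moreover have "edge_op W ix B l y =
      (case transition_type W ix B l of Merge \<Rightarrow> pderiv_at (ix l) | Split \<Rightarrow> id | Single \<Rightarrow> (\<lambda>_. 0)) y" for B l y
    by (cases "transition_type W ix B l") (simp_all add: edge_op_def)
  ultimately show ?thesis
    by (simp only: t_defs)
qed

lemma model_diff_sq:
  assumes g: "g \<in> model_cochains M W k i j"
  shows "model_diff M W ix (model_diff M W ix g) B = 0"
proof (cases "B \<subseteq> M")
  case B: True
  define F where "F m m' = edge_op W ix (B - {m}) m (edge_op W ix (B - {m} - {m'}) m' (g (B - {m} - {m'})))" for m m'
  have "edge_op W ix (B - {m}) m (model_diff M W ix g (B - {m})) = (\<Sum>m'\<in>B - {m}. F m m')" for m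
  proof -
    have "B - {m} \<subseteq> M" using B by auto
    then show ?thesis by (simp add: model_diff_def edge_op_sum F_def)
  qed
  moreover have "model_diff M W ix h B = (\<Sum>m\<in>B. edge_op W ix (B - {m}) m (h (B - {m})))" for h
    using B unfolding model_diff_def by (rule if_P)
  ultimately have "model_diff M W ix (model_diff M W ix g) B = (\<Sum>m\<in>B. \<Sum>m'\<in>B - {m}. F m m')"
    by presburger
  also have "\<dots> = 0"
  proof (rule sum_symmetric_pairs)
    show "finite B" using B finite_M by (rule finite_subset)
    fix m m' assume *: "m \<in> B" "m' \<in> B" "m \<noteq> m'"
    define A where "A = B - {m, m'}"
    have A: "A \<subseteq> M" "m \<in> M - A" "m' \<in> M - A" "B - {m} = insert m' A" "B - {m'} = insert m A"
      "B - {m} - {m'} = A" "B - {m'} - {m} = A"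
      using * B by (auto simp: A_def)
    show "F m m' = F m' m"
    proof (cases "g A = 0")
      case True
      then show ?thesis unfolding F_def A(6,7) by simp
    next
      case False
      then obtain p where "g A \<in> ext_power (W A) p"
        using g by (auto simp: model_cochains_def)
      then show ?thesis
        unfolding F_def A(6,7) unfolding A(4,5)
        by (rule edge_op_commute[OF A(1) A(3) A(2) *(3)[symmetric]])
    qed
  qed
  finally show ?thesis .
qed (simp add: model_diff_def)

lemma zero_cochain: "(\<lambda>_. 0) \<in> cochains P M i j"
  by (simp add: cochains_def)

lemma differential_sq:
  assumes f: "f \<in> cochains P M i j"
  shows "differential P M (differential P M f) = (\<lambda>_. 0)"
proof (rule cochains_eqI)
  show "differential P M (differential P M f) \<in> cochains P M (i + 1 + 1) j"
    using f by (intro differential_cochains)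
  show "(\<lambda>_. 0) \<in> cochains P M i j" by (rule zero_cochain)
  have "realize (differential P M f) = model_diff M W ix (realize f)"
    by (simp add: fun_eq_iff realize_differential)
  then show "realize (differential P M (differential P M f)) A = realize (\<lambda>_. 0) A" for A
    using model_diff_sq[OF realize_in_model[OF f]] by (simp add: realize_differential realize_eq_0)
qed

lemma coboundaries_subset_cocycles: "coboundaries P M i j \<subseteq> cocycles P M i j"
  using differential_cochains[of _ "i - 1" j] differential_sq[of _ "i - 1" j]
  by (auto simp: coboundaries_def cocycles_def)

end

section \<open>Isomorphic cohomology for two models on the same spaces\<close>

lemma image_binary:
  assumes "\<And>f g. f \<in> S \<Longrightarrow> g \<in> T \<Longrightarrow> h (p f g) = q (h f) (h g)"
  shows "h ` {p f g | f g. f \<in> S \<and> g \<in> T} = {q f g | f g. f \<in> h ` S \<and> g \<in> h ` T}"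
proof (intro equalityI subsetI)
  fix y assume "y \<in> h ` {p f g | f g. f \<in> S \<and> g \<in> T}"
  then obtain f g where "f \<in> S" "g \<in> T" "y = h (p f g)" by auto
  then show "y \<in> {q f g | f g. f \<in> h ` S \<and> g \<in> h ` T}" using assms by blast
next
  fix y assume "y \<in> {q f g | f g. f \<in> h ` S \<and> g \<in> h ` T}"
  then obtain f g where "f \<in> S" "g \<in> T" "y = q (h f) (h g)" by auto
  then have "y = h (p f g)" "p f g \<in> {p f g | f g. f \<in> S \<and> g \<in> T}" using assms by auto
  then show "y \<in> h ` {p f g | f g. f \<in> S \<and> g \<in> T}" by blast
qed

lemma quotient_space_iso:
  fixes C Z B :: "('a \<Rightarrow> 'k::field) set" and C' Z' B' :: "('b \<Rightarrow> 'k) set"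
  assumes bij: "bij_betw \<Psi> C C'"
    and add: "\<And>f g. f \<in> C \<Longrightarrow> g \<in> C \<Longrightarrow> \<Psi> (\<lambda>x. f x + g x) = (\<lambda>x. \<Psi> f x + \<Psi> g x)"
    and scale: "\<And>k f. f \<in> C \<Longrightarrow> \<Psi> (\<lambda>x. k * f x) = (\<lambda>x. k * \<Psi> f x)"
    and C_add: "\<And>f g. f \<in> C \<Longrightarrow> g \<in> C \<Longrightarrow> (\<lambda>x. f x + g x) \<in> C"
    and C_scale: "\<And>k f. f \<in> C \<Longrightarrow> (\<lambda>x. k * f x) \<in> C"
    and Z: "Z \<subseteq> C" "\<Psi> ` Z = Z'" and B: "B \<subseteq> C" "\<Psi> ` B = B'"
  shows "\<exists>\<phi>\<in>module_hom class_ring (quotient_space Z B) (quotient_space Z' B').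
           bij_betw \<phi> (carrier (quotient_space Z B)) (carrier (quotient_space Z' B'))"
proof (rule bexI[of _ "(`) \<Psi>"])
  have coset: "\<Psi> ` {\<lambda>x. f x + b x | b. b \<in> B} = {\<lambda>x. \<Psi> f x + b x | b. b \<in> B'}" if "f \<in> C" for f
  proof -
    have "\<Psi> ` {\<lambda>x. f x + b x | b. b \<in> B} = (\<lambda>b x. \<Psi> f x + \<Psi> b x) ` B"
      unfolding Setcompr_eq_image image_image using that add B(1) by (intro image_cong) auto
    then show ?thesis by (simp add: Setcompr_eq_image B(2)[symmetric] image_image)
  qed
  have sub: "S \<subseteq> C" if "S \<in> carrier (quotient_space Z B)" for S
    using that Z B C_add by (auto simp: quotient_space_def)
  have carrier: "(`) \<Psi> ` carrier (quotient_space Z B) = carrier (quotient_space Z' B')"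
  proof -
    have "(\<lambda>f. \<Psi> ` {\<lambda>x. f x + b x | b. b \<in> B}) ` Z = (\<lambda>f. {\<lambda>x. \<Psi> f x + b x | b. b \<in> B'}) ` Z"
      by (rule image_cong[OF refl]) (use coset Z(1) in blast)
    then show ?thesis
      by (simp add: quotient_space_def Z(2)[symmetric] image_image)
  qed
  have "inj_on ((`) \<Psi>) (carrier (quotient_space Z B))"
    using sub bij by (intro inj_onI) (metis bij_betw_def inj_on_image_eq_iff)
  with carrier show "bij_betw ((`) \<Psi>) (carrier (quotient_space Z B)) (carrier (quotient_space Z' B'))"
    by (simp add: bij_betw_def)
  show "(`) \<Psi> \<in> module_hom class_ring (quotient_space Z B) (quotient_space Z' B')"
    unfolding module_hom_def
  proof (intro CollectI conjI allI impI)
    show "(`) \<Psi> \<in> carrier (quotient_space Z B) \<rightarrow> carrier (quotient_space Z' B')"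
      using carrier by auto
    fix S T assume "S \<in> carrier (quotient_space Z B) \<and> T \<in> carrier (quotient_space Z B)"
    then have S: "S \<in> carrier (quotient_space Z B)" and T: "T \<in> carrier (quotient_space Z B)" by auto
    show "\<Psi> ` (S \<oplus>\<^bsub>quotient_space Z B\<^esub> T) = \<Psi> ` S \<oplus>\<^bsub>quotient_space Z' B'\<^esub> \<Psi> ` T"
      unfolding quotient_space_def ring.simps
      using sub[OF S] sub[OF T] add by (intro image_binary) auto
  next
    fix k :: 'k and S assume "k \<in> carrier class_ring \<and> S \<in> carrier (quotient_space Z B)"
    then have S: "S \<in> carrier (quotient_space Z B)" by simp
    have eq: "\<Psi> (\<lambda>x. k * f x + b x) = (\<lambda>x. k * \<Psi> f x + \<Psi> b x)" if "f \<in> C" "b \<in> C" for f b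
      using add[OF C_scale[OF that(1)] that(2)] scale[OF that(1)] by simp
    show "\<Psi> ` (k \<odot>\<^bsub>quotient_space Z B\<^esub> S) = k \<odot>\<^bsub>quotient_space Z' B'\<^esub> \<Psi> ` S"
      unfolding quotient_space_def module.simps B(2)[symmetric]
      using sub[OF S] B(1) eq by (intro image_binary) auto
  qed
qed

lemma circle_model_card_eq:
  assumes "circle_model P M v W ix" "circle_model P' M v' W ix" "A \<subseteq> M"
  shows "card (state_circles P M A) = card (state_circles P' M A)"
  using circle_model.card_W[OF assms(1,3)] circle_model.card_W[OF assms(2,3)] by simp

lemma two_factor_poly_eq:
  assumes "circle_model P M v W ix" "circle_model P' M v' W ix"
  shows "two_factor_poly P M = two_factor_poly P' M"
  unfolding two_factor_poly_def using circle_model_card_eq[OF assms] by (intro sum.cong) auto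

text \<open>Both complexes are realized in the same model, since it refers only to \<open>W\<close>,
  \<open>ix\<close> and the numbers of circles. The isomorphism is one realization followed by the
  inverse of the other.\<close>

lemma cohomology_iso:
  assumes "circle_model P M v W ix" "circle_model P' M v' W ix"
  shows "bigraded_isomorphic (cohomology P M) (cohomology P' M)"
  unfolding bigraded_isomorphic_def cohomology_def
proof (intro allI)
  fix i j
  interpret L: circle_model P M v W ix by fact
  interpret R: circle_model P' M v' W ix by fact
  have models: "model_cochains M W (\<lambda>A. card (state_circles P' M A)) i j =
      model_cochains M W (\<lambda>A. card (state_circles P M A)) i j" for i j
    using circle_model_card_eq[OF assms] unfolding model_cochains_def by (metis (no_types, lifting))
  define \<Psi> where "\<Psi> i j f = the_inv_into (cochains P' M i j) R.realize (L.realize f)" for i j f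
  have \<Psi>: "\<Psi> i j f \<in> cochains P' M i j" "R.realize (\<Psi> i j f) = L.realize f" if "f \<in> cochains P M i j" for f i j
  proof -
    have "L.realize f \<in> R.realize ` cochains P' M i j"
      using L.realize_in_model[OF that] R.realize_bij[of i j] models[of i j] by (simp add: bij_betw_def)
    then show "\<Psi> i j f \<in> cochains P' M i j" "R.realize (\<Psi> i j f) = L.realize f"
      unfolding \<Psi>_def using R.realize_inj
      by (auto intro: the_inv_into_into[OF R.realize_inj _ order_refl] f_the_inv_into_f[OF R.realize_inj])
  qed
  have unique: "\<Psi> i j f = f'" if "f \<in> cochains P M i j" "f' \<in> cochains P' M i j" "R.realize f' = L.realize f" for f f' i j
    using \<Psi>[OF that(1)] that by (intro inj_onD[OF R.realize_inj]) auto
  have bij: "bij_betw (\<Psi> i j) (cochains P M i j) (cochains P' M i j)" for i j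
  proof -
    have "bij_betw (the_inv_into (cochains P' M i j) R.realize \<circ> L.realize) (cochains P M i j) (cochains P' M i j)"
      using L.realize_bij[of i j] R.realize_bij[of i j] models[of i j]
      by (intro bij_betw_trans bij_betw_the_inv_into) auto
    moreover have "\<Psi> i j = the_inv_into (cochains P' M i j) R.realize \<circ> L.realize"
      by (simp add: fun_eq_iff \<Psi>_def)
    ultimately show ?thesis by (simp only:)
  qed
  have diff: "\<Psi> (i + 1) j (differential P M f) = differential P' M (\<Psi> i j f)" if "f \<in> cochains P M i j" for f i j
  proof -
    have "L.realize (differential P M f) = model_diff M W ix (L.realize f)"
      "R.realize (differential P' M (\<Psi> i j f)) = model_diff M W ix (R.realize (\<Psi> i j f))"
      by (simp_all add: fun_eq_iff L.realize_differential R.realize_differential)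
    then show ?thesis
      using that \<Psi>[OF that]
      by (intro unique L.differential_cochains R.differential_cochains) simp_all
  qed
  have zero: "\<Psi> i j (\<lambda>_. 0) = (\<lambda>_. 0)" for i j
    by (rule unique) (auto simp: L.zero_cochain R.zero_cochain fun_eq_iff L.realize_eq_0 R.realize_eq_0)
  show "\<exists>\<phi>\<in>module_hom class_ring (quotient_space (cocycles P M i j) (coboundaries P M i j))
      (quotient_space (cocycles P' M i j) (coboundaries P' M i j)).
      bij_betw \<phi> (carrier (quotient_space (cocycles P M i j) (coboundaries P M i j)))
        (carrier (quotient_space (cocycles P' M i j) (coboundaries P' M i j)))"
  proof (rule quotient_space_iso[OF bij[of i j]])
    show "\<Psi> i j (\<lambda>x. f x + g x) = (\<lambda>x. \<Psi> i j f x + \<Psi> i j g x)"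
      if "f \<in> cochains P M i j" "g \<in> cochains P M i j" for f g
      using that \<Psi>[OF that(1)] \<Psi>[OF that(2)]
      by (intro unique) (auto simp: cochains_def fun_eq_iff L.realize_add R.realize_add)
    show "\<Psi> i j (\<lambda>x. k * f x) = (\<lambda>x. k * \<Psi> i j f x)" if "f \<in> cochains P M i j" for k f
      using zero by (cases k) simp_all
    show "(\<lambda>x. f x + g x) \<in> cochains P M i j"
      if "f \<in> cochains P M i j" "g \<in> cochains P M i j" for f g
      using that by (auto simp: cochains_def)
    show "(\<lambda>x. k * f x) \<in> cochains P M i j" if "f \<in> cochains P M i j" for k f
      using that by (auto simp: cochains_def)
    show "cocycles P M i j \<subseteq> cochains P M i j" by (auto simp: cocycles_def)
    show "coboundaries P M i j \<subseteq> cochains P M i j"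
      using L.coboundaries_subset_cocycles by (force simp: cocycles_def)
    have "differential P' M (\<Psi> i j f) = (\<lambda>_. 0) \<longleftrightarrow> differential P M f = (\<lambda>_. 0)"
      if f: "f \<in> cochains P M i j" for f
      using inj_onD[OF bij_betw_imp_inj_on[OF bij[of "i + 1" j]], of "differential P M f" "\<lambda>_. 0"]
        diff[OF f] zero[of "i + 1" j] L.differential_cochains[OF f] L.zero_cochain by auto
    then have "\<Psi> i j ` cocycles P M i j =
        {f' \<in> \<Psi> i j ` cochains P M i j. differential P' M f' = (\<lambda>_. 0)}"
      unfolding cocycles_def by blast
    then show "\<Psi> i j ` cocycles P M i j = cocycles P' M i j"
      using bij[of i j] by (simp add: cocycles_def bij_betw_def)
    show "\<Psi> i j ` coboundaries P M i j = coboundaries P' M i j"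
    proof -
      have "\<Psi> i j ` coboundaries P M i j = (\<lambda>f. differential P' M (\<Psi> (i - 1) j f)) ` cochains P M (i - 1) j"
        unfolding coboundaries_def image_image using diff[of _ "i - 1" j] by (intro image_cong) auto
      also have "\<dots> = differential P' M ` (\<Psi> (i - 1) j ` cochains P M (i - 1) j)"
        by (simp add: image_image)
      also have "\<Psi> (i - 1) j ` cochains P M (i - 1) j = cochains P' M (i - 1) j"
        using bij[of "i - 1" j] by (simp add: bij_betw_def)
      finally show ?thesis by (simp add: coboundaries_def)
    qed
  qed
qed

lemma bit_add_left_self [simp]: "(a :: bit) + (a + b) = b"
  by (simp flip: add.assoc)

section \<open>The graded Euler characteristic\<close>

text \<open>Over two elements, closure under addition together with 0 makes a subspace, and
  cardinalities determine dimensions.\<close>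

locale bit_quotient =
  fixes Z B :: "('a \<Rightarrow> bit) set"
  assumes finite_Z: "finite Z" and B_sub: "B \<subseteq> Z"
    and Z_add: "\<And>f g. f \<in> Z \<Longrightarrow> g \<in> Z \<Longrightarrow> (\<lambda>x. f x + g x) \<in> Z"
    and B_add: "\<And>f g. f \<in> B \<Longrightarrow> g \<in> B \<Longrightarrow> (\<lambda>x. f x + g x) \<in> B"
    and B_0: "(\<lambda>_. 0) \<in> B"
begin

definition coset :: "('a \<Rightarrow> bit) \<Rightarrow> ('a \<Rightarrow> bit) set" where
  "coset f = {\<lambda>x. f x + b x | b. b \<in> B}"

lemma mem_coset_iff: "g \<in> coset f \<longleftrightarrow> (\<lambda>x. f x + g x) \<in> B"
proof
  assume "g \<in> coset f"
  then obtain b where b: "b \<in> B" "g = (\<lambda>x. f x + b x)" by (auto simp: coset_def)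
  then have "(\<lambda>x. f x + g x) = b" by simp
  then show "(\<lambda>x. f x + g x) \<in> B" using b by simp
next
  assume "(\<lambda>x. f x + g x) \<in> B"
  moreover have "g = (\<lambda>x. f x + (f x + g x))" by simp
  ultimately show "g \<in> coset f"
    unfolding coset_def by (intro CollectI exI[of _ "\<lambda>x. f x + g x"]) simp
qed

lemma coset_self: "f \<in> coset f"
  by (simp add: mem_coset_iff B_0)

lemma coset_eq: assumes "g \<in> coset f" shows "coset g = coset f"
proof -
  have *: "(\<lambda>x. f x + h x) \<in> B" if "(\<lambda>x. f x + g x) \<in> B" "(\<lambda>x. g x + h x) \<in> B" for f g h
  proof -
    have "(\<lambda>x. (f x + g x) + (g x + h x)) = (\<lambda>x. f x + h x)"
      by (rule ext) (metis add.assoc add.left_neutral bit_add_self)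
    then show ?thesis using B_add[OF that] by simp
  qed
  have fg: "(\<lambda>x. f x + g x) \<in> B" using assms by (simp add: mem_coset_iff)
  then have gf: "(\<lambda>x. g x + f x) \<in> B" by (simp add: add.commute)
  show ?thesis using *[OF fg] *[OF gf] by (auto simp: mem_coset_iff)
qed

lemma coset_sub: "f \<in> Z \<Longrightarrow> coset f \<subseteq> Z"
  using Z_add B_sub by (auto simp: coset_def)

lemma coset_0: "coset (\<lambda>_. 0) = B"
  by (auto simp: coset_def)

lemma carrier_quotient: "carrier (quotient_space Z B) = coset ` Z"
  by (simp add: quotient_space_def coset_def)

lemma add_coset: "coset f \<oplus>\<^bsub>quotient_space Z B\<^esub> coset g = coset (\<lambda>x. f x + g x)"
proof (intro equalityI subsetI)
  fix h assume "h \<in> coset f \<oplus>\<^bsub>quotient_space Z B\<^esub> coset g"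
  then obtain b c where "b \<in> B" "c \<in> B" "h = (\<lambda>x. (f x + b x) + (g x + c x))"
    by (auto simp: quotient_space_def coset_def)
  then have "h = (\<lambda>x. (f x + g x) + (b x + c x))" "(\<lambda>x. b x + c x) \<in> B"
    using B_add by (auto simp: ac_simps)
  then show "h \<in> coset (\<lambda>x. f x + g x)"
    unfolding coset_def by (intro CollectI exI[of _ "\<lambda>x. b x + c x"]) simp
next
  fix h assume "h \<in> coset (\<lambda>x. f x + g x)"
  then obtain b where b: "b \<in> B" "h = (\<lambda>x. f x + g x + b x)" by (auto simp: coset_def)
  then have "h = (\<lambda>x. f x + (\<lambda>x. g x + b x) x)" "(\<lambda>x. g x + b x) \<in> coset g"
    by (auto simp: coset_def ac_simps)
  then show "h \<in> coset f \<oplus>\<^bsub>quotient_space Z B\<^esub> coset g"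
    using coset_self[of f] unfolding quotient_space_def ring.simps
    by (intro CollectI exI[of _ f] exI[of _ "\<lambda>x. g x + b x"]) simp
qed

lemma smult_coset: "k \<odot>\<^bsub>quotient_space Z B\<^esub> coset f = coset (\<lambda>x. k * f x)"
proof (cases k)
  case zero
  have "coset f \<noteq> {}" using coset_self by blast
  then show ?thesis unfolding zero by (auto simp: quotient_space_def coset_def)
next
  case one
  have "{\<lambda>x. 1 * g x + b x |g b. g \<in> S \<and> b \<in> B} = (\<Union>g\<in>S. coset g)" for S
    by (auto simp: coset_def)
  moreover have "(\<Union>g\<in>coset f. coset g) = coset f"
    using coset_eq coset_self by blast
  ultimately show ?thesis unfolding one by (simp add: quotient_space_def)
qed

lemma zero_quotient: "\<zero>\<^bsub>quotient_space Z B\<^esub> = coset (\<lambda>_. 0)"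
  by (simp add: quotient_space_def coset_0)

lemma Z_0: "(\<lambda>_. 0) \<in> Z"
  using B_0 B_sub by blast

lemma vectorspace_quotient: "vectorspace class_ring (quotient_space Z B)"
proof -
  have "module class_ring (quotient_space Z B)"
  proof (rule moduleI)
    show "cring (class_ring :: bit ring)" by (rule class_cring.is_cring)
    show "abelian_group (quotient_space Z B)"
    proof (rule abelian_groupI)
      fix S assume "S \<in> carrier (quotient_space Z B)"
      then obtain f where f: "f \<in> Z" "S = coset f" by (auto simp: carrier_quotient)
      show "\<exists>y\<in>carrier (quotient_space Z B). y \<oplus>\<^bsub>quotient_space Z B\<^esub> S = \<zero>\<^bsub>quotient_space Z B\<^esub>"
        using f by (intro bexI[of _ S]) (auto simp: add_coset zero_quotient carrier_quotient)
    qed (auto simp: carrier_quotient add_coset zero_quotient Z_add Z_0 ac_simps)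
  next
    fix k :: bit and S assume "S \<in> carrier (quotient_space Z B)"
    then show "k \<odot>\<^bsub>quotient_space Z B\<^esub> S \<in> carrier (quotient_space Z B)"
      using Z_0 by (cases k) (auto simp: carrier_quotient smult_coset)
  qed (auto simp: carrier_quotient smult_coset add_coset class_ring_simps algebra_simps)
  then show ?thesis
    unfolding vectorspace_def using class_field by blast
qed

lemma card_quotient: "card (carrier (quotient_space Z B)) * card B = card Z"
proof -
  have "card B * card (coset ` Z) = card (\<Union> (coset ` Z))"
  proof (rule card_partition)
    show "finite (coset ` Z)" using finite_Z by simp
    have U: "\<Union> (coset ` Z) = Z" using coset_sub coset_self by blast
    show "finite (\<Union> (coset ` Z))" unfolding U by (rule finite_Z)
    show "card c = card B" if "c \<in> coset ` Z" for c
    proof -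
      from that obtain f where f: "c = coset f" by blast
      have "inj_on (\<lambda>b x. f x + b x) B" by (auto simp: inj_on_def fun_eq_iff)
      moreover have "c = (\<lambda>b x. f x + b x) ` B" by (auto simp: f coset_def)
      ultimately show ?thesis by (simp add: card_image)
    qed
    show "c1 \<inter> c2 = {}" if "c1 \<in> coset ` Z" "c2 \<in> coset ` Z" "c1 \<noteq> c2" for c1 c2
      using that coset_eq by blast
  qed
  moreover have "\<Union> (coset ` Z) = Z" using coset_sub coset_self by blast
  ultimately show ?thesis by (simp add: carrier_quotient mult.commute)
qed

text \<open>Coordinates with respect to a basis identify the quotient with the functions from the
  basis to a set of two elements.\<close>

lemma card_quotient_dim:
  "card (carrier (quotient_space Z B)) = 2 ^ vectorspace.dim class_ring (quotient_space Z B)"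
proof -
  interpret V: vectorspace class_ring "quotient_space Z B" by (rule vectorspace_quotient)
  have fin: "finite (carrier (quotient_space Z B))"
    using finite_Z by (simp add: carrier_quotient)
  have "V.gen_set (carrier (quotient_space Z B))"
    using V.in_own_span[of "carrier (quotient_space Z B)"] V.span_is_subset2 by blast
  then have "V.fin_dim" unfolding V.fin_dim_def using fin by blast
  then obtain \<beta> where \<beta>: "finite \<beta>" "V.basis \<beta>" using V.finite_basis_exists by blast
  have sub: "\<beta> \<subseteq> carrier (quotient_space Z B)" using \<beta>(2) by (simp add: V.basis_def)
  have ex1: "\<And>v. v \<in> carrier (quotient_space Z B) \<Longrightarrow>
      \<exists>!a. a \<in> \<beta> \<rightarrow>\<^sub>E (UNIV :: bit set) \<and> V.lincomb a \<beta> = v"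
    using V.basis_criterion[OF \<beta>(1) sub] \<beta>(2) by simp
  have closed: "V.lincomb a \<beta> \<in> carrier (quotient_space Z B)" for a
    using sub by (intro V.lincomb_closed) auto
  have "bij_betw (\<lambda>a. V.lincomb a \<beta>) (\<beta> \<rightarrow>\<^sub>E UNIV) (carrier (quotient_space Z B))"
  proof (rule bij_betwI')
    fix a b assume ab: "a \<in> \<beta> \<rightarrow>\<^sub>E (UNIV :: bit set)" "b \<in> \<beta> \<rightarrow>\<^sub>E (UNIV :: bit set)"
    show "V.lincomb a \<beta> = V.lincomb b \<beta> \<longleftrightarrow> a = b"
      using ex1[OF closed[of a]] ab by auto
  next
    fix v assume "v \<in> carrier (quotient_space Z B)"
    then show "\<exists>a\<in>\<beta> \<rightarrow>\<^sub>E UNIV. v = V.lincomb a \<beta>" using ex1[of v] by blast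
  qed (rule closed)
  then have "card (carrier (quotient_space Z B)) = card (\<beta> \<rightarrow>\<^sub>E (UNIV :: bit set))"
    using bij_betw_same_card by fastforce
  also have "\<dots> = 2 ^ card \<beta>"
  proof -
    have "(UNIV :: bit set) = {0, 1}" by auto
    moreover have "card {0, 1 :: bit} = 2" by simp
    ultimately have "card (UNIV :: bit set) = 2" by (simp only:)
    then show ?thesis using \<beta>(1) by (simp add: card_PiE)
  qed
  finally show ?thesis using V.dim_basis[OF \<beta>] by simp
qed

end


lemma card_supported:
  fixes S :: "'a set"
  assumes "finite S"
  shows "card {f :: 'a \<Rightarrow> bit. \<forall>x. x \<notin> S \<longrightarrow> f x = 0} = 2 ^ card S"
proof -
  have "bij_betw (\<lambda>f. {x. f x = 1}) {f :: 'a \<Rightarrow> bit. \<forall>x. x \<notin> S \<longrightarrow> f x = 0} (Pow S)"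
  proof (rule bij_betwI[where g = "\<lambda>T x. of_bool (x \<in> T)"])
    show "(\<lambda>x. of_bool (x \<in> {x. f x = 1})) = f" for f :: "'a \<Rightarrow> bit"
    proof
      show "of_bool (x \<in> {x. f x = 1}) = f x" for x by (cases "f x") simp_all
    qed
    show "(\<lambda>f. {x. f x = 1}) \<in> {f :: 'a \<Rightarrow> bit. \<forall>x. x \<notin> S \<longrightarrow> f x = 0} \<rightarrow> Pow S"
    proof (rule funcsetI, rule PowI, rule subsetI)
      fix f :: "'a \<Rightarrow> bit" and x assume "f \<in> {f. \<forall>x. x \<notin> S \<longrightarrow> f x = 0}" "x \<in> {x. f x = 1}"
      then show "x \<in> S" by (cases "x \<in> S") auto
    qed
  qed (auto split: if_splits)
  then show ?thesis
    using bij_betw_same_card card_Pow[OF assms] by fastforce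
qed

text \<open>Rank and nullity in multiplicative form: every fibre of an additive map is a translate
  of its kernel.\<close>

lemma card_kernel_image:
  fixes d :: "('a \<Rightarrow> bit) \<Rightarrow> ('b \<Rightarrow> bit)"
  assumes fin: "finite C"
    and C_add: "\<And>f g. f \<in> C \<Longrightarrow> g \<in> C \<Longrightarrow> (\<lambda>x. f x + g x) \<in> C"
    and d_add: "\<And>f g. f \<in> C \<Longrightarrow> g \<in> C \<Longrightarrow> d (\<lambda>x. f x + g x) = (\<lambda>x. d f x + d g x)"
  shows "card C = card {f \<in> C. d f = (\<lambda>_. 0)} * card (d ` C)"
proof -
  have "C = (\<Union>y\<in>d ` C. {f \<in> C. d f = y})" by auto
  then have "card C = card (\<Union>y\<in>d ` C. {f \<in> C. d f = y})" by simp
  also have "\<dots> = (\<Sum>y\<in>d ` C. card {f \<in> C. d f = y})"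
    by (rule card_UN_disjoint) (use fin in auto)
  also have "\<dots> = (\<Sum>y\<in>d ` C. card {f \<in> C. d f = (\<lambda>_. 0)})"
  proof (rule sum.cong[OF refl])
    fix y assume "y \<in> d ` C"
    then obtain g where g: "g \<in> C" "y = d g" by blast
    have "bij_betw (\<lambda>f x. g x + f x) {f \<in> C. d f = y} {f \<in> C. d f = (\<lambda>_. 0)}"
      by (rule bij_betwI[where g = "\<lambda>f x. g x + f x"]) (auto simp: g d_add C_add)
    then show "card {f \<in> C. d f = y} = card {f \<in> C. d f = (\<lambda>_. 0)}"
      by (rule bij_betw_same_card)
  qed
  finally show ?thesis by simp
qed

lemma fls_X_intpow_sum: "finite A \<Longrightarrow> (\<Prod>a\<in>A. fls_X_intpow (f a)) = (fls_X_intpow (\<Sum>a\<in>A. f a) :: int fls)"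
  by (induction A rule: finite_induct) (simp_all add: fls_X_intpow_times_fls_X_intpow)

section \<open>Dimension counts in the complex\<close>

context circle_model
begin

lemma differential_add: "differential P M (\<lambda>x. f x + g x) = (\<lambda>x. differential P M f x + differential P M g x)"
  by (auto simp: differential_def fun_eq_iff distrib_left sum.distrib)

lemma differential_zero: "differential P M (\<lambda>_. 0) = (\<lambda>_. 0)"
  by (auto simp: differential_def fun_eq_iff)

lemma finite_labeled_states: "finite (labeled_states P M i j)"
proof (rule finite_subset)
  show "labeled_states P M i j \<subseteq> (SIGMA A:Pow M. labs A)" by (auto simp: labeled_states_def)
  show "finite (SIGMA A:Pow M. labs A)" using finite_M finite_labs by auto
qed

lemma card_cochains: "card (cochains P M i j) = 2 ^ card (labeled_states P M i j)"
  unfolding cochains_def by (rule card_supported[OF finite_labeled_states])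

lemma finite_cochains: "finite (cochains P M i j)"
  using card_cochains[of i j] by (metis card.infinite power_not_zero zero_neq_numeral)

lemma cochains_add: "f \<in> cochains P M i j \<Longrightarrow> g \<in> cochains P M i j \<Longrightarrow> (\<lambda>x. f x + g x) \<in> cochains P M i j"
  by (auto simp: cochains_def)

lemma cocycles_subset: "cocycles P M i j \<subseteq> cochains P M i j"
  by (auto simp: cocycles_def)

lemma bit_quotient_cohomology: "bit_quotient (cocycles P M i j) (coboundaries P M i j)"
proof
  show "finite (cocycles P M i j)" using cocycles_subset finite_cochains by (rule finite_subset)
  show "coboundaries P M i j \<subseteq> cocycles P M i j" by (rule coboundaries_subset_cocycles)
  show "(\<lambda>x. f x + g x) \<in> cocycles P M i j" if "f \<in> cocycles P M i j" "g \<in> cocycles P M i j" for f g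
    using that by (simp add: cocycles_def cochains_add differential_add)
  show "(\<lambda>x. f x + g x) \<in> coboundaries P M i j" if "f \<in> coboundaries P M i j" "g \<in> coboundaries P M i j" for f g
    using that unfolding coboundaries_def
    by (auto simp flip: differential_add intro!: imageI cochains_add)
  show "(\<lambda>_. 0) \<in> coboundaries P M i j"
    unfolding coboundaries_def using zero_cochain differential_zero by (metis image_eqI)
qed

abbreviation "hdim i j \<equiv> vectorspace.dim class_ring (cohomology P M i j)"
abbreviation "cdim i j \<equiv> card (labeled_states P M i j)"

text \<open>Here \<open>b i\<close> is the dimension of the coboundaries in degree \<open>i\<close>.
  It exists because their number divides the number of cochains one degree below, a power of
  two.\<close>

lemma dimension_formula:
  obtains b where "\<And>i. cdim i j = hdim i j + b i + b (i + 1)"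
proof -
  have eq1: "card (cocycles P M i j) * card (coboundaries P M (i + 1) j) = 2 ^ cdim i j" for i
    using card_kernel_image[of "cochains P M i j" "differential P M"]
    by (simp add: cocycles_def coboundaries_def card_cochains finite_cochains cochains_add differential_add)
  have eq2: "2 ^ hdim i j * card (coboundaries P M i j) = card (cocycles P M i j)" for i
    using bit_quotient.card_quotient[OF bit_quotient_cohomology]
      bit_quotient.card_quotient_dim[OF bit_quotient_cohomology]
    by (simp add: cohomology_def)
  have "\<exists>b. card (coboundaries P M i j) = 2 ^ b" for i
  proof -
    have "card (coboundaries P M (i - 1 + 1) j) dvd 2 ^ cdim (i - 1) j"
      using eq1[of "i - 1"] by (metis dvd_triv_right)
    then show ?thesis using divides_primepow_nat[of 2] by auto
  qed
  then obtain b where b: "\<And>i. card (coboundaries P M i j) = 2 ^ b i" by metis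
  have "2 ^ (hdim i j + b i + b (i + 1)) = (2 ^ cdim i j :: nat)" for i
    using eq1[of i] unfolding eq2[of i, symmetric] b by (simp add: power_add)
  then have "cdim i j = hdim i j + b i + b (i + 1)" for i
    by (metis power_inject_exp one_less_numeral_iff semiring_norm(76))
  then show ?thesis by (rule that)
qed

text \<open>Each \<open>b i\<close> occurs in two neighbouring degrees with opposite signs, so the
  sum telescopes. The outer terms vanish because there are no states in the degrees -1 and
  \<open>card M + 1\<close>.\<close>

lemma alternating_dims:
  "(\<Sum>i\<le>card M. (-1) ^ i * int (cdim (int i) j)) = (\<Sum>i\<le>card M. (-1) ^ i * int (hdim (int i) j))"
proof -
  obtain b where b: "\<And>i. cdim i j = hdim i j + b i + b (i + 1)" using dimension_formula[of j] by blast
  have "labeled_states P M (- 1) j = {}" by (auto simp: labeled_states_def)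
  then have b0: "b 0 = 0" using b[of "-1"] by simp
  have "labeled_states P M (int (card M) + 1) j = {}"
  proof (rule equals0I)
    fix x assume "x \<in> labeled_states P M (int (card M) + 1) j"
    then have "fst x \<subseteq> M" "int (card (fst x)) = int (card M) + 1" by (auto simp: labeled_states_def)
    then show False using card_mono[OF finite_M, of "fst x"] by simp
  qed
  then have bn: "b (int (card M) + 1) = 0" using b[of "int (card M) + 1"] by simp
  have "(\<Sum>i\<le>n. (-1) ^ i * int (cdim (int i) j)) =
      (\<Sum>i\<le>n. (-1) ^ i * int (hdim (int i) j)) + (-1) ^ n * int (b (int n + 1))" for n
  proof (induction n)
    case 0
    then show ?case using b[of 0] b0 by simp
  next
    case (Suc n)
    then show ?case using b[of "int (Suc n)"] by (simp add: algebra_simps)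
  qed
  from this[of "card M"] show ?thesis by (simp add: bn)
qed

text \<open>The power of \<open>fls_X_inv + fls_X\<close> expands over the choices of one summand,
  that is, of one label, for every circle.\<close>

lemma two_factor_poly_states:
  "two_factor_poly P M =
     (\<Sum>(A, s)\<in>(SIGMA A:Pow M. labs A).
        (-1) ^ card A * fls_X_intpow ((\<Sum>c\<in>circs A. label_degree (s c)) + int (card A)))"
proof -
  have "(fls_X_inv + fls_X :: int fls) ^ card (circs A) =
      (\<Sum>s\<in>labs A. fls_X_intpow (\<Sum>c\<in>circs A. label_degree (s c)))" if A: "A \<subseteq> M" for A
  proof -
    have "(fls_X_inv + fls_X :: int fls) = (\<Sum>l\<in>UNIV. fls_X_intpow (label_degree l))"
      by (simp add: UNIV_label fls_X_conv_shift_1 fls_X_inv_conv_shift_1 add.commute)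
    then have "(fls_X_inv + fls_X :: int fls) ^ card (circs A) =
        (\<Prod>c\<in>circs A. \<Sum>l\<in>UNIV. fls_X_intpow (label_degree l))"
      by simp
    also have "\<dots> = (\<Sum>s\<in>labs A. \<Prod>c\<in>circs A. fls_X_intpow (label_degree (s c)))"
      unfolding labelings_def using finite_circles[OF A] by (intro prod_sum_PiE) auto
    finally show ?thesis using finite_circles[OF A] by (simp add: fls_X_intpow_sum)
  qed
  moreover have "(- fls_X) ^ n = (-1) ^ n * (fls_X_intpow (int n) :: int fls)" for n
    unfolding power_minus[of fls_X] using fls_X_intpow_power[of 1 n, where 'a = int]
    by (simp add: fls_X_conv_shift_1)
  ultimately have "two_factor_poly P M = (\<Sum>A\<in>Pow M. \<Sum>s\<in>labs A.
        (-1) ^ card A * fls_X_intpow ((\<Sum>c\<in>circs A. label_degree (s c)) + int (card A)))"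
    unfolding two_factor_poly_def
    by (intro sum.cong refl)
      (simp add: sum_distrib_left mult.assoc fls_X_intpow_times_fls_X_intpow add.commute)
  also have "\<dots> = (\<Sum>(A, s)\<in>(SIGMA A:Pow M. labs A).
        (-1) ^ card A * fls_X_intpow ((\<Sum>c\<in>circs A. label_degree (s c)) + int (card A)))"
    using finite_M finite_labs by (intro sum.Sigma) auto
  finally show ?thesis .
qed

theorem euler_characteristic:
  "two_factor_poly P M = (\<Sum>i\<le>card M. (-1) ^ i * qdim (cohomology P M (int i)))"
proof -
  define S where "S = (SIGMA A:Pow M. labs A)"
  define deg where "deg = (\<lambda>(A, s). (\<Sum>c\<in>circs A. label_degree (s c)) + int (card A))"
  \<comment> \<open>The finitely many second degrees in which labeled states exist; cohomology can
    be nonzero only there.\<close>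
  define J where "J = deg ` S"
  have finS: "finite S" using finite_M finite_labs by (auto simp: S_def)
  then have finJ: "finite J" by (simp add: J_def)
  have states: "labeled_states P M (int i) j = {x \<in> S. (card (fst x), deg x) = (i, j)}" for i j
    by (auto simp: labeled_states_def S_def deg_def)
  have "two_factor_poly P M = (\<Sum>x\<in>S. (-1) ^ card (fst x) * fls_X_intpow (deg x))"
    unfolding two_factor_poly_states S_def by (intro sum.cong) (auto simp: deg_def)
  also have "\<dots> = (\<Sum>y\<in>{..card M} \<times> J. \<Sum>x | x \<in> S \<and> (card (fst x), deg x) = y.
      (-1) ^ card (fst x) * fls_X_intpow (deg x))"
    using finS finJ card_mono[OF finite_M]
    by (intro sum.group[symmetric]) (auto simp: J_def S_def)
  also have "\<dots> = (\<Sum>(i, j)\<in>{..card M} \<times> J. \<Sum>x\<in>labeled_states P M (int i) j. (-1) ^ i * fls_X_intpow j)"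
    by (intro sum.cong refl) (auto simp: states intro!: sum.cong)
  also have "\<dots> = (\<Sum>i\<le>card M. \<Sum>j\<in>J. of_nat (cdim (int i) j) * ((-1) ^ i * fls_X_intpow j))"
    by (simp add: sum.cartesian_product)
  also have "\<dots> = (\<Sum>j\<in>J. \<Sum>i\<le>card M. of_int ((-1) ^ i * int (cdim (int i) j)) * fls_X_intpow j)"
    by (subst sum.swap) (simp add: mult.assoc mult.left_commute)
  also have "\<dots> = (\<Sum>j\<in>J. of_int (\<Sum>i\<le>card M. (-1) ^ i * int (cdim (int i) j)) * fls_X_intpow j)"
    by (simp only: of_int_sum sum_distrib_right)
  also have "\<dots> = (\<Sum>j\<in>J. of_int (\<Sum>i\<le>card M. (-1) ^ i * int (hdim (int i) j)) * fls_X_intpow j)"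
    by (simp only: alternating_dims)
  also have "\<dots> = (\<Sum>j\<in>J. \<Sum>i\<le>card M. of_int ((-1) ^ i * int (hdim (int i) j)) * fls_X_intpow j)"
    by (simp only: of_int_sum sum_distrib_right)
  also have "\<dots> = (\<Sum>i\<le>card M. \<Sum>j\<in>J. (-1) ^ i * (of_nat (hdim (int i) j) * fls_X_intpow j))"
    by (subst sum.swap) (simp add: mult.assoc)
  also have "\<dots> = (\<Sum>i\<le>card M. (-1) ^ i * qdim (cohomology P M (int i)))"
  proof (rule sum.cong[OF refl])
    fix i
    have sub: "{j. hdim (int i) j \<noteq> 0} \<subseteq> J"
    proof (rule subsetI, rule ccontr)
      fix j assume j: "j \<in> {j. hdim (int i) j \<noteq> 0}" "j \<notin> J"
      obtain b where "\<And>i. cdim i j = hdim i j + b i + b (i + 1)" using dimension_formula[of j] by blast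
      then have "hdim (int i) j \<le> cdim (int i) j" by simp
      moreover have "labeled_states P M (int i) j = {}" using j(2) by (auto simp: states J_def)
      ultimately show False using j(1) by simp
    qed
    have "qdim (cohomology P M (int i)) = (\<Sum>j\<in>J. of_nat (hdim (int i) j) * fls_X_intpow j)"
      unfolding qdim_def
    proof (rule sum.mono_neutral_left[OF finJ sub], rule ballI)
      fix j assume "j \<in> J - {j. hdim (int i) j \<noteq> 0}"
      then have "hdim (int i) j = 0" by blast
      then show "of_nat (hdim (int i) j) * fls_X_intpow j = (0 :: int fls)"
        by (simp only: of_nat_0 mult_zero_left)
    qed
    then show "(\<Sum>j\<in>J. (-1) ^ i * (of_nat (hdim (int i) j) * fls_X_intpow j)) =
        (-1) ^ i * qdim (cohomology P M (int i))"
      by (simp add: sum_distrib_left)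
  qed
  finally show ?thesis .
qed

end

section \<open>Circles of the states of a blow-up\<close>

text \<open>The closed sets are the unions of circles. Working with all of them instead of single
  circles makes the description linear.\<close>

definition closed_under :: "'a rel \<Rightarrow> 'a set \<Rightarrow> bool" where
  "closed_under J T \<longleftrightarrow> (\<forall>(x, y)\<in>J. x \<in> T \<longleftrightarrow> y \<in> T)"

lemma closed_underD: "closed_under J T \<Longrightarrow> (x, y) \<in> J \<Longrightarrow> x \<in> T \<longleftrightarrow> y \<in> T"
  by (auto simp: closed_under_def)

lemma closed_under_Un: "closed_under J T \<Longrightarrow> closed_under J T' \<Longrightarrow> closed_under J (T \<union> T')"
  by (fastforce simp: closed_under_def)

lemma closed_under_Int: "closed_under J T \<Longrightarrow> closed_under J T' \<Longrightarrow> closed_under J (T \<inter> T')"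
  by (fastforce simp: closed_under_def)

lemma closed_under_Union: "(\<And>T. T \<in> \<T> \<Longrightarrow> closed_under J T) \<Longrightarrow> closed_under J (\<Union>\<T>)"
  by (fastforce simp: closed_under_def)

locale join_relation =
  fixes X :: "'a set" and J :: "'a rel"
  assumes J_sub: "J \<subseteq> X \<times> X"
begin

definition comps :: "'a set set" where
  "comps = X // (J \<union> J\<inverse>)\<^sup>*"

lemma sym_closure: "(x, y) \<in> (J \<union> J\<inverse>)\<^sup>* \<Longrightarrow> (y, x) \<in> (J \<union> J\<inverse>)\<^sup>*"
  by (rule symD[OF sym_rtrancl]) (auto simp: sym_def)

lemma closed_step:
  assumes "closed_under J T" "(x, y) \<in> (J \<union> J\<inverse>)\<^sup>*" "x \<in> T"
  shows "y \<in> T"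
  using assms(2,3,1) by (induction rule: rtrancl_induct) (auto simp: closed_under_def)

lemma closed_X: "closed_under J X"
  using J_sub by (auto simp: closed_under_def)

lemma comps_closed:
  assumes "c \<in> comps" shows "closed_under J c"
proof -
  obtain x where c: "c = (J \<union> J\<inverse>)\<^sup>* `` {x}" using assms by (auto simp: comps_def quotient_def)
  show ?thesis unfolding closed_under_def c
    by (auto intro: rtrancl_into_rtrancl)
qed

lemma comps_subset: "c \<in> comps \<Longrightarrow> c \<subseteq> X"
  using closed_step[OF closed_X] by (auto simp: comps_def quotient_def)

lemma comps_nonempty: "c \<in> comps \<Longrightarrow> c \<noteq> {}"
  by (auto simp: comps_def quotient_def)

lemma comps_least:
  assumes "c \<in> comps" "x \<in> c" "x \<in> T" "closed_under J T"
  shows "c \<subseteq> T"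
proof
  fix y assume y: "y \<in> c"
  obtain z where c: "c = (J \<union> J\<inverse>)\<^sup>* `` {z}" using assms(1) by (auto simp: comps_def quotient_def)
  have "(x, y) \<in> (J \<union> J\<inverse>)\<^sup>*"
    using assms(2) y sym_closure unfolding c by (auto intro: rtrancl_trans)
  then show "y \<in> T" using closed_step assms by blast
qed

lemma comps_eqI: "c \<in> comps \<Longrightarrow> d \<in> comps \<Longrightarrow> x \<in> c \<Longrightarrow> x \<in> d \<Longrightarrow> c = d"
  by (meson comps_closed comps_least subset_antisym)

lemma comps_cover: "x \<in> X \<Longrightarrow> \<exists>c\<in>comps. x \<in> c"
  by (auto simp: comps_def quotient_def)

lemma closed_eq_Union:
  assumes "T \<subseteq> X" "closed_under J T"
  shows "T = \<Union>{c \<in> comps. c \<subseteq> T}"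
proof (intro equalityI subsetI)
  fix x assume x: "x \<in> T"
  then obtain c where c: "c \<in> comps" "x \<in> c" using assms(1) comps_cover by blast
  then have "c \<subseteq> T" using comps_least[OF c x assms(2)] by simp
  then show "x \<in> \<Union>{c \<in> comps. c \<subseteq> T}" using c by blast
qed blast

end

text \<open>
  Two ways to close up the same system of arcs: \<open>p\<^sub>1, p\<^sub>2, q\<^sub>1, q\<^sub>2\<close> are the ends left open by a
  matching edge. The parity condition says that the arcs join these ends in pairs.
\<close>

locale four_points =
  fixes X :: "'a set" and J0 :: "'a rel" and p1 p2 q1 q2 :: 'a
  assumes J0_sub: "J0 \<subseteq> X \<times> X"
    and points: "p1 \<in> X" "p2 \<in> X" "q1 \<in> X" "q2 \<in> X"
    and parity: "\<And>T. T \<subseteq> X \<Longrightarrow> closed_under J0 T \<Longrightarrow>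
      even (of_bool (p1 \<in> T) + of_bool (p2 \<in> T) + of_bool (q1 \<in> T) + of_bool (q2 \<in> T) :: nat)"
begin

definition "Jb = J0 \<union> {(p1, q2), (p2, q1)}"
definition "Ja = J0 \<union> {(p1, q1), (p2, q2)}"

sublocale before: join_relation X Jb
  by standard (use J0_sub points in \<open>auto simp: Jb_def\<close>)

sublocale after: join_relation X Ja
  by standard (use J0_sub points in \<open>auto simp: Ja_def\<close>)

lemma closed_before: "closed_under Jb T \<longleftrightarrow>
    closed_under J0 T \<and> (p1 \<in> T \<longleftrightarrow> q2 \<in> T) \<and> (p2 \<in> T \<longleftrightarrow> q1 \<in> T)"
  by (auto simp: closed_under_def Jb_def)

lemma closed_after: "closed_under Ja T \<longleftrightarrow>
    closed_under J0 T \<and> (p1 \<in> T \<longleftrightarrow> q1 \<in> T) \<and> (p2 \<in> T \<longleftrightarrow> q2 \<in> T)"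
  by (auto simp: closed_under_def Ja_def)

definition "at_before = {c \<in> before.comps. c \<inter> {p1, p2, q1, q2} \<noteq> {}}"
definition "at_after = {c \<in> after.comps. c \<inter> {p1, p2, q1, q2} \<noteq> {}}"

text \<open>A component away from the four ends is closed for both relations, and a component of the
  other relation inside it is closed for the first; minimality on both sides makes them
  equal.\<close>

lemma before_away:
  assumes "c \<in> before.comps - at_before" shows "c \<in> after.comps - at_after"
proof -
  have c: "c \<in> before.comps" "c \<inter> {p1, p2, q1, q2} = {}" using assms by (auto simp: at_before_def)
  then have ca: "closed_under Ja c"
    using before.comps_closed[OF c(1)] by (auto simp: closed_before closed_after)
  obtain x where x: "x \<in> c" using before.comps_nonempty[OF c(1)] by blast
  then obtain d where d: "d \<in> after.comps" "x \<in> d"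
    using after.comps_cover before.comps_subset[OF c(1)] by blast
  have dc: "d \<subseteq> c" using after.comps_least[OF d x ca] .
  then have "closed_under Jb d"
    using after.comps_closed[OF d(1)] c(2) by (auto simp: closed_before closed_after)
  then have "c \<subseteq> d" using before.comps_least[OF c(1) x d(2)] by blast
  then show ?thesis using dc d c by (auto simp: at_after_def)
qed

text \<open>Exchanging \<open>q1\<close> and \<open>q2\<close> interchanges the two closures, so
  every statement about passing from one to the other also yields its mirror image.\<close>

lemma swap: "four_points X J0 p1 p2 q2 q1"
  by standard (use J0_sub points parity in \<open>auto simp: ac_simps\<close>)

lemma swap_joins: "four_points.Jb J0 p1 p2 q2 q1 = Ja" "four_points.Ja J0 p1 p2 q2 q1 = Jb"
  by (simp_all add: four_points.Jb_def[OF swap] four_points.Ja_def[OF swap] Jb_def Ja_def)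

lemma away_eq: "after.comps - at_after = before.comps - at_before"
proof -
  interpret S: four_points X J0 p1 p2 q2 q1
    rewrites "four_points.Jb J0 p1 p2 q2 q1 = Ja" and "four_points.Ja J0 p1 p2 q2 q1 = Jb"
    by (rule swap swap_joins)+
  have "S.at_before = at_after" "S.at_after = at_before"
    by (auto simp: at_before_def at_after_def S.at_before_def S.at_after_def)
  then show ?thesis using before_away S.before_away by blast
qed

lemma at_before_eq:
  assumes "a \<in> before.comps" "p1 \<in> a" "b \<in> before.comps" "p2 \<in> b"
  shows "at_before = {a, b}" "q2 \<in> a" "q1 \<in> b"
proof -
  show q: "q2 \<in> a" "q1 \<in> b"
    using assms before.comps_closed by (auto simp: closed_before)
  show "at_before = {a, b}"
    using assms q before.comps_eqI by (auto simp: at_before_def)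
qed

text \<open>If two circles remained afterwards, the intersection of \<open>a\<close> with the new
  circle through \<open>p1\<close> would be closed under the arcs and contain exactly one of the
  four ends, against the parity condition.\<close>

lemma merge_aux:
  assumes "a \<in> before.comps" "p1 \<in> a" "b \<in> before.comps" "p2 \<in> b" "a \<noteq> b"
    and "c \<in> after.comps" "p1 \<in> c"
  shows "at_after = {c}" "c = a \<union> b" "a \<inter> b = {}" "p2 \<notin> a" "p1 \<notin> b"
proof -
  interpret S: four_points X J0 p1 p2 q2 q1
    rewrites "four_points.Jb J0 p1 p2 q2 q1 = Ja" and "four_points.Ja J0 p1 p2 q2 q1 = Jb"
    by (rule swap swap_joins)+
  have disj: "a \<inter> b = {}" using assms before.comps_eqI by blast
  then show "a \<inter> b = {}" "p2 \<notin> a" "p1 \<notin> b" using assms by auto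
  note q = at_before_eq(2,3)[OF assms(1-4)]
  obtain d where d: "d \<in> after.comps" "p2 \<in> d" using after.comps_cover points by blast
  have at: "at_after = {c, d}" "q1 \<in> c" "q2 \<in> d"
    using S.at_before_eq[OF assms(6,7) d] by (auto simp: at_after_def S.at_before_def)
  have "c = d"
  proof (rule ccontr)
    assume "c \<noteq> d"
    then have "c \<inter> d = {}" using assms(6) d after.comps_eqI by blast
    then have "of_bool (p1 \<in> a \<inter> c) + of_bool (p2 \<in> a \<inter> c) + of_bool (q1 \<in> a \<inter> c) +
        of_bool (q2 \<in> a \<inter> c) = (1::nat)"
      using disj assms(2,4,7) q at d by (auto simp: disjoint_iff)
    moreover have "closed_under J0 (a \<inter> c)" "a \<inter> c \<subseteq> X"
      using before.comps_closed[OF assms(1)] after.comps_closed[OF assms(6)] before.comps_subset[OF assms(1)]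
      by (auto simp: closed_before closed_after intro: closed_under_Int)
    ultimately show False using parity[of "a \<inter> c"] by simp
  qed
  then show "at_after = {c}" using at by simp
  have "closed_under Ja (a \<union> b)"
    using before.comps_closed[OF assms(1)] before.comps_closed[OF assms(3)] assms q
    by (auto simp: closed_before closed_after intro: closed_under_Un)
  then have "c \<subseteq> a \<union> b" using after.comps_least[OF assms(6,7)] assms(2) by blast
  moreover have "closed_under Jb c"
    using after.comps_closed[OF assms(6)] at d \<open>c = d\<close> assms(7) by (auto simp: closed_before closed_after)
  then have "a \<subseteq> c" "b \<subseteq> c"
    using before.comps_least[OF assms(1,2,7)] before.comps_least[OF assms(3,4)] d \<open>c = d\<close> by blast+
  ultimately show "c = a \<union> b" by blast
qed

text \<open>Each closure has one or two circles through the four ends, and two on one side force a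
  single one on the other. What is left is one circle on both sides.\<close>

lemma cases:
  obtains
    (merge) a b where "a \<in> before.comps" "b \<in> before.comps" "at_before = {a, b}" "at_after = {a \<union> b}"
      "a \<union> b \<in> after.comps" "a \<inter> b = {}" "a \<noteq> b" "p1 \<in> a" "p2 \<notin> a" "p2 \<in> b" "p1 \<notin> b"
  | (split) c d where "c \<in> after.comps" "d \<in> after.comps" "at_after = {c, d}" "at_before = {c \<union> d}"
      "c \<union> d \<in> before.comps" "c \<inter> d = {}" "c \<noteq> d" "p1 \<in> c" "p2 \<notin> c" "p2 \<in> d" "p1 \<notin> d"
  | (single) a c where "a \<in> before.comps" "c \<in> after.comps" "at_before = {a}" "at_after = {c}"
      "p1 \<in> a" "p2 \<in> a" "p1 \<in> c" "p2 \<in> c"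
proof -
  interpret S: four_points X J0 p1 p2 q2 q1
    rewrites "four_points.Jb J0 p1 p2 q2 q1 = Ja" and "four_points.Ja J0 p1 p2 q2 q1 = Jb"
    by (rule swap swap_joins)+
  have S: "S.at_before = at_after" "S.at_after = at_before"
    by (auto simp: at_before_def at_after_def S.at_before_def S.at_after_def)
  obtain a b where a: "a \<in> before.comps" "p1 \<in> a" and b: "b \<in> before.comps" "p2 \<in> b"
    using before.comps_cover points by blast
  obtain c d where c: "c \<in> after.comps" "p1 \<in> c" and d: "d \<in> after.comps" "p2 \<in> d"
    using after.comps_cover points by blast
  have at: "at_before = {a, b}" "at_after = {c, d}"
    using at_before_eq[OF a b] S.at_before_eq[OF c d] S by auto
  consider "a \<noteq> b" | "c \<noteq> d" | "a = b" "c = d" by blast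
  then show ?thesis
  proof cases
    assume "a \<noteq> b"
    note m = merge_aux[OF a b this c]
    show ?thesis by (rule merge[of a b]) (use m a b c at \<open>a \<noteq> b\<close> in auto)
  next
    assume "c \<noteq> d"
    note m = S.merge_aux[OF c d this a]
    show ?thesis by (rule split[of c d]) (use m a c d at \<open>c \<noteq> d\<close> S in auto)
  next
    assume "a = b" "c = d"
    then show ?thesis using single[of a c] a b c d at by auto
  qed
qed

end

section \<open>Rotation systems and the states of their blow-ups\<close>

definition even_edge_sets :: "('v, 'e, 'z) multigraph_scheme \<Rightarrow> 'e set set" where
  "even_edge_sets G =
     {z. z \<subseteq> edges G \<and> (\<forall>v\<in>verts G. even (card {h \<in> half_edges_at G v. fst h \<in> z}))}"

text \<open>The third component lists vertexless circles, which belong to every state. No rotation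
  and no drawing is mentioned.\<close>

definition twisted_cochains ::
  "('v, 'e, 'z) multigraph_scheme \<Rightarrow> ('e + 'e half_edge) set \<Rightarrow> ('e set \<times> 'v set \<times> 'e set) set" where
  "twisted_cochains G A =
     {(z, t, k). z \<in> even_edge_sets G \<and> t \<subseteq> verts G \<and> k \<subseteq> circles G \<and>
        (\<forall>e\<in>edges G. (endpoint G (e, False) \<in> t) \<noteq> (endpoint G (e, True) \<in> t) \<longleftrightarrow> e \<in> z \<and> Inl e \<in> A)}"

text \<open>The triple becomes one vector with coordinates for edges, vertices and vertexless
  circles. The two images under \<open>Inl\<close> do not collide, since a finite multigraph keeps
  edges and circles disjoint.\<close>

definition model_space ::
  "('v, 'e, 'z) multigraph_scheme \<Rightarrow> ('e + 'e half_edge) set \<Rightarrow> ('e + 'v) ext set" where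
  "model_space G A = (\<lambda>(z, t, k). vec_of (Inl ` z \<union> Inr ` t \<union> Inl ` k)) ` twisted_cochains G A"

definition model_index :: "'e + 'e half_edge \<Rightarrow> 'e + 'v" where
  "model_index m = Inl (projl m)"

text \<open>A trivalent graph with a cyclic order at each vertex, as on an arbitrary oriented
  surface. The genus is not restricted here; planarity is added later through face sets.\<close>

locale rot_sys =
  fixes P :: "('v, 'e) rot_graph"
  assumes fin: "finite_multigraph P"
    and ccw3: "h \<in> half_edges P \<Longrightarrow> ccw P (ccw P (ccw P h)) = h"
    and ccw_neq: "h \<in> half_edges P \<Longrightarrow> ccw P h \<noteq> h"
    and at: "h \<in> half_edges P \<Longrightarrow> half_edges_at P (endpoint P h) = {h, ccw P h, ccw P (ccw P h)}"
    and verts_half: "v \<in> verts P \<Longrightarrow> half_edges_at P v \<noteq> {}"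
begin

abbreviation "\<rho> \<equiv> ccw P"
abbreviation "H \<equiv> half_edges P"
abbreviation "E \<equiv> edges P"

lemma ccw_in: "h \<in> H \<Longrightarrow> \<rho> h \<in> H" and endpoint_ccw: "h \<in> H \<Longrightarrow> endpoint P (\<rho> h) = endpoint P h"
  using at[of h] by (auto simp: half_edges_at_def)

lemma endpoint_in: "h \<in> H \<Longrightarrow> endpoint P h \<in> verts P"
  using fin by (auto simp: finite_multigraph_def)

lemma finite_H: "finite H"
  using fin by (auto simp: finite_multigraph_def half_edges_def)

lemma mem_H [simp]: "(e, b) \<in> H \<longleftrightarrow> e \<in> E"
  by (simp add: half_edges_def)

lemma ccw2_bij: "bij_betw (\<lambda>h. \<rho> (\<rho> h)) H H"
  by (rule bij_betwI[where g = \<rho>]) (auto simp: ccw_in ccw3)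

abbreviation "B \<equiv> blowup P"
abbreviation M :: "('e + 'e half_edge) set" where "M \<equiv> Inl ` E"

lemma blowup_ends [simp]:
  "end_x1 B (Inl e) = (Inr (e, False), False)"
  "end_x2 B (Inl e) = (Inr (\<rho> (\<rho> (e, False))), True)"
  "end_y1 B (Inl e) = (Inr (e, True), False)"
  "end_y2 B (Inl e) = (Inr (\<rho> (\<rho> (e, True))), True)"
  by (simp_all add: end_x1_def end_x2_def end_y1_def end_y2_def blowup_def)

lemma state_edges_blowup: "state_edges B M = Inr ` H \<union> Inl ` circles P"
  by (auto simp: state_edges_def blowup_def)

abbreviation "X \<equiv> state_edges B M \<times> (UNIV :: bool set)"

definition arcs :: "('e + 'e half_edge) half_edge rel" where
  "arcs = {((e, False), (e, True)) | e. e \<in> state_edges B M}"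

lemma state_joins_eq: "state_joins B M A = arcs \<union> (\<Union>m\<in>M. smoothing B A m)"
  by (simp add: state_joins_def arcs_def)

lemma ends_in_X:
  assumes "e \<in> E"
  shows "(Inr (e, b), b') \<in> X" "(Inr (\<rho> (\<rho> (e, b))), b') \<in> X"
  using assms by (auto simp: state_edges_blowup ccw_in)

lemma arcs_sub: "arcs \<subseteq> X \<times> X"
  by (auto simp: arcs_def)

lemma smoothing_sub: "m \<in> M \<Longrightarrow> smoothing B A m \<subseteq> X \<times> X"
  using ends_in_X by (auto simp: smoothing_def)

lemma finite_X: "finite X"
  using finite_H fin by (auto simp: state_edges_blowup finite_multigraph_def)

lemma join_relation: "join_relation X (state_joins B M A)"
  by standard (use arcs_sub smoothing_sub in \<open>fastforce simp: state_joins_eq\<close>)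

lemma state_circles_eq: "state_circles B M A = join_relation.comps X (state_joins B M A)"
  unfolding join_relation.comps_def[OF join_relation] state_circles_def ..

lemma finite_state_circles: "finite (state_circles B M A)"
  using join_relation.comps_subset[OF join_relation] finite_X
  by (auto simp: state_circles_eq intro!: finite_subset[of _ "Pow X"])

text \<open>Summing over all matching edges counts both ends of every arc around a vertex, and a
  closed set contains both or none of them, so the total is even. Every edge other than
  \<open>e\<close> contributes an even number because of its smoothing.\<close>

lemma parity:
  assumes m: "e \<in> E" and T: "T \<subseteq> X" and cl: "closed_under (arcs \<union> (\<Union>m'\<in>M - {Inl e}. smoothing B A m')) T"
  shows "even (of_bool ((Inr (e, False), False) \<in> T) + of_bool ((Inr (\<rho> (\<rho> (e, False))), True) \<in> T) +
    of_bool ((Inr (e, True), False) \<in> T) + of_bool ((Inr (\<rho> (\<rho> (e, True))), True) \<in> T) :: nat)"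
proof -
  define n where "n f = of_bool ((Inr (f, False), False) \<in> T) + of_bool ((Inr (\<rho> (\<rho> (f, False))), True) \<in> T) +
    of_bool ((Inr (f, True), False) \<in> T) + (of_bool ((Inr (\<rho> (\<rho> (f, True))), True) \<in> T) :: nat)" for f
  have finE: "finite E" using fin by (simp add: finite_multigraph_def)
  have "even (n f)" if "f \<in> E - {e}" for f
  proof -
    have "Inl f \<in> M - {Inl e}" using that by auto
    then have "closed_under (smoothing B A (Inl f)) T" using cl by (auto simp: closed_under_def)
    then show ?thesis
      by (auto simp: closed_under_def smoothing_def n_def split: if_splits)
  qed
  then have "even (\<Sum>f\<in>E - {e}. n f)" by (rule dvd_sum)
  moreover have "even (\<Sum>f\<in>E. n f)"
  proof -
    have "(\<Sum>f\<in>E. n f) =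
        (\<Sum>h\<in>H. of_bool ((Inr h, False) \<in> T) + of_bool ((Inr (\<rho> (\<rho> h)), True) \<in> T))"
      unfolding half_edges_def n_def sum.cartesian_product' UNIV_bool
      by (intro sum.cong refl) simp
    also have "\<dots> = (\<Sum>h\<in>H. of_bool ((Inr h, False) \<in> T)) + (\<Sum>h\<in>H. of_bool ((Inr h, True) \<in> T))"
      using sum.reindex_bij_betw[OF ccw2_bij, of "\<lambda>h. of_bool ((Inr h, True) \<in> T)"]
      by (simp add: sum.distrib)
    also have "(\<Sum>h\<in>H. of_bool ((Inr h, True) \<in> T)) = (\<Sum>h\<in>H. of_bool ((Inr h, False) \<in> T) :: nat)"
    proof (rule sum.cong[OF refl])
      fix h assume "h \<in> H"
      then have "((Inr h, False), (Inr h, True)) \<in> arcs" by (auto simp: arcs_def state_edges_blowup)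
      then show "of_bool ((Inr h, True) \<in> T) = (of_bool ((Inr h, False) \<in> T) :: nat)"
        using closed_underD[OF cl, of "(Inr h, False)" "(Inr h, True)"] by simp
    qed
    finally show ?thesis by simp
  qed
  ultimately have "even (n e)"
    using sum.remove[OF finE m, of n] by simp
  then show ?thesis by (simp add: n_def)
qed

end

text \<open>
  A linear relation over \<open>\<int>\<^sub>2\<close> contains a linear function on its domain; \<open>\<sigma>\<close> gives the images of
  unit vectors, even if these are not in the domain.
\<close>

lemma linear_section:
  fixes R :: "'e set \<Rightarrow> 'h set \<Rightarrow> bool"
  assumes "finite E" and "finite H" and R_sub: "\<And>z S. R z S \<Longrightarrow> S \<subseteq> H"
    and "R {} {}"
    and R_add: "\<And>z S z' S'. R z S \<Longrightarrow> R z' S' \<Longrightarrow> R (sym_diff z z') (sym_diff S S')"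
  shows "\<exists>\<sigma>. (\<forall>e. \<sigma> e \<subseteq> H) \<and>
    (\<forall>z\<subseteq>E. (\<exists>S. R z S) \<longrightarrow> R z {h \<in> H. odd (card {e \<in> z. h \<in> \<sigma> e})})"
  using assms(1)
proof (induction E rule: finite_induct)
  case empty
  have "{h \<in> H. odd (card {e \<in> {}. h \<in> \<sigma> e})} = {}" for \<sigma> :: "'e \<Rightarrow> 'h set" by simp
  then show ?case using assms(4) by (intro exI[of _ "\<lambda>_. {}"]) simp
next
  case (insert e E)
  then obtain \<sigma> where \<sigma>: "\<forall>e. \<sigma> e \<subseteq> H"
    "\<And>z. z \<subseteq> E \<Longrightarrow> (\<exists>S. R z S) \<Longrightarrow> R z {h \<in> H. odd (card {e \<in> z. h \<in> \<sigma> e})}"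
    by blast
  have cong: "{e' \<in> z. h \<in> (\<sigma>(e := T)) e'} = {e' \<in> z. h \<in> \<sigma> e'}" if "z \<subseteq> E" for z h T
    using that insert.hyps by auto
  show ?case
  proof (cases "\<exists>z0 S0. z0 \<subseteq> insert e E \<and> e \<in> z0 \<and> R z0 S0")
    case False
    then have "z \<subseteq> E" if "z \<subseteq> insert e E" "\<exists>S. R z S" for z
      using that by blast
    then show ?thesis using \<sigma> by (intro exI[of _ \<sigma>]) blast
  next
    case True
    then obtain z0 S0 where z0: "z0 \<subseteq> insert e E" "e \<in> z0" "R z0 S0" by blast
    define lin where "lin z = {h \<in> H. odd (card {e \<in> z. h \<in> \<sigma> e})}" for z
    \<comment> \<open>The value at the new unit vector is forced: the linear extension has to send
      \<open>z0\<close> to \<open>S0\<close>.\<close>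
    define T where "T = sym_diff S0 (lin (z0 - {e}))"
    have TH: "T \<subseteq> H" using R_sub[OF z0(3)] by (auto simp: T_def lin_def)
    let ?\<sigma> = "\<sigma>(e := T)"
    have lin: "{h \<in> H. odd (card {e' \<in> z. h \<in> ?\<sigma> e'})} =
        (if e \<in> z then sym_diff T (lin (z - {e})) else lin z)" if "z \<subseteq> insert e E" for z
    proof (cases "e \<in> z")
      case True
      have "odd (card {e' \<in> z. h \<in> ?\<sigma> e'}) \<longleftrightarrow> (h \<in> T) \<noteq> odd (card {e' \<in> z - {e}. h \<in> \<sigma> e'})" for h
      proof -
        have "{e' \<in> z. h \<in> ?\<sigma> e'} =
            (if h \<in> T then insert e {e' \<in> z - {e}. h \<in> \<sigma> e'} else {e' \<in> z - {e}. h \<in> \<sigma> e'})"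
          using True by auto
        moreover have "finite {e' \<in> z - {e}. h \<in> \<sigma> e'}"
          using that insert.hyps(1) finite_subset by fastforce
        ultimately show ?thesis by simp
      qed
      then show ?thesis using True TH by (auto simp: lin_def)
    next
      case False
      then have "z \<subseteq> E" using that by auto
      then show ?thesis using False cong by (simp add: lin_def)
    qed
    have "R z {h \<in> H. odd (card {e' \<in> z. h \<in> ?\<sigma> e'})}" if z: "z \<subseteq> insert e E" "\<exists>S. R z S" for z
    proof (cases "e \<in> z")
      case False
      then show ?thesis using lin[OF z(1)] \<sigma>(2)[of z] z by (auto simp: lin_def)
    next
      case True
      obtain S where S: "R z S" using z by blast
      have add: "lin (sym_diff y y') = sym_diff (lin y) (lin y')" if "y \<subseteq> E" "y' \<subseteq> E" for y y'
      proof -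
        have "odd (card {e \<in> sym_diff y y'. h \<in> \<sigma> e}) \<longleftrightarrow>
            odd (card {e \<in> y. h \<in> \<sigma> e}) \<noteq> odd (card {e \<in> y'. h \<in> \<sigma> e})" for h
        proof -
          let ?a = "{e \<in> y. h \<in> \<sigma> e}" and ?b = "{e \<in> y'. h \<in> \<sigma> e}"
          have fin: "finite ?a" "finite ?b"
            using that insert.hyps(1) by (auto intro: finite_subset)
          have "{e \<in> sym_diff y y'. h \<in> \<sigma> e} = (?a - ?b) \<union> (?b - ?a)" by auto
          moreover have "card ((?a - ?b) \<union> (?b - ?a)) = card (?a - ?b) + card (?b - ?a)"
            using fin by (intro card_Un_disjoint) auto
          moreover have "card ?a = card (?a - ?b) + card (?a \<inter> ?b)"
            "card ?b = card (?b - ?a) + card (?a \<inter> ?b)"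
            using fin by (subst card_Un_disjoint[symmetric]; auto intro!: arg_cong[of _ _ card])+
          ultimately show ?thesis by presburger
        qed
        then show ?thesis by (auto simp: lin_def)
      qed
      have sub: "z - {e} \<subseteq> E" "z0 - {e} \<subseteq> E" using z z0 by auto
      \<comment> \<open>Adding \<open>z0\<close> removes \<open>e\<close>, so the section for the
        smaller set applies; adding the pair of \<open>z0\<close> and \<open>S0\<close> back gives
        the claim for \<open>z\<close>.\<close>
      have diff: "sym_diff z z0 = sym_diff (z - {e}) (z0 - {e})" "sym_diff z z0 \<subseteq> E"
        using True z0 z by auto
      have "R (sym_diff z z0) (lin (sym_diff z z0))"
        unfolding lin_def using diff(2) R_add[OF S z0(3)] by (intro \<sigma>(2)) blast+
      then have "R (sym_diff (sym_diff z z0) z0) (sym_diff (lin (sym_diff z z0)) S0)"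
        using z0(3) by (rule R_add)
      moreover have "sym_diff (sym_diff z z0) z0 = z" by auto
      moreover have "sym_diff (lin (sym_diff z z0)) S0 = sym_diff T (lin (z - {e}))"
        unfolding diff(1) add[OF sub] T_def by auto
      ultimately show ?thesis using lin[OF z(1)] True by simp
    qed
    moreover have "\<forall>e. ?\<sigma> e \<subseteq> H" using \<sigma>(1) TH by simp
    ultimately show ?thesis by (intro exI[of _ ?\<sigma>]) blast
  qed
qed

text \<open>
  The half-edge \<open>h\<close> stands for the corner between \<open>h\<close> and \<open>ccw P h\<close>. It lies to the left of the edge
  when one leaves the vertex along \<open>h\<close>; the corner to the right of \<open>h\<close> is \<open>ccw P (ccw P h)\<close>. A set of
  faces is a set of corners that contains both or none of the two corners on each side of an edge.
\<close>

definition (in rot_sys) face_set :: "'e set \<Rightarrow> 'e half_edge set \<Rightarrow> bool" where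
  "face_set z S \<longleftrightarrow> S \<subseteq> H \<and> (\<forall>e\<in>E.
     ((e, False) \<in> S \<longleftrightarrow> \<rho> (\<rho> (e, True)) \<in> S) \<and>
     ((e, True) \<in> S \<longleftrightarrow> \<rho> (\<rho> (e, False)) \<in> S) \<and>
     (((e, False) \<in> S) \<noteq> (\<rho> (\<rho> (e, False)) \<in> S) \<longleftrightarrow> e \<in> z))"

section \<open>Coordinates of unions of circles in the planar case\<close>

locale planar_rot_sys = rot_sys +
  fixes \<sigma> :: "'b \<Rightarrow> 'b half_edge set"
  assumes face_section: "z \<in> even_edge_sets P \<Longrightarrow> face_set z {h \<in> H. odd (card {e \<in> z. h \<in> \<sigma> e})}"
begin

text \<open>For even \<open>z\<close>, the chosen set of faces with boundary \<open>z\<close>. Its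
  additivity makes \<open>shift\<close> and finally \<open>circle_vec\<close> additive.\<close>

definition faces :: "'b set \<Rightarrow> 'b half_edge set" where
  "faces z = {h \<in> H. odd (card {e \<in> z. h \<in> \<sigma> e})}"

text \<open>The arc \<open>Inr h\<close> of the circle around a vertex sits in the corner between
  \<open>h\<close> and its successor; it is tested at its first half-edge.\<close>

definition corner :: "('b + 'b half_edge) half_edge set \<Rightarrow> 'b half_edge \<Rightarrow> bool" where
  "corner T h \<longleftrightarrow> (Inr h, False) \<in> T"

text \<open>The jump is measured at the end \<open>False\<close>, left corner against right corner.
  For the right corner the final half-edge of its arc is tested, because that is the end
  \<open>end_x2\<close> at the smoothing.\<close>

definition bd :: "('b + 'b half_edge) half_edge set \<Rightarrow> 'b set" where
  "bd T = {e \<in> E. corner T (e, False) \<noteq> ((Inr (\<rho> (\<rho> (e, False))), True) \<in> T)}"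

definition base_half :: "'a \<Rightarrow> 'b half_edge" where
  "base_half v = (SOME h. h \<in> half_edges_at P v)"

definition shift :: "('b + 'b half_edge) half_edge set \<Rightarrow> 'a set" where
  "shift T = {v \<in> verts P. corner T (base_half v) \<noteq> (base_half v \<in> faces (bd T))}"

definition loops :: "('b + 'b half_edge) half_edge set \<Rightarrow> 'b set" where
  "loops T = {c \<in> circles P. (Inl c, False) \<in> T}"

definition support :: "('b + 'b half_edge) half_edge set \<Rightarrow> ('b + 'a) set" where
  "support T = Inl ` bd T \<union> Inr ` shift T \<union> Inl ` loops T"

definition circle_vec :: "('b + 'b half_edge) half_edge set \<Rightarrow> ('b + 'a) ext" where
  "circle_vec T = vec_of (support T)"

lemma finite_E: "finite E" and finite_V: "finite (verts P)" and finite_circ: "finite (circles P)"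
  and edges_circles: "E \<inter> circles P = {}"
  using fin by (auto simp: finite_multigraph_def)

lemma base_half: "v \<in> verts P \<Longrightarrow> base_half v \<in> half_edges_at P v"
  using verts_half[of v] unfolding base_half_def by (meson ex_in_conv someI_ex)

lemma finite_support: "finite (support T)"
  using finite_E finite_V finite_circ by (auto simp: support_def bd_def shift_def loops_def)

lemma faces_symdiff:
  assumes "z \<subseteq> E" "z' \<subseteq> E"
  shows "faces (sym_diff z z') = sym_diff (faces z) (faces z')"
proof -
  have "odd (card {e \<in> sym_diff z z'. h \<in> \<sigma> e}) \<longleftrightarrow>
      odd (card {e \<in> z. h \<in> \<sigma> e}) \<noteq> odd (card {e \<in> z'. h \<in> \<sigma> e})" for h
  proof -
    let ?a = "{e \<in> z. h \<in> \<sigma> e}" and ?b = "{e \<in> z'. h \<in> \<sigma> e}"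
    have fin: "finite ?a" "finite ?b"
      using assms finite_E by (auto intro: finite_subset)
    have "{e \<in> sym_diff z z'. h \<in> \<sigma> e} = (?a - ?b) \<union> (?b - ?a)" by auto
    moreover have "card ((?a - ?b) \<union> (?b - ?a)) = card (?a - ?b) + card (?b - ?a)"
      using fin by (intro card_Un_disjoint) auto
    moreover have "card ?a = card (?a - ?b) + card (?a \<inter> ?b)"
      "card ?b = card (?b - ?a) + card (?a \<inter> ?b)"
      using fin by (subst card_Un_disjoint[symmetric]; auto intro!: arg_cong[of _ _ card])+
    ultimately show ?thesis by presburger
  qed
  then show ?thesis by (auto simp: faces_def)
qed

lemma bd_Un: "T \<inter> T' = {} \<Longrightarrow> bd (T \<union> T') = sym_diff (bd T) (bd T')"
  by (auto simp: bd_def corner_def)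

lemma bd_sub: "bd T \<subseteq> E"
  by (auto simp: bd_def)

text \<open>Jumps, the chosen faces and hence the shift all depend additively on the corner values,
  and a disjoint union adds these modulo two.\<close>

lemma circle_vec_Un:
  assumes "T \<inter> T' = {}"
  shows "circle_vec (T \<union> T') = circle_vec T + circle_vec T'"
proof -
  have "shift (T \<union> T') = sym_diff (shift T) (shift T')"
    using assms unfolding shift_def bd_Un[OF assms] faces_symdiff[OF bd_sub bd_sub]
    by (auto simp: corner_def)
  moreover have "loops (T \<union> T') = sym_diff (loops T) (loops T')"
    using assms by (auto simp: loops_def)
  moreover have "sym_diff (Inl ` z \<union> Inr ` t \<union> Inl ` k) (Inl ` z' \<union> Inr ` t' \<union> Inl ` k') =
      Inl ` sym_diff z z' \<union> Inr ` sym_diff t t' \<union> Inl ` sym_diff k k'"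
    if "z \<union> z' \<subseteq> E" "k \<union> k' \<subseteq> circles P" for z z' k k' :: "'b set" and t t' :: "'a set"
  proof -
    have disj: "z \<inter> k = {}" "z \<inter> k' = {}" "z' \<inter> k = {}" "z' \<inter> k' = {}"
      using that edges_circles by auto
    show ?thesis
    proof (rule Set.set_eqI)
      fix x :: "'b + 'a"
      show "x \<in> sym_diff (Inl ` z \<union> Inr ` t \<union> Inl ` k) (Inl ` z' \<union> Inr ` t' \<union> Inl ` k') \<longleftrightarrow>
          x \<in> Inl ` sym_diff z z' \<union> Inr ` sym_diff t t' \<union> Inl ` sym_diff k k'"
        using disj by (cases x) auto
    qed
  qed
  ultimately have "support (T \<union> T') = sym_diff (support T) (support T')"
    unfolding support_def bd_Un[OF assms] using bd_sub by (auto simp: loops_def)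
  then show ?thesis
    unfolding circle_vec_def by (simp add: vec_of_symdiff finite_support)
qed

lemma circle_vec_empty: "circle_vec {} = 0"
proof -
  have "bd {} = {}" by (simp add: bd_def corner_def)
  moreover have "faces {} = {}" by (simp add: faces_def)
  ultimately have "support {} = {}" by (simp add: support_def shift_def loops_def corner_def)
  then show ?thesis by (simp add: circle_vec_def)
qed

lemma circle_vec_Union:
  assumes "finite S" "disjoint S"
  shows "circle_vec (\<Union>S) = sum circle_vec S"
  using assms
proof (induction S rule: finite_induct)
  case (insert c S)
  have "c \<inter> \<Union>S = {}" using insert.prems insert.hyps by (auto simp: pairwise_def disjnt_def)
  then show ?case using insert by (simp add: circle_vec_Un pairwise_insert)
qed (simp add: circle_vec_empty)

text \<open>A 0-smoothing connects corners on the same side of the edge, a 1-smoothing connects the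
  left corner at one end with the right corner at the other, sides being taken along the
  edge.\<close>

lemma closed_state:
  assumes "closed_under (state_joins B M A) T"
  shows "h \<in> H \<Longrightarrow> (Inr h, True) \<in> T \<longleftrightarrow> corner T h"
    and "c \<in> circles P \<Longrightarrow> (Inl c, True) \<in> T \<longleftrightarrow> (Inl c, False) \<in> T"
    and "e \<in> E \<Longrightarrow> Inl e \<notin> A \<Longrightarrow>
      (corner T (e, False) \<longleftrightarrow> corner T (\<rho> (\<rho> (e, True)))) \<and>
      (corner T (e, True) \<longleftrightarrow> corner T (\<rho> (\<rho> (e, False))))"
    and "e \<in> E \<Longrightarrow> Inl e \<in> A \<Longrightarrow>
      (corner T (e, False) \<longleftrightarrow> corner T (e, True)) \<and>
      (corner T (\<rho> (\<rho> (e, False))) \<longleftrightarrow> corner T (\<rho> (\<rho> (e, True))))"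
proof -
  note cl = closed_underD[OF assms]
  show 1: "(Inr h, True) \<in> T \<longleftrightarrow> corner T h" if "h \<in> H" for h
    using cl[of "(Inr h, False)" "(Inr h, True)"] that
    by (auto simp: state_joins_eq arcs_def state_edges_blowup corner_def)
  show "c \<in> circles P \<Longrightarrow> (Inl c, True) \<in> T \<longleftrightarrow> (Inl c, False) \<in> T"
    using cl[of "(Inl c, False)" "(Inl c, True)"]
    by (auto simp: state_joins_eq arcs_def state_edges_blowup)
  have sm: "x \<in> T \<longleftrightarrow> y \<in> T" if "e \<in> E" "(x, y) \<in> smoothing B A (Inl e)" for x y e
    using that by (intro cl) (auto simp: state_joins_eq)
  have r: "\<rho> (\<rho> (e, b)) \<in> H" if "e \<in> E" for e b using that by (simp add: ccw_in)
  show "(corner T (e, False) \<longleftrightarrow> corner T (\<rho> (\<rho> (e, True)))) \<and>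
      (corner T (e, True) \<longleftrightarrow> corner T (\<rho> (\<rho> (e, False))))" if "e \<in> E" "Inl e \<notin> A"
    using sm[OF that(1), of "(Inr (e, False), False)" "(Inr (\<rho> (\<rho> (e, True))), True)"]
      sm[OF that(1), of "(Inr (\<rho> (\<rho> (e, False))), True)" "(Inr (e, True), False)"]
      1[OF r[OF that(1)]] that(2) by (auto simp: smoothing_def corner_def)
  show "(corner T (e, False) \<longleftrightarrow> corner T (e, True)) \<and>
      (corner T (\<rho> (\<rho> (e, False))) \<longleftrightarrow> corner T (\<rho> (\<rho> (e, True))))" if "e \<in> E" "Inl e \<in> A"
    using sm[OF that(1), of "(Inr (e, False), False)" "(Inr (e, True), False)"]
      sm[OF that(1), of "(Inr (\<rho> (\<rho> (e, False))), True)" "(Inr (\<rho> (\<rho> (e, True))), True)"]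
      1[OF r[OF that(1)]] that(2) by (auto simp: smoothing_def corner_def)
qed

text \<open>Both smoothings carry the jump at one end of the edge unchanged to the other
  end.\<close>

lemma mem_bd_iff:
  assumes "closed_under (state_joins B M A) T" "(e, b) \<in> H"
  shows "e \<in> bd T \<longleftrightarrow> corner T (e, b) \<noteq> corner T (\<rho> (\<rho> (e, b)))"
proof -
  have e: "e \<in> E" using assms by simp
  have "e \<in> bd T \<longleftrightarrow> corner T (e, False) \<noteq> corner T (\<rho> (\<rho> (e, False)))"
    using e closed_state(1)[OF assms(1), of "\<rho> (\<rho> (e, False))"] by (simp add: bd_def ccw_in)
  then show ?thesis
    using closed_state(3,4)[OF assms(1) e] by (cases b; cases "Inl e \<in> A") auto
qed

lemma face_setD:
  assumes "face_set z S" "e \<in> E"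
  shows "(e, False) \<in> S \<longleftrightarrow> \<rho> (\<rho> (e, True)) \<in> S"
    and "(e, True) \<in> S \<longleftrightarrow> \<rho> (\<rho> (e, False)) \<in> S"
    and "((e, False) \<in> S) \<noteq> (\<rho> (\<rho> (e, False)) \<in> S) \<longleftrightarrow> e \<in> z"
  using bspec[OF conjunct2[OF assms(1)[unfolded face_set_def]] assms(2)] by blast+

lemma face_set_iff:
  assumes "face_set z S" "(e, b) \<in> H"
  shows "e \<in> z \<longleftrightarrow> ((e, b) \<in> S) \<noteq> (\<rho> (\<rho> (e, b)) \<in> S)"
  using face_setD[OF assms(1), of e] assms(2) by (cases b) auto

lemma at_three:
  assumes "h \<in> H"
  shows "\<rho> h \<noteq> h" "\<rho> (\<rho> h) \<noteq> h" "\<rho> (\<rho> h) \<noteq> \<rho> h"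
proof -
  show "\<rho> h \<noteq> h" "\<rho> (\<rho> h) \<noteq> \<rho> h"
    using ccw_neq[OF assms] ccw_neq[OF ccw_in[OF assms]] by simp_all
  then show "\<rho> (\<rho> h) \<noteq> h" using ccw3[OF assms] by auto
qed

text \<open>The jumps around a vertex are differences of consecutive corner values, so they sum to
  zero modulo two.\<close>

lemma even_at:
  fixes f :: "'b half_edge \<Rightarrow> bool"
  assumes h: "h \<in> H" and f: "\<And>g. g \<in> {h, \<rho> h, \<rho> (\<rho> h)} \<Longrightarrow> fst g \<in> z \<longleftrightarrow> f g \<noteq> f (\<rho> (\<rho> g))"
  shows "even (card {g \<in> half_edges_at P (endpoint P h). fst g \<in> z})"
proof -
  have c: "card {g \<in> {a, b, c}. p g} = of_bool (p a) + of_bool (p b) + of_bool (p c)"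
    if "a \<noteq> b" "a \<noteq> c" "b \<noteq> c" for a b c :: "'b half_edge" and p
  proof -
    have "{g \<in> {a, b, c}. p g} = (if p a then {a} else {}) \<union> (if p b then {b} else {}) \<union> (if p c then {c} else {})"
      by auto
    then show ?thesis using that by simp
  qed
  have r: "\<rho> (\<rho> (\<rho> h)) = h" "\<rho> (\<rho> (\<rho> (\<rho> h))) = \<rho> h" using ccw3[OF h] by simp_all
  show ?thesis
    unfolding at[OF h] using at_three[OF h] f[of h] f[of "\<rho> h"] f[of "\<rho> (\<rho> h)"]
    by (subst c) (auto simp: r)
qed

lemma vertex_half:
  assumes "v \<in> verts P" obtains h where "h \<in> H" "endpoint P h = v"
  using verts_half[OF assms] by (auto simp: half_edges_at_def)

lemma bd_even:
  assumes "closed_under (state_joins B M A) T"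
  shows "bd T \<in> even_edge_sets P"
  unfolding even_edge_sets_def
proof (intro CollectI conjI ballI)
  fix v assume "v \<in> verts P"
  then obtain h where h: "h \<in> H" "endpoint P h = v" by (rule vertex_half)
  have "fst g \<in> bd T \<longleftrightarrow> corner T g \<noteq> corner T (\<rho> (\<rho> g))" if "g \<in> {h, \<rho> h, \<rho> (\<rho> h)}" for g
    using mem_bd_iff[OF assms, of "fst g" "snd g"] that h(1) by (auto simp: ccw_in)
  then show "even (card {g \<in> half_edges_at P v. fst g \<in> bd T})"
    using even_at[OF h(1), of "bd T" "corner T"] h(2) by simp
qed (rule bd_sub)

text \<open>The union of circles and the chosen faces have the same jump at each half-edge, so their
  difference does not change on turning around the vertex. In particular the choice of
  \<open>base_half\<close> is immaterial.\<close>

lemma shift_iff: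
  assumes cl: "closed_under (state_joins B M A) T" and h: "h \<in> H"
  shows "endpoint P h \<in> shift T \<longleftrightarrow> corner T h \<noteq> (h \<in> faces (bd T))"
proof -
  have fs: "face_set (bd T) (faces (bd T))"
    unfolding faces_def by (rule face_section[OF bd_even[OF cl]])
  define c where "c g \<longleftrightarrow> corner T g \<noteq> (g \<in> faces (bd T))" for g
  have step: "c g \<longleftrightarrow> c (\<rho> (\<rho> g))" if "g \<in> H" for g
    using mem_bd_iff[OF cl, of "fst g" "snd g"] face_set_iff[OF fs, of "fst g" "snd g"] that
    by (auto simp: c_def)
  have "c h \<longleftrightarrow> c (\<rho> (\<rho> h))" "c (\<rho> (\<rho> h)) \<longleftrightarrow> c (\<rho> h)"
    using step[OF h] step[OF ccw_in[OF ccw_in[OF h]]] ccw3[OF h] by simp_all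
  then have "c g \<longleftrightarrow> c h" if "g \<in> half_edges_at P (endpoint P h)" for g
    using that at[OF h] by auto
  then have "c (base_half (endpoint P h)) \<longleftrightarrow> c h"
    using base_half endpoint_in[OF h] by blast
  then show ?thesis
    using endpoint_in[OF h] by (simp add: shift_def c_def)
qed

text \<open>Compare the corners on one side of \<open>e\<close> at its two ends. The chosen faces
  agree there; the given union agrees for a 0-smoothing and differs by the jump across
  \<open>e\<close> for a 1-smoothing.\<close>

lemma support_in_model:
  assumes cl: "closed_under (state_joins B M A) T"
  shows "(bd T, shift T, loops T) \<in> twisted_cochains P A"
  unfolding twisted_cochains_def
proof (intro CollectI case_prodI conjI ballI)
  show "bd T \<in> even_edge_sets P" by (rule bd_even[OF cl])
  show "shift T \<subseteq> verts P" "loops T \<subseteq> circles P" by (auto simp: shift_def loops_def)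
  fix e assume e: "e \<in> E"
  have r: "\<rho> (\<rho> (e, True)) \<in> H" "endpoint P (\<rho> (\<rho> (e, True))) = endpoint P (e, True)"
    using e by (simp_all add: ccw_in endpoint_ccw)
  have fs: "face_set (bd T) (faces (bd T))"
    unfolding faces_def by (rule face_section[OF bd_even[OF cl]])
  then have S: "(e, False) \<in> faces (bd T) \<longleftrightarrow> \<rho> (\<rho> (e, True)) \<in> faces (bd T)"
    using e by (rule face_setD)
  have sh: "endpoint P (e, False) \<in> shift T \<longleftrightarrow> corner T (e, False) \<noteq> ((e, False) \<in> faces (bd T))"
    "endpoint P (e, True) \<in> shift T \<longleftrightarrow> corner T (\<rho> (\<rho> (e, True))) \<noteq> (\<rho> (\<rho> (e, True)) \<in> faces (bd T))"
    using shift_iff[OF cl, of "(e, False)"] shift_iff[OF cl r(1)] e r(2) by simp_all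
  have bd: "e \<in> bd T \<longleftrightarrow> corner T (e, True) \<noteq> corner T (\<rho> (\<rho> (e, True)))"
    using mem_bd_iff[OF cl, of e True] e by simp
  show "(endpoint P (e, False) \<in> shift T) \<noteq> (endpoint P (e, True) \<in> shift T) \<longleftrightarrow> e \<in> bd T \<and> Inl e \<in> A"
  proof (cases "Inl e \<in> A")
    case True
    then have "corner T (e, False) \<longleftrightarrow> corner T (e, True)" using closed_state(4)[OF cl e] by simp
    then show ?thesis using True S sh bd by blast
  next
    case False
    then have "corner T (e, False) \<longleftrightarrow> corner T (\<rho> (\<rho> (e, True)))" using closed_state(3)[OF cl e] by simp
    then show ?thesis using False S sh by blast
  qed
qed

text \<open>The inverse construction: \<open>t\<close>, spread to all corners around its vertices,
  is added to the chosen faces with boundary \<open>z\<close>.\<close>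

lemma model_to_closed:
  assumes "(z, t, k) \<in> twisted_cochains P A"
  obtains T where "T \<subseteq> X" "closed_under (state_joins B M A) T" "bd T = z" "shift T = t" "loops T = k"
proof -
  have z: "z \<in> even_edge_sets P" and t: "t \<subseteq> verts P" and k: "k \<subseteq> circles P"
    and tw: "\<And>e. e \<in> E \<Longrightarrow> (endpoint P (e, False) \<in> t) \<noteq> (endpoint P (e, True) \<in> t) \<longleftrightarrow> e \<in> z \<and> Inl e \<in> A"
    using assms by (auto simp: twisted_cochains_def)
  have zE: "z \<subseteq> E" using z by (simp add: even_edge_sets_def)
  have fs: "face_set z (faces z)" unfolding faces_def by (rule face_section[OF z])
  define c where "c h \<longleftrightarrow> (endpoint P h \<in> t) \<noteq> (h \<in> faces z)" for h
  define T :: "('b + 'b half_edge) half_edge set"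
    where "T = {(Inr h, b) | h b. h \<in> H \<and> c h} \<union> {(Inl e, b) | e b. e \<in> k}"
  have T: "(Inr h, b) \<in> T \<longleftrightarrow> h \<in> H \<and> c h" "(Inl e, b) \<in> T \<longleftrightarrow> e \<in> k" for h e b
    unfolding T_def by blast+
  have r: "\<rho> (\<rho> (e, b)) \<in> H" "endpoint P (\<rho> (\<rho> (e, b))) = endpoint P (e, b)" if "e \<in> E" for e b
    using that by (simp_all add: ccw_in endpoint_ccw)
  have cl: "closed_under (state_joins B M A) T"
  proof -
    have "x \<in> T \<longleftrightarrow> y \<in> T" if "(x, y) \<in> smoothing B A (Inl e)" "e \<in> E" for x y e
      using that(1) tw[OF that(2)] face_setD[OF fs that(2)] that(2) r[OF that(2)]
      by (cases "Inl e \<in> A") (auto simp: smoothing_def T c_def)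
    moreover have "x \<in> T \<longleftrightarrow> y \<in> T" if "(x, y) \<in> arcs" for x y
      using that by (auto simp: arcs_def T state_edges_blowup)
    ultimately show ?thesis by (auto simp: closed_under_def state_joins_eq)
  qed
  have bd: "bd T = z"
  proof -
    have "e \<in> bd T \<longleftrightarrow> e \<in> z" if "e \<in> E" for e
      using face_set_iff[OF fs, of e False] that r[OF that, of False]
      by (auto simp: bd_def corner_def T c_def)
    then show ?thesis using zE bd_sub by blast
  qed
  have "shift T = t"
  proof -
    have "v \<in> shift T \<longleftrightarrow> v \<in> t" if v: "v \<in> verts P" for v
    proof -
      obtain h where h: "h \<in> H" "endpoint P h = v" using v by (rule vertex_half)
      then show ?thesis using shift_iff[OF cl h(1)] by (auto simp: bd corner_def T c_def)
    qed
    then show ?thesis using t by (auto simp: shift_def)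
  qed
  moreover have "loops T = k" using k by (auto simp: loops_def T)
  moreover have "x \<in> X" if "x \<in> T" for x
  proof -
    obtain y b where x: "x = (y, b)" by (cases x)
    show ?thesis using that k T(1)[of _ b] T(2)[of _ b] x by (cases y) (auto simp: state_edges_blowup)
  qed
  ultimately show ?thesis using that[of T] cl bd by blast
qed

lemma pderiv_circle_vec:
  assumes "e \<in> E"
  shows "pderiv_at (Inl e) (circle_vec T) = of_bool (e \<in> bd T)"
proof -
  have "pderiv_at (Inl e) (circle_vec T) = set_deriv {Inl e} (vec_of (support T))"
    by (simp add: set_deriv_def circle_vec_def)
  also have "\<dots> = of_bool (Inl e \<in> support T)"
    by (subst set_deriv_vec_of) (auto simp: finite_support Int_insert_left)
  also have "Inl e \<in> support T \<longleftrightarrow> e \<in> bd T"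
    using assms edges_circles by (auto simp: support_def loops_def)
  finally show ?thesis .
qed

text \<open>Membership of a corner \<open>h\<close> is a linear functional of the coordinates: the
  value of \<open>t\<close> at its vertex plus the parity of the edges \<open>e\<close> in
  \<open>z\<close> with \<open>h\<close> in \<open>\<sigma> e\<close>. The set \<open>J\<close> is
  the same for all states.\<close>

lemma dual_point:
  assumes "x \<in> X"
  shows "\<exists>J. \<forall>A T. closed_under (state_joins B M A) T \<longrightarrow> set_deriv J (circle_vec T) = of_bool (x \<in> T)"
proof -
  obtain y b where x: "x = (y, b)" by (cases x)
  show ?thesis
  proof (cases y)
    case (Inl c)
    then have c: "c \<in> circles P" using assms x by (auto simp: state_edges_blowup)
    have "set_deriv {Inl c} (circle_vec T) = of_bool (x \<in> T)" if "closed_under (state_joins B M A) T" for A T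
    proof -
      have "set_deriv {Inl c} (circle_vec T) = of_bool (Inl c \<in> support T)"
        unfolding circle_vec_def by (subst set_deriv_vec_of) (auto simp: finite_support Int_insert_left)
      moreover have "Inl c \<in> support T \<longleftrightarrow> x \<in> T"
        using closed_state(2)[OF that c] c edges_circles x Inl
        by (cases b) (auto simp: support_def loops_def bd_def)
      ultimately show ?thesis by simp
    qed
    then show ?thesis by blast
  next
    case (Inr h)
    then have h: "h \<in> H" using assms x by (auto simp: state_edges_blowup)
    define J :: "('b + 'a) set" where "J = insert (Inr (endpoint P h)) (Inl ` {e \<in> E. h \<in> \<sigma> e})"
    have finJ: "finite J" using finite_E by (simp add: J_def)
    have "set_deriv J (circle_vec T) = of_bool (x \<in> T)" if cl: "closed_under (state_joins B M A) T" for A T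
    proof -
      have Int: "J \<inter> support T = (if endpoint P h \<in> shift T then {Inr (endpoint P h)} else {}) \<union>
          Inl ` {e \<in> bd T. h \<in> \<sigma> e}"
        using edges_circles by (auto simp: J_def support_def bd_def loops_def)
      have fin: "finite {e \<in> bd T. h \<in> \<sigma> e}" using finite_E bd_sub finite_subset by fastforce
      have "card (J \<inter> support T) = of_bool (endpoint P h \<in> shift T) + card {e \<in> bd T. h \<in> \<sigma> e}"
        unfolding Int using fin by (subst card_Un_disjoint) (auto simp: card_image)
      moreover have "odd (card {e \<in> bd T. h \<in> \<sigma> e}) \<longleftrightarrow> h \<in> faces (bd T)"
        using h by (simp add: faces_def)
      ultimately have "odd (card (J \<inter> support T)) \<longleftrightarrow> corner T h"
        using shift_iff[OF cl h] by simp
      moreover have "corner T h \<longleftrightarrow> x \<in> T"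
        using closed_state(1)[OF cl h] x Inr by (cases b) (auto simp: corner_def)
      ultimately show ?thesis
        unfolding circle_vec_def by (simp add: set_deriv_vec_of finJ finite_support)
    qed
    then show ?thesis by blast
  qed
qed

lemma state_closed: "c \<in> state_circles B M A \<Longrightarrow> closed_under (state_joins B M A) c"
  using join_relation.comps_closed[OF join_relation] by (simp add: state_circles_eq)

lemma circle_vec_eq_W: "model_space P A = sum circle_vec ` Pow (state_circles B M A)"
proof (intro equalityI subsetI)
  interpret join_relation X "state_joins B M A" by (rule join_relation)
  have disj: "disjoint S" if "S \<subseteq> state_circles B M A" for S
    using that comps_eqI by (fastforce simp: pairwise_def disjnt_def state_circles_eq)
  have fin: "finite S" if "S \<subseteq> state_circles B M A" for S
    using that finite_state_circles by (rule finite_subset)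
  {
    fix w assume "w \<in> model_space P A"
    then obtain z t k where m: "(z, t, k) \<in> twisted_cochains P A" "w = vec_of (Inl ` z \<union> Inr ` t \<union> Inl ` k)"
      by (auto simp: model_space_def)
    obtain T where T: "T \<subseteq> X" "closed_under (state_joins B M A) T" "bd T = z" "shift T = t" "loops T = k"
      using m(1) by (rule model_to_closed)
    let ?S = "{c \<in> comps. c \<subseteq> T}"
    have S: "?S \<subseteq> state_circles B M A" by (auto simp: state_circles_eq)
    have "w = circle_vec T" using m(2) T by (simp add: circle_vec_def support_def)
    also have "T = \<Union>?S" using closed_eq_Union[OF T(1,2)] .
    also have "circle_vec (\<Union>?S) = sum circle_vec ?S"
      by (rule circle_vec_Union[OF fin[OF S] disj[OF S]])
    finally show "w \<in> sum circle_vec ` Pow (state_circles B M A)" using S by blast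
  }
  fix w assume "w \<in> sum circle_vec ` Pow (state_circles B M A)"
  then obtain S where S: "S \<subseteq> state_circles B M A" "w = sum circle_vec S" by auto
  then have "w = circle_vec (\<Union>S)"
    using circle_vec_Union[OF fin disj] by simp
  moreover have "closed_under (state_joins B M A) (\<Union>S)"
    using S state_closed by (intro closed_under_Union) auto
  ultimately show "w \<in> model_space P A"
    using support_in_model unfolding model_space_def circle_vec_def support_def by force
qed

text \<open>For \<open>e\<close> outside \<open>z\<close> the condition at \<open>e\<close> is the
  same whether or not \<open>e\<close> belongs to \<open>A\<close>.\<close>

lemma model_Int:
  assumes "e \<in> E"
  shows "{w \<in> model_space P (insert (Inl e) A). pderiv_at (Inl e) w = 0} =
         {w \<in> model_space P A. pderiv_at (Inl e) w = 0}"
proof -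
  have pd: "pderiv_at (Inl e) (vec_of (Inl ` z \<union> Inr ` t \<union> Inl ` k)) = of_bool (e \<in> z)"
    if "(z, t, k) \<in> twisted_cochains P A'" for z t k A'
  proof -
    have zk: "z \<subseteq> E" "k \<subseteq> circles P" "t \<subseteq> verts P"
      using that by (auto simp: twisted_cochains_def even_edge_sets_def)
    then have fin: "finite (Inl ` z \<union> Inr ` t \<union> Inl ` k :: ('b + 'a) set)"
      using finite_E finite_V finite_circ by (auto intro: finite_subset)
    have "pderiv_at (Inl e) (vec_of (Inl ` z \<union> Inr ` t \<union> Inl ` k)) =
        set_deriv {Inl e} (vec_of (Inl ` z \<union> Inr ` t \<union> Inl ` k))"
      by (simp add: set_deriv_def)
    also have "\<dots> = of_bool (Inl e \<in> (Inl ` z \<union> Inr ` t \<union> Inl ` k :: ('b + 'a) set))"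
      by (subst set_deriv_vec_of) (auto simp: fin[simplified] fin Int_insert_left)
    finally show ?thesis using zk assms edges_circles by auto
  qed
  have tw: "(z, t, k) \<in> twisted_cochains P (insert (Inl e) A) \<longleftrightarrow> (z, t, k) \<in> twisted_cochains P A"
    if "e \<notin> z" for z t k
    using that by (auto simp: twisted_cochains_def)
  have sub: "w \<in> model_space P A''" if w: "w \<in> model_space P A'" "pderiv_at (Inl e) w = 0"
    and A: "\<And>z t k. e \<notin> z \<Longrightarrow> (z, t, k) \<in> twisted_cochains P A' \<Longrightarrow> (z, t, k) \<in> twisted_cochains P A''" for w A' A''
  proof -
    obtain z t k where m: "(z, t, k) \<in> twisted_cochains P A'" "w = vec_of (Inl ` z \<union> Inr ` t \<union> Inl ` k)"
      using w(1) by (auto simp: model_space_def)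
    have "e \<notin> z" using pd[OF m(1)] w(2) m(2) by auto
    then show ?thesis using A m by (force simp: model_space_def)
  qed
  show ?thesis using sub tw by blast
qed

theorem circle_model_blowup: "circle_model B M circle_vec (model_space P) model_index"
proof
  show "finite M" using finite_E by simp
  fix A assume A: "A \<subseteq> M"
  show "finite (state_circles B M A)" by (rule finite_state_circles)
  show "model_space P A = sum circle_vec ` Pow (state_circles B M A)" by (rule circle_vec_eq_W)
  show "circle_vec c * circle_vec c = 0" for c by (simp add: circle_vec_def)
  show "\<exists>J. \<forall>c'\<in>state_circles B M A. set_deriv J (circle_vec c') = of_bool (c' = c)"
    if c: "c \<in> state_circles B M A" for c
  proof -
    interpret join_relation X "state_joins B M A" by (rule join_relation)
    obtain x where x: "x \<in> c" "x \<in> X"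
      using c comps_nonempty[of c] comps_subset[of c] by (auto simp: state_circles_eq)
    obtain J where J: "\<And>T. closed_under (state_joins B M A) T \<Longrightarrow> set_deriv J (circle_vec T) = of_bool (x \<in> T)"
      using dual_point[OF x(2)] by blast
    have "x \<in> c' \<longleftrightarrow> c' = c" if "c' \<in> state_circles B M A" for c'
      using that c x comps_eqI by (auto simp: state_circles_eq)
    then show ?thesis using J state_closed by (intro exI[of _ J]) auto
  qed
  fix m
  show "pderiv_at (model_index m) w \<in> {0, 1}" if "m \<in> M" "w \<in> model_space P A" for w
  proof -
    from that(1) obtain e where e: "m = Inl e" "e \<in> E" by auto
    from that(2) obtain S where S: "S \<subseteq> state_circles B M A" "w = sum circle_vec S"
      unfolding circle_vec_eq_W by auto
    have "finite S" using S(1) finite_state_circles by (rule finite_subset)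
    then have "sum (\<lambda>c. pderiv_at (Inl e) (circle_vec c)) S \<in> {0, 1}"
      using e(2) by (simp add: pderiv_circle_vec sum_of_bool_ext del: sum_of_bool_eq)
    then show ?thesis using S e by (simp add: model_index_def pderiv_at_sum)
  qed
  assume mA: "m \<in> M - A"
  then obtain e where e: "m = Inl e" "e \<in> E" and eA: "Inl e \<notin> A" by auto
  show "{w \<in> model_space P (insert m A). pderiv_at (model_index m) w = 0} =
      {w \<in> model_space P A. pderiv_at (model_index m) w = 0}"
    using model_Int[OF e(2)] by (simp add: e model_index_def)
  \<comment> \<open>All joins except those at \<open>m\<close>; the two smoothings of
    \<open>m\<close> are the two ways to close this system.\<close>
  define J0 where "J0 = arcs \<union> (\<Union>m'\<in>M - {m}. smoothing B A m')"
  define p1 p2 q1 q2 :: "('b + 'b half_edge) half_edge"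
    where "p1 = (Inr (e, False), False)" and "p2 = (Inr (\<rho> (\<rho> (e, False))), True)"
      and "q1 = (Inr (e, True), False)" and "q2 = (Inr (\<rho> (\<rho> (e, True))), True)"
  note pts = p1_def p2_def q1_def q2_def
  interpret four_points X J0 p1 p2 q1 q2
  proof
    show "J0 \<subseteq> X \<times> X" unfolding J0_def using arcs_sub smoothing_sub by blast
    show "p1 \<in> X" "p2 \<in> X" "q1 \<in> X" "q2 \<in> X" using ends_in_X[OF e(2)] by (auto simp: pts)
    show "even (of_bool (p1 \<in> T) + of_bool (p2 \<in> T) + of_bool (q1 \<in> T) + of_bool (q2 \<in> T) :: nat)"
      if "T \<subseteq> X" "closed_under J0 T" for T
      using parity[OF e(2) that(1)] that(2) by (simp add: J0_def e pts)
  qed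
  have MM: "M = insert m (M - {m})" using mA by auto
  have "state_joins B M A = J0 \<union> smoothing B A m"
    unfolding state_joins_eq J0_def by (subst MM) auto
  also have "smoothing B A m = {(p1, q2), (p2, q1)}"
    using eA by (simp add: smoothing_def e pts)
  finally have jA: "state_joins B M A = Jb" by (simp add: Jb_def)
  have "smoothing B (insert m A) m' = smoothing B A m'" if "m' \<in> M - {m}" for m'
    using that by (simp add: smoothing_def)
  then have "state_joins B M (insert m A) = J0 \<union> smoothing B (insert m A) m"
    unfolding state_joins_eq J0_def by (subst MM) auto
  also have "smoothing B (insert m A) m = {(p1, q1), (p2, q2)}"
    by (simp add: smoothing_def e pts)
  finally have jA': "state_joins B M (insert m A) = Ja" by (simp add: Ja_def)
  have C: "state_circles B M A = before.comps" "state_circles B M (insert m A) = after.comps"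
    by (simp_all add: state_circles_eq jA jA')
  have at: "circles_at B M A m = at_before" "circles_at B M (insert m A) m = at_after"
  proof -
    have "end_x1 B m = p1" "end_x2 B m = p2" "end_y1 B m = q1" "end_y2 B m = q2"
      by (simp_all add: e pts)
    then show "circles_at B M A m = at_before" "circles_at B M (insert m A) m = at_after"
      unfolding circles_at_def at_before_def at_after_def C by (simp_all only:)
  qed
  show "state_circles B M (insert m A) - circles_at B M (insert m A) m =
      state_circles B M A - circles_at B M A m"
    unfolding C at by (rule away_eq)
  have pd: "pderiv_at (model_index m) (circle_vec c) = of_bool ((p1 \<in> c) \<noteq> (p2 \<in> c))" for c
    using pderiv_circle_vec[OF e(2), of c] e by (simp add: model_index_def bd_def corner_def pts)
  show "pderiv_at (model_index m) (circle_vec c) = 0" if "c \<in> state_circles B M A - circles_at B M A m" for c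
    using that unfolding C at by (simp add: pd at_before_def)
  show "(\<exists>a b c. circles_at B M A m = {a, b} \<and> a \<noteq> b \<and> circles_at B M (insert m A) m = {c} \<and>
         circle_vec c = circle_vec a + circle_vec b \<and>
         pderiv_at (model_index m) (circle_vec a) = 1 \<and> pderiv_at (model_index m) (circle_vec b) = 1) \<or>
      (\<exists>a c d. circles_at B M A m = {a} \<and> circles_at B M (insert m A) m = {c, d} \<and> c \<noteq> d \<and>
         circle_vec a = circle_vec c + circle_vec d \<and>
         pderiv_at (model_index m) (circle_vec c) = 1 \<and> pderiv_at (model_index m) (circle_vec d) = 1) \<or>
      (\<exists>a c. circles_at B M A m = {a} \<and> circles_at B M (insert m A) m = {c} \<and>
         pderiv_at (model_index m) (circle_vec a) = 0 \<and> pderiv_at (model_index m) (circle_vec c) = 0)"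
  proof (rule cases)
    fix a b
    assume *: "at_before = {a, b}" "at_after = {a \<union> b}" "a \<inter> b = {}" "a \<noteq> b" "p1 \<in> a" "p2 \<notin> a" "p2 \<in> b" "p1 \<notin> b"
    show ?thesis
      by (rule disjI1, rule exI[of _ a], rule exI[of _ b], rule exI[of _ "a \<union> b"])
        (use * in \<open>simp add: at pd circle_vec_Un\<close>)
  next
    fix c d
    assume *: "at_after = {c, d}" "at_before = {c \<union> d}" "c \<inter> d = {}" "c \<noteq> d" "p1 \<in> c" "p2 \<notin> c" "p2 \<in> d" "p1 \<notin> d"
    show ?thesis
      by (rule disjI2, rule disjI1, rule exI[of _ "c \<union> d"], rule exI[of _ c], rule exI[of _ d])
        (use * in \<open>simp add: at pd circle_vec_Un\<close>)
  next
    fix a c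
    assume *: "at_before = {a}" "at_after = {c}" "p1 \<in> a" "p2 \<in> a" "p1 \<in> c" "p2 \<in> c"
    show ?thesis
      by (rule disjI2, rule disjI2, rule exI[of _ a], rule exI[of _ c]) (use * in \<open>simp add: at pd\<close>)
  qed
qed

end

section \<open>Cycles in a multigraph\<close>

definition opposite :: "'e half_edge \<Rightarrow> 'e half_edge" where
  "opposite h = (fst h, \<not> snd h)"

lemma opposite [simp]: "fst (opposite h) = fst h" "opposite (opposite h) = h" "opposite h \<noteq> h" "h \<noteq> opposite h"
  by (auto simp: opposite_def prod_eq_iff)

lemma opposite_half_edges [simp]: "opposite h \<in> half_edges G \<longleftrightarrow> h \<in> half_edges G"
  by (cases h) (simp add: opposite_def half_edges_def)

lemma same_edge: "fst h = fst h' \<Longrightarrow> h' = h \<or> h' = opposite h"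
  by (auto simp: opposite_def prod_eq_iff)

fun half_edge_walk :: "('v, 'e, 'z) multigraph_scheme \<Rightarrow> 'v \<Rightarrow> 'e half_edge list \<Rightarrow> 'v \<Rightarrow> bool" where
  "half_edge_walk G u [] v \<longleftrightarrow> u = v"
| "half_edge_walk G u (h # hs) v \<longleftrightarrow> endpoint G h = u \<and> half_edge_walk G (endpoint G (opposite h)) hs v"

lemma walk_append:
  "half_edge_walk G u (xs @ ys) v \<longleftrightarrow> (\<exists>w. half_edge_walk G u xs w \<and> half_edge_walk G w ys v)"
  by (induction xs arbitrary: u) auto

lemma walk_endpoints:
  "half_edge_walk G u hs v \<Longrightarrow>
    map (endpoint G) hs @ [v] = u # map (\<lambda>h. endpoint G (opposite h)) hs"
  by (induction hs arbitrary: u) auto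

text \<open>A loop is a cycle of length one and two parallel edges form one of length two;
  distinctness of the edges rules out running along an edge and straight back.\<close>

definition edge_cycle :: "('v, 'e, 'z) multigraph_scheme \<Rightarrow> 'e half_edge list \<Rightarrow> bool" where
  "edge_cycle G hs \<longleftrightarrow> hs \<noteq> [] \<and> set hs \<subseteq> half_edges G \<and>
     half_edge_walk G (endpoint G (hd hs)) hs (endpoint G (hd hs)) \<and>
     distinct (map (endpoint G) hs) \<and> distinct (map fst hs)"

lemma edge_cycle_rotate:
  assumes "edge_cycle G (xs @ h # ys)"
  shows "edge_cycle G (h # ys @ xs)"
proof -
  define u where "u = endpoint G (hd (xs @ h # ys))"
  have "half_edge_walk G u (xs @ h # ys) u" using assms by (simp add: edge_cycle_def u_def)
  then obtain w where "half_edge_walk G u xs w" "half_edge_walk G w (h # ys) u" by (auto simp: walk_append)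
  then have "half_edge_walk G (endpoint G h) (h # ys @ xs) (endpoint G h)"
    by (auto simp: walk_append)
  then show ?thesis using assms by (auto simp: edge_cycle_def)
qed

lemma edge_cycle_at:
  assumes "edge_cycle G hs" "h \<in> set hs"
  obtains hs' where "edge_cycle G (h # hs')" "set (h # hs') = set hs"
proof -
  obtain xs ys where "hs = xs @ h # ys" using assms(2) by (meson split_list)
  then show ?thesis using that[of "ys @ xs"] edge_cycle_rotate assms(1) by fastforce
qed

lemma edge_cycle_ends:
  assumes "edge_cycle G hs"
  shows "inj_on (endpoint G) (set hs)" "inj_on (\<lambda>h. endpoint G (opposite h)) (set hs)"
    "(\<lambda>h. endpoint G (opposite h)) ` set hs = endpoint G ` set hs"
    "endpoint G (opposite (last hs)) = endpoint G (hd hs)" "inj_on fst (set hs)"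
proof -
  let ?f = "\<lambda>h. endpoint G (opposite h)" and ?u = "endpoint G (hd hs)"
  have c: "hs \<noteq> []" "half_edge_walk G ?u hs ?u" "distinct (map (endpoint G) hs)" "distinct (map fst hs)"
    using assms by (auto simp: edge_cycle_def)
  have eq: "map (endpoint G) hs @ [?u] = ?u # map ?f hs" by (rule walk_endpoints[OF c(2)])
  have "mset (map (endpoint G) hs @ [?u]) = mset (?u # map ?f hs)" by (simp only: eq)
  then have m: "mset (map ?f hs) = mset (map (endpoint G) hs)" by (simp only: mset_append mset.simps) simp
  then have "distinct (map ?f hs)" using c(3) mset_eq_imp_distinct_iff by blast
  then show "inj_on ?f (set hs)" by (simp add: distinct_map)
  show "?f ` set hs = endpoint G ` set hs" using mset_eq_setD[OF m] by simp
  have "last (map (endpoint G) hs @ [?u]) = last (?u # map ?f hs)" by (simp only: eq)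
  then show "?f (last hs) = ?u" using c(1) by (simp add: last_map)
  show "inj_on (endpoint G) (set hs)" "inj_on fst (set hs)" using c by (auto simp: distinct_map)
qed

text \<open>Each vertex of the cycle is left once and entered once. The two half-edges concerned
  differ, also for a loop.\<close>

lemma edge_cycle_even:
  assumes "edge_cycle G hs"
  shows "even (card {h \<in> half_edges_at G v. fst h \<in> fst ` set hs})"
proof -
  let ?f = "\<lambda>h. endpoint G (opposite h)"
  let ?A = "{h \<in> set hs. endpoint G h = v}" and ?B = "{h \<in> set hs. ?f h = v}"
  note ends = edge_cycle_ends[OF assms]
  have sub: "set hs \<subseteq> half_edges G" using assms by (simp add: edge_cycle_def)
  have no: "opposite h \<notin> set hs" if "h \<in> set hs" for h
    using inj_onD[OF ends(5), of "opposite h" h] that by auto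
  have split: "{h \<in> half_edges_at G v. fst h \<in> fst ` set hs} = ?A \<union> opposite ` ?B"
  proof (intro Set.set_eqI iffI)
    fix h assume h: "h \<in> {h \<in> half_edges_at G v. fst h \<in> fst ` set hs}"
    then obtain h' where h': "h' \<in> set hs" "fst h' = fst h" by force
    from same_edge[OF h'(2)] show "h \<in> ?A \<union> opposite ` ?B"
    proof
      assume "h = h'" then show ?thesis using h h'(1) by (simp add: half_edges_at_def)
    next
      assume "h = opposite h'" then show ?thesis using h h'(1) by (simp add: half_edges_at_def)
    qed
  next
    fix h assume h: "h \<in> ?A \<union> opposite ` ?B"
    show "h \<in> {h \<in> half_edges_at G v. fst h \<in> fst ` set hs}"
    proof (cases "h \<in> ?A")
      case True then show ?thesis using sub by (auto simp: half_edges_at_def)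
    next
      case False
      then obtain h' where "h' \<in> ?B" "h = opposite h'" using h by blast
      then show ?thesis using sub by (auto simp: half_edges_at_def)
    qed
  qed
  have disj: "?A \<inter> opposite ` ?B = {}"
  proof (intro equalityI subsetI)
    fix x assume "x \<in> ?A \<inter> opposite ` ?B"
    then obtain h where "h \<in> set hs" "x = opposite h" "x \<in> set hs" by blast
    then show "x \<in> {}" using no[of h] by simp
  qed simp
  have card: "card (opposite ` ?B) = card ?B"
    by (rule card_image, rule inj_onI) (metis opposite(2))
  have fin: "finite ?A" "finite (opposite ` ?B)" by simp_all
  have sum: "card {h \<in> half_edges_at G v. fst h \<in> fst ` set hs} = card ?A + card ?B"
    unfolding split card_Un_disjoint[OF fin disj] card by (rule refl)
  have "card {h \<in> S. g h = v} = of_bool (v \<in> g ` S)" if "inj_on g S" for g :: "'b half_edge \<Rightarrow> 'a" and S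
  proof (cases "v \<in> g ` S")
    case True
    then obtain h where "h \<in> S" "g h = v" by blast
    then have "{h \<in> S. g h = v} = {h}" using inj_onD[OF that, of h] by blast
    then show ?thesis using True by simp
  next
    case False
    then have "{h \<in> S. g h = v} = {}" by blast
    then show ?thesis using False by (simp del: split_paired_All Collect_empty_eq)
  qed
  from this[OF ends(1)] this[OF ends(2)] show ?thesis unfolding sum ends(3) by simp
qed

lemma distinct_map_upt:
  assumes "\<And>a b. i \<le> a \<Longrightarrow> a < b \<Longrightarrow> b < j \<Longrightarrow> f (w a) \<noteq> f (w b)"
  shows "distinct (map f (map w [i..<j]))"
  unfolding map_map
proof (subst distinct_map, intro conjI inj_onI)
  fix x y assume "x \<in> set [i..<j]" "y \<in> set [i..<j]" "(f \<circ> w) x = (f \<circ> w) y"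
  then show "x = y" using assms[of x y] assms[of y x] by (cases x y rule: linorder_cases) auto
qed simp

text \<open>Evenness lets a walk in \<open>z\<close> continue without turning back. Finiteness
  forces a repeated vertex, and a closed stretch of minimal length over all starting points repeats
  no vertex inside.\<close>

lemma edge_cycle_exists:
  assumes "finite_multigraph G" "z \<in> even_edge_sets G" "z \<noteq> {}"
  obtains hs where "edge_cycle G hs" "fst ` set hs \<subseteq> z"
proof -
  define H where "H = {h \<in> half_edges G. fst h \<in> z}"
  have z: "z \<subseteq> edges G" using assms(2) by (simp add: even_edge_sets_def)
  have fin: "finite (half_edges G)" "finite (verts G)" and V: "endpoint G h \<in> verts G" if "h \<in> half_edges G" for h
    using assms(1) that by (auto simp: finite_multigraph_def half_edges_def)
  have opp: "opposite h \<in> H" if "h \<in> H" for h using that by (auto simp: H_def)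
  have "\<exists>h'\<in>H. endpoint G h' = endpoint G (opposite h) \<and> h' \<noteq> opposite h" if h: "h \<in> H" for h
  proof (rule ccontr)
    assume no: "\<not> ?thesis"
    let ?v = "endpoint G (opposite h)"
    have "{h' \<in> half_edges_at G ?v. fst h' \<in> z} = {opposite h}"
      using no opp[OF h] by (auto simp: half_edges_at_def H_def)
    then have "card {h' \<in> half_edges_at G ?v. fst h' \<in> z} = 1" by simp
    moreover have "?v \<in> verts G" using V opp[OF h] by (simp add: H_def)
    then have "even (card {h' \<in> half_edges_at G ?v. fst h' \<in> z})" using assms(2) by (simp add: even_edge_sets_def)
    ultimately show False by simp
  qed
  then obtain nx where nx: "\<And>h. h \<in> H \<Longrightarrow> nx h \<in> H \<and> endpoint G (nx h) = endpoint G (opposite h) \<and> nx h \<noteq> opposite h"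
    by metis
  obtain e where "e \<in> z" using assms(3) by blast
  then have h0: "(e, False) \<in> H" using z by (auto simp: H_def half_edges_def)
  define w where "w n = (nx ^^ n) (e, False)" for n
  have wH: "w n \<in> H" for n by (induction n) (use h0 nx in \<open>auto simp: w_def\<close>)
  have w_Suc: "endpoint G (w (Suc n)) = endpoint G (opposite (w n))" "w (Suc n) \<noteq> opposite (w n)" for n
    using nx[OF wH[of n]] by (auto simp: w_def)
  have sub: "(\<lambda>n. endpoint G (w n)) ` UNIV \<subseteq> verts G" using wH V by (fastforce simp: H_def simp del: split_paired_All)
  have "\<not> inj (\<lambda>n. endpoint G (w n))"
  proof
    assume "inj (\<lambda>n. endpoint G (w n))"
    then have "infinite ((\<lambda>n. endpoint G (w n)) ` UNIV)" using finite_imageD infinite_UNIV_nat by blast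
    then show False using finite_subset[OF sub] assms(1) by (simp add: finite_multigraph_def)
  qed
  then obtain a b where ab: "a \<noteq> b" "endpoint G (w a) = endpoint G (w b)" by (auto simp: inj_def)
  define P where "P d \<longleftrightarrow> 0 < d \<and> (\<exists>i. endpoint G (w i) = endpoint G (w (i + d)))" for d
  have P_I: "P (b - a)" if "a < b" "endpoint G (w a) = endpoint G (w b)" for a b
    using that by (auto simp: P_def intro!: exI[of _ a])
  have exP: "\<exists>d. P d" using P_I[of a b] P_I[of b a] ab by (cases "a < b") auto
  define d where "d = (LEAST d. P d)"
  have "P d" unfolding d_def using exP by (rule LeastI_ex)
  then obtain i where i: "0 < d" "endpoint G (w i) = endpoint G (w (i + d))" by (auto simp: P_def)
  have min: "endpoint G (w a) \<noteq> endpoint G (w b)" if "i \<le> a" "a < b" "b < i + d" for a b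
  proof
    assume "endpoint G (w a) = endpoint G (w b)"
    then have "P (b - a)" using P_I that by blast
    then have "d \<le> b - a" unfolding d_def by (rule Least_le)
    then show False using that by linarith
  qed
  define hs where "hs = map w [i..<i + d]"
  have walk: "half_edge_walk G (endpoint G (w i)) (map w [i..<i + k]) (endpoint G (w (i + k)))" for k
    by (induction k) (auto simp: walk_append w_Suc(1))
  have "edge_cycle G hs"
    unfolding edge_cycle_def
  proof (intro conjI)
    show "hs \<noteq> []" using i(1) by (simp add: hs_def)
    have hd: "hd hs = w i" using i(1) by (simp add: hs_def hd_map)
    show "set hs \<subseteq> half_edges G" using wH by (auto simp: hs_def H_def)
    show "half_edge_walk G (endpoint G (hd hs)) hs (endpoint G (hd hs))"
      using walk[of d] i(2) unfolding hd by (simp only: hs_def)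
    show "distinct (map (endpoint G) hs)" unfolding hs_def by (rule distinct_map_upt) (rule min)
    show "distinct (map fst hs)"
      unfolding hs_def
    proof (rule distinct_map_upt)
      fix a b assume ab: "i \<le> a" "a < b" "b < i + d"
      show "fst (w a) \<noteq> fst (w b)"
      proof
        assume "fst (w a) = fst (w b)"
        then consider "w b = w a" | "w b = opposite (w a)" using same_edge by blast
        then show False
        proof cases
          case 1 then show ?thesis using min[OF ab] by simp
        next
          case 2
          \<comment> \<open>Traversing the edge of \<open>w a\<close> backwards would close a
            shorter stretch, unless it happens at the very next step, which the walk
            excludes.\<close>
          then have eq: "endpoint G (w (Suc a)) = endpoint G (w b)" using w_Suc(1)[of a] by simp
          then have "b = Suc a" using min[of "Suc a" b] ab by (cases "Suc a < b") auto
          then show ?thesis using 2 w_Suc(2)[of a] by simp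
        qed
      qed
    qed
  qed
  moreover have "fst ` set hs \<subseteq> z" using wH by (auto simp: hs_def H_def)
  ultimately show ?thesis by (rule that)
qed

text \<open>Removing a cycle keeps all vertex degrees even and makes the set smaller.\<close>

lemma even_edge_sets_induct:
  assumes G: "finite_multigraph G" and "z \<in> even_edge_sets G" and "P {}"
    and step: "\<And>hs z. edge_cycle G hs \<Longrightarrow> fst ` set hs \<subseteq> z \<Longrightarrow> P (z - fst ` set hs) \<Longrightarrow> P z"
  shows "P z"
  using assms(2)
proof (induction "card z" arbitrary: z rule: less_induct)
  case less
  show ?case
  proof (cases "z = {}")
    case True
    then show ?thesis using assms(3) by simp
  next
    case False
    then obtain hs where hs: "edge_cycle G hs" "fst ` set hs \<subseteq> z" using edge_cycle_exists[OF G less.prems] by blast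
    let ?c = "fst ` set hs"
    have z: "z \<subseteq> edges G" using less.prems by (simp add: even_edge_sets_def)
    have "finite (edges G)" using G by (simp add: finite_multigraph_def)
    with z have fin: "finite (half_edges G)" "finite z"
      by (simp add: half_edges_def, rule finite_subset)
    have "hs \<noteq> []" using hs(1) by (simp add: edge_cycle_def)
    then have "hd hs \<in> set hs" by simp
    then have "fst (hd hs) \<in> ?c" by (rule imageI)
    then have "fst (hd hs) \<in> z" "fst (hd hs) \<notin> z - ?c" using hs(2) by (rule subsetD[rotated], simp)
    then have "z - ?c \<subset> z" by blast
    then have card: "card (z - ?c) < card z" using fin(2) by (rule psubset_card_mono[rotated])
    have "z - ?c \<in> even_edge_sets G"
      unfolding even_edge_sets_def
    proof (intro CollectI conjI ballI)
      fix v assume v: "v \<in> verts G"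
      have eq: "{h \<in> half_edges_at G v. fst h \<in> z - ?c} =
          {h \<in> half_edges_at G v. fst h \<in> z} - {h \<in> half_edges_at G v. fst h \<in> ?c}" by blast
      have sub: "{h \<in> half_edges_at G v. fst h \<in> ?c} \<subseteq> {h \<in> half_edges_at G v. fst h \<in> z}" using hs(2) by blast
      have "finite (half_edges_at G v)" using fin(1) by (simp add: half_edges_at_def)
      then have "card {h \<in> half_edges_at G v. fst h \<in> z - ?c} =
          card {h \<in> half_edges_at G v. fst h \<in> z} - card {h \<in> half_edges_at G v. fst h \<in> ?c}"
        unfolding eq by (intro card_Diff_subset[OF _ sub]) (simp add: finite_subset)
      moreover have "even (card {h \<in> half_edges_at G v. fst h \<in> z})"
        using less.prems v by (simp add: even_edge_sets_def)
      ultimately show "even (card {h \<in> half_edges_at G v. fst h \<in> z - ?c})"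
        using edge_cycle_even[OF hs(1)] by simp
    qed (use z in auto)
    then have "P (z - ?c)" using less.hyps[OF card] by blast
    then show ?thesis using step hs by blast
  qed
qed

section \<open>The two sides of a simple closed curve\<close>

text \<open>The exit time is left existential, so that the notion survives joins, initial subpaths
  and composition with a projection, all of which change parametrization or target.\<close>

definition exits_at :: "(real \<Rightarrow> 'a) \<Rightarrow> 'a set \<Rightarrow> 'a \<Rightarrow> bool" where
  "exits_at g U x \<longleftrightarrow> (\<exists>t\<in>{0<..1}. g t = x \<and> x \<notin> U \<and> (\<forall>s\<in>{0..<t}. g s \<in> U))"

lemma exits_at_frontier:
  fixes g :: "real \<Rightarrow> 'a::topological_space"
  assumes "path g" "exits_at g U x" "open U"
  shows "x \<in> frontier U"
proof -
  obtain t where t: "t \<in> {0<..1}" "g t = x" "x \<notin> U" "\<And>s. s \<in> {0..<t} \<Longrightarrow> g s \<in> U"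
    using assms(2) by (auto simp: exits_at_def)
  have "continuous_on {0..t} g"
    using assms(1) t(1) by (auto simp: path_def intro: continuous_on_subset)
  then have "g ` closure {0..<t} \<subseteq> closure U"
    using t by (intro image_closure_subset) (auto intro: closure_subset[THEN subsetD])
  then have "x \<in> closure U" using t(1,2) by auto
  then show ?thesis using t(3) assms(3) by (simp add: frontier_def interior_open)
qed

section \<open>Circular arcs and the cyclic order of points on a circle\<close>

lemma on_circle_angle:
  assumes "b \<in> sphere z R" "R > 0"
  obtains \<theta> where "\<theta>\<^sub>0 \<le> \<theta>" "\<theta> < \<theta>\<^sub>0 + 2 * pi" "b = z + R * cis \<theta>"
proof -
  define w where "w = (b - z) / (R * cis \<theta>\<^sub>0)"
  have R: "cmod (b - z) = R" using assms by (simp add: dist_norm norm_minus_commute)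
  have "cmod w = 1" using R assms by (simp add: w_def norm_divide norm_mult)
  then have w: "w = cis (Arg2pi w)"
    using Arg2pi_eq[of w] by (simp add: cis_conv_exp)
  have "b = z + R * cis \<theta>\<^sub>0 * w" using assms(2) by (simp add: w_def)
  then have "b = z + R * cis (\<theta>\<^sub>0 + Arg2pi w)"
    using w by (metis cis_mult mult.assoc)
  moreover have "0 \<le> Arg2pi w" "Arg2pi w < 2 * pi" by (simp_all add: Arg2pi_ge_0 Arg2pi_lt_2pi)
  ultimately show ?thesis using that[of "\<theta>\<^sub>0 + Arg2pi w"] by simp
qed

lemma part_circlepath_ends:
  "pathstart (part_circlepath z R s t) = z + R * cis s"
  "pathfinish (part_circlepath z R s t) = z + R * cis t"
  by (simp_all add: cis_conv_exp)

lemma cis_minus_2pi: "cis (t - 2 * pi) = cis t"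
  by (simp add: complex_eq_iff cos_diff sin_diff)

lemma sphere_angle_image:
  assumes "0 < R"
  shows "path_image (part_circlepath z R s t) \<subseteq> sphere z R"
  using path_image_part_circlepath_subset'[of R z s t] assms by simp

lemma winding_number_part_circlepath_centre:
  assumes "R > 0"
  shows "winding_number (part_circlepath z R s t) z = complex_of_real ((t - s) / (2 * pi))"
proof -
  have z: "z \<notin> path_image (part_circlepath z R s t)"
    using sphere_angle_image[OF assms, of z s t] assms by auto
  have "contour_integral (part_circlepath z R s t) (\<lambda>w. 1 / (w - z)) = \<i> * (t - s)"
  proof -
    have "((\<lambda>w. 1 / (w - z)) has_contour_integral \<i> * (t - s)) (part_circlepath z R s t)"
    proof -
      have "((\<lambda>x. \<i> * (t - s)) has_integral \<i> * (t - s)) {0..1::real}"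
        using has_integral_const_real[of "\<i> * (t - s)" 0 1] by simp
      moreover have "1 / (part_circlepath z R s t x - z) *
          vector_derivative (part_circlepath z R s t) (at x within {0..1}) = \<i> * (t - s)"
        if "x \<in> {0..1}" for x
        using that assms by (simp add: vector_derivative_part_circlepath01) (simp add: part_circlepath_def)
      ultimately show ?thesis
        unfolding has_contour_integral_def by (metis (no_types, lifting) has_integral_eq)
    qed
    then show ?thesis by (rule contour_integral_unique)
  qed
  then show ?thesis
    using winding_number_valid_path[OF valid_path_part_circlepath z] by simp
qed

text \<open>One arc followed by the other in reverse is the full circle, whose winding number is
  constant in the disc and equals 1 at the centre.\<close>

lemma winding_number_complementary_arcs:
  assumes "R > 0" "w \<in> ball z R"
  shows "winding_number (part_circlepath z R s t) w =
    winding_number (part_circlepath z R s (t - 2 * pi)) w + 1"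
proof -
  define p where "p = part_circlepath z R s t"
  define p' where "p' = part_circlepath z R s (t - 2 * pi)"
  have img: "path_image p \<subseteq> sphere z R" "path_image p' \<subseteq> sphere z R"
    unfolding p_def p'_def using sphere_angle_image[OF assms(1)] by blast+
  have ends: "pathstart p = pathstart p'" "pathfinish p = pathfinish p'"
    unfolding p_def p'_def part_circlepath_ends cis_minus_2pi by (rule refl)+
  have paths: "path p" "path p'" by (simp_all add: p_def p'_def)
  have wn: "winding_number (p +++ reversepath p') u = winding_number p u - winding_number p' u"
    if "u \<in> ball z R" for u
  proof -
    have "u \<notin> path_image p" "u \<notin> path_image p'" using that img by auto
    then show ?thesis
      using paths ends by (simp add: winding_number_join winding_number_reversepath)
  qed
  have "winding_number (p +++ reversepath p') w = winding_number (p +++ reversepath p') z"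
  proof (rule winding_number_eq)
    show "path (p +++ reversepath p')" using paths ends by simp
    show "pathfinish (p +++ reversepath p') = pathstart (p +++ reversepath p')" using ends by simp
    show "w \<in> ball z R" "z \<in> ball z R" using assms by auto
    show "connected (ball z R)" by simp
    show "ball z R \<inter> path_image (p +++ reversepath p') = {}"
    proof -
      have "path_image (p +++ reversepath p') \<subseteq> sphere z R"
        using img path_image_join_subset[of p "reversepath p'"] path_image_reversepath[of p'] by blast
      moreover have "ball z R \<inter> sphere z R = {}" by auto
      ultimately show ?thesis by blast
    qed
  qed
  also have "\<dots> = 1"
  proof -
    have "(t - s) / (2 * pi) - (t - 2 * pi - s) / (2 * pi) = 1"
      by (simp flip: diff_divide_distrib)
    moreover have "z \<in> ball z R" using assms by simp
    ultimately show ?thesis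
      unfolding wn[OF \<open>z \<in> ball z R\<close>] unfolding p_def p'_def winding_number_part_circlepath_centre[OF assms(1)]
      by (simp only: of_real_1 flip: of_real_diff)
  qed
  finally show ?thesis using wn[OF assms(2)] by (simp add: p_def p'_def algebra_simps)
qed

lemma no_multiple_of_2pi:
  assumes "2 * pi * real_of_int n < 0" "2 * pi * real_of_int n > - (2 * pi)"
  shows False
proof -
  have "n < 0" using assms(1) by (simp add: mult_less_0_iff)
  moreover have "0 < 2 * pi * (real_of_int n + 1)" using assms(2) by (simp add: algebra_simps)
  then have "0 < real_of_int n + 1" using pi_gt_zero by (simp add: zero_less_mult_iff)
  ultimately show False by linarith
qed

text \<open>Twice the signed area of an inscribed triangle. A chord is written as
  \<open>2 * \<i> * sin ((x - y) / 2) * cis ((x + y) / 2)\<close>; in the product of two chords the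
  remaining angle is half the difference of their far ends.\<close>

lemma cis_cross:
  "Im (cnj (cis \<theta> - cis \<alpha>) * (cis \<beta> - cis \<alpha>)) =
     4 * sin ((\<theta> - \<alpha>) / 2) * sin ((\<beta> - \<alpha>) / 2) * sin ((\<beta> - \<theta>) / 2)"
proof -
  have d: "cis x - cis y = 2 * \<i> * sin ((x - y) / 2) * cis ((x + y) / 2)" for x y
  proof -
    have "cis x = cis ((x + y) / 2) * cis ((x - y) / 2)" "cis y = cis ((x + y) / 2) * cis (- ((x - y) / 2))"
      by (simp_all add: cis_mult field_simps)
    moreover have "cis ((x - y) / 2) - cis (- ((x - y) / 2)) = 2 * \<i> * sin ((x - y) / 2)"
      by (simp add: complex_eq_iff)
    ultimately show ?thesis by (metis (no_types, lifting) mult.commute right_diff_distrib)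
  qed
  have "cnj (2 * \<i> * a * u) * (2 * \<i> * b * v) = complex_of_real (4 * a * b) * (cnj u * v)" for a b :: real and u v
    by (simp add: complex_eq_iff algebra_simps)
  then have "cnj (cis \<theta> - cis \<alpha>) * (cis \<beta> - cis \<alpha>) =
      complex_of_real (4 * sin ((\<theta> - \<alpha>) / 2) * sin ((\<beta> - \<alpha>) / 2)) *
      (cis (- ((\<theta> + \<alpha>) / 2)) * cis ((\<beta> + \<alpha>) / 2))"
    unfolding d cis_cnj[symmetric] by blast
  also have "cis (- ((\<theta> + \<alpha>) / 2)) * cis ((\<beta> + \<alpha>) / 2) = cis ((\<beta> - \<theta>) / 2)"
  proof -
    have "- ((\<theta> + \<alpha>) / 2) + (\<beta> + \<alpha>) / 2 = (\<beta> - \<theta>) / 2" by (simp add: field_simps)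
    then show ?thesis by (simp only: cis_mult)
  qed
  finally show ?thesis by simp
qed

lemma ccw_on_circle_iff:
  fixes R \<alpha> \<beta> \<theta> :: real
  assumes "R > 0" "\<alpha> < \<theta>" "\<theta> < \<alpha> + 2 * pi" "\<alpha> < \<beta>" "\<beta> < \<alpha> + 2 * pi"
  shows "Im (cnj ((z + R * cis \<theta>) - (z + R * cis \<alpha>)) * ((z + R * cis \<beta>) - (z + R * cis \<alpha>))) > 0 \<longleftrightarrow> \<theta> < \<beta>"
proof -
  have eq: "cnj ((z + R * cis \<theta>) - (z + R * cis \<alpha>)) * ((z + R * cis \<beta>) - (z + R * cis \<alpha>)) =
      complex_of_real (R\<^sup>2) * (cnj (cis \<theta> - cis \<alpha>) * (cis \<beta> - cis \<alpha>))"
    by (simp add: power2_eq_square algebra_simps)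
  have "Im (complex_of_real (R\<^sup>2) * (cnj (cis \<theta> - cis \<alpha>) * (cis \<beta> - cis \<alpha>))) =
      R\<^sup>2 * (4 * sin ((\<theta> - \<alpha>) / 2) * sin ((\<beta> - \<alpha>) / 2) * sin ((\<beta> - \<theta>) / 2))"
    unfolding cis_cross[symmetric] by simp
  moreover have pos: "0 < sin ((\<theta> - \<alpha>) / 2)" "0 < sin ((\<beta> - \<alpha>) / 2)"
    using assms by (intro sin_gt_zero; simp)+
  ultimately have "Im (cnj ((z + R * cis \<theta>) - (z + R * cis \<alpha>)) * ((z + R * cis \<beta>) - (z + R * cis \<alpha>))) =
      (R\<^sup>2 * 4 * sin ((\<theta> - \<alpha>) / 2) * sin ((\<beta> - \<alpha>) / 2)) * sin ((\<beta> - \<theta>) / 2)"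
    unfolding eq by (simp only: mult.assoc)
  moreover have "0 < R\<^sup>2 * 4 * sin ((\<theta> - \<alpha>) / 2) * sin ((\<beta> - \<alpha>) / 2)"
    using pos assms(1) by simp
  ultimately have "Im (cnj ((z + R * cis \<theta>) - (z + R * cis \<alpha>)) * ((z + R * cis \<beta>) - (z + R * cis \<alpha>))) > 0 \<longleftrightarrow>
      sin ((\<beta> - \<theta>) / 2) > 0"
    by (metis mult_pos_pos zero_less_mult_pos)
  also have "\<dots> \<longleftrightarrow> \<theta> < \<beta>"
  proof
    assume "\<theta> < \<beta>"
    then show "sin ((\<beta> - \<theta>) / 2) > 0" using assms by (intro sin_gt_zero) auto
  next
    assume *: "sin ((\<beta> - \<theta>) / 2) > 0"
    show "\<theta> < \<beta>"
    proof (rule ccontr)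
      assume "\<not> \<theta> < \<beta>"
      then have "0 \<le> sin ((\<theta> - \<beta>) / 2)" using assms by (intro sin_ge_zero) auto
      moreover have "sin ((\<theta> - \<beta>) / 2) = - sin ((\<beta> - \<theta>) / 2)"
      proof -
        have "(\<theta> - \<beta>) / 2 = - ((\<beta> - \<theta>) / 2)" by (simp add: field_simps)
        then show ?thesis by (simp only: sin_minus)
      qed
      ultimately show False using * by simp
    qed
  qed
  finally show ?thesis .
qed

text \<open>
  A crosscut \<open>g\<close> of a disc from \<open>b\<close> to \<open>a\<close>, closed by one of the two boundary arcs from \<open>a\<close> to \<open>b\<close>.
  The two winding numbers differ by \<open>1\<close> inside the disc, and as both curves are simple, the one
  for the counterclockwise arc can only be \<open>0\<close> or \<open>1\<close>.
\<close>

locale crosscut =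
  fixes g :: "real \<Rightarrow> complex" and z :: complex and R \<alpha> \<beta> :: real
  assumes R: "R > 0" and arc_g: "arc g"
    and start: "pathstart g = z + R * cis \<beta>" and finish: "pathfinish g = z + R * cis \<alpha>"
    and inner: "path_image g - {pathstart g, pathfinish g} \<subseteq> ball z R"
    and angles: "\<alpha> < \<beta>" "\<beta> < \<alpha> + 2 * pi"
begin

abbreviation "arc_ccw \<equiv> part_circlepath z R \<alpha> \<beta>"
abbreviation "arc_cw \<equiv> part_circlepath z R \<alpha> (\<beta> - 2 * pi)"

lemma arc_ends: "pathstart arc_ccw = pathfinish g" "pathfinish arc_ccw = pathstart g"
  "pathstart arc_cw = pathfinish g" "pathfinish arc_cw = pathstart g"
  unfolding start finish part_circlepath_ends cis_minus_2pi by (rule refl)+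

lemma on_circle: "path_image g \<inter> sphere z R \<subseteq> {pathstart g, pathfinish g}"
  using inner by force

lemma simple_close:
  "simple_path (g +++ arc_ccw)" "simple_path (g +++ arc_cw)"
proof -
  have arcs: "arc arc_ccw" "arc arc_cw" using angles R by (auto intro!: arc_part_circlepath)
  have img: "path_image arc_ccw \<subseteq> sphere z R" "path_image arc_cw \<subseteq> sphere z R"
    using sphere_angle_image[OF R] by blast+
  show "simple_path (g +++ arc_ccw)" "simple_path (g +++ arc_cw)"
    using arc_g arcs arc_ends img on_circle by (auto intro!: simple_path_join_loop)
qed

lemma winding_close:
  assumes "w \<notin> path_image g" "w \<notin> sphere z R"
  shows "winding_number (g +++ arc_ccw) w = winding_number g w + winding_number arc_ccw w"
    "winding_number (g +++ arc_cw) w = winding_number g w + winding_number arc_cw w"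
proof -
  have "w \<notin> path_image arc_ccw" "w \<notin> path_image arc_cw"
    using assms(2) sphere_angle_image[OF R, of z] by blast+
  then show "winding_number (g +++ arc_ccw) w = winding_number g w + winding_number arc_ccw w"
    "winding_number (g +++ arc_cw) w = winding_number g w + winding_number arc_cw w"
    using assms(1) arc_imp_path[OF arc_g] arc_ends
    by (auto intro!: winding_number_join simp del: pathstart_part_circlepath pathfinish_part_circlepath)
qed

lemma winding_inside:
  assumes w: "w \<in> ball z R" "w \<notin> path_image g"
  shows "winding_number (g +++ arc_ccw) w \<in> {0, 1}"
    and "winding_number (g +++ arc_ccw) w = winding_number (g +++ arc_cw) w + 1"
proof -
  have ws: "w \<notin> sphere z R" using w by auto
  then show diff: "winding_number (g +++ arc_ccw) w = winding_number (g +++ arc_cw) w + 1"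
    using winding_close[OF w(2)] winding_number_complementary_arcs[OF R w(1), of \<alpha> \<beta>]
    by (simp del: pathstart_part_circlepath pathfinish_part_circlepath)
  have notin: "w \<notin> path_image (g +++ arc_ccw)" "w \<notin> path_image (g +++ arc_cw)"
    using ws w(2) sphere_angle_image[OF R, of z] path_image_join_subset by blast+
  have "winding_number (g +++ arc_ccw) w \<in> {-1, 0, 1}" "winding_number (g +++ arc_cw) w \<in> {-1, 0, 1}"
    using simple_close notin arc_ends by (intro simple_closed_path_winding_number_cases; simp)+
  then show "winding_number (g +++ arc_ccw) w \<in> {0, 1}" using diff by auto
qed

text \<open>The path \<open>f\<close> leads from the point to its exit \<open>c\<close> without
  meeting the curve, and from \<open>c\<close> a radial ray leads away outside the disc. So the
  winding number is that of a far point.\<close>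

lemma winding_zero:
  assumes h: "h = arc_ccw \<or> h = arc_cw"
    and f: "path f" "exits_at f (ball z R) c" "f t \<in> ball z R" "t \<in> {0<..1}" "\<And>s. s \<in> {0<..t} \<Longrightarrow> f s \<in> ball z R"
    and disj: "f ` {0<..1} \<inter> path_image g = {}" and c: "c \<notin> path_image h"
  shows "winding_number (g +++ h) (f t) = 0"
proof -
  obtain t3 where t3: "t3 \<in> {0<..1}" "f t3 = c" "c \<notin> ball z R" "\<And>s. s \<in> {0..<t3} \<Longrightarrow> f s \<in> ball z R"
    using f(2) by (auto simp: exits_at_def)
  have c_sph: "c \<in> sphere z R" using exits_at_frontier[OF f(1,2)] R by simp
  have "t < t3" using t3(1,2,3) f(5)[of t3] by fastforce
  let ?ray = "(\<lambda>s. z + s *\<^sub>R (c - z)) ` {1..}"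
  let ?S = "f ` {0<..t3} \<union> ?ray"
  have conn1: "connected (f ` {0<..t3})"
    using f(1) t3(1) by (intro connected_continuous_image) (auto simp: path_def intro: continuous_on_subset)
  have conn2: "connected ?ray"
    by (intro connected_continuous_image continuous_intros) auto
  have conn: "connected ?S"
  proof (rule connected_Un[OF conn1 conn2])
    have "c \<in> f ` {0<..t3}" using t3 by auto
    moreover have "c \<in> ?ray" by (rule image_eqI[of _ _ 1]) auto
    ultimately show "f ` {0<..t3} \<inter> ?ray \<noteq> {}" by blast
  qed
  have h_img: "path_image h \<subseteq> sphere z R" using h sphere_angle_image[OF R] by blast
  have ends: "pathfinish g = pathstart h" "pathfinish h = pathstart g" "path h"
    using h arc_ends by auto
  have g_img: "path_image g \<subseteq> cball z R"
    using inner start finish R by (force simp: dist_norm norm_mult)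
  have img: "path_image (g +++ h) = path_image g \<union> path_image h"
    using ends by (intro path_image_join) simp
  have ray: "dist z y \<ge> R \<and> (dist z y = R \<longrightarrow> y = c)" if "y \<in> ?ray" for y
  proof -
    from that obtain s where s: "s \<ge> 1" "y = z + s *\<^sub>R (c - z)" by auto
    have "dist z y = s * R" using s c_sph by (simp add: dist_norm norm_minus_commute)
    then show ?thesis using s R by (auto simp: mult_le_cancel_right1)
  qed
  have c_g: "c \<notin> path_image g" using disj t3 by blast
  have disjS: "?S \<inter> path_image (g +++ h) = {}"
  proof -
    have "f s \<notin> path_image h" if "s \<in> {0<..t3}" for s
    proof (cases "s = t3")
      case False
      then have "f s \<in> ball z R" using that t3(4) by auto
      then show ?thesis using h_img by auto
    qed (use c t3 in simp)
    moreover have "f s \<notin> path_image g" if "s \<in> {0<..t3}" for s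
    proof -
      have "f s \<in> f ` {0<..1}" using that t3(1) by auto
      then show ?thesis using disj by blast
    qed
    moreover have "y \<notin> path_image h" "y \<notin> path_image g" if "y \<in> ?ray" for y
      using ray[OF that] h_img g_img c c_g by (fastforce simp: mem_sphere)+
    ultimately show ?thesis unfolding img by blast
  qed
  let ?far = "z + 2 *\<^sub>R (c - z)"
  have far: "?far \<in> ?ray" by (rule image_eqI[of _ _ 2]) auto
  have "winding_number (g +++ h) (f t) = winding_number (g +++ h) ?far"
  proof (rule winding_number_eq)
    show "path (g +++ h)" using ends arc_imp_path[OF arc_g] by simp
    show "pathfinish (g +++ h) = pathstart (g +++ h)" using ends by simp
    show "f t \<in> ?S" using f(4) \<open>t < t3\<close> by auto
    show "?far \<in> ?S" using far by blast
  qed (use conn disjS in auto)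
  also have "\<dots> = 0"
  proof (rule winding_number_zero_outside)
    show "path (g +++ h)" using ends arc_imp_path[OF arc_g] by simp
    show "?far \<notin> cball z R" using c_sph R by (simp add: dist_norm norm_minus_commute)
    show "path_image (g +++ h) \<subseteq> cball z R" unfolding img using g_img h_img by auto
  qed (use ends in auto)
  finally show ?thesis .
qed

text \<open>If \<open>c\<close> is off the counterclockwise arc, closing by that arc gives 0. If it
  is on it, closing by the other arc gives 0, and the two closures differ by 1.\<close>

lemma winding_exit:
  assumes f: "path f" "exits_at f (ball z R) c" "t \<in> {0<..1}" "\<And>s. s \<in> {0<..t} \<Longrightarrow> f s \<in> ball z R"
    and disj: "f ` {0<..1} \<inter> path_image g = {}"
  shows "winding_number (g +++ arc_ccw) (f t) =
    of_bool (Im (cnj (c - pathfinish g) * (pathstart g - pathfinish g)) > 0)"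
proof -
  have c: "c \<in> sphere z R" using exits_at_frontier[OF f(1,2)] R by simp
  have ft: "f t \<in> ball z R" using f(3,4) by auto
  have ftg: "f t \<notin> path_image g" using disj f(3) by blast
  have c_g: "c \<notin> path_image g" using disj f(2) by (auto simp: exits_at_def)
  obtain \<theta> where \<theta>: "\<alpha> \<le> \<theta>" "\<theta> < \<alpha> + 2 * pi" "c = z + R * cis \<theta>"
    using on_circle_angle[OF c R] by blast
  have "\<theta> \<noteq> \<alpha>" "\<theta> \<noteq> \<beta>" using c_g \<theta>(3) start finish pathstart_in_path_image pathfinish_in_path_image by metis+
  then have iff: "Im (cnj (c - pathfinish g) * (pathstart g - pathfinish g)) > 0 \<longleftrightarrow> \<theta> < \<beta>"
    unfolding \<theta>(3) start finish using R \<theta> angles by (intro ccw_on_circle_iff) auto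
  have in_arc: "(\<exists>x. s \<le> x \<and> x \<le> t \<and> c = z + R * cis x)" if "c \<in> path_image (part_circlepath z R s t)" "s \<le> t" for s t
    using that by (auto simp: path_image_part_circlepath cis_conv_exp)
  have unique: "\<exists>n::int. x = \<theta> + 2 * pi * n" if "c = z + R * cis x" for x
  proof -
    have "cis x = cis \<theta>" using that \<theta>(3) R by simp
    then show ?thesis using sin_cos_eq_iff[of x \<theta>] by (auto simp: complex_eq_iff mult_ac)
  qed
  show ?thesis
  proof (cases "\<theta> < \<beta>")
    case True
    have "c \<notin> path_image arc_cw"
    proof
      assume "c \<in> path_image arc_cw"
      then have "c \<in> path_image (part_circlepath z R (\<beta> - 2 * pi) \<alpha>)"
        by (metis path_image_reversepath reversepath_part_circlepath)
      then obtain x where x: "\<beta> - 2 * pi \<le> x" "x \<le> \<alpha>" "c = z + R * cis x"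
        using in_arc[of "\<beta> - 2 * pi" \<alpha>] angles by auto
      obtain n :: int where n: "x = \<theta> + 2 * pi * n" using unique[OF x(3)] by blast
      have "2 * pi * n < 0" "2 * pi * n > - (2 * pi)" using n x True \<theta> \<open>\<theta> \<noteq> \<alpha>\<close> by auto
      then show False by (rule no_multiple_of_2pi)
    qed
    then have "winding_number (g +++ arc_cw) (f t) = 0"
      using winding_zero[OF _ f(1,2) ft f(3,4) disj] by blast
    then show ?thesis using iff True winding_inside[OF ft ftg] by simp
  next
    case False
    have "c \<notin> path_image arc_ccw"
    proof
      assume "c \<in> path_image arc_ccw"
      then obtain x where x: "\<alpha> \<le> x" "x \<le> \<beta>" "c = z + R * cis x"
        using in_arc[of \<alpha> \<beta>] angles by auto
      obtain n :: int where n: "x = \<theta> + 2 * pi * n" using unique[OF x(3)] by blast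
      have "2 * pi * n < 0" "2 * pi * n > - (2 * pi)" using n x False \<theta> \<open>\<theta> \<noteq> \<beta>\<close> by auto
      then show False by (rule no_multiple_of_2pi)
    qed
    then show ?thesis
      using winding_zero[OF _ f(1,2) ft f(3,4) disj] iff False by simp
  qed
qed

end

text \<open>
  The smaller one of the two values of the winding number, \<open>0\<close> or \<open>-1\<close>. The region to the left of \<open>\<gamma>\<close>
  is where the winding number is \<open>low \<gamma> + 1\<close>.
\<close>

definition low :: "(real \<Rightarrow> complex) \<Rightarrow> complex" where
  "low \<gamma> = (if \<exists>w. w \<notin> path_image \<gamma> \<and> winding_number \<gamma> w = -1 then -1 else 0)"

lemma low_cases:
  assumes "simple_path \<gamma>" "pathfinish \<gamma> = pathstart \<gamma>"
  obtains "low \<gamma> = 0" "\<And>w. w \<in> inside (path_image \<gamma>) \<Longrightarrow> winding_number \<gamma> w = 1"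
  | "low \<gamma> = -1" "\<And>w. w \<in> inside (path_image \<gamma>) \<Longrightarrow> winding_number \<gamma> w = -1"
proof -
  have path: "path \<gamma>" using assms(1) by (rule simple_path_imp_path)
  have ne: "inside (path_image \<gamma>) \<noteq> {}" using Jordan_inside_outside[OF assms] by blast
  have out: "winding_number \<gamma> w = 0" if "w \<in> outside (path_image \<gamma>)" for w
    using winding_number_zero_in_outside[OF path assms(2) that] .
  have io: "w \<in> inside (path_image \<gamma>) \<or> w \<in> outside (path_image \<gamma>)" if "w \<notin> path_image \<gamma>" for w
    using that inside_Un_outside[of "path_image \<gamma>"] by blast
  from assms(1) show ?thesis
  proof (rule simple_closed_path_winding_number_inside)
    assume 1: "\<And>w. w \<in> inside (path_image \<gamma>) \<Longrightarrow> winding_number \<gamma> w = 1"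
    have "winding_number \<gamma> w \<noteq> -1" if "w \<notin> path_image \<gamma>" for w
      using io[OF that] 1[of w] out[of w] by auto
    then have "low \<gamma> = 0" by (auto simp: low_def)
    then show ?thesis using 1 that(1) by blast
  next
    assume 1: "\<And>w. w \<in> inside (path_image \<gamma>) \<Longrightarrow> winding_number \<gamma> w = -1"
    obtain w where "w \<in> inside (path_image \<gamma>)" using ne by blast
    then have "w \<notin> path_image \<gamma> \<and> winding_number \<gamma> w = -1"
      using 1 inside_no_overlap[of "path_image \<gamma>"] by blast
    then have "low \<gamma> = -1" by (auto simp: low_def)
    then show ?thesis using 1 that(2) by blast
  qed
qed

section \<open>The side on which a path leaves a simple closed curve\<close>

lemma winding_number_connected_image:
  assumes "path \<gamma>" "pathfinish \<gamma> = pathstart \<gamma>" "path f" "f ` {0<..1} \<inter> path_image \<gamma> = {}"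
    and "s \<in> {0<..1}" "t \<in> {0<..1}"
  shows "winding_number \<gamma> (f s) = winding_number \<gamma> (f t)"
proof (rule winding_number_eq[where S = "f ` {0<..1}"])
  show "connected (f ` {0<..1})"
    using assms(3) by (intro connected_continuous_image) (auto simp: path_def intro: continuous_on_subset)
qed (use assms in auto)

lemma unit_jump:
  fixes x y n :: complex
  assumes "x \<in> {0, 1}" "y \<in> {0, 1}" "0 = y + n"
  shows "1 = x + n \<Longrightarrow> n = 0" "-1 = x + n \<Longrightarrow> n = -1"
  using assms by (auto simp: complex_eq_iff)

text \<open>The curve is a crosscut through its base point closed by a boundary arc, plus the rest
  closed by the same arc reversed. The second part has constant winding number near the base point,
  so only the crosscut decides the side.\<close>

theorem winding_number_side:
  assumes \<gamma>: "simple_path \<gamma>" "pathfinish \<gamma> = pathstart \<gamma>" and R: "R > 0"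
    and p: "pathstart \<gamma> \<in> ball z R"
    and a: "exits_at \<gamma> (ball z R) a" and b: "exits_at (reversepath \<gamma>) (ball z R) b" and ab: "a \<noteq> b"
    and f: "path f" "pathstart f = pathstart \<gamma>" "f ` {0<..1} \<inter> path_image \<gamma> = {}"
    and c: "exits_at f (ball z R) c"
  shows "winding_number \<gamma> (f 1) = of_bool (Im (cnj (c - a) * (b - a)) > 0) + low \<gamma>"
proof -
  have path: "path \<gamma>" using \<gamma>(1) by (rule simple_path_imp_path)
  have inj: "x = y \<or> x = 0 \<and> y = 1 \<or> x = 1 \<and> y = 0" if "\<gamma> x = \<gamma> y" "x \<in> {0..1}" "y \<in> {0..1}" for x y
    using \<gamma>(1) that by (simp add: simple_path_def loop_free_def)
  obtain t1 where t1: "0 < t1" "t1 \<le> 1" "\<gamma> t1 = a" "a \<notin> ball z R" "\<And>s. 0 \<le> s \<Longrightarrow> s < t1 \<Longrightarrow> \<gamma> s \<in> ball z R"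
    using a by (auto simp: exits_at_def)
  obtain t' where t': "0 < t'" "t' \<le> 1" "\<gamma> (1 - t') = b" "b \<notin> ball z R"
    "\<And>s. 0 \<le> s \<Longrightarrow> s < t' \<Longrightarrow> \<gamma> (1 - s) \<in> ball z R"
    using b by (auto simp: exits_at_def reversepath_def)
  define t2 where "t2 = 1 - t'"
  have t2: "0 \<le> t2" "t2 < 1" "\<gamma> t2 = b" "\<And>s. t2 < s \<Longrightarrow> s \<le> 1 \<Longrightarrow> \<gamma> s \<in> ball z R"
    using t' t'(5)[of "1 - s" for s] by (auto simp: t2_def)
  have "t1 < t2"
  proof (rule ccontr)
    assume "\<not> t1 < t2"
    then have "t2 < t1" using t1(3) t2(3) ab by (cases "t1 = t2") auto
    then show False using t1(5)[of t2] t2(1,3) t'(4) by simp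
  qed
  define ga where "ga = subpath 0 t1 \<gamma>"
  define gb where "gb = subpath t2 1 \<gamma>"
  define gm where "gm = subpath t1 t2 \<gamma>"
  \<comment> \<open>The crosscut arrives from \<open>b\<close> along the end of the curve and leaves
    to \<open>a\<close> along its beginning.\<close>
  define g where "g = gb +++ ga"
  have paths: "path ga" "path gb" "path gm"
    unfolding ga_def gb_def gm_def using path t1 t2 \<open>t1 < t2\<close> by (auto intro!: path_subpath)
  have ends: "pathstart ga = pathstart \<gamma>" "pathfinish ga = a" "pathstart gb = b" "pathfinish gb = pathstart \<gamma>"
    "pathstart gm = a" "pathfinish gm = b"
  proof -
    have "\<gamma> 0 = pathstart \<gamma>" "\<gamma> 1 = pathstart \<gamma>"
      using \<gamma>(2) by (simp_all add: pathstart_def pathfinish_def)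
    then show "pathstart ga = pathstart \<gamma>" "pathfinish ga = a" "pathstart gb = b" "pathfinish gb = pathstart \<gamma>"
      "pathstart gm = a" "pathfinish gm = b"
      using t1(3) t2(3) by (simp_all add: ga_def gb_def gm_def)
  qed
  have img: "path_image ga = \<gamma> ` {0..t1}" "path_image gb = \<gamma> ` {t2..1}" "path_image gm = \<gamma> ` {t1..t2}"
    unfolding ga_def gb_def gm_def path_image_subpath using t1 t2 \<open>t1 < t2\<close> by auto
  have g_img: "path_image g = \<gamma> ` {t2..1} \<union> \<gamma> ` {0..t1}"
    unfolding g_def using ends by (subst path_image_join) (simp_all add: img)
  have sub: "path_image g \<subseteq> path_image \<gamma>" "path_image gm \<subseteq> path_image \<gamma>"
    unfolding g_img img using t1 t2 \<open>t1 < t2\<close> by (auto simp: path_image_def)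
  have "arc g"
    unfolding g_def
  proof (rule arc_join)
    show "arc gb" "arc ga"
      unfolding ga_def gb_def using \<gamma>(1) t1 t2 \<open>t1 < t2\<close> by (auto intro!: arc_simple_path_subpath_interior)
    show "pathfinish gb = pathstart ga" using ends by simp
    show "path_image gb \<inter> path_image ga \<subseteq> {pathstart ga}"
    proof
      fix x assume "x \<in> path_image gb \<inter> path_image ga"
      then have "x \<in> \<gamma> ` {t2..1}" "x \<in> \<gamma> ` {0..t1}" by (simp_all add: img)
      then obtain s s' where s: "x = \<gamma> s" "x = \<gamma> s'" "t2 \<le> s" "s \<le> 1" "0 \<le> s'" "s' \<le> t1"
        by (meson atLeastAtMost_iff imageE)
      then have "s' = 0" using inj[of s s'] \<open>t1 < t2\<close> t1 t2 by auto
      then show "x \<in> {pathstart ga}" using s ends by (simp add: pathstart_def)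
    qed
  qed
  have a_sph: "a \<in> sphere z R" and b_sph: "b \<in> sphere z R"
    using exits_at_frontier[OF path a] exits_at_frontier[OF _ b] path R by auto
  obtain \<alpha> where \<alpha>: "a = z + R * cis \<alpha>" using on_circle_angle[OF a_sph R] by metis
  obtain \<beta> where \<beta>: "\<alpha> \<le> \<beta>" "\<beta> < \<alpha> + 2 * pi" "b = z + R * cis \<beta>"
    using on_circle_angle[OF b_sph R] by metis
  have g_ends: "pathstart g = b" "pathfinish g = a" using ends by (simp_all add: g_def)
  interpret crosscut g z R \<alpha> \<beta>
  proof
    show "\<alpha> < \<beta>" using \<beta> \<alpha> ab by (cases "\<alpha> = \<beta>") auto
    show "path_image g - {pathstart g, pathfinish g} \<subseteq> ball z R"
    proof
      fix x assume x: "x \<in> path_image g - {pathstart g, pathfinish g}"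
      then obtain s where s: "x = \<gamma> s" "t2 \<le> s \<and> s \<le> 1 \<or> 0 \<le> s \<and> s \<le> t1"
        by (auto simp: g_img)
      moreover have "s \<noteq> t1" "s \<noteq> t2" using x s(1) t1(3) t2(3) g_ends by auto
      ultimately show "x \<in> ball z R" using t1(5)[of s] t2(4)[of s] by force
    qed
  qed (use R \<open>arc g\<close> \<alpha> \<beta> g_ends in auto)
  define L where "L = gm +++ reversepath arc_ccw"
  have arc_ends': "pathstart arc_ccw = a" "pathfinish arc_ccw = b" using arc_ends g_ends by auto
  note [simp del] = pathstart_part_circlepath pathfinish_part_circlepath reversepath_part_circlepath
  have circ: "path_image arc_ccw \<subseteq> sphere z R" by (rule sphere_angle_image[OF R])
  have L: "path L" "pathfinish L = pathstart L"
    using paths ends arc_ends' by (simp_all add: L_def)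
  have L_img: "path_image L \<subseteq> path_image gm \<union> sphere z R"
    using circ path_image_join_subset[of gm "reversepath arc_ccw"] path_image_reversepath[of arc_ccw]
    unfolding L_def by blast
  have split: "winding_number \<gamma> w = winding_number (g +++ arc_ccw) w + winding_number L w"
    if w: "w \<notin> path_image \<gamma>" "w \<notin> sphere z R" for w
  proof -
    have nw: "w \<notin> path_image ga" "w \<notin> path_image gb" "w \<notin> path_image gm" "w \<notin> path_image arc_ccw" "w \<notin> path_image g"
      using w sub circ ends unfolding g_def by (auto simp: path_image_join)
    have "winding_number gm w + winding_number gb w = winding_number (subpath t1 1 \<gamma>) w"
      unfolding gm_def gb_def using path w(1) t1 t2 by (intro winding_number_subpath_combine) auto
    moreover have "winding_number ga w + winding_number (subpath t1 1 \<gamma>) w = winding_number (subpath 0 1 \<gamma>) w"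
      unfolding ga_def using path w(1) t1 t2 by (intro winding_number_subpath_combine) auto
    moreover have "winding_number g w = winding_number gb w + winding_number ga w"
      unfolding g_def using paths nw ends by (intro winding_number_join) auto
    moreover have "winding_number L w = winding_number gm w + winding_number (reversepath arc_ccw) w"
      unfolding L_def using paths nw ends arc_ends' by (intro winding_number_join) auto
    moreover have "winding_number (reversepath arc_ccw) w = - winding_number arc_ccw w"
      using nw by (intro winding_number_reversepath) auto
    moreover have "x5 = x10 + x7"
      if "x1 + x2 = x3" "x4 + x3 = x5" "x6 = x2 + x4" "x7 = x1 + x8" "x8 = - x9" "x10 = x6 + x9"
      for x1 x2 x3 x4 x5 x6 x7 x8 x9 x10 :: complex
      using that by (auto simp: algebra_simps)
    ultimately show ?thesis
      using winding_close(1)[OF nw(5) w(2)] unfolding subpath_trivial by blast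
  qed
  let ?p = "pathstart \<gamma>"
  have p_gm: "?p \<notin> path_image gm"
  proof
    assume "?p \<in> path_image gm"
    then obtain s where s: "\<gamma> 0 = \<gamma> s" "t1 \<le> s" "s \<le> t2" by (auto simp: img pathstart_def)
    then show False using inj[of 0 s] t1 t2 \<open>t1 < t2\<close> by auto
  qed
  have "open (ball z R - path_image gm)" using paths(3) by (intro open_Diff) (auto intro: closed_path_image)
  moreover have "?p \<in> ball z R - path_image gm" using p p_gm by blast
  ultimately obtain \<epsilon> where \<epsilon>: "\<epsilon> > 0" "ball ?p \<epsilon> \<subseteq> ball z R - path_image gm"
    by (meson open_contains_ball)
  have L_const: "winding_number L w = winding_number L ?p" if "w \<in> ball ?p \<epsilon>" for w
  proof (rule winding_number_eq[OF L])
    show "connected (ball ?p \<epsilon>)" by simp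
    show "ball ?p \<epsilon> \<inter> path_image L = {}" using \<epsilon>(2) L_img by force
  qed (use that \<epsilon> in auto)
  have near: "winding_number \<gamma> w = winding_number (g +++ arc_ccw) w + winding_number L ?p"
    "winding_number (g +++ arc_ccw) w \<in> {0, 1}"
    if "w \<in> ball ?p \<epsilon>" "w \<notin> path_image \<gamma>" for w
  proof -
    have "w \<in> ball z R" using that \<epsilon> by blast
    moreover from this have "w \<notin> sphere z R" by simp
    ultimately show "winding_number \<gamma> w = winding_number (g +++ arc_ccw) w + winding_number L ?p"
      "winding_number (g +++ arc_ccw) w \<in> {0, 1}"
      using split[OF that(2)] L_const[OF that(1)] winding_inside(1)[of w] that(2) sub by auto
  qed
  have p_img: "?p \<in> path_image \<gamma>" by (rule pathstart_in_path_image)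
  have fr: "frontier (inside (path_image \<gamma>)) = path_image \<gamma>" "frontier (outside (path_image \<gamma>)) = path_image \<gamma>"
    using Jordan_inside_outside[OF \<gamma>] by auto
  obtain wi where wi: "wi \<in> inside (path_image \<gamma>)" "wi \<in> ball ?p \<epsilon>"
  proof -
    have "?p \<in> frontier (inside (path_image \<gamma>))" using p_img fr(1) by simp
    then show ?thesis using \<epsilon>(1) that unfolding frontier_straddle by auto
  qed
  obtain wo where wo: "wo \<in> outside (path_image \<gamma>)" "wo \<in> ball ?p \<epsilon>"
  proof -
    have "?p \<in> frontier (outside (path_image \<gamma>))" using p_img fr(2) by simp
    then show ?thesis using \<epsilon>(1) that unfolding frontier_straddle by auto
  qed
  have wi_n: "wi \<notin> path_image \<gamma>" and wo_n: "wo \<notin> path_image \<gamma>"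
    using wi wo inside_no_overlap outside_no_overlap by blast+
  have wo0: "winding_number \<gamma> wo = 0"
    using winding_number_zero_in_outside[OF path \<gamma>(2) wo(1)] .
  \<comment> \<open>Points inside and outside exist arbitrarily close to the base point. Their
    winding numbers differ by one, which uses up both values 0 and 1 of the crosscut term and
    thereby fixes the constant.\<close>
  have N: "winding_number L ?p = low \<gamma>"
    using \<gamma>
  proof (rule low_cases)
    assume "low \<gamma> = 0" "\<And>w. w \<in> inside (path_image \<gamma>) \<Longrightarrow> winding_number \<gamma> w = 1"
    then show ?thesis
      using unit_jump(1)[OF near(2)[OF wi(2) wi_n] near(2)[OF wo(2) wo_n]]
        near(1)[OF wi(2) wi_n] near(1)[OF wo(2) wo_n] wo0 wi(1) by simp
  next
    assume "low \<gamma> = -1" "\<And>w. w \<in> inside (path_image \<gamma>) \<Longrightarrow> winding_number \<gamma> w = -1"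
    then show ?thesis
      using unit_jump(2)[OF near(2)[OF wi(2) wi_n] near(2)[OF wo(2) wo_n]]
        near(1)[OF wi(2) wi_n] near(1)[OF wo(2) wo_n] wo0 wi(1) by simp
  qed
  obtain t where t: "0 < t" "t \<le> 1" "\<And>s. 0 < s \<Longrightarrow> s \<le> t \<Longrightarrow> f s \<in> ball ?p \<epsilon>"
  proof -
    have "continuous_on {0..1} f" using f(1) by (simp add: path_def)
    then obtain d where d: "d > 0" "\<And>x. x \<in> {0..1} \<Longrightarrow> dist x 0 < d \<Longrightarrow> dist (f x) (f 0) < \<epsilon>"
      using \<epsilon>(1) unfolding continuous_on_iff by (metis atLeastAtMost_iff order_refl zero_le_one)
    show ?thesis
    proof (rule that[of "min 1 (d / 2)"])
      fix s assume "0 < s" "s \<le> min 1 (d / 2)"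
      then show "f s \<in> ball ?p \<epsilon>" using d(2)[of s] d(1) f(2) by (simp add: dist_commute pathstart_def)
    qed (use d in auto)
  qed
  have "f t \<in> f ` {0<..1}" using t by auto
  then have ft: "f t \<notin> path_image \<gamma>" using f(3) by blast
  have "winding_number \<gamma> (f 1) = winding_number \<gamma> (f t)"
    using t by (intro winding_number_connected_image[OF path \<gamma>(2) f(1,3)]) auto
  also have "\<dots> = winding_number (g +++ arc_ccw) (f t) + low \<gamma>"
    using near(1)[OF t(3)[OF t(1) order_refl] ft] N by simp
  also have "winding_number (g +++ arc_ccw) (f t) = of_bool (Im (cnj (c - a) * (b - a)) > 0)"
    unfolding g_ends[symmetric]
  proof (rule winding_exit[OF f(1) c])
    show "f s \<in> ball z R" if "s \<in> {0<..t}" for s using t(3)[of s] that \<epsilon>(2) by auto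
    show "f ` {0<..1} \<inter> path_image g = {}" using f(3) sub by blast
  qed (use t in auto)
  finally show ?thesis .
qed

no_notation vec_index (infixl "$" 100)
no_notation fps_nth (infixl "$" 75)

section \<open>Curves on the sphere\<close>

definition pole :: "real ^ 3" where "pole = axis 3 1"

text \<open>
  The sign of the second coordinate makes the projection orientation preserving for the sphere seen
  from outside.
\<close>

definition stereo :: "real ^ 3 \<Rightarrow> complex" where
  "stereo x = Complex (x $ 1) (- (x $ 2)) / of_real (1 - x $ 3)"

lemma sphere_coords: "x \<in> sphere 0 1 \<longleftrightarrow> (x $ 1)\<^sup>2 + (x $ 2)\<^sup>2 + (x $ 3)\<^sup>2 = 1" for x :: "real ^ 3"
  by (simp add: norm_eq_1 inner_vec_def sum_3 power2_eq_square)

lemma inner_coords: "x \<bullet> y = x $ 1 * y $ 1 + x $ 2 * y $ 2 + x $ 3 * y $ 3" for x y :: "real ^ 3"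
  by (simp add: inner_vec_def sum_3)

lemma pole_coords [simp]: "pole $ 1 = 0" "pole $ 2 = 0" "pole $ 3 = 1"
  by (simp_all add: pole_def axis_def)

lemma pole_sphere: "pole \<in> sphere 0 1"
  by (simp add: pole_def)

lemma off_pole:
  assumes "x \<in> sphere 0 1" "x \<noteq> pole"
  shows "x $ 3 < 1"
proof (rule ccontr)
  assume "\<not> x $ 3 < 1"
  then have "1 \<le> x $ 3" by simp
  then have "1 \<le> (x $ 3)\<^sup>2" by (rule one_le_power)
  with assms(1) have "(x $ 1)\<^sup>2 = 0" "(x $ 2)\<^sup>2 = 0" "(x $ 3)\<^sup>2 = 1"
    unfolding sphere_coords using zero_le_power2[of "x $ 1"] zero_le_power2[of "x $ 2"] by linarith+
  then have "x $ 1 = 0" "x $ 2 = 0" "x $ 3 = 1"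
    using \<open>1 \<le> x $ 3\<close> by (auto simp: power2_eq_1_iff)
  then have "x = pole" by (simp add: Finite_Cartesian_Product.vec_eq_iff forall_3)
  then show False using assms(2) by simp
qed

lemma continuous_on_stereo_aux:
  fixes S :: "(real ^ 3) set"
  assumes "\<forall>x\<in>S. complex_of_real (1 - x $ 3) \<noteq> 0"
  shows "continuous_on S (\<lambda>x. (of_real (x $ 1) - \<i> * of_real (x $ 2)) / complex_of_real (1 - x $ 3))"
  by (intro continuous_intros assms)

lemma continuous_on_stereo: "continuous_on (sphere 0 1 - {pole}) stereo"
proof -
  have "stereo = (\<lambda>x. (of_real (x $ 1) - \<i> * of_real (x $ 2)) / of_real (1 - x $ 3))"
    by (simp add: stereo_def fun_eq_iff Complex_eq)
  moreover have "\<forall>x\<in>sphere 0 1 - {pole}. complex_of_real (1 - x $ 3) \<noteq> 0"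
  proof
    fix x assume "x \<in> sphere 0 1 - {pole}"
    then have "x $ 3 < 1" using off_pole by blast
    then show "complex_of_real (1 - x $ 3) \<noteq> 0" unfolding of_real_eq_0_iff by simp
  qed
  ultimately show ?thesis
    using continuous_on_stereo_aux by presburger
qed

lemma stereo_parts: "Re (stereo x) = x $ 1 / (1 - x $ 3)" "Im (stereo x) = - (x $ 2) / (1 - x $ 3)"
  unfolding stereo_def by (simp_all only: Re_divide_of_real Im_divide_of_real complex.sel)

lemma inj_on_stereo: "inj_on stereo (sphere 0 1 - {pole})"
proof (rule inj_onI)
  fix x y assume x: "x \<in> sphere 0 1 - {pole}" and y: "y \<in> sphere 0 1 - {pole}" and eq: "stereo x = stereo y"
  have x3: "x $ 3 < 1" and y3: "y $ 3 < 1" using off_pole x y by auto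
  have nrm: "(Re (stereo v))\<^sup>2 + (Im (stereo v))\<^sup>2 = 2 / (1 - v $ 3) - 1" if "v \<in> sphere 0 1" "v $ 3 < 1" for v
  proof -
    have 1: "(v $ 1)\<^sup>2 + (v $ 2)\<^sup>2 = (1 - v $ 3) * (1 + v $ 3)"
      using that(1) unfolding sphere_coords by (simp add: algebra_simps power2_eq_square)
    have "(Re (stereo v))\<^sup>2 + (Im (stereo v))\<^sup>2 = ((v $ 1)\<^sup>2 + (v $ 2)\<^sup>2) / (1 - v $ 3)\<^sup>2"
      by (simp add: stereo_parts power_divide add_divide_distrib)
    also have "\<dots> = (1 + v $ 3) / (1 - v $ 3)"
      unfolding 1 using that(2) by (simp add: power2_eq_square)
    also have "\<dots> = 2 / (1 - v $ 3) - 1" using that(2) by (simp add: field_simps)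
    finally show ?thesis .
  qed
  have "2 / (1 - x $ 3) = 2 / (1 - y $ 3)" using nrm[of x] nrm[of y] x y x3 y3 eq by auto
  then have 3: "x $ 3 = y $ 3" using x3 y3 by (simp add: field_simps)
  then have "x $ 1 = y $ 1" "x $ 2 = y $ 2"
    using arg_cong[OF eq, of Re] arg_cong[OF eq, of Im] x3 by (auto simp: stereo_parts)
  then show "x = y" using 3 by (simp add: Finite_Cartesian_Product.vec_eq_iff forall_3)
qed

lemma dist_sphere: "x \<in> sphere 0 1 \<Longrightarrow> y \<in> sphere 0 1 \<Longrightarrow> (dist x y)\<^sup>2 = 2 - 2 * (x \<bullet> y)" for x y :: "real ^ 3"
  by (simp add: dist_norm power2_norm_eq_inner inner_diff inner_commute norm_eq_1)

lemma dist_sphere_less: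
  fixes x y :: "real ^ 3"
  assumes "x \<in> sphere 0 1" "y \<in> sphere 0 1" "r > 0"
  shows "dist x y < r \<longleftrightarrow> x \<bullet> y > 1 - r\<^sup>2 / 2"
proof -
  have "dist x y < r \<longleftrightarrow> (dist x y)\<^sup>2 < r\<^sup>2"
    using assms(3) by (auto intro: power_strict_mono power2_less_imp_less)
  also have "\<dots> \<longleftrightarrow> x \<bullet> y > 1 - r\<^sup>2 / 2"
    using dist_sphere[OF assms(1,2)] by auto
  finally show ?thesis .
qed

text \<open>A ball around \<open>p\<close> cuts out the cap of points whose height along
  \<open>p\<close> exceeds \<open>k\<close>, and stereographic projection maps circles to circles.
  The radius bound keeps the pole out of the closed cap, so \<open>k - p $ 3\<close> is positive;
  centre and radius come from completing the square.\<close>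

lemma stereo_ball:
  assumes p: "p \<in> sphere 0 1" and r: "0 < r" "r < dist p pole"
  obtains z R where "R > 0"
    "\<And>x. x \<in> sphere 0 1 - {pole} \<Longrightarrow> stereo x \<in> ball z R \<longleftrightarrow> x \<in> ball p r"
proof -
  define k where "k = 1 - r\<^sup>2 / 2"
  have pole: "pole \<in> sphere 0 1" by (rule pole_sphere)
  have "r\<^sup>2 < (dist p pole)\<^sup>2" using r by (intro power_strict_mono) auto
  then have pk: "p $ 3 < k" using dist_sphere[OF p pole] by (simp add: inner_coords k_def)
  have "dist p pole \<le> 2"
    using dist_triangle[of p pole 0] p pole by simp
  then have "r\<^sup>2 < 2\<^sup>2" using r by (intro power_strict_mono) auto
  then have k1: "k\<^sup>2 < 1" "k < 1" using r(1) by (auto simp: k_def abs_square_less_1 abs_less_iff)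
  define z where "z = Complex (p $ 1 / (k - p $ 3)) (- (p $ 2) / (k - p $ 3))"
  define R where "R = sqrt (1 - k\<^sup>2) / (k - p $ 3)"
  have R: "R > 0" using k1 pk by (simp add: R_def)
  have "stereo x \<in> ball z R \<longleftrightarrow> x \<in> ball p r" if x: "x \<in> sphere 0 1 - {pole}" for x
  proof -
    define s where "s = 1 - x $ 3"
    define d where "d = k - p $ 3"
    have s: "s > 0" using off_pole x by (auto simp: s_def)
    have d: "d > 0" using pk by (simp add: d_def)
    have xs: "(x $ 1)\<^sup>2 + (x $ 2)\<^sup>2 + (x $ 3)\<^sup>2 = 1" and ps: "(p $ 1)\<^sup>2 + (p $ 2)\<^sup>2 + (p $ 3)\<^sup>2 = 1"
      using x p sphere_coords by blast+
    have "stereo x \<in> ball z R \<longleftrightarrow> (dist z (stereo x))\<^sup>2 < R\<^sup>2"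
      using R by (auto intro: power_strict_mono power2_less_imp_less)
    also have "(dist z (stereo x))\<^sup>2 = (p $ 1 / d - x $ 1 / s)\<^sup>2 + (p $ 2 / d - x $ 2 / s)\<^sup>2"
      by (simp add: dist_norm cmod_power2 z_def stereo_parts s_def d_def power2_commute)
    also have "R\<^sup>2 = (1 - k\<^sup>2) / d\<^sup>2" using k1 by (simp add: R_def power_divide d_def)
    also have "(p $ 1 / d - x $ 1 / s)\<^sup>2 + (p $ 2 / d - x $ 2 / s)\<^sup>2 < (1 - k\<^sup>2) / d\<^sup>2 \<longleftrightarrow>
        ((p $ 1 / d - x $ 1 / s)\<^sup>2 + (p $ 2 / d - x $ 2 / s)\<^sup>2) * (d\<^sup>2 * s\<^sup>2) < (1 - k\<^sup>2) / d\<^sup>2 * (d\<^sup>2 * s\<^sup>2)"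
    proof -
      have "0 < d\<^sup>2 * s\<^sup>2" using s d by simp
      then show ?thesis by (rule mult_less_cancel_right_pos[symmetric])
    qed
    also have "((p $ 1 / d - x $ 1 / s)\<^sup>2 + (p $ 2 / d - x $ 2 / s)\<^sup>2) * (d\<^sup>2 * s\<^sup>2) =
        (p $ 1 * s - x $ 1 * d)\<^sup>2 + (p $ 2 * s - x $ 2 * d)\<^sup>2"
    proof -
      have "(a / d - b / s)\<^sup>2 * (d\<^sup>2 * s\<^sup>2) = (a * s - b * d)\<^sup>2" for a b
      proof -
        have "(a / d - b / s) * (d * s) = a * s - b * d" using s d by (simp add: field_simps)
        then show ?thesis by (metis power_mult_distrib)
      qed
      then show ?thesis by (simp add: distrib_right)
    qed
    also have "\<dots> = s\<^sup>2 * (1 - (p $ 3)\<^sup>2) + d\<^sup>2 * (1 - (x $ 3)\<^sup>2) - 2 * s * d * (p $ 1 * x $ 1 + p $ 2 * x $ 2)"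
    proof -
      have "1 - (p $ 3)\<^sup>2 = (p $ 1)\<^sup>2 + (p $ 2)\<^sup>2" "1 - (x $ 3)\<^sup>2 = (x $ 1)\<^sup>2 + (x $ 2)\<^sup>2"
        using xs ps by linarith+
      note e = this
      show ?thesis unfolding e by (simp add: power2_eq_square algebra_simps)
    qed
    also have "(1 - k\<^sup>2) / d\<^sup>2 * (d\<^sup>2 * s\<^sup>2) = (1 - k\<^sup>2) * s\<^sup>2" using d by simp
    also have "s\<^sup>2 * (1 - (p $ 3)\<^sup>2) + d\<^sup>2 * (1 - (x $ 3)\<^sup>2) - 2 * s * d * (p $ 1 * x $ 1 + p $ 2 * x $ 2) <
        (1 - k\<^sup>2) * s\<^sup>2 \<longleftrightarrow> 2 * s * d * (k - p \<bullet> x) < 0"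
    proof -
      have "s\<^sup>2 * (1 - (p $ 3)\<^sup>2) + d\<^sup>2 * (1 - (x $ 3)\<^sup>2) - 2 * s * d * (p $ 1 * x $ 1 + p $ 2 * x $ 2) -
        (1 - k\<^sup>2) * s\<^sup>2 = 2 * s * d * (k - p \<bullet> x)"
        unfolding s_def d_def inner_coords by (simp add: power2_eq_square algebra_simps)
      then show ?thesis by linarith
    qed
    also have "\<dots> \<longleftrightarrow> p \<bullet> x > k" using s d by (auto simp: mult_less_0_iff)
    also have "\<dots> \<longleftrightarrow> x \<in> ball p r" using dist_sphere_less[OF p _ r(1), of x] x by (simp add: k_def)
    finally show ?thesis .
  qed
  then show ?thesis using that R by blast
qed

text \<open>The three points lie in a plane orthogonal to \<open>p\<close>, so the cross product of
  two chords is a multiple of \<open>p\<close>. After clearing positive denominators, the signed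
  area of the projected triangle is that multiple times \<open>k - p $ 3\<close>, up to a positive
  constant.\<close>

lemma stereo_orientation:
  assumes p: "p \<in> sphere 0 1" and r: "0 < r" "r < dist p pole"
    and a: "a \<in> sphere 0 1" "dist p a = r" and b: "b \<in> sphere 0 1" "dist p b = r"
    and c: "c \<in> sphere 0 1" "dist p c = r"
  shows "Im (cnj (stereo c - stereo a) * (stereo b - stereo a)) > 0 \<longleftrightarrow> cross3 (c - a) (b - a) \<bullet> p > 0"
proof -
  define k where "k = 1 - r\<^sup>2 / 2"
  have pole: "pole \<in> sphere 0 1" by (rule pole_sphere)
  have "r\<^sup>2 < (dist p pole)\<^sup>2" using r by (intro power_strict_mono) auto
  then have pk: "p $ 3 < k" using dist_sphere[OF p pole] by (simp add: inner_coords k_def)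
  have ip: "x \<bullet> p = k" if "x \<in> sphere 0 1" "dist p x = r" for x
    using dist_sphere[OF p that(1)] unfolding that(2) k_def inner_commute[of x] by linarith
  have neq: "x \<noteq> pole" if "dist p x = r" for x using that r by auto
  have s: "1 - a $ 3 > 0" "1 - b $ 3 > 0" "1 - c $ 3 > 0"
    using off_pole a b c neq by auto
  define n where "n = cross3 (c - a) (b - a)"
  define l where "l = n \<bullet> p"
  have orth: "(c - a) \<bullet> p = 0" "(b - a) \<bullet> p = 0"
    using ip a b c by (simp_all add: inner_diff_left)
  have n: "n = l *\<^sub>R p"
  proof -
    have "cross3 p (cross3 n p) = (p \<bullet> p) *\<^sub>R n - (p \<bullet> n) *\<^sub>R p"
      by (simp add: Lagrange)
    moreover have "cross3 n p = 0"
    proof -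
      have "cross3 p n = (p \<bullet> (b - a)) *\<^sub>R (c - a) - (p \<bullet> (c - a)) *\<^sub>R (b - a)"
        unfolding n_def by (rule Lagrange)
      then have "cross3 p n = 0" using orth by (simp add: inner_commute)
      then show ?thesis by (metis cross_skew neg_equal_0_iff_equal)
    qed
    moreover have "p \<bullet> p = 1" using p by (simp add: norm_eq_1)
    ultimately show ?thesis by (simp add: l_def inner_commute)
  qed
  have n3: "n $ 3 = l * p $ 3" using n by simp
  have na: "n \<bullet> a = l * k" using n ip[OF a] by (simp add: inner_commute)
  have n_coords: "n $ 1 = (c $ 2 - a $ 2) * (b $ 3 - a $ 3) - (c $ 3 - a $ 3) * (b $ 2 - a $ 2)"
    "n $ 2 = (c $ 3 - a $ 3) * (b $ 1 - a $ 1) - (c $ 1 - a $ 1) * (b $ 3 - a $ 3)"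
    "n $ 3 = (c $ 1 - a $ 1) * (b $ 2 - a $ 2) - (c $ 2 - a $ 2) * (b $ 1 - a $ 1)"
    by (simp_all add: n_def cross3_def algebra_simps)
  have "Im (cnj (stereo c - stereo a) * (stereo b - stereo a)) =
      - ((c $ 1 / (1 - c $ 3) - a $ 1 / (1 - a $ 3)) * (b $ 2 / (1 - b $ 3) - a $ 2 / (1 - a $ 3)) -
        (c $ 2 / (1 - c $ 3) - a $ 2 / (1 - a $ 3)) * (b $ 1 / (1 - b $ 3) - a $ 1 / (1 - a $ 3)))"
    by (simp add: stereo_parts algebra_simps)
  also have "\<dots> * ((1 - a $ 3) * (1 - b $ 3) * (1 - c $ 3)) = n \<bullet> a - n $ 3"
  proof -
    define A B C where "A = 1 - a $ 3" and "B = 1 - b $ 3" and "C = 1 - c $ 3"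
    have pos: "A \<noteq> 0" "B \<noteq> 0" "C \<noteq> 0" using s by (auto simp: A_def B_def C_def)
    have "- ((c1 / C - a1 / A) * (b2 / B - a2 / A) - (c2 / C - a2 / A) * (b1 / B - a1 / A)) * (A * B * C) =
        - (c1 * b2 * A - c1 * a2 * B - a1 * b2 * C - c2 * b1 * A + c2 * a1 * B + a2 * b1 * C)"
      for a1 a2 b1 b2 c1 c2
      using pos by (simp add: field_simps)
    then have "- ((c $ 1 / C - a $ 1 / A) * (b $ 2 / B - a $ 2 / A) - (c $ 2 / C - a $ 2 / A) * (b $ 1 / B - a $ 1 / A)) * (A * B * C) =
        - (c $ 1 * b $ 2 * A - c $ 1 * a $ 2 * B - a $ 1 * b $ 2 * C - c $ 2 * b $ 1 * A + c $ 2 * a $ 1 * B + a $ 2 * b $ 1 * C)" .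
    also have "\<dots> = n \<bullet> a - n $ 3"
      unfolding inner_coords n_coords A_def B_def C_def by (simp add: algebra_simps)
    finally show ?thesis unfolding A_def B_def C_def .
  qed
  finally have "Im (cnj (stereo c - stereo a) * (stereo b - stereo a)) *
      ((1 - a $ 3) * (1 - b $ 3) * (1 - c $ 3)) = l * (k - p $ 3)"
    unfolding na n3 by (simp add: algebra_simps)
  moreover have "0 < (1 - a $ 3) * (1 - b $ 3) * (1 - c $ 3)" "0 < k - p $ 3"
    using s pk by simp_all
  ultimately have "Im (cnj (stereo c - stereo a) * (stereo b - stereo a)) > 0 \<longleftrightarrow> l > 0"
    by (metis zero_less_mult_pos zero_less_mult_pos2 mult_pos_pos)
  then show ?thesis by (simp add: l_def n_def)
qed

section \<open>Projection from an arbitrary point of the sphere\<close>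

definition rot_to_pole :: "real ^ 3 \<Rightarrow> real ^ 3 \<Rightarrow> real ^ 3" where
  "rot_to_pole q = (SOME f. orthogonal_transformation f \<and> Determinants.det (matrix f) = 1 \<and> f q = pole)"

definition stereo_from :: "real ^ 3 \<Rightarrow> real ^ 3 \<Rightarrow> complex" where
  "stereo_from q = stereo \<circ> rot_to_pole q"

context
  fixes q :: "real ^ 3"
  assumes q: "q \<in> sphere 0 1"
begin

lemma rot_to_pole: "orthogonal_transformation (rot_to_pole q)" "Determinants.det (matrix (rot_to_pole q)) = 1"
  "rot_to_pole q q = pole"
proof -
  have "norm q = norm pole" using q pole_sphere by simp
  then obtain f where "orthogonal_transformation f" "Determinants.det (matrix f) = 1" "f q = pole"
    using rotation_exists[of q pole] by auto
  then have "\<exists>f. orthogonal_transformation f \<and> Determinants.det (matrix f) = 1 \<and> f q = pole" by blast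
  from someI_ex[OF this] show "orthogonal_transformation (rot_to_pole q)" "Determinants.det (matrix (rot_to_pole q)) = 1"
    "rot_to_pole q q = pole"
    by (simp_all add: rot_to_pole_def)
qed

lemma rot_linear: "linear (rot_to_pole q)"
  using rot_to_pole(1) by (simp add: orthogonal_transformation)

lemma rot_norm: "norm (rot_to_pole q x) = norm x"
  using rot_to_pole(1) by (simp add: orthogonal_transformation)

lemma rot_dist: "dist (rot_to_pole q x) (rot_to_pole q y) = dist x y"
  by (simp add: dist_norm rot_norm flip: linear_diff[OF rot_linear])

lemma rot_inner: "rot_to_pole q x \<bullet> rot_to_pole q y = x \<bullet> y"
  using rot_to_pole(1) by (simp add: orthogonal_transformation_def)

text \<open>This is where determinant 1 enters: the rotation to the pole must preserve
  orientation.\<close>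

lemma rot_cross: "cross3 (rot_to_pole q x) (rot_to_pole q y) = rot_to_pole q (cross3 x y)"
  using rot_to_pole(2) by (intro cross_linear_image rot_linear rot_norm)

lemma rot_off_pole:
  assumes "x \<in> sphere 0 1 - {q}"
  shows "rot_to_pole q x \<in> sphere 0 1 - {pole}"
proof -
  have "dist (rot_to_pole q x) pole = dist x q" using rot_dist[of x q] by (simp only: rot_to_pole(3))
  then have "rot_to_pole q x \<noteq> pole" using assms by auto
  moreover have "rot_to_pole q x \<in> sphere 0 1" using assms by (simp add: rot_norm)
  ultimately show ?thesis by blast
qed

lemma continuous_on_stereo_from: "continuous_on (sphere 0 1 - {q}) (stereo_from q)"
  unfolding stereo_from_def
proof (rule continuous_on_compose)
  show "continuous_on (sphere 0 1 - {q}) (rot_to_pole q)"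
    by (rule linear_continuous_on[OF linear_conv_bounded_linear[THEN iffD1, OF rot_linear]])
  show "continuous_on (rot_to_pole q ` (sphere 0 1 - {q})) stereo"
    by (rule continuous_on_subset[OF continuous_on_stereo], rule image_subsetI, rule rot_off_pole)
qed

lemma inj_on_stereo_from: "inj_on (stereo_from q) (sphere 0 1 - {q})"
proof (rule inj_onI)
  fix x y assume xy: "x \<in> sphere 0 1 - {q}" "y \<in> sphere 0 1 - {q}" "stereo_from q x = stereo_from q y"
  have "stereo (rot_to_pole q x) = stereo (rot_to_pole q y)"
    using xy(3) by (simp add: stereo_from_def)
  then have "rot_to_pole q x = rot_to_pole q y"
    by (rule inj_onD[OF inj_on_stereo _ rot_off_pole[OF xy(1)] rot_off_pole[OF xy(2)]])
  then show "x = y" using rot_dist[of x y] by simp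
qed

lemma stereo_from_ball:
  assumes p: "p \<in> sphere 0 1" and r: "0 < r" "r < dist p q"
  obtains z R where "R > 0"
    "\<And>x. x \<in> sphere 0 1 - {q} \<Longrightarrow> stereo_from q x \<in> ball z R \<longleftrightarrow> x \<in> ball p r"
proof -
  have "r < dist (rot_to_pole q p) pole" using r(2) rot_dist[of p q] rot_to_pole(3) by simp
  moreover have "rot_to_pole q p \<in> sphere 0 1" using p rot_norm by simp
  ultimately obtain z R where zR: "R > 0"
    "\<And>x. x \<in> sphere 0 1 - {pole} \<Longrightarrow> stereo x \<in> ball z R \<longleftrightarrow> x \<in> ball (rot_to_pole q p) r"
    using stereo_ball[of "rot_to_pole q p" r] r(1) by metis
  show ?thesis
  proof (rule that[OF zR(1)])
    fix x assume "x \<in> sphere 0 1 - {q}"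
    from zR(2)[OF rot_off_pole[OF this]] show "stereo_from q x \<in> ball z R \<longleftrightarrow> x \<in> ball p r"
      by (simp add: stereo_from_def rot_dist)
  qed
qed

lemma stereo_from_orientation:
  assumes p: "p \<in> sphere 0 1" and r: "0 < r" "r < dist p q"
    and a: "a \<in> sphere 0 1" "dist p a = r" and b: "b \<in> sphere 0 1" "dist p b = r"
    and c: "c \<in> sphere 0 1" "dist p c = r"
  shows "Im (cnj (stereo_from q c - stereo_from q a) * (stereo_from q b - stereo_from q a)) > 0 \<longleftrightarrow>
    cross3 (c - a) (b - a) \<bullet> p > 0"
proof -
  let ?T = "rot_to_pole q"
  have "Im (cnj (stereo (?T c) - stereo (?T a)) * (stereo (?T b) - stereo (?T a))) > 0 \<longleftrightarrow>
      cross3 (?T c - ?T a) (?T b - ?T a) \<bullet> ?T p > 0"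
  proof (rule stereo_orientation)
    show "r < dist (?T p) pole" using r(2) rot_dist[of p q] rot_to_pole(3) by simp
  qed (use assms in \<open>simp_all add: rot_norm rot_dist\<close>)
  then show ?thesis
    by (simp add: stereo_from_def rot_cross rot_inner flip: linear_diff[OF rot_linear])
qed

end

section \<open>First exits and sides on the sphere\<close>

lemma exits_at_comp:
  assumes "exits_at g U x" "\<And>y. y \<in> path_image g \<Longrightarrow> h y \<in> V \<longleftrightarrow> y \<in> U"
  shows "exits_at (h \<circ> g) V (h x)"
proof -
  obtain t where t: "t \<in> {0<..1}" "g t = x" "x \<notin> U" "\<forall>s\<in>{0..<t}. g s \<in> U"
    using assms(1) by (auto simp: exits_at_def)
  have "g s \<in> path_image g" if "0 \<le> s" "s \<le> 1" for s using that by (auto simp: path_image_def)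
  then show ?thesis
    using t assms(2) unfolding exits_at_def by (intro bexI[of _ t]) auto
qed

lemma exits_at_join:
  assumes "exits_at g1 U x"
  shows "exits_at (g1 +++ g2) U x"
proof -
  obtain t where t: "t \<in> {0<..1}" "g1 t = x" "x \<notin> U" "\<forall>s\<in>{0..<t}. g1 s \<in> U"
    using assms by (auto simp: exits_at_def)
  then show ?thesis
    unfolding exits_at_def by (intro bexI[of _ "t / 2"]) (auto simp: joinpaths_def)
qed

lemma exits_at_subpath:
  assumes "0 < t" "t \<le> u" "u \<le> 1" "g t = x" "x \<notin> U" "\<And>s. 0 \<le> s \<Longrightarrow> s < t \<Longrightarrow> g s \<in> U"
  shows "exits_at (subpath 0 u g) U x"
  using assms unfolding exits_at_def
  by (intro bexI[of _ "t / u"]) (auto simp: subpath_def field_simps)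

text \<open>The times at distance \<open>r\<close> form a closed set, nonempty by the intermediate
  value theorem, so the infimum in the definition is attained. Before it the distance stays below
  \<open>r\<close>, by the same theorem.\<close>

lemma first_exit:
  fixes g :: "real \<Rightarrow> 'a::metric_space"
  assumes "path g" "0 < r" "0 < t0" "t0 \<le> 1" "r < dist (pathstart g) (g t0)"
  obtains t where "0 < t" "t < t0" "g t = first_exit g r" "dist (pathstart g) (g t) = r"
    "\<And>s. 0 \<le> s \<Longrightarrow> s < t \<Longrightarrow> g s \<in> ball (pathstart g) r"
proof -
  define d where "d t = dist (pathstart g) (g t)" for t
  define S where "S = {t \<in> {0..1}. d t = r}"
  have cont: "continuous_on {0..1} d"
    using assms(1) unfolding d_def path_def by (intro continuous_intros)
  have d0: "d 0 = 0" by (simp add: d_def pathstart_def)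
  have ivt: "\<exists>s. 0 \<le> s \<and> s \<le> t \<and> d s = r" if "0 \<le> t" "t \<le> 1" "r \<le> d t" for t
    using IVT'[of d 0 r t] d0 assms(2) that continuous_on_subset[OF cont, of "{0..t}"] by auto
  have "r \<le> d t0" using assms(5) by (simp add: d_def)
  then obtain s0 where "0 \<le> s0" "s0 \<le> t0" "d s0 = r" using ivt[of t0] assms(3,4) by auto
  then have "s0 \<in> S" using assms(4) by (simp add: S_def)
  then have "S \<noteq> {}" by blast
  moreover have "closed S"
  proof -
    have "closed ({0..1} \<inter> d -` {r})" by (rule continuous_closed_preimage[OF cont]) auto
    moreover have "{0..1} \<inter> d -` {r} = S" by (auto simp: S_def)
    ultimately show ?thesis by simp
  qed
  moreover have bdd: "bdd_below S" by (auto simp: S_def intro: bdd_belowI[of _ 0])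
  ultimately have inS: "Inf S \<in> S" by (intro closed_contains_Inf)
  define t where "t = Inf S"
  have t: "0 \<le> t" "t \<le> 1" "d t = r" using inS by (auto simp: S_def t_def)
  have less: "d s < r" if s: "0 \<le> s" "s < t" for s
  proof (rule ccontr)
    assume "\<not> d s < r"
    then obtain s' where "0 \<le> s'" "s' \<le> s" "d s' = r" using ivt[of s] s t by auto
    then have "s' \<in> S" using s t by (auto simp: S_def)
    then have "t \<le> s'" unfolding t_def using bdd by (rule cInf_lower)
    then show False using \<open>s' \<le> s\<close> s by simp
  qed
  have "t < t0"
  proof (rule ccontr)
    assume "\<not> t < t0"
    then have "d t0 \<le> r" using less[of t0] t assms(3) by (cases "t = t0") auto
    then show False using assms(5) by (simp add: d_def)
  qed
  moreover have "t > 0" using t d0 assms(2) by (cases "t = 0") auto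
  moreover have "g t = first_exit g r" by (simp add: first_exit_def t_def S_def d_def)
  ultimately show ?thesis using that[of t] t(3) less by (simp add: d_def)
qed

text \<open>The planar theorem after projection from a point off the curve and the path; the
  orientation tests agree by \<open>stereo_from_orientation\<close>.\<close>

theorem sphere_side:
  assumes q: "q \<in> sphere 0 1"
    and \<gamma>: "simple_path \<gamma>" "pathfinish \<gamma> = pathstart \<gamma>" "path_image \<gamma> \<subseteq> sphere 0 1 - {q}"
    and r: "0 < r" "r < dist (pathstart \<gamma>) q"
    and a: "exits_at \<gamma> (ball (pathstart \<gamma>) r) a" and b: "exits_at (reversepath \<gamma>) (ball (pathstart \<gamma>) r) b"
    and ab: "a \<noteq> b"
    and f: "path f" "pathstart f = pathstart \<gamma>" "f ` {0<..1} \<inter> path_image \<gamma> = {}"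
      "path_image f \<subseteq> sphere 0 1 - {q}"
    and c: "exits_at f (ball (pathstart \<gamma>) r) c"
  shows "winding_number (stereo_from q \<circ> \<gamma>) (stereo_from q (f 1)) =
    of_bool (cross3 (c - a) (b - a) \<bullet> pathstart \<gamma> > 0) + low (stereo_from q \<circ> \<gamma>)"
proof -
  let ?\<pi> = "stereo_from q" and ?p = "pathstart \<gamma>"
  have p: "?p \<in> sphere 0 1" "?p \<in> sphere 0 1 - {q}" using \<gamma>(3) pathstart_in_path_image by blast+
  obtain z R where R: "R > 0" "\<And>x. x \<in> sphere 0 1 - {q} \<Longrightarrow> ?\<pi> x \<in> ball z R \<longleftrightarrow> x \<in> ball ?p r"
    using stereo_from_ball[OF q p(1) r] by metis
  have path: "path \<gamma>" using \<gamma>(1) by (rule simple_path_imp_path)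
  have cont: "continuous_on S ?\<pi>" if "S \<subseteq> sphere 0 1 - {q}" for S
    using continuous_on_stereo_from[OF q] that by (rule continuous_on_subset)
  have inj: "inj_on ?\<pi> S" if "S \<subseteq> sphere 0 1 - {q}" for S
    using inj_on_stereo_from[OF q] that by (rule inj_on_subset)
  have exits: "exits_at (?\<pi> \<circ> h) (ball z R) (?\<pi> x)"
    if "exits_at h (ball ?p r) x" "path_image h \<subseteq> sphere 0 1 - {q}" for h x
    by (rule exits_at_comp[OF that(1)]) (use that(2) R(2) in blast)
  have on: "x \<in> path_image h" "dist ?p x = r"
    if "exits_at h (ball ?p r) x" "path h" for h x
  proof -
    show "x \<in> path_image h" using that(1) by (auto simp: exits_at_def path_image_def)
    have "x \<in> frontier (ball ?p r)" using exits_at_frontier[OF that(2,1)] by simp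
    then show "dist ?p x = r" using r by simp
  qed
  have rev: "path_image (reversepath \<gamma>) \<subseteq> sphere 0 1 - {q}" "path (reversepath \<gamma>)"
    using \<gamma>(3) path by simp_all
  note oa = on[OF a path] and ob = on[OF b rev(2)] and oc = on[OF c f(1)]
  have abc: "a \<in> sphere 0 1 - {q}" "b \<in> sphere 0 1 - {q}" "c \<in> sphere 0 1 - {q}"
    using oa(1) ob(1) oc(1) \<gamma>(3) rev(1) f(4) by blast+
  have "winding_number (?\<pi> \<circ> \<gamma>) ((?\<pi> \<circ> f) 1) =
      of_bool (Im (cnj (?\<pi> c - ?\<pi> a) * (?\<pi> b - ?\<pi> a)) > 0) + low (?\<pi> \<circ> \<gamma>)"
  proof (rule winding_number_side[OF _ _ R(1)])
    show "simple_path (?\<pi> \<circ> \<gamma>)"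
      by (rule simple_path_continuous_image[OF \<gamma>(1) cont[OF \<gamma>(3)] inj[OF \<gamma>(3)]])
    show "pathfinish (?\<pi> \<circ> \<gamma>) = pathstart (?\<pi> \<circ> \<gamma>)" using \<gamma>(2) by (simp add: pathstart_compose pathfinish_compose)
    show "pathstart (?\<pi> \<circ> \<gamma>) \<in> ball z R" using R(2)[OF p(2)] r by (simp add: pathstart_compose)
    show "exits_at (?\<pi> \<circ> \<gamma>) (ball z R) (?\<pi> a)" using exits[OF a \<gamma>(3)] .
    show "exits_at (reversepath (?\<pi> \<circ> \<gamma>)) (ball z R) (?\<pi> b)"
      using exits[OF b rev(1)] by (simp add: path_compose_reversepath)
    show "?\<pi> a \<noteq> ?\<pi> b" using inj_onD[OF inj_on_stereo_from[OF q]] abc ab by blast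
    show "path (?\<pi> \<circ> f)" using f(1) cont[OF f(4)] by (rule path_continuous_image)
    show "pathstart (?\<pi> \<circ> f) = pathstart (?\<pi> \<circ> \<gamma>)" using f(2) by (simp add: pathstart_compose)
    show "(?\<pi> \<circ> f) ` {0<..1} \<inter> path_image (?\<pi> \<circ> \<gamma>) = {}"
    proof -
      have "f ` {0<..1} \<subseteq> path_image f" by (auto simp: path_image_def)
      then have "?\<pi> ` (f ` {0<..1}) \<inter> ?\<pi> ` path_image \<gamma> = ?\<pi> ` (f ` {0<..1} \<inter> path_image \<gamma>)"
        using f(4) \<gamma>(3) by (intro inj_on_image_Int[OF inj_on_stereo_from[OF q], symmetric]) auto
      then show ?thesis using f(3) by (simp add: path_image_compose image_comp)
    qed
    show "exits_at (?\<pi> \<circ> f) (ball z R) (?\<pi> c)" using exits[OF c f(4)] .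
  qed
  also have "Im (cnj (?\<pi> c - ?\<pi> a) * (?\<pi> b - ?\<pi> a)) > 0 \<longleftrightarrow> cross3 (c - a) (b - a) \<bullet> ?p > 0"
    using abc oa(2) ob(2) oc(2) by (intro stereo_from_orientation[OF q p(1) r]) auto
  finally show ?thesis unfolding comp_apply .
qed

lemma circle_orientation_total:
  assumes "a \<in> sphere z R" "b \<in> sphere z R" "c \<in> sphere z R" "R > 0" "a \<noteq> b" "a \<noteq> c" "b \<noteq> c"
  shows "Im (cnj (c - a) * (b - a)) > 0 \<or> Im (cnj (b - a) * (c - a)) > 0"
proof -
  obtain \<alpha> where \<alpha>: "a = z + R * cis \<alpha>" using on_circle_angle[OF assms(1,4)] by metis
  obtain \<beta> where \<beta>: "\<alpha> \<le> \<beta>" "\<beta> < \<alpha> + 2 * pi" "b = z + R * cis \<beta>"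
    using on_circle_angle[OF assms(2,4)] by metis
  obtain \<theta> where \<theta>: "\<alpha> \<le> \<theta>" "\<theta> < \<alpha> + 2 * pi" "c = z + R * cis \<theta>"
    using on_circle_angle[OF assms(3,4)] by metis
  have "\<alpha> \<noteq> \<beta>" "\<alpha> \<noteq> \<theta>" "\<beta> \<noteq> \<theta>" using \<alpha> \<beta>(3) \<theta>(3) assms by auto
  then have "Im (cnj (c - a) * (b - a)) > 0 \<longleftrightarrow> \<theta> < \<beta>" "Im (cnj (b - a) * (c - a)) > 0 \<longleftrightarrow> \<beta> < \<theta>"
    unfolding \<alpha> \<beta>(3) \<theta>(3) using \<beta> \<theta> assms(4) by (intro ccw_on_circle_iff; simp)+
  then show ?thesis using \<open>\<beta> \<noteq> \<theta>\<close> by auto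
qed

text \<open>The quantity whose sign for small \<open>r\<close> is tested in
  \<open>ccw_triple\<close>.\<close>

definition exit_triple :: "(real \<Rightarrow> real ^ 3) \<Rightarrow> (real \<Rightarrow> real ^ 3) \<Rightarrow> (real \<Rightarrow> real ^ 3) \<Rightarrow> real \<Rightarrow> real" where
  "exit_triple g1 g2 g3 r =
     cross3 (first_exit g2 r - first_exit g1 r) (first_exit g3 r - first_exit g1 r) \<bullet> pathstart g1"

lemma exit_triple_swap: "exit_triple g1 g3 g2 r = - exit_triple g1 g2 g3 r"
  unfolding exit_triple_def by (subst cross_skew) simp

lemma exit_triple_rotate:
  assumes "pathstart g2 = pathstart g1"
  shows "exit_triple g2 g3 g1 r = exit_triple g1 g2 g3 r"
proof -
  have "cross3 (y - x) (z - x) = cross3 (z - y) (x - y)" for x y z :: "real ^ 3"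
    by (simp add: Finite_Cartesian_Product.vec_eq_iff forall_3 cross_components algebra_simps)
  then show ?thesis unfolding exit_triple_def assms by metis
qed

text \<open>
  The arcs of \<open>g\<^sub>1\<close> and \<open>g\<^sub>2\<close> up to their exits from the disc of radius \<open>\<delta>\<close> are closed up by an arc of
  its boundary. The winding number around a point of \<open>g\<^sub>3\<close> inside that disc does not depend on \<open>r\<close>, and by
  the theorem on the sides of a curve it determines the orientation of the exits from every disc of radius \<open>r\<close>.
\<close>

lemma exit_triple_total:
  fixes g1 g2 g3 :: "real \<Rightarrow> real ^ 3"
  assumes q: "q \<in> sphere 0 1"
    and path: "path g1" "path g2" "path g3"
    and sph: "path_image g1 \<subseteq> sphere 0 1 - {q}" "path_image g2 \<subseteq> sphere 0 1 - {q}" "path_image g3 \<subseteq> sphere 0 1 - {q}"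
    and start: "pathstart g1 = p" "pathstart g2 = p" "pathstart g3 = p"
    and inj: "inj_on g1 {0..<1/2}" "inj_on g2 {0..<1/2}" "inj_on g3 {0..<1/2}"
    and disj: "g1 ` {0<..<1/2} \<inter> g2 ` {0<..<1/2} = {}" "g1 ` {0<..<1/2} \<inter> g3 ` {0<..<1/2} = {}"
      "g2 ` {0<..<1/2} \<inter> g3 ` {0<..<1/2} = {}"
    and \<delta>: "0 < \<delta>" "\<delta> < dist p q" "\<delta> < dist p (g1 (1/2))" "\<delta> < dist p (g2 (1/2))" "\<delta> < dist p (g3 (1/2))"
  shows "(\<forall>r\<in>{0<..<\<delta>}. exit_triple g1 g2 g3 r > 0) \<or> (\<forall>r\<in>{0<..<\<delta>}. exit_triple g1 g3 g2 r > 0)"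
proof -
  let ?\<pi> = "stereo_from q"
  have g0: "g1 0 = p" "g2 0 = p" "g3 0 = p" using start by (simp_all add: pathstart_def)
  have on1: "g1 s \<in> sphere 0 1 - {q}" and on2: "g2 s \<in> sphere 0 1 - {q}" and on3: "g3 s \<in> sphere 0 1 - {q}"
    if "0 \<le> s" "s \<le> 1" for s
  proof -
    have "g s \<in> path_image g" for g :: "real \<Rightarrow> real ^ 3" using that by (auto simp: path_image_def)
    then show "g1 s \<in> sphere 0 1 - {q}" "g2 s \<in> sphere 0 1 - {q}" "g3 s \<in> sphere 0 1 - {q}"
      using sph by blast+
  qed
  have p: "p \<in> sphere 0 1" using on1[of 0] g0 by simp
  have \<pi>_inj: "x = y" if "?\<pi> x = ?\<pi> y" "x \<in> sphere 0 1 - {q}" "y \<in> sphere 0 1 - {q}" for x y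
    using inj_onD[OF inj_on_stereo_from[OF q]] that by blast
  define G1 G2 G3 where "G1 = ?\<pi> \<circ> g1" and "G2 = ?\<pi> \<circ> g2" and "G3 = ?\<pi> \<circ> g3"
  note G = G1_def G2_def G3_def
  have Gpath: "path G1" "path G2" "path G3"
    unfolding G using path sph continuous_on_stereo_from[OF q]
    by (auto intro!: path_continuous_image intro: continuous_on_subset)
  obtain T1 where T1: "0 < T1" "T1 < 1/2" "dist p (g1 T1) = \<delta>" "\<And>s. 0 \<le> s \<Longrightarrow> s < T1 \<Longrightarrow> g1 s \<in> ball p \<delta>"
    "g1 T1 = first_exit g1 \<delta>"
    using first_exit[OF path(1) \<delta>(1), of "1/2"] \<delta>(3) start(1) by auto
  obtain T2 where T2: "0 < T2" "T2 < 1/2" "dist p (g2 T2) = \<delta>" "\<And>s. 0 \<le> s \<Longrightarrow> s < T2 \<Longrightarrow> g2 s \<in> ball p \<delta>"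
    "g2 T2 = first_exit g2 \<delta>"
    using first_exit[OF path(2) \<delta>(1), of "1/2"] \<delta>(4) start(2) by auto
  obtain T3 where T3: "0 < T3" "T3 < 1/2" "dist p (g3 T3) = \<delta>" "\<And>s. 0 \<le> s \<Longrightarrow> s < T3 \<Longrightarrow> g3 s \<in> ball p \<delta>"
    "g3 T3 = first_exit g3 \<delta>"
    using first_exit[OF path(3) \<delta>(1), of "1/2"] \<delta>(5) start(3) by auto
  obtain z0 R0 where R0: "R0 > 0" "\<And>x. x \<in> sphere 0 1 - {q} \<Longrightarrow> ?\<pi> x \<in> ball z0 R0 \<longleftrightarrow> x \<in> ball p \<delta>"
    using stereo_from_ball[OF q p \<delta>(1,2)] by metis
  have in1: "G1 s \<in> ball z0 R0" if "0 \<le> s" "s < T1" for s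
    using R0(2)[OF on1[of s]] T1 that by (simp add: G)
  have in2: "G2 s \<in> ball z0 R0" if "0 \<le> s" "s < T2" for s
    using R0(2)[OF on2[of s]] T2 that by (simp add: G)
  have in3: "G3 s \<in> ball z0 R0" if "0 \<le> s" "s < T3" for s
    using R0(2)[OF on3[of s]] T3 that by (simp add: G)
  have out: "G1 T1 \<notin> ball z0 R0" "G2 T2 \<notin> ball z0 R0"
    using R0(2)[OF on1[of T1]] R0(2)[OF on2[of T2]] T1 T2 by (simp_all add: G)
  have ne12: "G1 s \<noteq> G2 s'" if "0 < s" "s < 1/2" "0 < s'" "s' < 1/2" for s s'
    using \<pi>_inj[of "g1 s" "g2 s'"] on1[of s] on2[of s'] disj(1) that by (fastforce simp: G)
  have ne13: "G1 s \<noteq> G3 s'" if "0 < s" "s < 1/2" "0 < s'" "s' < 1/2" for s s'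
    using \<pi>_inj[of "g1 s" "g3 s'"] on1[of s] on3[of s'] disj(2) that by (fastforce simp: G)
  have ne23: "G2 s \<noteq> G3 s'" if "0 < s" "s < 1/2" "0 < s'" "s' < 1/2" for s s'
    using \<pi>_inj[of "g2 s" "g3 s'"] on2[of s] on3[of s'] disj(3) that by (fastforce simp: G)
  have G0: "G1 0 = ?\<pi> p" "G2 0 = ?\<pi> p" "G3 0 = ?\<pi> p" by (simp_all add: G g0)
  have Ginj1: "inj_on G1 {0..<1/2}" and Ginj2: "inj_on G2 {0..<1/2}" and Ginj3: "inj_on G3 {0..<1/2}"
  proof -
    have *: "inj_on (?\<pi> \<circ> g) {0..<1/2}" if "inj_on g {0..<1/2}" "path_image g \<subseteq> sphere 0 1 - {q}" for g
    proof (rule comp_inj_on[OF that(1)])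
      have "g ` {0..<1/2} \<subseteq> path_image g" unfolding path_image_def by (rule image_mono) auto
      then have "g ` {0..<1/2} \<subseteq> sphere 0 1 - {q}" using that(2) by (rule subset_trans)
      then show "inj_on ?\<pi> (g ` {0..<1/2})" by (rule inj_on_subset[OF inj_on_stereo_from[OF q]])
    qed
    show "inj_on G1 {0..<1/2}" "inj_on G2 {0..<1/2}" "inj_on G3 {0..<1/2}"
      unfolding G by (rule *[OF inj(1) sph(1)], rule *[OF inj(2) sph(2)], rule *[OF inj(3) sph(3)])
  qed
  define A where "A = subpath 0 T1 G1"
  define B where "B = subpath 0 T2 G2"
  have sph_ends: "G1 T1 \<in> sphere z0 R0" "G2 T2 \<in> sphere z0 R0"
  proof -
    have "exits_at A (ball z0 R0) (G1 T1)" "exits_at B (ball z0 R0) (G2 T2)"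
      unfolding A_def B_def
      by (rule exits_at_subpath[of T1 T1], use T1 in1 out in auto)
        (rule exits_at_subpath[of T2 T2], use T2 in2 out in auto)
    moreover have "path A" "path B" unfolding A_def B_def using Gpath T1 T2 by (auto intro!: path_subpath)
    ultimately show "G1 T1 \<in> sphere z0 R0" "G2 T2 \<in> sphere z0 R0"
      using exits_at_frontier[of A "ball z0 R0" "G1 T1"] exits_at_frontier[of B "ball z0 R0" "G2 T2"] R0(1) by simp_all
  qed
  obtain \<alpha> where \<alpha>: "G1 T1 = z0 + R0 * cis \<alpha>" using on_circle_angle[OF sph_ends(1) R0(1)] by metis
  obtain \<beta> where \<beta>: "\<alpha> \<le> \<beta>" "\<beta> < \<alpha> + 2 * pi" "G2 T2 = z0 + R0 * cis \<beta>"
    using on_circle_angle[OF sph_ends(2) R0(1)] by metis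
  have "\<alpha> \<noteq> \<beta>" using \<alpha> \<beta>(3) ne12[of T1 T2] T1 T2 by auto
  define C where "C = part_circlepath z0 R0 \<alpha> \<beta>"
  have C: "arc C" "path_image C \<subseteq> sphere z0 R0" "pathstart C = G1 T1" "pathfinish C = G2 T2"
    unfolding C_def using \<beta> \<open>\<alpha> \<noteq> \<beta>\<close> R0(1) sphere_angle_image[OF R0(1), of z0 \<alpha> \<beta>]
    by (auto simp: part_circlepath_ends \<alpha> intro!: arc_part_circlepath simp del: pathstart_part_circlepath pathfinish_part_circlepath)
  have iA: "inj_on G1 {0..T1}" by (rule inj_on_subset[OF Ginj1]) (use T1(2) in auto)
  have iB: "inj_on G2 {0..T2}" by (rule inj_on_subset[OF Ginj2]) (use T2(2) in auto)
  have A: "arc A" "path_image A = G1 ` {0..T1}" "pathstart A = ?\<pi> p" "pathfinish A = G1 T1"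
    unfolding A_def using Gpath T1(1,2) G0 iA
    by (auto simp: arc_subpath_eq path_image_subpath closed_segment_eq_real_ivl)
  have B: "arc B" "path_image B = G2 ` {0..T2}" "pathstart B = ?\<pi> p" "pathfinish B = G2 T2"
    unfolding B_def using Gpath T2(1,2) G0 iB
    by (auto simp: arc_subpath_eq path_image_subpath closed_segment_eq_real_ivl)
  define \<gamma> where "\<gamma> = A +++ (C +++ reversepath B)"
  have CB: "pathfinish C = pathstart (reversepath B)" "pathfinish A = pathstart (C +++ reversepath B)"
    "pathfinish (C +++ reversepath B) = pathstart A"
    using C B A by simp_all
  have A_sph: "x = G1 T1" if x: "x \<in> path_image A" "x \<in> sphere z0 R0" for x
  proof -
    obtain s where s: "x = G1 s" "0 \<le> s" "s \<le> T1" using x(1) A by auto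
    then show ?thesis using in1[of s] x(2) by (cases "s = T1") auto
  qed
  have B_sph: "x = G2 T2" if x: "x \<in> path_image B" "x \<in> sphere z0 R0" for x
  proof -
    obtain s where s: "x = G2 s" "0 \<le> s" "s \<le> T2" using x(1) B by auto
    then show ?thesis using in2[of s] x(2) by (cases "s = T2") auto
  qed
  have AB: "x = ?\<pi> p" if x: "x \<in> path_image A" "x \<in> path_image B" for x
  proof -
    obtain s where s: "x = G1 s" "0 \<le> s" "s \<le> T1" using x(1) A by auto
    obtain s' where s': "x = G2 s'" "0 \<le> s'" "s' \<le> T2" using x(2) B by auto
    show ?thesis using ne12[of s s'] s s' T1 T2 G0 by (cases "s = 0"; cases "s' = 0") auto
  qed
  have \<gamma>_img: "path_image \<gamma> = path_image A \<union> path_image C \<union> path_image B"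
    unfolding \<gamma>_def using CB by (auto simp: path_image_join)
  have simple: "simple_path \<gamma>"
    unfolding \<gamma>_def
  proof (rule simple_path_join_loop)
    show "arc (C +++ reversepath B)"
      using C B B_sph by (intro arc_join) (auto simp: arc_reversepath)
    show "path_image A \<inter> path_image (C +++ reversepath B) \<subseteq> {pathstart A, pathstart (C +++ reversepath B)}"
    proof
      fix x assume x: "x \<in> path_image A \<inter> path_image (C +++ reversepath B)"
      then have "x \<in> path_image C \<or> x \<in> path_image B" using CB by (auto simp: path_image_join)
      then show "x \<in> {pathstart A, pathstart (C +++ reversepath B)}"
        using x A_sph[of x] AB[of x] C A by auto
    qed
  qed (use A CB in auto)
  have closed: "pathfinish \<gamma> = pathstart \<gamma>" using CB by (simp add: \<gamma>_def)
  have \<gamma>0: "pathstart \<gamma> = ?\<pi> p" using A by (simp add: \<gamma>_def)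
  have G3_off: "G3 s \<notin> path_image \<gamma>" if s: "0 < s" "s < T3" for s
  proof -
    have "G3 s \<noteq> ?\<pi> p" using inj_onD[OF Ginj3, of s 0] s T3 G0 by auto
    then have "G3 s \<noteq> G1 s'" if "0 \<le> s'" "s' \<le> T1" for s'
      using ne13[of s' s] s T1 T3 that G0 by (cases "s' = 0") auto
    moreover have "G3 s \<noteq> G2 s'" if "0 \<le> s'" "s' \<le> T2" for s'
      using \<open>G3 s \<noteq> ?\<pi> p\<close> ne23[of s' s] s T2 T3 that G0 by (cases "s' = 0") auto
    moreover have "G3 s \<notin> path_image C" using in3[of s] s C(2) by auto
    ultimately show ?thesis unfolding \<gamma>_img A(2) B(2) by (metis (no_types, lifting) UnE atLeastAtMost_iff imageE)
  qed
  have const: "winding_number \<gamma> (G3 s) = winding_number \<gamma> (G3 t)" if "0 < s" "s < T3" "0 < t" "t < T3" for s t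
  proof (rule winding_number_eq[where S = "G3 ` {0<..<T3}"])
    have "continuous_on {0<..<T3} G3"
      using Gpath(3) T3 unfolding path_def by (auto intro: continuous_on_subset)
    then show "connected (G3 ` {0<..<T3})" by (intro connected_continuous_image) auto
    show "path \<gamma>" using simple by (rule simple_path_imp_path)
    show "G3 ` {0<..<T3} \<inter> path_image \<gamma> = {}" using G3_off by auto
  qed (use that closed in auto)
  have key: "winding_number \<gamma> (G3 (T3 / 2)) = of_bool (exit_triple g1 g3 g2 r > 0) + low \<gamma> \<and>
      (exit_triple g1 g2 g3 r > 0 \<or> exit_triple g1 g3 g2 r > 0)" if r: "0 < r" "r < \<delta>" for r
  proof -
    obtain t1 where t1: "0 < t1" "t1 < T1" "g1 t1 = first_exit g1 r" "dist p (g1 t1) = r"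
      "\<And>s. 0 \<le> s \<Longrightarrow> s < t1 \<Longrightarrow> g1 s \<in> ball p r"
      using first_exit[OF path(1) r(1), of T1] T1 start(1) r by auto
    obtain t2 where t2: "0 < t2" "t2 < T2" "g2 t2 = first_exit g2 r" "dist p (g2 t2) = r"
      "\<And>s. 0 \<le> s \<Longrightarrow> s < t2 \<Longrightarrow> g2 s \<in> ball p r"
      using first_exit[OF path(2) r(1), of T2] T2 start(2) r by auto
    obtain t3 where t3: "0 < t3" "t3 < T3" "g3 t3 = first_exit g3 r" "dist p (g3 t3) = r"
      "\<And>s. 0 \<le> s \<Longrightarrow> s < t3 \<Longrightarrow> g3 s \<in> ball p r"
      using first_exit[OF path(3) r(1), of T3] T3 start(3) r by auto
    have rq: "r < dist p q" using r \<delta> by simp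
    obtain z R where R: "R > 0" "\<And>x. x \<in> sphere 0 1 - {q} \<Longrightarrow> ?\<pi> x \<in> ball z R \<longleftrightarrow> x \<in> ball p r"
      using stereo_from_ball[OF q p r(1) rq] by metis
    define f where "f = subpath 0 t3 G3"
    have eA: "exits_at A (ball z R) (G1 t1)"
      unfolding A_def
    proof (rule exits_at_subpath[OF t1(1)])
      show "G1 t1 \<notin> ball z R" using R(2)[OF on1[of t1]] t1 T1 by (simp add: G)
      show "G1 s \<in> ball z R" if "0 \<le> s" "s < t1" for s
        using R(2)[OF on1[of s]] t1(5)[OF that] that t1 T1 by (simp add: G)
    qed (use t1 T1 in auto)
    have eB: "exits_at B (ball z R) (G2 t2)"
      unfolding B_def
    proof (rule exits_at_subpath[OF t2(1)])
      show "G2 t2 \<notin> ball z R" using R(2)[OF on2[of t2]] t2 T2 by (simp add: G)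
      show "G2 s \<in> ball z R" if "0 \<le> s" "s < t2" for s
        using R(2)[OF on2[of s]] t2(5)[OF that] that t2 T2 by (simp add: G)
    qed (use t2 T2 in auto)
    have ef: "exits_at f (ball z R) (G3 t3)"
      unfolding f_def
    proof (rule exits_at_subpath[OF t3(1)])
      show "G3 t3 \<notin> ball z R" using R(2)[OF on3[of t3]] t3 T3 by (simp add: G)
      show "G3 s \<in> ball z R" if "0 \<le> s" "s < t3" for s
        using R(2)[OF on3[of s]] t3(5)[OF that] that t3 T3 by (simp add: G)
    qed (use t3 T3 in auto)
    have "winding_number \<gamma> (f 1) =
        of_bool (Im (cnj (G3 t3 - G1 t1) * (G2 t2 - G1 t1)) > 0) + low \<gamma>"
    proof (rule winding_number_side[OF simple closed R(1)])
      show "pathstart \<gamma> \<in> ball z R" using R(2)[OF on1[of 0]] r(1) by (simp add: \<gamma>0 g0)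
      show "exits_at \<gamma> (ball z R) (G1 t1)" unfolding \<gamma>_def by (rule exits_at_join[OF eA])
      have "reversepath \<gamma> = (B +++ reversepath C) +++ reversepath A"
        unfolding \<gamma>_def using CB by (simp add: reversepath_joinpaths)
      then show "exits_at (reversepath \<gamma>) (ball z R) (G2 t2)"
        by (simp add: exits_at_join eB)
      show "G1 t1 \<noteq> G2 t2" using ne12 t1 t2 T1 T2 by auto
      show "path f" unfolding f_def using Gpath t3 T3 by (auto intro!: path_subpath)
      show "pathstart f = pathstart \<gamma>" by (simp add: f_def \<gamma>0 G0)
      show "f ` {0<..1} \<inter> path_image \<gamma> = {}"
      proof -
        have "f s \<notin> path_image \<gamma>" if "s \<in> {0<..1}" for s
        proof -
          have "t3 * s \<le> t3 * 1" using that t3 by (intro mult_left_mono) auto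
          then have "t3 * s < T3" using t3(2) by linarith
          moreover have "0 < t3 * s" using that t3(1) by simp
          ultimately have "G3 (t3 * s) \<notin> path_image \<gamma>" by (intro G3_off)
          then show ?thesis by (simp add: f_def subpath_def)
        qed
        then show ?thesis by blast
      qed
    qed (rule ef)
    moreover have "f 1 = G3 t3" by (simp add: f_def subpath_def)
    moreover have "winding_number \<gamma> (G3 t3) = winding_number \<gamma> (G3 (T3 / 2))"
      using const[of t3 "T3 / 2"] t3 T3 by simp
    moreover have o1: "Im (cnj (G3 t3 - G1 t1) * (G2 t2 - G1 t1)) > 0 \<longleftrightarrow> exit_triple g1 g3 g2 r > 0"
      unfolding exit_triple_def G comp_def t1(3)[symmetric] t2(3)[symmetric] t3(3)[symmetric] start
      using on1[of t1] on2[of t2] on3[of t3] t1 t2 t3 T1 T2 T3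
      by (intro stereo_from_orientation[OF q p r(1) rq]) auto
    moreover have "Im (cnj (G2 t2 - G1 t1) * (G3 t3 - G1 t1)) > 0 \<longleftrightarrow> exit_triple g1 g2 g3 r > 0"
      unfolding exit_triple_def G comp_def t1(3)[symmetric] t2(3)[symmetric] t3(3)[symmetric] start
      using on1[of t1] on2[of t2] on3[of t3] t1 t2 t3 T1 T2 T3
      by (intro stereo_from_orientation[OF q p r(1) rq]) auto
    moreover have "Im (cnj (G3 t3 - G1 t1) * (G2 t2 - G1 t1)) > 0 \<or> Im (cnj (G2 t2 - G1 t1) * (G3 t3 - G1 t1)) > 0"
    proof (rule circle_orientation_total[OF _ _ _ R(1)])
      have fr: "x \<in> sphere z R" if "exits_at h (ball z R) x" "path h" for h x
        using exits_at_frontier[OF that(2,1)] R(1) by simp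
      show "G1 t1 \<in> sphere z R" using fr[OF eA] A(1) arc_imp_path by blast
      show "G2 t2 \<in> sphere z R" using fr[OF eB] B(1) arc_imp_path by blast
      show "G3 t3 \<in> sphere z R" using fr[OF ef] Gpath t3 T3 by (simp add: f_def path_subpath)
      show "G1 t1 \<noteq> G2 t2" "G1 t1 \<noteq> G3 t3" "G2 t2 \<noteq> G3 t3"
        using ne12 ne13 ne23 t1 t2 t3 T1 T2 T3 by auto
    qed
    ultimately show ?thesis by auto
  qed
  have same: "exit_triple g1 g3 g2 r > 0 \<longleftrightarrow> exit_triple g1 g3 g2 r' > 0"
    if "0 < r" "r < \<delta>" "0 < r'" "r' < \<delta>" for r r'
  proof -
    have "(of_bool (exit_triple g1 g3 g2 r > 0) :: complex) + low \<gamma> = of_bool (exit_triple g1 g3 g2 r' > 0) + low \<gamma>"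
      using key[OF that(1,2)] key[OF that(3,4)] by simp
    then show ?thesis by (simp split: if_splits add: of_bool_def)
  qed
  show ?thesis
  proof (cases "exit_triple g1 g3 g2 (\<delta> / 2) > 0")
    case True
    then have "\<forall>r\<in>{0<..<\<delta>}. exit_triple g1 g3 g2 r > 0" using same[of "\<delta> / 2"] \<delta>(1) by auto
    then show ?thesis by blast
  next
    case False
    then have "\<forall>r\<in>{0<..<\<delta>}. \<not> exit_triple g1 g3 g2 r > 0" using same[of "\<delta> / 2"] \<delta>(1) by auto
    then have "\<forall>r\<in>{0<..<\<delta>}. exit_triple g1 g2 g3 r > 0" using key by auto
    then show ?thesis by blast
  qed
qed

text \<open>
  An arc covers no nonempty open subset of a surface, by invariance of dimension.
\<close>

lemma open_avoids_arcs:
  fixes s :: "complex \<Rightarrow> 'a::euclidean_space"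
  assumes "finite F" "\<And>g. g \<in> F \<Longrightarrow> arc g"
    and "open U" "U \<noteq> {}" "continuous_on U s" "inj_on s U"
  shows "\<exists>z\<in>U. \<forall>g\<in>F. s z \<notin> path_image g"
proof -
  have "\<exists>V. open V \<and> V \<noteq> {} \<and> V \<subseteq> U \<and> (\<forall>g\<in>F. s ` V \<inter> path_image g = {})"
    using assms(1,2)
  proof (induction F rule: finite_induct)
    case empty
    then show ?case using assms(3,4) by auto
  next
    case (insert g F)
    then obtain V where V: "open V" "V \<noteq> {}" "V \<subseteq> U" "\<forall>g\<in>F. s ` V \<inter> path_image g = {}"
      by auto
    have cont: "continuous_on V s" and inj: "inj_on s V"
      using V(3) assms(5,6) continuous_on_subset inj_on_subset by blast+
    have "open (V \<inter> s -` (- path_image g))"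
      using cont V(1) insert.prems[of g] by (intro continuous_open_preimage) (auto intro: closed_arc_image)
    moreover have "V \<inter> s -` (- path_image g) \<noteq> {}"
    proof
      assume "V \<inter> s -` (- path_image g) = {}"
      then have sub: "s ` V \<subseteq> path_image g" by blast
      obtain h where h: "homeomorphism {0..1} (path_image g) g h"
        using homeomorphism_arc[of g] insert.prems[of g] by blast
      have "continuous_on V (h \<circ> s)"
        using homeomorphism_cont2[OF h] sub by (intro continuous_on_compose cont) (rule continuous_on_subset)
      moreover have "inj_on (h \<circ> s) V"
      proof (rule comp_inj_on[OF inj])
        show "inj_on h (s ` V)"
          by (rule inj_on_inverseI[where g = g]) (use homeomorphism_apply2[OF h] sub in blast)
      qed
      ultimately have "DIM(complex) \<le> DIM(real)" using V(1,2) by (intro invariance_of_dimension) auto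
      then show False by simp
    qed
    ultimately show ?case using V by (intro exI[of _ "V \<inter> s -` (- path_image g)"]) auto
  qed
  then show ?thesis by blast
qed

section \<open>A centre of projection off the edges\<close>

lemma simple_path_injD:
  assumes "simple_path g" "g x = g y" "0 \<le> x" "x \<le> 1" "0 \<le> y" "y \<le> 1"
  shows "x = y \<or> x = 0 \<and> y = 1 \<or> x = 1 \<and> y = 0"
  using assms unfolding simple_path_def loop_free_def by (meson atLeastAtMost_iff)

text \<open>The open upper hemisphere is parametrized by the unit disc of the first two coordinates.
  A closed simple path is not an arc, so every path is first cut into two arcs.\<close>

lemma sphere_avoids_simple_paths:
  fixes F :: "(real \<Rightarrow> real ^ 3) set"
  assumes "finite F" "\<And>g. g \<in> F \<Longrightarrow> simple_path g"
  obtains q where "q \<in> sphere 0 1" "\<And>g. g \<in> F \<Longrightarrow> q \<notin> path_image g"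
proof -
  define s :: "complex \<Rightarrow> real ^ 3" where
    "s z = Re z *\<^sub>R axis 1 1 + Im z *\<^sub>R axis 2 1 + sqrt (1 - (Re z)\<^sup>2 - (Im z)\<^sup>2) *\<^sub>R axis 3 1" for z
  have s: "s z $ 1 = Re z" "s z $ 2 = Im z" "s z $ 3 = sqrt (1 - (Re z)\<^sup>2 - (Im z)\<^sup>2)" for z
    by (simp_all add: s_def axis_def)
  define F' where "F' = (\<Union>g\<in>F. {subpath 0 (1/2) g, subpath (1/2) 1 g})"
  have "arc g" if "g \<in> F'" for g
  proof -
    obtain g0 where g0: "g0 \<in> F" "g = subpath 0 (1/2) g0 \<or> g = subpath (1/2) 1 g0"
      using \<open>g \<in> F'\<close> by (auto simp: F'_def)
    have "g0 0 \<noteq> g0 (1/2)" "g0 (1/2) \<noteq> g0 1"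
      using simple_path_injD[OF assms(2)[OF g0(1)], of 0 "1/2"]
        simple_path_injD[OF assms(2)[OF g0(1)], of "1/2" 1] by auto
    then show ?thesis using g0 assms(2)[OF g0(1)] by (auto intro!: arc_simple_path_subpath)
  qed
  moreover have "finite F'" using assms(1) by (simp add: F'_def)
  moreover have "continuous_on (ball 0 1) s" unfolding s_def by (intro continuous_intros)
  moreover have "inj_on s (ball 0 1)" 
  proof (rule inj_onI)
    fix x y assume "s x = s y"
    then show "x = y" using s(1,2)[of x] s(1,2)[of y] by (intro complex_eqI) simp_all
  qed
  ultimately obtain z where z: "z \<in> ball 0 1" "\<forall>g\<in>F'. s z \<notin> path_image g"
    using open_avoids_arcs[of F' "ball 0 1" s] by auto
  show ?thesis
  proof (rule that[of "s z"])
    have "(Re z)\<^sup>2 + (Im z)\<^sup>2 \<le> 1" using z(1) by (simp add: cmod_def)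
    then show "s z \<in> sphere 0 1" unfolding sphere_coords s by simp
    fix g assume g: "g \<in> F"
    show "s z \<notin> path_image g"
    proof
      assume "s z \<in> path_image g"
      then obtain t where t: "0 \<le> t" "t \<le> 1" "s z = g t" by (auto simp: path_image_def)
      then have "s z \<in> path_image (subpath 0 (1/2) g) \<or> s z \<in> path_image (subpath (1/2) 1 g)"
        by (cases "t \<le> 1/2") (auto simp: path_image_subpath)
      then show False using z(2) g by (auto simp: F'_def)
    qed
  qed
qed

section \<open>Plane graphs\<close>

locale plane_embedding =
  fixes G :: "('v, 'e) multigraph" and \<Gamma> :: "('v, 'e) drawing"
  assumes triv: "trivalent G" and plane: "plane_graph G \<Gamma>"
begin

abbreviation "halves \<equiv> half_edges G"
abbreviation "src \<equiv> endpoint G"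
abbreviation "hc \<equiv> half_curve \<Gamma>"
abbreviation "pt \<equiv> place \<Gamma>"
abbreviation "\<rho> \<equiv> rotation G \<Gamma>"

text \<open>One centre of projection for all cycles. It avoids the edges; vertexless circles have no
  corners and are never projected.\<close>

definition q :: "real ^ 3" where
  "q = (SOME q. q \<in> sphere 0 1 \<and> (\<forall>e\<in>edges G. q \<notin> path_image (curve \<Gamma> e)))"

abbreviation "\<pi> \<equiv> stereo_from q"

lemma G_fin: "finite (edges G)" "edges G \<inter> circles G = {}" "finite_multigraph G"
  using triv by (auto simp: trivalent_def finite_multigraph_def)

lemma src_in: "h \<in> halves \<Longrightarrow> src h \<in> verts G"
  using G_fin(3) by (auto simp: finite_multigraph_def)

lemma fst_in: "h \<in> halves \<Longrightarrow> fst h \<in> edges G"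
  by (auto simp: half_edges_def)

lemma curve_simple: "e \<in> edges G \<Longrightarrow> simple_path (curve \<Gamma> e)"
  using plane by (simp add: plane_graph_def)

lemma q: "q \<in> sphere 0 1" and q_off: "e \<in> edges G \<Longrightarrow> q \<notin> path_image (curve \<Gamma> e)"
proof -
  have "finite (curve \<Gamma> ` edges G)" using G_fin by simp
  then obtain x where "x \<in> sphere 0 1" "\<And>g. g \<in> curve \<Gamma> ` edges G \<Longrightarrow> x \<notin> path_image g"
    by (rule sphere_avoids_simple_paths) (use curve_simple in auto)
  then have "\<exists>q. q \<in> sphere 0 1 \<and> (\<forall>e\<in>edges G. q \<notin> path_image (curve \<Gamma> e))" by blast
  from someI_ex[OF this] show "q \<in> sphere 0 1" "e \<in> edges G \<Longrightarrow> q \<notin> path_image (curve \<Gamma> e)"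
    by (auto simp: q_def)
qed

lemma hc_opposite: "hc (opposite h) = reversepath (hc h)"
  by (simp add: half_curve_def opposite_def)

lemma hc:
  assumes "h \<in> halves"
  shows "simple_path (hc h)" "path (hc h)" "path_image (hc h) \<subseteq> sphere 0 1 - {q}"
    "pathstart (hc h) = pt (src h)" "pathfinish (hc h) = pt (src (opposite h))"
    "hc h ` {0<..<1} = open_curve G \<Gamma> (fst h)"
proof -
  obtain e b where h: "h = (e, b)" "e \<in> edges G" using assms by (auto simp: half_edges_def)
  have c: "simple_path (curve \<Gamma> e)" "path_image (curve \<Gamma> e) \<subseteq> sphere 0 1"
    "pathstart (curve \<Gamma> e) = pt (src (e, False))" "pathfinish (curve \<Gamma> e) = pt (src (e, True))"
    using plane h(2) by (simp_all add: plane_graph_def)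
  show s: "simple_path (hc h)" using c(1) h(1) by (simp add: half_curve_def simple_path_reversepath)
  then show "path (hc h)" by (rule simple_path_imp_path)
  show "path_image (hc h) \<subseteq> sphere 0 1 - {q}" using c(2) q_off[OF h(2)] h(1) by (auto simp: half_curve_def)
  show "pathstart (hc h) = pt (src h)" "pathfinish (hc h) = pt (src (opposite h))"
    using c(3,4) h(1) by (auto simp: half_curve_def opposite_def)
  have "e \<notin> circles G" using G_fin(2) h(2) by blast
  moreover have "reversepath (curve \<Gamma> e) ` {0<..<1} = curve \<Gamma> e ` {0<..<1}"
  proof -
    have "(\<lambda>x. 1 - x) ` {0<..<1 :: real} = {0<..<1}"
    proof (intro equalityI subsetI)
      fix x :: real assume "x \<in> {0<..<1}"
      then show "x \<in> (\<lambda>x. 1 - x) ` {0<..<1}" by (intro image_eqI[of _ _ "1 - x"]) auto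
    qed auto
    moreover have "reversepath (curve \<Gamma> e) = curve \<Gamma> e \<circ> (\<lambda>x. 1 - x)" by (auto simp: reversepath_def)
    ultimately show ?thesis by (simp only: image_comp[symmetric])
  qed
  ultimately show "hc h ` {0<..<1} = open_curve G \<Gamma> (fst h)" using h(1) by (simp add: half_curve_def open_curve_def)
qed

lemma hc_ends: "h \<in> halves \<Longrightarrow> hc h 0 = pt (src h)" "h \<in> halves \<Longrightarrow> hc h 1 = pt (src (opposite h))"
  using hc(4,5) by (simp_all add: pathstart_def pathfinish_def)

lemma hc_image:
  assumes "h \<in> halves"
  shows "path_image (hc h) = hc h ` {0<..<1} \<union> {pt (src h), pt (src (opposite h))}"
proof -
  have "{0..1 :: real} = {0<..<1} \<union> {0, 1}" by auto
  then show ?thesis unfolding path_image_def using hc_ends[OF assms] by (simp add: image_Un)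
qed

lemma open_vertex: "h \<in> halves \<Longrightarrow> hc h ` {0<..<1} \<inter> pt ` verts G = {}"
  using plane fst_in[of h] by (simp add: hc(6) plane_graph_def)

lemma open_disjoint:
  assumes "h \<in> halves" "h' \<in> halves" "fst h \<noteq> fst h'"
  shows "hc h ` {0<..<1} \<inter> hc h' ` {0<..<1} = {}"
proof -
  have "disjoint_family_on (open_curve G \<Gamma>) (edges G \<union> circles G)" using plane by (simp add: plane_graph_def)
  then have "open_curve G \<Gamma> (fst h) \<inter> open_curve G \<Gamma> (fst h') = {}"
    using fst_in[OF assms(1)] fst_in[OF assms(2)] assms(3) unfolding disjoint_family_on_def by blast
  then show ?thesis by (simp add: hc(6) assms)
qed

lemma hc_inj:
  assumes "h \<in> halves" "hc h s = hc h t" "0 \<le> s" "s \<le> 1" "0 \<le> t" "t \<le> 1"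
  shows "s = t \<or> s = 0 \<and> t = 1 \<or> s = 1 \<and> t = 0"
  using simple_path_injD[OF hc(1)[OF assms(1)] assms(2-6)] .

lemma half_inj: "h \<in> halves \<Longrightarrow> inj_on (hc h) {0..<1/2}"
  by (rule inj_onI) (use hc_inj[of h] in fastforce)

text \<open>Stopping at the parameter 1/2 separates the two half-edges of one edge, which matters
  for loops, where both start at the same vertex.\<close>

lemma half_disjoint:
  assumes "h \<in> halves" "h' \<in> halves" "h \<noteq> h'"
  shows "hc h ` {0<..<1/2} \<inter> hc h' ` {0<..<1/2} = {}"
proof (cases "fst h = fst h'")
  case True
  then have h': "h' = opposite h" using same_edge[of h h'] assms(3) by auto
  have False if "0 < s" "s < 1/2" "0 < t" "t < 1/2" "hc h s = hc h' t" for s t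
  proof -
    have "hc h s = hc h (1 - t)" using that(5) by (simp add: h' hc_opposite reversepath_def)
    from hc_inj[OF assms(1) this] that show False by simp
  qed
  then show ?thesis by fastforce
next
  case False
  have "hc x ` {0<..<1/2} \<subseteq> hc x ` {0<..<1}" for x by (rule image_mono) auto
  then show ?thesis using open_disjoint[OF assms(1,2) False] by blast
qed

lemma mid_ne_src:
  assumes "h \<in> halves"
  shows "hc h (1/2) \<noteq> pt (src h)"
  using hc_inj[OF assms, of "1/2" 0] hc_ends(1)[OF assms] by auto

lemma pt_on: "h \<in> halves \<Longrightarrow> pt (src h) \<in> sphere 0 1 - {q}"
  using hc(3,4)[of h] pathstart_in_path_image[of "hc h"] by auto

text \<open>In such a disc every half-edge at the vertex has its first exit within its first half,
  and the centre of projection stays outside. Only finitely many positive distances have to be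
  respected.\<close>

lemma good_radius:
  assumes "h \<in> halves"
  obtains \<delta> where "0 < \<delta>" "\<delta> < dist (pt (src h)) q"
    "\<And>h'. h' \<in> halves \<Longrightarrow> src h' = src h \<Longrightarrow> \<delta> < dist (pt (src h)) (hc h' (1/2))"
proof -
  let ?p = "pt (src h)"
  define X where "X = insert q ((\<lambda>h. hc h (1/2)) ` halves)"
  have "finite X" unfolding X_def using G_fin(1) by (simp add: half_edges_def)
  then obtain d where d: "d > 0" "\<And>x. x \<in> X \<Longrightarrow> x \<noteq> ?p \<Longrightarrow> d \<le> dist ?p x"
    using finite_set_avoid[of X ?p] by blast
  show ?thesis
  proof (rule that[of "d / 2"])
    show "d / 2 > 0" using d by simp
    show "d / 2 < dist ?p q" using d(2)[of q] pt_on[OF assms] d(1) by (auto simp: X_def)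
    show "d / 2 < dist ?p (hc h' (1/2))" if "h' \<in> halves" "src h' = src h" for h'
      using d(2)[of "hc h' (1/2)"] mid_ne_src[OF that(1)] that d(1) by (auto simp: X_def)
  qed
qed

section \<open>The rotation at a vertex of a plane graph\<close>

lemma ccw_triple_exit: "ccw_triple \<Gamma> h1 h2 h3 \<longleftrightarrow> (\<forall>\<^sub>F r in at_right 0. exit_triple (hc h1) (hc h2) (hc h3) r > 0)"
  by (simp add: ccw_triple_def exit_triple_def Let_def)

lemma ccw_triple_rotate:
  assumes "h1 \<in> halves" "h2 \<in> halves" "src h2 = src h1"
  shows "ccw_triple \<Gamma> h2 h3 h1 \<longleftrightarrow> ccw_triple \<Gamma> h1 h2 h3"
  unfolding ccw_triple_exit using exit_triple_rotate[of "hc h2" "hc h1" "hc h3"] assms by (simp add: hc(4))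

text \<open>By \<open>exit_triple_total\<close> the sign is constant for all small radii. So
  \<open>ccw_triple\<close> may be tested at one radius, and exactly one of the two cyclic orders
  holds.\<close>

lemma ccw_radius:
  assumes h: "h1 \<in> halves" "h2 \<in> halves" "h3 \<in> halves" "src h2 = src h1" "src h3 = src h1" "distinct [h1, h2, h3]"
    and \<delta>: "0 < \<delta>" "\<delta> < dist (pt (src h1)) q"
      "\<And>h'. h' \<in> halves \<Longrightarrow> src h' = src h1 \<Longrightarrow> \<delta> < dist (pt (src h1)) (hc h' (1/2))"
  shows "r \<in> {0<..<\<delta>} \<Longrightarrow> exit_triple (hc h1) (hc h2) (hc h3) r > 0 \<longleftrightarrow> ccw_triple \<Gamma> h1 h2 h3"
    "ccw_triple \<Gamma> h1 h3 h2 \<longleftrightarrow> \<not> ccw_triple \<Gamma> h1 h2 h3"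
proof -
  have ev: "ccw_triple \<Gamma> a b c \<and> \<not> ccw_triple \<Gamma> a c b" if "\<forall>r\<in>{0<..<\<delta>}. exit_triple (hc a) (hc b) (hc c) r > 0" for a b c
  proof
    show abc: "ccw_triple \<Gamma> a b c"
      unfolding ccw_triple_exit using that \<delta>(1) by (intro eventually_at_rightI) auto
    show "\<not> ccw_triple \<Gamma> a c b"
    proof
      assume "ccw_triple \<Gamma> a c b"
      with abc have "\<forall>\<^sub>F r in at_right 0. exit_triple (hc a) (hc b) (hc c) r > 0 \<and> exit_triple (hc a) (hc c) (hc b) r > 0"
        unfolding ccw_triple_exit by (rule eventually_conj)
      then have "\<forall>\<^sub>F r in at_right (0 :: real). False"
        by (rule eventually_mono) (use exit_triple_swap[of "hc a" "hc c" "hc b"] in auto)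
      then show False by simp
    qed
  qed
  have total: "(\<forall>r\<in>{0<..<\<delta>}. exit_triple (hc h1) (hc h2) (hc h3) r > 0) \<or> (\<forall>r\<in>{0<..<\<delta>}. exit_triple (hc h1) (hc h3) (hc h2) r > 0)"
  proof (rule exit_triple_total[OF q, where p = "pt (src h1)"])
    show "inj_on (hc h1) {0..<1/2}" "inj_on (hc h2) {0..<1/2}" "inj_on (hc h3) {0..<1/2}"
      using half_inj h by blast+
    show "hc h1 ` {0<..<1/2} \<inter> hc h2 ` {0<..<1/2} = {}" "hc h1 ` {0<..<1/2} \<inter> hc h3 ` {0<..<1/2} = {}"
      "hc h2 ` {0<..<1/2} \<inter> hc h3 ` {0<..<1/2} = {}"
      by (rule half_disjoint; use h in simp)+
    show "\<delta> < dist (pt (src h1)) (hc h1 (1/2))" "\<delta> < dist (pt (src h1)) (hc h2 (1/2))" "\<delta> < dist (pt (src h1)) (hc h3 (1/2))"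
      using \<delta>(3) h by blast+
  qed (use h \<delta> in \<open>simp_all add: hc\<close>)
  then show "ccw_triple \<Gamma> h1 h3 h2 \<longleftrightarrow> \<not> ccw_triple \<Gamma> h1 h2 h3" using ev by blast
  show "exit_triple (hc h1) (hc h2) (hc h3) r > 0 \<longleftrightarrow> ccw_triple \<Gamma> h1 h2 h3" if "r \<in> {0<..<\<delta>}"
    using total
  proof
    assume a: "\<forall>r\<in>{0<..<\<delta>}. exit_triple (hc h1) (hc h2) (hc h3) r > 0"
    then show ?thesis using ev[OF a] that by blast
  next
    assume a: "\<forall>r\<in>{0<..<\<delta>}. exit_triple (hc h1) (hc h3) (hc h2) r > 0"
    then have "exit_triple (hc h1) (hc h3) (hc h2) r > 0" using that by blast
    then show ?thesis using ev[OF a] exit_triple_swap[of "hc h1" "hc h3" "hc h2" r] by simp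
  qed
qed

lemma ccw_triple_swap:
  assumes "h1 \<in> halves" "h2 \<in> halves" "h3 \<in> halves" "src h2 = src h1" "src h3 = src h1" "distinct [h1, h2, h3]"
  shows "ccw_triple \<Gamma> h1 h3 h2 \<longleftrightarrow> \<not> ccw_triple \<Gamma> h1 h2 h3"
proof -
  obtain \<delta> where "0 < \<delta>" "\<delta> < dist (pt (src h1)) q"
    "\<And>h'. h' \<in> halves \<Longrightarrow> src h' = src h1 \<Longrightarrow> \<delta> < dist (pt (src h1)) (hc h' (1/2))"
    using good_radius[OF assms(1)] by blast
  from ccw_radius(2)[OF assms this] show ?thesis .
qed

text \<open>The description in \<open>rotation\<close> is unique because the reverse order of the
  same three half-edges is excluded; cyclic symmetry gives the other two values.\<close>

lemma rotation_eq:
  assumes at: "half_edges_at G (src h) = {h, a, b}" "distinct [h, a, b]" and ccw: "ccw_triple \<Gamma> h a b"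
  shows "\<rho> h = a" "\<rho> a = b" "\<rho> b = h"
proof -
  have in_at: "x \<in> halves \<and> src x = src h" if "x \<in> {h, a, b}" for x
    using that unfolding at(1)[symmetric] by (simp add: half_edges_at_def)
  have rot: "\<rho> x = y" if xyz: "{x, y, z} = {h, a, b}" "distinct [x, y, z]" "ccw_triple \<Gamma> x y z" for x y z
    unfolding rotation_def
  proof (rule the_equality)
    have "x \<in> {h, a, b}" "y \<in> {h, a, b}" "z \<in> {h, a, b}" using xyz(1) by blast+
    then have xs: "x \<in> halves" "y \<in> halves" "z \<in> halves" "src x = src h" "src y = src x" "src z = src x"
      using in_at[of x] in_at[of y] in_at[of z] by simp_all
    show "\<exists>h''. half_edges_at G (src x) = {x, y, h''} \<and> ccw_triple \<Gamma> x y h''"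
      using xyz at(1) xs(4) by (intro exI[of _ z]) simp
    fix y' assume "\<exists>h''. half_edges_at G (src x) = {x, y', h''} \<and> ccw_triple \<Gamma> x y' h''"
    then obtain z' where z': "{x, y', z'} = {x, y, z}" "ccw_triple \<Gamma> x y' z'" using xyz(1) at(1) xs(4) by auto
    have "card {x, y', z'} = 3" unfolding z'(1) using xyz(2) by simp
    then have d: "y' \<noteq> x" "z' \<noteq> x" "y' \<noteq> z'" by (simp_all add: card_insert_if split: if_splits)
    have "y' \<in> {x, y, z}" "z' \<in> {x, y, z}" unfolding z'(1)[symmetric] by simp_all
    with d consider "y' = y" | "y' = z" "z' = y" by blast
    then show "y' = y"
      using ccw_triple_swap[OF xs(1,2,3,5,6) xyz(2)] z'(2) xyz(3) by cases auto
  qed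
  have "h \<in> halves" "a \<in> halves" "b \<in> halves" "src a = src h" "src b = src h"
    using in_at[of h] in_at[of a] in_at[of b] by simp_all
  then have "ccw_triple \<Gamma> a b h" "ccw_triple \<Gamma> b h a"
    using ccw ccw_triple_rotate[of h a b] ccw_triple_rotate[of a b h] by simp_all
  then show "\<rho> h = a" "\<rho> a = b" "\<rho> b = h"
    using ccw at(2) by (intro rot[of _ _ b] rot[of _ _ h] rot[of _ _ a]; auto)+
qed

lemma rotation_at:
  assumes "h \<in> halves"
  obtains a b where "half_edges_at G (src h) = {h, a, b}" "distinct [h, a, b]" "ccw_triple \<Gamma> h a b"
proof -
  have "card (half_edges_at G (src h)) = 3" using triv src_in[OF assms] by (simp add: trivalent_def)
  moreover have "h \<in> half_edges_at G (src h)" using assms by (simp add: half_edges_at_def)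
  ultimately have "card (half_edges_at G (src h) - {h}) = 2" by simp
  then obtain a b where ab: "half_edges_at G (src h) - {h} = {a, b}" "a \<noteq> b" by (meson card_2_iff)
  then have at: "half_edges_at G (src h) = {h, a, b}" and d: "distinct [h, a, b]"
    using \<open>h \<in> half_edges_at G (src h)\<close> by auto
  have "a \<in> half_edges_at G (src h)" "b \<in> half_edges_at G (src h)" unfolding at by simp_all
  then have "ccw_triple \<Gamma> h b a \<longleftrightarrow> \<not> ccw_triple \<Gamma> h a b"
    using assms d by (intro ccw_triple_swap) (simp_all add: half_edges_at_def)
  moreover have "{h, b, a} = {h, a, b}" "distinct [h, b, a]" using d by auto
  ultimately show ?thesis using that[of a b] that[of b a] at d by metis
qed

lemma rotation_cycle:
  assumes "h \<in> halves"
  shows "\<rho> (\<rho> (\<rho> h)) = h" "\<rho> h \<noteq> h" "half_edges_at G (src h) = {h, \<rho> h, \<rho> (\<rho> h)}"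
    "\<rho> h \<in> halves" "src (\<rho> h) = src h"
proof -
  obtain a b where ab: "half_edges_at G (src h) = {h, a, b}" "distinct [h, a, b]" "ccw_triple \<Gamma> h a b"
    using rotation_at[OF assms] by blast
  note r = rotation_eq[OF ab]
  show "\<rho> (\<rho> (\<rho> h)) = h" "\<rho> h \<noteq> h" unfolding r using ab(2) by auto
  show at: "half_edges_at G (src h) = {h, \<rho> h, \<rho> (\<rho> h)}" unfolding r by (rule ab(1))
  have "\<rho> h \<in> half_edges_at G (src h)" unfolding at by simp
  then show "\<rho> h \<in> halves" "src (\<rho> h) = src h" by (simp_all add: half_edges_at_def)
qed

end

section \<open>Cycles as closed curves on the sphere\<close>

context plane_embedding
begin

text \<open>The constant path for the empty list is only a default. A one-edge list is treated
  separately, so that a loop is represented by its own curve.\<close>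

primrec route :: "'e half_edge list \<Rightarrow> real \<Rightarrow> real ^ 3" where
  "route [] = linepath 0 0"
| "route (h # hs) = (if hs = [] then hc h else hc h +++ route hs)"

lemma route:
  assumes "half_edge_walk G u hs v" "hs \<noteq> []" "set hs \<subseteq> halves"
  shows "path (route hs)" "pathstart (route hs) = pt u" "pathfinish (route hs) = pt v"
    "path_image (route hs) = (\<Union>h\<in>set hs. path_image (hc h))"
  using assms
proof (induction hs arbitrary: u)
  case (Cons h hs)
  {
    case 1
    show ?case using Cons.IH[of "src (opposite h)"] 1 hc[of h] by (cases "hs = []") (auto intro!: path_join_imp)
  next
    case 2
    show ?case using 2 hc[of h] by auto
  next
    case 3
    show ?case using Cons.IH(3)[of "src (opposite h)"] 3 hc[of h] by (cases "hs = []") auto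
  next
    case 4
    show ?case using Cons.IH[of "src (opposite h)"] 4 hc[of h] by (cases "hs = []") (auto simp: path_image_join)
  }
qed simp_all

lemma route_exits:
  assumes "half_edge_walk G u hs v" "hs \<noteq> []" "set hs \<subseteq> halves"
  shows "exits_at (hc (hd hs)) U x \<Longrightarrow> exits_at (route hs) U x"
    and "exits_at (hc (opposite (last hs))) U x \<Longrightarrow> exits_at (reversepath (route hs)) U x"
proof -
  show "exits_at (route hs) U x" if "exits_at (hc (hd hs)) U x"
    using that assms(2) by (cases hs) (auto simp: exits_at_join)
  show "exits_at (reversepath (route hs)) U x" if "exits_at (hc (opposite (last hs))) U x"
    using assms that
  proof (induction hs arbitrary: u)
    case (Cons h hs)
    show ?case
    proof (cases "hs = []")
      case True
      then show ?thesis using Cons.prems by (simp add: hc_opposite)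
    next
      case False
      have w: "half_edge_walk G (src (opposite h)) hs v" "h \<in> halves" "set hs \<subseteq> halves" using Cons.prems by auto
      then have "pathfinish (hc h) = pathstart (route hs)" using route(2)[OF w(1) False w(3)] by (simp add: hc(5))
      moreover have "exits_at (reversepath (route hs)) U x"
        using Cons.IH[OF w(1) False w(3)] Cons.prems(4) False by simp
      ultimately show ?thesis using False by (simp add: reversepath_joinpaths exits_at_join)
    qed
  qed simp
qed

text \<open>
  The winding number around a cycle is written as a sum over its edges, so that it does not depend
  on the vertex at which the cycle starts.
\<close>

definition cycle_image :: "'e half_edge set \<Rightarrow> complex set" where
  "cycle_image Z = (\<Union>h\<in>Z. path_image (\<pi> \<circ> hc h))"

definition cycle_winding :: "'e half_edge set \<Rightarrow> complex \<Rightarrow> complex" where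
  "cycle_winding Z w = (\<Sum>h\<in>Z. winding_number (\<pi> \<circ> hc h) w)"

definition cycle_low :: "'e half_edge set \<Rightarrow> complex" where
  "cycle_low Z = (if \<exists>w. w \<notin> cycle_image Z \<and> cycle_winding Z w = -1 then -1 else 0)"

lemma path_\<pi>: "path g \<Longrightarrow> path_image g \<subseteq> sphere 0 1 - {q} \<Longrightarrow> path (\<pi> \<circ> g)"
  by (rule path_continuous_image, assumption) (rule continuous_on_subset[OF continuous_on_stereo_from[OF q]])

lemma route_winding:
  assumes "half_edge_walk G u hs v" "hs \<noteq> []" "set hs \<subseteq> halves" "w \<notin> cycle_image (set hs)"
  shows "winding_number (\<pi> \<circ> route hs) w = (\<Sum>h\<leftarrow>hs. winding_number (\<pi> \<circ> hc h) w)"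
  using assms
proof (induction hs arbitrary: u)
  case (Cons h hs)
  show ?case
  proof (cases "hs = []")
    case False
    have walk: "half_edge_walk G (src (opposite h)) hs v" "h \<in> halves" "set hs \<subseteq> halves" using Cons.prems by auto
    note r = route[OF walk(1) False walk(3)]
    have sub: "path_image (route hs) \<subseteq> sphere 0 1 - {q}" unfolding r(4) using hc(3) walk(3) by blast
    have "w \<notin> path_image (\<pi> \<circ> hc h)" "w \<notin> path_image (\<pi> \<circ> route hs)" "w \<notin> cycle_image (set hs)"
      using Cons.prems(4) unfolding cycle_image_def path_image_compose r(4) by auto
    moreover have "path (\<pi> \<circ> hc h)" "path (\<pi> \<circ> route hs)"
      using path_\<pi> hc[OF walk(2)] r(1) sub by blast+
    moreover have "pathfinish (\<pi> \<circ> hc h) = pathstart (\<pi> \<circ> route hs)"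
      unfolding pathfinish_compose pathstart_compose r(2) hc(5)[OF walk(2)] by (rule refl)
    ultimately have "winding_number ((\<pi> \<circ> hc h) +++ (\<pi> \<circ> route hs)) w =
        winding_number (\<pi> \<circ> hc h) w + winding_number (\<pi> \<circ> route hs) w"
      by (intro winding_number_join)
    moreover have "winding_number (\<pi> \<circ> route hs) w = (\<Sum>h\<leftarrow>hs. winding_number (\<pi> \<circ> hc h) w)"
      using Cons.IH[OF walk(1) False walk(3)] \<open>w \<notin> cycle_image (set hs)\<close> by blast
    ultimately show ?thesis using False
      by (simp only: route.simps if_False path_compose_join list.map sum_list.Cons)
  qed simp
qed simp

text \<open>Open edges are disjoint from each other and from the vertices, so a common point is an
  endpoint of both; injectivity of the vertex placement identifies the two endpoints.\<close>

lemma hc_meet: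
  assumes "h \<in> halves" "h' \<in> halves" "fst h \<noteq> fst h'" "x \<in> path_image (hc h)" "x \<in> path_image (hc h')"
  obtains v where "x = pt v" "v \<in> {src h, src (opposite h)}" "v \<in> {src h', src (opposite h')}"
proof -
  have V: "src h \<in> verts G" "src (opposite h) \<in> verts G" "src h' \<in> verts G" "src (opposite h') \<in> verts G"
    using src_in assms(1,2) by simp_all
  have "x \<notin> hc h ` {0<..<1}"
  proof
    assume x: "x \<in> hc h ` {0<..<1}"
    then have "x \<notin> hc h' ` {0<..<1}" "x \<notin> pt ` verts G"
      using open_disjoint[OF assms(1-3)] open_vertex[OF assms(1)] by blast+
    then show False using assms(5) V unfolding hc_image[OF assms(2)] by blast
  qed
  then obtain v where v: "x = pt v" "v \<in> {src h, src (opposite h)}"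
    using assms(4) unfolding hc_image[OF assms(1)] by blast
  then have vV: "v \<in> verts G" using V by blast
  then have "x \<notin> hc h' ` {0<..<1}" using open_vertex[OF assms(2)] v(1) by blast
  then obtain v' where v': "x = pt v'" "v' \<in> {src h', src (opposite h')}"
    using assms(5) unfolding hc_image[OF assms(2)] by blast
  have "inj_on pt (verts G)" using plane by (simp add: plane_graph_def)
  moreover have "v' \<in> verts G" using v'(2) V by blast
  ultimately have "v = v'" using v(1) v'(1) vV by (auto dest: inj_onD)
  then show ?thesis using that v v' by blast
qed

lemma arc_hc:
  assumes "h \<in> halves" "src h \<noteq> src (opposite h)"
  shows "arc (hc h)"
proof -
  have "inj_on pt (verts G)" using plane by (simp add: plane_graph_def)
  then have "pt (src h) \<noteq> pt (src (opposite h))" using inj_onD[of pt "verts G" "src h" "src (opposite h)"] assms src_in by auto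
  then show ?thesis using hc[OF assms(1)] by (simp add: arc_simple_path)
qed

lemma walk_meet:
  assumes "half_edge_walk G (src (opposite h)) hs v" "h \<in> halves" "set hs \<subseteq> halves" "fst h \<notin> fst ` set hs"
    and "x \<in> path_image (hc h)" "x \<in> (\<Union>h'\<in>set hs. path_image (hc h'))"
    and "src h \<notin> src ` set hs"
  shows "x = pt (src (opposite h)) \<or> x = pt (src h) \<and> src h = v"
proof -
  obtain h' where h': "h' \<in> set hs" "x \<in> path_image (hc h')" using assms(6) by blast
  then have "h' \<in> halves" "fst h \<noteq> fst h'" using assms(3,4) by auto
  then obtain w where w: "x = pt w" "w \<in> {src h, src (opposite h)}" "w \<in> {src h', src (opposite h')}"
    using hc_meet[OF assms(2) _ _ assms(5) h'(2)] by blast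
  have "set (map src hs @ [v]) = set (src (opposite h) # map (\<lambda>h. src (opposite h)) hs)"
    using walk_endpoints[OF assms(1)] by simp
  then have "src (opposite h') \<in> src ` set hs \<union> {v}" using h'(1) by auto
  then have "w \<in> src ` set hs \<union> {v}" using w(3) h'(1) by auto
  then have "w \<in> src ` set hs \<or> w = v" by blast
  then show ?thesis using w(1,2) assms(7) by (elim insertE emptyE disjE) simp_all
qed

lemma arc_route:
  assumes "half_edge_walk G u hs v" "hs \<noteq> []" "set hs \<subseteq> halves" "distinct (map fst hs)" "distinct (map src hs @ [v])"
  shows "arc (route hs)"
  using assms
proof (induction hs arbitrary: u)
  case (Cons h hs)
  have h: "h \<in> halves" "src h \<noteq> v" "src h \<notin> src ` set hs" "fst h \<notin> fst ` set hs" using Cons.prems by auto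
  show ?case
  proof (cases "hs = []")
    case True
    then have "src (opposite h) = v" using Cons.prems(1) by simp
    then show ?thesis using True arc_hc[OF h(1)] h(2) by simp
  next
    case False
    have w: "half_edge_walk G (src (opposite h)) hs v" "set hs \<subseteq> halves" using Cons.prems by auto
    note r = route[OF w(1) False w(2)]
    have "src (opposite h) = src (hd hs)" using w(1) False by (cases hs) auto
    then have "src (opposite h) \<in> src ` set hs" using False by simp
    then have "src h \<noteq> src (opposite h)" using h(3) by metis
    then have "arc (hc h)" by (rule arc_hc[OF h(1)])
    moreover have "arc (route hs)" using Cons.IH[OF w(1) False w(2)] Cons.prems by simp
    moreover have "path_image (hc h) \<inter> path_image (route hs) \<subseteq> {pathstart (route hs)}"
      unfolding r(2,4) using walk_meet[OF w(1) h(1) w(2) h(4) _ _ h(3)] h(2) by blast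
    ultimately show ?thesis using False r(2) hc(5)[OF h(1)] by (simp add: arc_join)
  qed
qed simp

text \<open>The first edge and the arc formed by the remaining ones meet only in their common ends.
  A cycle of one edge is a loop, whose curve is simple by itself.\<close>

lemma cycle_route:
  assumes "edge_cycle G hs"
  shows "simple_path (route hs)" "pathstart (route hs) = pt (src (hd hs))" "pathfinish (route hs) = pathstart (route hs)"
    "path_image (route hs) = (\<Union>h\<in>set hs. path_image (hc h))" "path_image (route hs) \<subseteq> sphere 0 1 - {q}"
    "path_image (\<pi> \<circ> route hs) = cycle_image (set hs)"
    "w \<notin> cycle_image (set hs) \<Longrightarrow> winding_number (\<pi> \<circ> route hs) w = cycle_winding (set hs) w"
proof -
  have c: "hs \<noteq> []" "set hs \<subseteq> halves" "half_edge_walk G (src (hd hs)) hs (src (hd hs))"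
    "distinct (map src hs)" "distinct (map fst hs)"
    using assms by (auto simp: edge_cycle_def)
  note r = route[OF c(3,1,2)]
  show "pathstart (route hs) = pt (src (hd hs))" "pathfinish (route hs) = pathstart (route hs)" using r by simp_all
  show img: "path_image (route hs) = (\<Union>h\<in>set hs. path_image (hc h))" by (rule r(4))
  show "path_image (route hs) \<subseteq> sphere 0 1 - {q}" unfolding img using hc(3) c(2) by blast
  show "path_image (\<pi> \<circ> route hs) = cycle_image (set hs)"
    unfolding path_image_compose img cycle_image_def by blast
  show "winding_number (\<pi> \<circ> route hs) w = cycle_winding (set hs) w" if "w \<notin> cycle_image (set hs)"
  proof -
    have "distinct hs" using c(4) by (simp add: distinct_map)
    then show ?thesis unfolding route_winding[OF c(3,1,2) that] cycle_winding_def by (rule sum_list_distinct_conv_sum_set)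
  qed
  obtain h hs' where hs: "hs = h # hs'" using c(1) by (cases hs) auto
  have h: "h \<in> halves" "set hs' \<subseteq> halves" "src h \<notin> src ` set hs'" "fst h \<notin> fst ` set hs'"
    "half_edge_walk G (src (opposite h)) hs' (src h)" "distinct (map fst hs')" "distinct (map src hs' @ [src h])"
    using c by (auto simp: hs)
  show "simple_path (route hs)"
  proof (cases "hs' = []")
    case True
    then show ?thesis using hc(1)[OF h(1)] by (simp add: hs)
  next
    case False
    note r' = route[OF h(5) False h(2)]
    have "src (opposite h) = src (hd hs')" using h(5) False by (cases hs') auto
    then have "src (opposite h) \<in> src ` set hs'" using False by simp
    then have "src h \<noteq> src (opposite h)" using h(3) by metis
    then have "arc (hc h)" by (rule arc_hc[OF h(1)])
    moreover have "arc (route hs')" using arc_route[OF h(5) False h(2,6,7)] .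
    moreover have "path_image (hc h) \<inter> path_image (route hs') \<subseteq> {pathstart (hc h), pathstart (route hs')}"
      unfolding r'(2,4) hc(4)[OF h(1)] using walk_meet[OF h(5,1,2,4) _ _ h(3)] by blast
    ultimately have "simple_path (hc h +++ route hs')"
      using r'(2,3) hc(4,5)[OF h(1)] by (intro simple_path_join_loop) simp_all
    then show ?thesis using False by (simp add: hs)
  qed
qed

lemma cycle_low: "edge_cycle G hs \<Longrightarrow> low (\<pi> \<circ> route hs) = cycle_low (set hs)"
  unfolding low_def cycle_low_def using cycle_route(6,7)[of hs] by metis

lemma off_cycle:
  assumes "edge_cycle G hs" "f \<in> halves" "fst f \<notin> fst ` set hs" "0 < s" "s < 1"
  shows "hc f s \<notin> path_image (route hs)"
proof
  assume "hc f s \<in> path_image (route hs)"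
  then obtain h where h: "h \<in> set hs" "hc f s \<in> path_image (hc h)" unfolding cycle_route(4)[OF assms(1)] by blast
  have hh: "h \<in> halves" using h(1) assms(1) by (auto simp: edge_cycle_def)
  have x: "hc f s \<in> hc f ` {0<..<1}" using assms(4,5) by simp
  have "fst f \<noteq> fst h" using h(1) assms(3) by auto
  then have "hc f s \<notin> hc h ` {0<..<1}" using open_disjoint[OF assms(2) hh] x by blast
  moreover have "hc f s \<notin> pt ` verts G" using open_vertex[OF assms(2)] x by blast
  moreover have "src h \<in> verts G" "src (opposite h) \<in> verts G" using src_in hh by simp_all
  ultimately show False using h(2) unfolding hc_image[OF hh] by blast
qed

text \<open>Going counterclockwise from the outgoing half-edge of the cycle, \<open>f\<close> is on
  the left exactly if it comes before the half-edge of the incoming edge. Only the first half of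
  \<open>f\<close> is followed, because its other end may lie on the cycle again.\<close>

lemma cycle_side:
  assumes cyc: "edge_cycle G hs" and f: "f \<in> halves" "src f = src (hd hs)" "fst f \<notin> fst ` set hs"
  shows "cycle_winding (set hs) (\<pi> (hc f (1/2))) =
    of_bool (ccw_triple \<Gamma> (hd hs) f (opposite (last hs))) + cycle_low (set hs)"
proof -
  define h1 h2 where "h1 = hd hs" and "h2 = opposite (last hs)"
  have c: "hs \<noteq> []" "set hs \<subseteq> halves" "half_edge_walk G (src (hd hs)) hs (src (hd hs))"
    using cyc by (auto simp: edge_cycle_def)
  note ends = edge_cycle_ends[OF cyc] and r = cycle_route[OF cyc]
  have in_hs: "hd hs \<in> set hs" "last hs \<in> set hs" using c(1) by simp_all
  have h: "h1 \<in> halves" "h2 \<in> halves" "src h2 = src h1" "src f = src h1"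
    using in_hs c(2) ends(4) f(2) by (auto simp: h1_def h2_def)
  have "h1 \<noteq> h2"
  proof
    assume eq: "h1 = h2"
    then have "fst (hd hs) = fst (last hs)" by (simp add: h1_def h2_def)
    then have "hd hs = last hs" using inj_onD[OF ends(5)] in_hs by blast
    then show False using eq by (simp add: h1_def h2_def)
  qed
  moreover have "f \<noteq> h1" "f \<noteq> h2" using f(3) in_hs by (auto simp: h1_def h2_def)
  ultimately have d: "distinct [h1, f, h2]" by auto
  obtain \<delta> where \<delta>: "0 < \<delta>" "\<delta> < dist (pt (src h1)) q"
    "\<And>h'. h' \<in> halves \<Longrightarrow> src h' = src h1 \<Longrightarrow> \<delta> < dist (pt (src h1)) (hc h' (1/2))"
    using good_radius[OF h(1)] by blast
  define r where "r = \<delta> / 2"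
  have rd: "0 < r" "r < \<delta>" using \<delta>(1) by (simp_all add: r_def)
  let ?p = "pt (src h1)" and ?U = "ball (pt (src h1)) r"
  have exit: "\<exists>t. 0 < t \<and> t < 1/2 \<and> hc x t = first_exit (hc x) r \<and> dist ?p (hc x t) = r \<and>
      (\<forall>s. 0 \<le> s \<longrightarrow> s < t \<longrightarrow> hc x s \<in> ?U)" if x: "x \<in> halves" "src x = src h1" for x
  proof -
    have "r < dist (pathstart (hc x)) (hc x (1/2))" using \<delta>(3)[OF x] rd hc(4)[OF x(1)] x(2) by simp
    then obtain t where "0 < t" "t < 1/2" "hc x t = first_exit (hc x) r" "dist (pathstart (hc x)) (hc x t) = r"
      "\<And>s. 0 \<le> s \<Longrightarrow> s < t \<Longrightarrow> hc x s \<in> ball (pathstart (hc x)) r"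
      using first_exit[OF hc(2)[OF x(1)] rd(1), of "1/2"] by auto
    then show ?thesis using hc(4)[OF x(1)] x(2) by auto
  qed
  have exits: "exits_at (hc x) ?U (first_exit (hc x) r)" if x: "x \<in> halves" "src x = src h1" for x
  proof -
    obtain t where "0 < t" "t < 1/2" "hc x t = first_exit (hc x) r" "dist ?p (hc x t) = r"
      "\<And>s. 0 \<le> s \<Longrightarrow> s < t \<Longrightarrow> hc x s \<in> ?U" using exit[OF x] by blast
    then show ?thesis unfolding exits_at_def by (intro bexI[of _ t]) auto
  qed
  define g where "g = subpath 0 (1/2) (hc f)"
  have start: "pathstart (route hs) = ?p" using r(2) by (simp add: h1_def)
  have "winding_number (\<pi> \<circ> route hs) (\<pi> (g 1)) =
      of_bool (cross3 (first_exit (hc f) r - first_exit (hc h1) r) (first_exit (hc h2) r - first_exit (hc h1) r) \<bullet>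
        pathstart (route hs) > 0) + low (\<pi> \<circ> route hs)"
  proof (rule sphere_side[OF q r(1,3,5) rd(1)])
    show "r < dist (pathstart (route hs)) q" unfolding start using rd \<delta>(2) by simp
    show "exits_at (route hs) (ball (pathstart (route hs)) r) (first_exit (hc h1) r)"
      unfolding start by (rule route_exits(1)[OF c(3,1,2)]) (use exits[OF h(1)] in \<open>simp add: h1_def\<close>)
    show "exits_at (reversepath (route hs)) (ball (pathstart (route hs)) r) (first_exit (hc h2) r)"
      unfolding start by (rule route_exits(2)[OF c(3,1,2)]) (use exits[OF h(2,3)] in \<open>simp add: h2_def\<close>)
    show "first_exit (hc h1) r \<noteq> first_exit (hc h2) r"
    proof -
      obtain t1 where "0 < t1" "t1 < 1/2" "hc h1 t1 = first_exit (hc h1) r" using exit[OF h(1)] by blast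
      moreover obtain t2 where "0 < t2" "t2 < 1/2" "hc h2 t2 = first_exit (hc h2) r" using exit[OF h(2,3)] by blast
      ultimately show ?thesis using half_disjoint[OF h(1,2) \<open>h1 \<noteq> h2\<close>] by (metis IntI empty_iff greaterThanLessThan_iff imageI)
    qed
    show "path g" unfolding g_def using hc(2)[OF f(1)] by (intro path_subpath) auto
    show "pathstart g = pathstart (route hs)" unfolding start using hc_ends(1)[OF f(1)] h(4) by (simp add: g_def)
    show "g ` {0<..1} \<inter> path_image (route hs) = {}"
      using off_cycle[OF cyc f(1,3)] by (auto simp: g_def subpath_def)
    have "path_image g \<subseteq> path_image (hc f)" unfolding g_def by (rule path_image_subpath_subset) auto
    then show "path_image g \<subseteq> sphere 0 1 - {q}" using hc(3)[OF f(1)] by (rule subset_trans)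
    obtain t where "0 < t" "t < 1/2" "hc f t = first_exit (hc f) r" "dist ?p (hc f t) = r"
      "\<And>s. 0 \<le> s \<Longrightarrow> s < t \<Longrightarrow> hc f s \<in> ?U" using exit[OF f(1) h(4)] by blast
    then show "exits_at g (ball (pathstart (route hs)) r) (first_exit (hc f) r)"
      unfolding g_def start by (intro exits_at_subpath[of t]) auto
  qed
  moreover have "g 1 = hc f (1/2)" by (simp add: g_def subpath_def)
  moreover have "hc f (1/2) \<notin> path_image (route hs)" by (rule off_cycle[OF cyc f(1,3)]) auto
  then have "\<pi> (hc f (1/2)) \<notin> cycle_image (set hs)"
  proof -
    have "hc f (1/2) \<in> path_image (hc f)" by (auto simp: path_image_def)
    then have "hc f (1/2) \<in> sphere 0 1 - {q}" using hc(3)[OF f(1)] by blast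
    then show ?thesis
      using \<open>hc f (1/2) \<notin> path_image (route hs)\<close> inj_on_image_mem_iff[OF inj_on_stereo_from[OF q] _ r(5)]
      unfolding r(6)[symmetric] path_image_compose by blast
  qed
  moreover have "cross3 (first_exit (hc f) r - first_exit (hc h1) r) (first_exit (hc h2) r - first_exit (hc h1) r) \<bullet>
      pathstart (route hs) = exit_triple (hc h1) (hc f) (hc h2) r"
    unfolding exit_triple_def start hc(4)[OF h(1)] by (rule refl)
  moreover have "exit_triple (hc h1) (hc f) (hc h2) r > 0 \<longleftrightarrow> ccw_triple \<Gamma> h1 f h2"
    using rd by (intro ccw_radius(1)[OF h(1) f(1) h(2,4,3) d \<delta>]) auto
  ultimately show ?thesis using r(7) cycle_low[OF cyc] by (simp add: h1_def h2_def)
qed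

text \<open>The first half of \<open>h\<close>, including its vertex, misses the cycle, so the
  midpoint has the same winding number as the vertex, a value common to all half-edges
  there.\<close>

lemma cycle_away:
  assumes cyc: "edge_cycle G hs" and h: "h \<in> halves" "src h \<notin> src ` set hs"
  shows "fst h \<notin> fst ` set hs"
    "cycle_winding (set hs) (\<pi> (hc h (1/2))) = cycle_winding (set hs) (\<pi> (pt (src h)))"
proof -
  note ends = edge_cycle_ends[OF cyc] and r = cycle_route[OF cyc]
  show nz: "fst h \<notin> fst ` set hs"
  proof
    assume "fst h \<in> fst ` set hs"
    then obtain h' where h': "h' \<in> set hs" "fst h' = fst h" by force
    then have "src h = src h' \<or> src h = src (opposite h')" using same_edge by metis
    moreover have "src (opposite h') \<in> src ` set hs" using ends(3) h'(1) by blast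
    ultimately show False using h'(1) h(2) by auto
  qed
  have off: "hc h s \<notin> path_image (route hs)" if "s \<in> {0..1/2}" for s
  proof (cases "s = 0")
    case True
    show ?thesis
    proof
      assume "hc h s \<in> path_image (route hs)"
      then obtain h' where h': "h' \<in> set hs" "hc h s \<in> path_image (hc h')" unfolding r(4) by blast
      have "h' \<in> halves" "fst h \<noteq> fst h'" using h'(1) cyc nz by (auto simp: edge_cycle_def)
      moreover have "hc h s \<in> path_image (hc h)" using True by (auto simp: path_image_def)
      ultimately obtain v where v: "hc h s = pt v" "v \<in> {src h', src (opposite h')}"
        using hc_meet[OF h(1) _ _ _ h'(2)] by blast
      then have "v \<in> src ` set hs" using ends(3) h'(1) by blast
      moreover have "v \<in> verts G" using v(2) src_in[of h'] src_in[of "opposite h'"] \<open>h' \<in> halves\<close>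
        by (elim insertE emptyE) simp_all
      moreover have "pt v = pt (src h)" using v(1) True hc_ends(1)[OF h(1)] by simp
      moreover have "inj_on pt (verts G)" using plane by (simp add: plane_graph_def)
      ultimately show False using inj_onD[of pt "verts G" v "src h"] src_in[OF h(1)] h(2) by simp
    qed
  next
    case False
    then show ?thesis using off_cycle[OF cyc h(1) nz, of s] that by simp
  qed
  have sub: "hc h ` {0..1/2} \<subseteq> sphere 0 1 - {q}"
  proof -
    have "hc h ` {0..1/2} \<subseteq> path_image (hc h)" unfolding path_image_def by (rule image_mono) auto
    then show ?thesis using hc(3)[OF h(1)] by (rule subset_trans)
  qed
  have not: "\<pi> (hc h s) \<notin> cycle_image (set hs)" if "s \<in> {0..1/2}" for s
    using off[OF that] sub that inj_on_image_mem_iff[OF inj_on_stereo_from[OF q] _ r(5), of "hc h s"]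
    unfolding r(6)[symmetric] path_image_compose by blast
  have "winding_number (\<pi> \<circ> route hs) (\<pi> (hc h (1/2))) = winding_number (\<pi> \<circ> route hs) (\<pi> (hc h 0))"
  proof (rule winding_number_eq[where S = "(\<pi> \<circ> hc h) ` {0..1/2}"])
    have "path (\<pi> \<circ> hc h)" using path_\<pi> hc[OF h(1)] by blast
    then have "continuous_on {0..1/2} (\<pi> \<circ> hc h)" unfolding path_def by (rule continuous_on_subset) auto
    then show "connected ((\<pi> \<circ> hc h) ` {0..1/2})" by (rule connected_continuous_image) auto
    show "path (\<pi> \<circ> route hs)" using path_\<pi> simple_path_imp_path r(1,5) by blast
    show "pathfinish (\<pi> \<circ> route hs) = pathstart (\<pi> \<circ> route hs)" using r(3) by (simp add: pathfinish_compose pathstart_compose)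
    show "(\<pi> \<circ> hc h) ` {0..1/2} \<inter> path_image (\<pi> \<circ> route hs) = {}" unfolding r(6) using not by auto
  qed auto
  then show "cycle_winding (set hs) (\<pi> (hc h (1/2))) = cycle_winding (set hs) (\<pi> (pt (src h)))"
    using r(7)[OF not[of "1/2"]] r(7)[OF not[of 0]] hc_ends(1)[OF h(1)] by simp
qed

end

lemma edge_cycle_last:
  assumes "edge_cycle G hs" "h \<in> set hs"
  obtains hs' where "edge_cycle G hs'" "set hs' = set hs" "last hs' = h"
proof -
  obtain hs' where hs': "edge_cycle G (h # hs')" "set (h # hs') = set hs"
    using edge_cycle_at[OF assms] by blast
  show ?thesis
  proof (cases hs')
    case Nil
    then show ?thesis using that[OF hs'] by simp
  next
    case (Cons y ys)
    then have "edge_cycle G (y # ys @ [h])" using edge_cycle_rotate[of G "[h]" y ys] hs'(1) by simp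
    then show ?thesis using that[of "y # ys @ [h]"] hs'(2) Cons by auto
  qed
qed

section \<open>The faces to the left of a cycle\<close>

context plane_embedding
begin

text \<open>
  The corners to the left of the cycle. A half-edge \<open>h\<close> on the cycle has \<open>h\<close> to its left if it
  points in the direction of the cycle; the corner of any other half-edge lies on the same side as
  the edge itself.
\<close>

definition cycle_faces :: "'e half_edge set \<Rightarrow> 'e half_edge set" where
  "cycle_faces Z = {h \<in> halves. if fst h \<in> fst ` Z then h \<in> Z
     else cycle_winding Z (\<pi> (hc h (1/2))) = cycle_low Z + 1}"

text \<open>The vertex has an outgoing, an incoming and a third half-edge. Both cyclic orders are
  checked, with \<open>cycle_side\<close> deciding on which side the third one lies;
  \<open>\<rho> (\<rho> h)\<close> is the corner to the right of \<open>h\<close>.\<close>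

lemma cycle_faces_at:
  assumes cyc: "edge_cycle G hs"
  shows "\<rho> (\<rho> (hd hs)) \<notin> cycle_faces (set hs)" "\<rho> (\<rho> (opposite (last hs))) \<in> cycle_faces (set hs)"
    "f \<in> halves \<Longrightarrow> src f = src (hd hs) \<Longrightarrow> fst f \<notin> fst ` set hs \<Longrightarrow>
      \<rho> (\<rho> f) \<in> cycle_faces (set hs) \<longleftrightarrow> f \<in> cycle_faces (set hs)"
proof -
  let ?h1 = "hd hs" and ?h2 = "opposite (last hs)" and ?S = "cycle_faces (set hs)"
  note ends = edge_cycle_ends[OF cyc]
  have c: "hs \<noteq> []" "set hs \<subseteq> halves" using cyc by (auto simp: edge_cycle_def)
  have in_hs: "?h1 \<in> set hs" "last hs \<in> set hs" using c(1) by simp_all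
  have h: "?h1 \<in> halves" "?h2 \<in> halves" "src ?h2 = src ?h1" using in_hs c(2) ends(4) by auto
  have h2: "?h2 \<notin> set hs" using inj_onD[OF ends(5), of ?h2 "last hs"] in_hs by auto
  then have ne: "?h2 \<noteq> ?h1" using in_hs(1) by metis
  obtain a b where ab: "half_edges_at G (src ?h1) = {?h1, a, b}" "distinct [?h1, a, b]"
    using rotation_at[OF h(1)] by metis
  have "?h2 \<in> half_edges_at G (src ?h1)" using h by (simp add: half_edges_at_def)
  then have "?h2 = a \<or> ?h2 = b" unfolding ab(1) using ne by simp
  then obtain f0 where at: "half_edges_at G (src ?h1) = {?h1, ?h2, f0}" "distinct [?h1, ?h2, f0]"
  proof
    assume "?h2 = a" then show ?thesis using that[of b] ab by simp
  next
    assume "?h2 = b" then have "half_edges_at G (src ?h1) = {?h1, ?h2, a}" "distinct [?h1, ?h2, a]"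
      using ab by (simp_all add: insert_commute[of a b], blast)
    then show ?thesis by (rule that)
  qed
  have "f0 \<in> half_edges_at G (src ?h1)" unfolding at(1) by simp
  then have f0: "f0 \<in> halves" "src f0 = src ?h1" by (simp_all add: half_edges_at_def)
  have f0_off: "fst f0 \<notin> fst ` set hs"
  proof
    assume "fst f0 \<in> fst ` set hs"
    then obtain h' where h': "h' \<in> set hs" "fst h' = fst f0" by force
    from same_edge[OF h'(2)] show False
    proof
      assume "f0 = h'"
      then have "f0 = ?h1" using inj_onD[OF ends(1), of f0 ?h1] f0(2) h'(1) in_hs(1) by simp
      then show False using at(2) by simp
    next
      assume f: "f0 = opposite h'"
      then have "h' = last hs" using inj_onD[OF ends(2), of h' "last hs"] f0(2) h(3) h'(1) in_hs(2) by simp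
      then show False using f at(2) by simp
    qed
  qed
  have f0S: "f0 \<in> ?S \<longleftrightarrow> ccw_triple \<Gamma> ?h1 f0 ?h2"
    unfolding cycle_faces_def using f0 f0_off cycle_side[OF cyc f0 f0_off] by simp
  have h1S: "?h1 \<in> ?S" using h(1) in_hs(1) by (simp add: cycle_faces_def)
  have "fst ?h2 \<in> fst ` set hs" using in_hs(2) by simp
  then have h2S: "?h2 \<notin> ?S" using h2 by (simp add: cycle_faces_def)
  have key: "\<rho> (\<rho> ?h1) \<notin> ?S \<and> \<rho> (\<rho> ?h2) \<in> ?S \<and> (\<rho> (\<rho> f0) \<in> ?S \<longleftrightarrow> f0 \<in> ?S)"
  proof (cases "ccw_triple \<Gamma> ?h1 f0 ?h2")
    case True
    have "half_edges_at G (src ?h1) = {?h1, f0, ?h2}" "distinct [?h1, f0, ?h2]" using at by (auto simp: insert_commute)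
    from rotation_eq[OF this True] show ?thesis using f0S h1S h2S True by simp
  next
    case False
    then have "ccw_triple \<Gamma> ?h1 ?h2 f0"
      using ccw_triple_swap[OF h(1) f0(1) h(2) f0(2) h(3)] at(2) by auto
    from rotation_eq[OF at this] show ?thesis using f0S h1S h2S False by simp
  qed
  then show "\<rho> (\<rho> ?h1) \<notin> ?S" "\<rho> (\<rho> ?h2) \<in> ?S" by blast+
  show "\<rho> (\<rho> f) \<in> ?S \<longleftrightarrow> f \<in> ?S" if "f \<in> halves" "src f = src ?h1" "fst f \<notin> fst ` set hs"
  proof -
    have "f \<in> {?h1, ?h2, f0}" unfolding at(1)[symmetric] using that by (simp add: half_edges_at_def)
    moreover have "f \<noteq> ?h1" "f \<noteq> ?h2" using that(3) in_hs by auto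
    ultimately show ?thesis using key by auto
  qed
qed

text \<open>Rotating the list makes any half-edge of the cycle the first or the last one, so the
  analysis at one vertex serves all. For edges off the cycle, both half-edges are tested at their
  common midpoint.\<close>

lemma cycle_faces_boundary:
  assumes cyc: "edge_cycle G hs" and h: "h \<in> halves"
  shows "h \<in> cycle_faces (set hs) \<longleftrightarrow> \<rho> (\<rho> (opposite h)) \<in> cycle_faces (set hs)"
    "(h \<in> cycle_faces (set hs)) \<noteq> (\<rho> (\<rho> h) \<in> cycle_faces (set hs)) \<longleftrightarrow> fst h \<in> fst ` set hs"
proof -
  let ?S = "cycle_faces (set hs)"
  note ends = edge_cycle_ends[OF cyc]
  have sub: "set hs \<subseteq> halves" using cyc by (simp add: edge_cycle_def)
  have on: "k \<in> ?S \<and> opposite k \<notin> ?S \<and> \<rho> (\<rho> k) \<notin> ?S \<and> \<rho> (\<rho> (opposite k)) \<in> ?S" if k: "k \<in> set hs" for k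
  proof (intro conjI)
    show "k \<in> ?S" using k sub by (auto simp: cycle_faces_def)
    have "opposite k \<notin> set hs" using inj_onD[OF ends(5), of "opposite k" k] k by auto
    moreover have "fst (opposite k) \<in> fst ` set hs" using k by simp
    ultimately show "opposite k \<notin> ?S" by (simp add: cycle_faces_def)
    obtain hs' where hs': "edge_cycle G (k # hs')" "set (k # hs') = set hs" using edge_cycle_at[OF cyc k] by blast
    show "\<rho> (\<rho> k) \<notin> ?S" using cycle_faces_at(1)[OF hs'(1)] unfolding hs'(2) by simp
    obtain hs'' where hs'': "edge_cycle G hs''" "set hs'' = set hs" "last hs'' = k" using edge_cycle_last[OF cyc k] by blast
    show "\<rho> (\<rho> (opposite k)) \<in> ?S" using cycle_faces_at(2)[OF hs''(1)] unfolding hs''(2,3) .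
  qed
  have off: "\<rho> (\<rho> k) \<in> ?S \<longleftrightarrow> k \<in> ?S" if k: "k \<in> halves" "fst k \<notin> fst ` set hs" for k
  proof (cases "src k \<in> src ` set hs")
    case True
    then obtain h' where h': "h' \<in> set hs" "src k = src h'" by blast
    obtain hs' where hs': "edge_cycle G (h' # hs')" "set (h' # hs') = set hs" using edge_cycle_at[OF cyc h'(1)] by blast
    show ?thesis using cycle_faces_at(3)[OF hs'(1), of k] k h'(2) unfolding hs'(2) by simp
  next
    case False
    have r: "\<rho> (\<rho> k) \<in> halves" "src (\<rho> (\<rho> k)) = src k"
      using rotation_cycle(4,5)[OF k(1)] rotation_cycle(4,5)[of "\<rho> k"] by simp_all
    have "fst (\<rho> (\<rho> k)) \<notin> fst ` set hs"
      "cycle_winding (set hs) (\<pi> (hc (\<rho> (\<rho> k)) (1/2))) = cycle_winding (set hs) (\<pi> (hc k (1/2)))"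
      using cycle_away[OF cyc r(1)] cycle_away(2)[OF cyc k(1) False] False r(2) by simp_all
    then show ?thesis using k r(1) by (simp add: cycle_faces_def)
  qed
  have "(h \<in> ?S \<longleftrightarrow> \<rho> (\<rho> (opposite h)) \<in> ?S) \<and> ((h \<in> ?S) \<noteq> (\<rho> (\<rho> h) \<in> ?S) \<longleftrightarrow> fst h \<in> fst ` set hs)"
  proof (cases "fst h \<in> fst ` set hs")
    case True
    then obtain h' where h': "h' \<in> set hs" "fst h' = fst h" by force
    from same_edge[OF h'(2)] show ?thesis
    proof
      assume "h = h'"
      then show ?thesis using on[OF h'(1)] True by simp
    next
      assume "h = opposite h'"
      then show ?thesis using on[OF h'(1)] True by simp
    qed
  next
    case False
    have "hc (opposite h) (1/2) = hc h (1/2)" by (simp add: hc_opposite reversepath_def)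
    then have "opposite h \<in> ?S \<longleftrightarrow> h \<in> ?S" using h False by (simp add: cycle_faces_def)
    moreover have "\<rho> (\<rho> (opposite h)) \<in> ?S \<longleftrightarrow> opposite h \<in> ?S" using h False by (intro off) simp_all
    ultimately show ?thesis using off[OF h False] False by blast
  qed
  then show "h \<in> ?S \<longleftrightarrow> \<rho> (\<rho> (opposite h)) \<in> ?S" "(h \<in> ?S) \<noteq> (\<rho> (\<rho> h) \<in> ?S) \<longleftrightarrow> fst h \<in> fst ` set hs"
    by blast+
qed

end

section \<open>Every even edge set bounds a set of faces\<close>

lemma (in rot_sys) face_set_empty: "face_set {} {}"
  by (simp add: face_set_def)

lemma (in rot_sys) face_set_sym_diff:
  assumes "face_set z S" "face_set z' S'"
  shows "face_set (sym_diff z z') (sym_diff S S')"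
  unfolding face_set_def
proof (intro conjI ballI)
  show "sym_diff S S' \<subseteq> H" using assms unfolding face_set_def by blast
  have mem: "x \<in> sym_diff A B \<longleftrightarrow> (x \<in> A) \<noteq> (x \<in> B)" for x and A B :: "'x set" by blast
  fix e assume e: "e \<in> E"
  note f = assms[unfolded face_set_def, THEN conjunct2, THEN bspec, OF e]
  show "(e, False) \<in> sym_diff S S' \<longleftrightarrow> \<rho> (\<rho> (e, True)) \<in> sym_diff S S'"
    unfolding mem using f by blast
  show "(e, True) \<in> sym_diff S S' \<longleftrightarrow> \<rho> (\<rho> (e, False)) \<in> sym_diff S S'"
    unfolding mem using f by blast
  show "((e, False) \<in> sym_diff S S') \<noteq> (\<rho> (\<rho> (e, False)) \<in> sym_diff S S') \<longleftrightarrow> e \<in> sym_diff z z'"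
    unfolding mem using f by blast
qed

context plane_embedding
begin

abbreviation "P \<equiv> rot_graph_of G \<Gamma>"

lemma rot_graph_simps [simp]: "verts P = verts G" "edges P = edges G" "circles P = circles G"
  "endpoint P = endpoint G" "ccw P = \<rho>" "half_edges P = halves" "half_edges_at P = half_edges_at G"
  "finite_multigraph P = finite_multigraph G" "even_edge_sets P = even_edge_sets G"
  by (auto simp: rot_graph_of_def half_edges_def half_edges_at_def fun_eq_iff finite_multigraph_def even_edge_sets_def)

lemma model_space_eq: "model_space P = model_space G"
  by (simp add: model_space_def twisted_cochains_def fun_eq_iff)

sublocale R: rot_sys P
proof
  show "finite_multigraph P" using G_fin(3) by simp
  show "half_edges_at P v \<noteq> {}" if "v \<in> verts P" for v
  proof
    assume "half_edges_at P v = {}"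
    then show False using triv that by (auto simp: trivalent_def)
  qed
qed (simp_all add: rotation_cycle)

lemma face_set_cycle:
  assumes "edge_cycle G hs"
  shows "R.face_set (fst ` set hs) (cycle_faces (set hs))"
  unfolding R.face_set_def
proof (intro conjI ballI)
  show "cycle_faces (set hs) \<subseteq> half_edges P" by (auto simp: cycle_faces_def)
  fix e assume "e \<in> edges P"
  then have "(e, b) \<in> halves" for b by (simp add: half_edges_def)
  note b = cycle_faces_boundary[OF assms this]
  show "(e, False) \<in> cycle_faces (set hs) \<longleftrightarrow> ccw P (ccw P (e, True)) \<in> cycle_faces (set hs)"
    using b(1)[of False] by (simp add: opposite_def)
  show "(e, True) \<in> cycle_faces (set hs) \<longleftrightarrow> ccw P (ccw P (e, False)) \<in> cycle_faces (set hs)"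
    using b(1)[of True] by (simp add: opposite_def)
  show "((e, False) \<in> cycle_faces (set hs)) \<noteq> (ccw P (ccw P (e, False)) \<in> cycle_faces (set hs)) \<longleftrightarrow>
      e \<in> fst ` set hs"
    using b(2)[of False] unfolding rot_graph_simps fst_conv .
qed

text \<open>An even set is a sum of cycles modulo two, each cycle bounds by
  \<open>face_set_cycle\<close>, and face sets can be added.\<close>

lemma face_set_exists:
  assumes "z \<in> even_edge_sets G"
  shows "\<exists>S. R.face_set z S"
  using G_fin(3) assms
proof (rule even_edge_sets_induct)
  show "\<exists>S. R.face_set {} S" using R.face_set_empty by blast
  fix hs z assume hs: "edge_cycle G hs" "fst ` set hs \<subseteq> z" and "\<exists>S. R.face_set (z - fst ` set hs) S"
  then obtain S where S: "R.face_set (z - fst ` set hs) S" by blast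
  have "sym_diff (z - fst ` set hs) (fst ` set hs) = z" using hs(2) by blast
  then show "\<exists>S. R.face_set z S" using R.face_set_sym_diff[OF S face_set_cycle[OF hs(1)]] by metis
qed

text \<open>The spaces and coordinates in the conclusion mention only \<open>G\<close>; the drawing
  enters through the blow-up and the vectors \<open>v\<close> alone.\<close>

lemma circle_model_exists:
  obtains v where
    "circle_model (blowup P) (Inl ` edges G) v (model_space G) model_index"
proof -
  have "\<exists>\<sigma>. (\<forall>e. \<sigma> e \<subseteq> half_edges P) \<and> (\<forall>z\<subseteq>edges P. (\<exists>S. R.face_set z S) \<longrightarrow>
      R.face_set z {h \<in> half_edges P. odd (card {e \<in> z. h \<in> \<sigma> e})})"
  proof (rule linear_section)
    show "finite (edges P)" using G_fin(1) by simp
    show "finite (half_edges P)" by (rule R.finite_H)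
    show "S \<subseteq> half_edges P" if "R.face_set z S" for z S using that by (simp add: R.face_set_def)
  qed (rule R.face_set_empty, rule R.face_set_sym_diff)
  then obtain \<sigma> where \<sigma>: "\<And>z. z \<subseteq> edges P \<Longrightarrow> \<exists>S. R.face_set z S \<Longrightarrow>
      R.face_set z {h \<in> half_edges P. odd (card {e \<in> z. h \<in> \<sigma> e})}" by blast
  interpret planar_rot_sys P \<sigma>
  proof
    fix z assume z: "z \<in> even_edge_sets P"
    then have "z \<subseteq> edges P" by (simp add: even_edge_sets_def)
    moreover have "\<exists>S. R.face_set z S" using z by (intro face_set_exists) simp
    ultimately show "R.face_set z {h \<in> half_edges P. odd (card {e \<in> z. h \<in> \<sigma> e})}" by (rule \<sigma>)
  qed
  show ?thesis using that circle_model_blowup unfolding model_space_eq rot_graph_simps by blast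
qed

end

text \<open>Any two drawings give models on the same spaces with the same coordinates, and these
  data determine the polynomial and, up to isomorphism, the cohomology.\<close>

theorem theorem7p3:
  fixes G :: "('v, 'e) multigraph"
  assumes "trivalent G" and "planar G"
  shows
    "(\<forall>\<Gamma> \<Gamma>'. plane_graph G \<Gamma> \<longrightarrow> plane_graph G \<Gamma>' \<longrightarrow>
        plane_graph_poly G \<Gamma> = plane_graph_poly G \<Gamma>' \<and>
        bigraded_isomorphic (plane_graph_cohomology G \<Gamma>) (plane_graph_cohomology G \<Gamma>')) \<and>
     (\<forall>\<Gamma>. plane_graph G \<Gamma> \<longrightarrow>
        plane_graph_poly G \<Gamma> =
          (\<Sum>i\<le>card (edges G). (-1) ^ i * qdim (plane_graph_cohomology G \<Gamma> (int i))))"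
proof (intro conjI allI impI)
  fix \<Gamma> \<Gamma>' assume "plane_graph G \<Gamma>" "plane_graph G \<Gamma>'"
  then have "plane_embedding G \<Gamma>" "plane_embedding G \<Gamma>'" using assms(1) by (simp_all add: plane_embedding_def)
  then obtain v v' where
    v: "circle_model (blowup (rot_graph_of G \<Gamma>)) (Inl ` edges G) v (model_space G) model_index"
    and v': "circle_model (blowup (rot_graph_of G \<Gamma>')) (Inl ` edges G) v' (model_space G) model_index"
    using plane_embedding.circle_model_exists by metis
  show "plane_graph_poly G \<Gamma> = plane_graph_poly G \<Gamma>'"
    unfolding plane_graph_poly_def by (rule two_factor_poly_eq[OF v v'])
  show "bigraded_isomorphic (plane_graph_cohomology G \<Gamma>) (plane_graph_cohomology G \<Gamma>')"
    unfolding plane_graph_cohomology_def by (rule cohomology_iso[OF v v'])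
next
  fix \<Gamma> assume "plane_graph G \<Gamma>"
  then have "plane_embedding G \<Gamma>" using assms(1) by (simp add: plane_embedding_def)
  then obtain v where
    v: "circle_model (blowup (rot_graph_of G \<Gamma>)) (Inl ` edges G) v (model_space G) model_index"
    using plane_embedding.circle_model_exists by metis
  have "card (Inl ` edges G :: ('e + 'e half_edge) set) = card (edges G)" by (simp add: card_image)
  then show "plane_graph_poly G \<Gamma> =
      (\<Sum>i\<le>card (edges G). (-1) ^ i * qdim (plane_graph_cohomology G \<Gamma> (int i)))"
    unfolding plane_graph_poly_def plane_graph_cohomology_def
    using circle_model.euler_characteristic[OF v] by simp
qed

end
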